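(* Let $0<\alpha_1,\alpha_2\le1$ and $0<\beta\le1$. For $n\ge1$ let $\{N_{\alpha_1,\alpha_2}^{\beta,(n^2)}(t_1,t_2),\ (t_1,t_2)\in\mathbb{R}^2_+\}$ be the space-time fractional Poisson random field with parameter $\lambda=n^2$, independent of iid standard normal random variables $Z_1,Z_2,\dots$. Let $\{B(t),\ t\ge0\}$ be a standard Brownian motion, $\{H_\beta(t_1,t_2),\ (t_1,t_2)\in\mathbb{R}^2_+\}$ a two parameter stable subordinator of index $\beta$, and, for $i=1,2$, $\{T_{2\alpha_i}(t),\ t\ge0\}$ a nonnegative random process whose one-dimensional densities are the folded solutions of the Cauchy problem $$\frac{\partial^{2\alpha_i}}{\partial t^{2\alpha_i}}u_{2\alpha_i}(x,t)=\frac{\partial^2}{\partial x^2}u_{2\alpha_i}(x,t),\quad t>0,\ x\in\mathbb{R},$$ with $u_{2\alpha_i}(x,0)=\delta(x)$ for $0<\alpha_i\le1$, and additionally $\frac{\partial}{\partial t}u_{2\alpha_i}(x,t)|_{t=0}=0$ for $\frac12<\alpha_i\le1$; all of $B$, $H_\beta$, $T_{2\alpha_1}$, $T_{2\alpha_2}$ being independent of each other. Then, for all $(t_1,t_2)\in\mathbb{R}^2_+$, as $n\to\infty$, the random variable $$n^{-1}\sum_{j=1}^{N_{\alpha_1,\alpha_2}^{\beta,(n^2)}(t_1,t_2)}Z_j$$ converges weakly (in distribution) to $B(H_\beta(T_{2\alpha_1}(t_1),T_{2\alpha_2}(t_2)))$.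
   Context: $\mathbb{R}_+=[0,\infty)$. An empty sum is $0$. Space-time fractional Poisson random field (STFPRF): a nonnegative-integer-valued random field on $\mathbb{R}^2_+$, depending on a parameter $\lambda>0$, whose distribution $p_{\alpha_1,\alpha_2}^\beta(n,t_1,t_2)=\mathrm{Pr}\{N_{\alpha_1,\alpha_2}^\beta(t_1,t_2)=n\}$ (regarded also as a function of $\lambda\in(0,\infty)$) solves $$\frac{\partial^{\alpha_1+\alpha_2}}{\partial t_2^{\alpha_2}\partial t_1^{\alpha_1}}p_{\alpha_1,\alpha_2}^\beta(n,t_1,t_2)=-\bigg(\frac{\lambda^{\beta+1}}{\beta}\frac{\partial}{\partial\lambda}+\lambda^\beta\bigg)(I-B)^\beta p_{\alpha_1,\alpha_2}^\beta(n,t_1,t_2),\quad n\ge0,$$ with $p_{\alpha_1,\alpha_2}^\beta(0,0,t_2)=p_{\alpha_1,\alpha_2}^\beta(0,t_1,0)=p_{\alpha_1,\alpha_2}^\beta(0,0,0)=1$ and $p_{\alpha_1,\alpha_2}^\beta(n,\cdot,\cdot)=0$ for $n<0$. In this system $B$ is the backward shift, $Bp(n,t_1,t_2)=p(n-1,t_1,t_2)$ (not the Brownian motion), $(I-B)^\beta=\sum_{k=0}^\infty\frac{(\beta)_k}{k!}(-B)^k$, $(\beta)_k=\beta(\beta-1)\cdots(\beta-k+1)$, $(\beta)_0=1$, and the $t_i$-derivatives are Caputo derivatives: $\frac{1}{\Gamma(1-\alpha)}\int_0^t\frac{g'(s)}{(t-s)^\alpha}\,\mathrm{d}s$ for $0<\alpha<1$,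 and $g'(t)$ for $\alpha=1$. "Parameter $n^2$" means the distribution at $\lambda=n^2$. Two parameter stable subordinator of index $\beta\in(0,1)$: a process $\{H_\beta(t_1,t_2)\}$ vanishing a.s. on the axes, with stationary and independent increments over disjoint rectangles $(s_1,t_1]\times(s_2,t_2]$ (increment $X(t_1,t_2)-X(s_1,t_2)-X(t_1,s_2)+X(s_1,s_2)$), non-decreasing in the coordinatewise order, with $\mathbb{E}e^{-uH_\beta(t_1,t_2)}=e^{-t_1t_2u^\beta}$, $u>0$; for $\beta=1$, $H_1(t_1,t_2)=t_1t_2$. Folded solution: the density of $T_{2\alpha}(t)$ is $2u_{2\alpha}(x,t)$ for $x\ge0$ and $0$ for $x<0$ (for $\alpha=1$ this is the point mass at $x=t$, i.e. $T_2(t)=t$). The fractional time derivative is of Caputo type (for order $\nu=2\alpha\in(1,2)$: $\frac{1}{\Gamma(2-\nu)}\int_0^t\frac{g''(s)}{(t-s)^{\nu-1}}\,\mathrm{d}s$). It is known (Orsingher–Beghin) that $\int_0^\infty e^{-zt}\mathrm{Pr}\{T_{2\alpha}(t)\in\mathrm{d}x\}\,\mathrm{d}t=z^{\alpha-1}e^{-z^{\alpha}x}\,\mathrm{d}x$, $z>0$. *)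

theory Defs
  imports "HOL-Probability.Probability"
begin

section \<open>Caputo derivatives\<close>

text \<open>
  Caputo derivative of order \<open>\<nu> > 0\<close>, with \<open>m = \<lceil>\<nu>\<rceil>\<close>; for integer \<open>\<nu>\<close> it is the ordinary derivative.
  Only the values of \<open>g\<close> on \<open>[0, \<infinity>)\<close> matter at times \<open>t > 0\<close>.
\<close>
definition caputo_deriv :: "real \<Rightarrow> (real \<Rightarrow> real) \<Rightarrow> real \<Rightarrow> real" where
  "caputo_deriv \<nu> g t =
     (let m = nat \<lceil>\<nu>\<rceil> in
      if \<nu> = real m then (deriv ^^ m) g t
      else 1 / Gamma (real m - \<nu>) *
             (LINT s:{0<..<t}|lborel. (deriv ^^ m) g s / (t - s) powr (\<nu> - real m + 1)))"

text \<open>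
  The functions for which the preceding formula is meaningful at every \<open>t > 0\<close>.  Differentiability
  at \<open>0\<close> is not demanded: already \<open>t powr \<nu>\<close> with \<open>\<nu> < 1\<close> lacks it.
\<close>
definition caputo_differentiable :: "real \<Rightarrow> (real \<Rightarrow> real) \<Rightarrow> bool" where
  "caputo_differentiable \<nu> g \<longleftrightarrow>
     (let m = nat \<lceil>\<nu>\<rceil> in
      continuous_on {0..} g \<and>
      (\<forall>i<m. \<forall>t>0. (deriv ^^ i) g differentiable at t) \<and>
      (\<forall>t>0. set_integrable lborel {0<..<t} ((deriv ^^ m) g)) \<and>
      (\<nu> \<noteq> real m \<longrightarrow>
         (\<forall>t>0. set_integrable lborel {0<..<t}
                  (\<lambda>s. (deriv ^^ m) g s / (t - s) powr (\<nu> - real m + 1)))))"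


section \<open>Processes and the sigma-algebras they generate\<close>

definition process_events ::
  "'a measure \<Rightarrow> 'b measure \<Rightarrow> 'i set \<Rightarrow> ('i \<Rightarrow> 'a \<Rightarrow> 'b) \<Rightarrow> 'a set set" where
  "process_events M S I X =
     sigma_sets (space M) {X i -` A \<inter> space M | i A. i \<in> I \<and> A \<in> sets S}"


section \<open>Space-time fractional Poisson random field\<close>

definition backward_shift :: "(int \<Rightarrow> real) \<Rightarrow> int \<Rightarrow> real" where
  "backward_shift f n = f (n - 1)"

text \<open>
  The operator \<open>(I - B)\<close> to the power \<open>\<beta>\<close>; \<open>\<beta> gchoose k\<close> is the falling factorial \<open>(\<beta>)\<^sub>k\<close> over \<open>k!\<close>.
  The series is a finite sum for every \<open>f\<close> vanishing on the negative integers.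
\<close>
definition frac_difference :: "real \<Rightarrow> (int \<Rightarrow> real) \<Rightarrow> int \<Rightarrow> real" where
  "frac_difference \<beta> f n = (\<Sum>k. (\<beta> gchoose k) * (-1) ^ k * (backward_shift ^^ k) f n)"

text \<open>
  The system of equations, for \<open>p l n t1 t2\<close> with \<open>l\<close> the parameter \<open>\<lambda>\<close>.  It is read as a classical
  system: all derivatives exist, and \<open>p\<close> and its \<open>l\<close>-derivative are jointly continuous up to the
  axes.  The Caputo derivatives are only evaluated at positive times; the derivative in \<open>t1\<close> is the
  inner one.
\<close>
definition stfprf_system ::
  "real \<Rightarrow> real \<Rightarrow> real \<Rightarrow> (real \<Rightarrow> int \<Rightarrow> real \<Rightarrow> real \<Rightarrow> real) \<Rightarrow> bool" where
  "stfprf_system \<alpha>1 \<alpha>2 \<beta> p \<longleftrightarrow>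
     \<comment> \<open>probability distributions on the nonnegative integers\<close>
     (\<forall>l>0. \<forall>t1\<ge>0. \<forall>t2\<ge>0.
        (\<forall>n<0. p l n t1 t2 = 0) \<and> (\<forall>n\<ge>0. p l n t1 t2 \<ge> 0) \<and>
        (\<lambda>n::nat. p l (int n) t1 t2) sums 1) \<and>
     \<comment> \<open>initial conditions\<close>
     (\<forall>l>0. \<forall>t\<ge>0. p l 0 0 t = 1 \<and> p l 0 t 0 = 1) \<and>
     \<comment> \<open>regularity\<close>
     (\<forall>n\<ge>0.
        (\<forall>l>0. \<forall>t2\<ge>0. caputo_differentiable \<alpha>1 (\<lambda>s1. p l n s1 t2)) \<and>
        (\<forall>l>0. \<forall>t1>0. caputo_differentiable \<alpha>2
           (\<lambda>s2. caputo_deriv \<alpha>1 (\<lambda>s1. p l n s1 s2) t1)) \<and>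
        (\<forall>l>0. \<forall>t1\<ge>0. \<forall>t2\<ge>0. (\<lambda>r. p r n t1 t2) differentiable at l) \<and>
        continuous_on ({0<..} \<times> {0..} \<times> {0..}) (\<lambda>(l, t1, t2). p l n t1 t2) \<and>
        continuous_on ({0<..} \<times> {0..} \<times> {0..}) (\<lambda>(l, t1, t2). deriv (\<lambda>r. p r n t1 t2) l)) \<and>
     \<comment> \<open>governing equations\<close>
     (\<forall>l>0. \<forall>n\<ge>0. \<forall>t1>0. \<forall>t2>0.
        caputo_deriv \<alpha>2 (\<lambda>s2. caputo_deriv \<alpha>1 (\<lambda>s1. p l n s1 s2) t1) t2 =
        - (l powr (\<beta> + 1) / \<beta> * deriv (\<lambda>r. frac_difference \<beta> (\<lambda>m. p r m t1 t2) n) l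
           + l powr \<beta> * frac_difference \<beta> (\<lambda>m. p l m t1 t2) n))"

definition stfprf ::
  "'a measure \<Rightarrow> real \<Rightarrow> real \<Rightarrow> real \<Rightarrow> real \<Rightarrow> (real \<Rightarrow> real \<Rightarrow> 'a \<Rightarrow> nat) \<Rightarrow> bool" where
  "stfprf M \<alpha>1 \<alpha>2 \<beta> l N \<longleftrightarrow>
     (\<forall>t1\<ge>0. \<forall>t2\<ge>0. N t1 t2 \<in> measurable M (count_space UNIV)) \<and>
     (\<exists>p. stfprf_system \<alpha>1 \<alpha>2 \<beta> p \<and>
          (\<forall>t1\<ge>0. \<forall>t2\<ge>0. \<forall>n. measure M {\<omega> \<in> space M. int (N t1 t2 \<omega>) = n} = p l n t1 t2))"


section \<open>Brownian motion\<close>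

definition brownian_motion :: "'a measure \<Rightarrow> (real \<Rightarrow> 'a \<Rightarrow> real) \<Rightarrow> bool" where
  "brownian_motion M B \<longleftrightarrow>
     (\<forall>t\<ge>0. B t \<in> borel_measurable M) \<and>
     (AE \<omega> in M. B 0 \<omega> = 0) \<and>
     (\<forall>(k::nat) t. mono t \<and> t 0 \<ge> 0 \<longrightarrow>
        prob_space.indep_vars M (\<lambda>_. borel) (\<lambda>i \<omega>. B (t (Suc i)) \<omega> - B (t i) \<omega>) {..<k}) \<and>
     (\<forall>s t. 0 \<le> s \<and> s < t \<longrightarrow>
        distributed M lborel (\<lambda>\<omega>. B t \<omega> - B s \<omega>) (\<lambda>x. ennreal (normal_density 0 (sqrt (t - s)) x))) \<and>
     (AE \<omega> in M. continuous_on {0..} (\<lambda>t. B t \<omega>))"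


section \<open>Two parameter stable subordinator\<close>

definition rect_increment :: "(real \<Rightarrow> real \<Rightarrow> 'a \<Rightarrow> real) \<Rightarrow> real \<times> real \<times> real \<times> real \<Rightarrow> 'a \<Rightarrow> real" where
  "rect_increment X = (\<lambda>(s1, t1, s2, t2) \<omega>. X t1 t2 \<omega> - X s1 t2 \<omega> - X t1 s2 \<omega> + X s1 s2 \<omega>)"

definition rects :: "(real \<times> real \<times> real \<times> real) set" where
  "rects = {(s1, t1, s2, t2). 0 \<le> s1 \<and> s1 < t1 \<and> 0 \<le> s2 \<and> s2 < t2}"

definition stable_subordinator2 ::
  "'a measure \<Rightarrow> real \<Rightarrow> (real \<Rightarrow> real \<Rightarrow> 'a \<Rightarrow> real) \<Rightarrow> bool" where
  "stable_subordinator2 M \<beta> H \<longleftrightarrow>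
     (if \<beta> = 1 then \<forall>\<omega>\<in>space M. \<forall>t1\<ge>0. \<forall>t2\<ge>0. H t1 t2 \<omega> = t1 * t2
      else
        (\<forall>t1\<ge>0. \<forall>t2\<ge>0. H t1 t2 \<in> borel_measurable M) \<and>
        (\<forall>t\<ge>0. AE \<omega> in M. H 0 t \<omega> = 0 \<and> H t 0 \<omega> = 0) \<and>
        (\<forall>J. finite J \<and> J \<subseteq> rects \<and>
             disjoint_family_on (\<lambda>(s1, t1, s2, t2). {s1<..t1} \<times> {s2<..t2}) J \<longrightarrow>
             prob_space.indep_vars M (\<lambda>_. borel) (rect_increment H) J) \<and>
        (\<forall>s1 t1 s2 t2 h1 h2. (s1, t1, s2, t2) \<in> rects \<and> h1 \<ge> 0 \<and> h2 \<ge> 0 \<longrightarrow>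
             distr M borel (rect_increment H (s1 + h1, t1 + h1, s2 + h2, t2 + h2)) =
             distr M borel (rect_increment H (s1, t1, s2, t2))) \<and>
        (AE \<omega> in M. \<forall>s1 s2 t1 t2. 0 \<le> s1 \<and> s1 \<le> t1 \<and> 0 \<le> s2 \<and> s2 \<le> t2 \<longrightarrow> H s1 s2 \<omega> \<le> H t1 t2 \<omega>) \<and>
        (\<forall>u>0. \<forall>t1\<ge>0. \<forall>t2\<ge>0.
             (LINT \<omega>|M. exp (- u * H t1 t2 \<omega>)) = exp (- t1 * t2 * u powr \<beta>)))"


section \<open>Time-fractional diffusion equation and its folded solution\<close>

definition test_function :: "(real \<Rightarrow> real) \<Rightarrow> bool" where
  "test_function \<phi> \<longleftrightarrow>
     (\<forall>x. \<phi> differentiable at x) \<and> (\<forall>x. deriv \<phi> differentiable at x) \<and>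
     continuous_on UNIV (deriv (deriv \<phi>)) \<and> bounded {x. \<phi> x \<noteq> 0}"

text \<open>Pairing of \<open>u(\<cdot>, t)\<close> with a test function; \<open>u(\<cdot>, 0)\<close> is the Dirac delta at the origin.\<close>
definition pairing :: "(real \<Rightarrow> real \<Rightarrow> real) \<Rightarrow> (real \<Rightarrow> real) \<Rightarrow> real \<Rightarrow> real" where
  "pairing u \<phi> t = (if t = 0 then \<phi> 0 else (LINT x|lborel. \<phi> x * u x t))"

text \<open>
  Solutions of the Cauchy problem of order \<open>\<nu>\<close> in \<open>(0, 2)\<close>, integrable in \<open>x\<close> with bounded norm.  The
  initial datum is a distribution and for \<open>\<nu> \<noteq> 1\<close> the solution has a kink at \<open>x = 0\<close>, so the
  equation is taken in the sense of distributions in \<open>x\<close>.  The datum \<open>u(\<cdot>, 0) = \<delta>\<close> is the continuity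
  of the pairing at \<open>t = 0\<close>, contained in \<open>caputo_differentiable\<close>.
\<close>
definition diffusion_solution :: "real \<Rightarrow> (real \<Rightarrow> real \<Rightarrow> real) \<Rightarrow> bool" where
  "diffusion_solution \<nu> u \<longleftrightarrow>
     (\<forall>t>0. integrable lborel (\<lambda>x. u x t)) \<and>
     (\<exists>C. \<forall>t>0. (LINT x|lborel. \<bar>u x t\<bar>) \<le> C) \<and>
     (\<forall>\<phi>. test_function \<phi> \<longrightarrow>
        caputo_differentiable \<nu> (pairing u \<phi>) \<and>
        (\<forall>t>0. caputo_deriv \<nu> (pairing u \<phi>) t = pairing u (deriv (deriv \<phi>)) t) \<and>
        (\<nu> > 1 \<longrightarrow> (deriv (pairing u \<phi>) \<longlongrightarrow> 0) (at_right 0)))"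

text \<open>
  For \<open>\<alpha> = 1\<close> the solution \<open>(\<delta>(x - t) + \<delta>(x + t)) / 2\<close> of the wave equation has no density and its
  folded version is the point mass at \<open>t\<close>.
\<close>
definition folded_solution_process :: "'a measure \<Rightarrow> real \<Rightarrow> (real \<Rightarrow> 'a \<Rightarrow> real) \<Rightarrow> bool" where
  "folded_solution_process M \<alpha> T \<longleftrightarrow>
     (\<forall>t\<ge>0. T t \<in> borel_measurable M) \<and>
     (\<forall>t\<ge>0. \<forall>\<omega>\<in>space M. T t \<omega> \<ge> 0) \<and>
     (AE \<omega> in M. T 0 \<omega> = 0) \<and>
     (if \<alpha> = 1 then \<forall>t>0. AE \<omega> in M. T t \<omega> = t
      else \<exists>u. diffusion_solution (2 * \<alpha>) u \<and>
               (\<forall>t>0. distributed M lborel (T t) (\<lambda>x. ennreal (if x \<ge> 0 then 2 * u x t else 0))))"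

end

theory Submission
  imports Defs
begin

text \<open>
  Conditioning on the number of summands, the characteristic function of the normalised sum at \<open>u\<close> is the
  probability generating function of the random field with \<open>\<lambda> = n\<^sup>2\<close> at \<open>z = exp (- u\<^sup>2 / (2 * n\<^sup>2))\<close>.
  The heart of the matter is that this generating function is \<open>E exp (- (\<lambda> * (1 - z)) powr \<beta> * T1 t1 * T2 t2)\<close>,
  which tends to \<open>E exp (- (u\<^sup>2 / 2) powr \<beta> * T1 t1 * T2 t2)\<close>, the characteristic function of the limit.

  Power series in \<open>\<lambda>\<close> are of no use, since they diverge for \<open>\<alpha>1 + \<alpha>2 < 1\<close>.  Instead, put \<open>y = \<lambda> powr (- \<beta>)\<close>.
  Then the operator in \<open>\<lambda>\<close> on the right-hand side of the system sends \<open>p\<close> to the \<open>y\<close>-derivative of \<open>p / y\<close>,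
  up to the factor \<open>y\<close>.  Inverting the Caputo derivatives, summing against \<open>z ^ n\<close> and taking Laplace
  transforms in both times gives, for the transform \<open>Q\<close> of the generating function divided by \<open>y\<close>, the equation
  \<open>Q' = (s1 powr \<alpha>1 * s2 powr \<alpha>2 / (1 - z) powr \<beta>) * (Q - 1 / (y * s1 * s2))\<close>.  Its homogeneous solutions grow
  exponentially in \<open>y\<close>, whereas \<open>Q\<close> is bounded at infinity, so \<open>Q\<close> is determined, and it agrees with the
  transform computed from the laws of \<open>T1\<close> and \<open>T2\<close>.
\<close>


section \<open>Riemann-Liouville integrals and Caputo derivatives\<close>

text \<open>Each \<open>p l n\<close> is differentiable in \<open>l\<close>, but without any bound
  uniform in \<open>n\<close>, so the generating function cannot be differentiated termwise. Hence
  the system is integrated before it is summed: over a rectangle of times and over an interval of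
  \<open>l\<close>. After that only probabilities occur, and the sum against \<open>z ^ n\<close>
  has summable bounds. The end at which boundedness selects the solution is \<open>y\<close> to
  infinity, that is \<open>l\<close> to 0; this is why the whole family in \<open>l\<close> is used
  although the limit theorem looks at \<open>l = n\<^sup>2\<close> only. On the other side, the law
  of each random time is accessible only through a distributional equation tested with compactly
  supported functions, and \<open>exp (- \<mu> * \<bar>x\<bar>)\<close> is neither compactly
  supported nor smooth. Cutoffs remove the first defect, a second exponential with the opposite kink
  the other. The two sides meet in the integral of \<open>1 / (s1 powr \<alpha>1 + W * r)\<close>
  against \<open>exp (- (s2 powr \<alpha>2) * r)\<close> over \<open>r > 0\<close>, with
  \<open>W = (l * (1 - z)) powr \<beta>\<close>; it is never evaluated.\<close>

definition rl_kernel :: "real \<Rightarrow> real \<Rightarrow> real" where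
  "rl_kernel a t = (if t > 0 then t powr (a - 1) / Gamma a else 0)"

text \<open>Fractional integrals are taken against a measure, finite for \<open>a > 0\<close>, so
  that Fubini, dominated convergence and almost-everywhere arguments apply to them as they stand.
  The indicator removes negative times, where the functions integrated later may have arbitrary
  values.\<close>

definition rl_measure :: "real \<Rightarrow> real \<Rightarrow> real measure" where
  "rl_measure a t = density lborel (\<lambda>r. ennreal (rl_kernel a (t - r)) * indicator {0<..} r)"

definition laplace_measure :: "real \<Rightarrow> real measure" where
  "laplace_measure s = density lborel (\<lambda>t. ennreal (exp (- s * t)) * indicator {0<..} t)"

lemma rl_kernel_measurable [measurable]: "rl_kernel a \<in> borel_measurable borel"
  unfolding rl_kernel_def by measurable

lemma rl_kernel_nonneg: "a > 0 \<Longrightarrow> rl_kernel a t \<ge> 0"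
  by (simp add: rl_kernel_def less_imp_le Gamma_real_pos)

lemma sets_rl_measure [simp, measurable_cong]: "sets (rl_measure a t) = sets borel"
  by (simp add: rl_measure_def)

lemma space_rl_measure [simp]: "space (rl_measure a t) = UNIV"
  by (simp add: rl_measure_def)

lemma sets_laplace_measure [simp, measurable_cong]: "sets (laplace_measure a) = sets borel"
  by (simp add: laplace_measure_def)

lemma space_laplace_measure [simp]: "space (laplace_measure a) = UNIV"
  by (simp add: laplace_measure_def)

text \<open>With \<open>r = b + d * x\<close> and \<open>d = t - b\<close> the integral becomes
  Euler's Beta integral on the unit interval. The shift \<open>b\<close> lets one statement serve
  both the semigroup law and the total mass of \<open>rl_measure\<close>.\<close>

lemma rl_kernel_convolution:
  fixes p q t b :: real
  assumes "p > 0" "q > 0"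
  shows "(\<integral>\<^sup>+ r. ennreal (rl_kernel p (t - r)) * ennreal (rl_kernel q (r - b)) \<partial>lborel)
           = ennreal (rl_kernel (p + q) (t - b))"
proof (cases "t > b")
  case False
  then have "(\<integral>\<^sup>+ r. ennreal (rl_kernel p (t - r)) * ennreal (rl_kernel q (r - b)) \<partial>lborel)
     = (\<integral>\<^sup>+ r. 0 \<partial>(lborel :: real measure))"
    by (intro nn_integral_cong) (auto simp: rl_kernel_def)
  with False show ?thesis by (simp add: rl_kernel_def)
next
  case True
  define d where "d = t - b"
  have d: "d > 0" using True by (simp add: d_def)
  define K where "K = d powr (p + q - 2) / (Gamma p * Gamma q)"
  have pos: "Gamma p > 0" "Gamma q > 0" "Gamma (p + q) > 0" using assms by (auto intro: Gamma_real_pos)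
  then have nz: "Gamma p \<noteq> 0" "Gamma q \<noteq> 0" "Gamma (p + q) \<noteq> 0" by linarith+
  have K: "K \<ge> 0" using pos by (simp add: K_def)
  let ?B = "\<lambda>x::real. indicator {0..1} x * (x powr (q - 1) * (1 - x) powr (p - 1))"
  have "(\<integral>\<^sup>+ r. ennreal (rl_kernel p (t - r)) * ennreal (rl_kernel q (r - b)) \<partial>lborel)
      = ennreal d * (\<integral>\<^sup>+ x. ennreal (rl_kernel p (t - (b + d * x))) * ennreal (rl_kernel q (b + d * x - b)) \<partial>lborel)"
    using d by (subst nn_integral_real_affine[where c = d and t = b]) auto
  also have "(\<integral>\<^sup>+ x. ennreal (rl_kernel p (t - (b + d * x))) * ennreal (rl_kernel q (b + d * x - b)) \<partial>lborel)
      = (\<integral>\<^sup>+ x. ennreal K * ennreal (?B x) \<partial>lborel)"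
  proof (rule nn_integral_cong_AE)
    have "AE x in lborel. x \<noteq> (0::real)" "AE x in lborel. x \<noteq> (1::real)"
      by (auto intro: AE_lborel_singleton)
    then show "AE x in lborel. ennreal (rl_kernel p (t - (b + d * x))) * ennreal (rl_kernel q (b + d * x - b))
        = ennreal K * ennreal (?B x)"
    proof eventually_elim
      case (elim x)
      have *: "t - (b + d * x) = d * (1 - x)" by (simp add: d_def algebra_simps)
      show ?case
      proof (cases "0 < x \<and> x < 1")
        case True
        have "rl_kernel p (d * (1 - x)) * rl_kernel q (d * x) = K * ?B x"
          using True d powr_mult[of d "1 - x" p]
          by (simp add: rl_kernel_def K_def powr_mult powr_diff powr_add powr_numeral power2_eq_square field_simps)
        then show ?thesis
          unfolding * using K assms by (simp add: ennreal_mult'[symmetric] rl_kernel_nonneg)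
      next
        case False
        then have "x < 0 \<or> x > 1" using elim by auto
        then show ?thesis using d unfolding * by (auto simp: rl_kernel_def zero_less_mult_iff)
      qed
    qed
  qed
  also have "\<dots> = ennreal K * ennreal (Beta q p)"
    by (subst nn_integral_cmult)
       (auto intro!: arg_cong2[where f = "(*)"] nn_integral_has_integral_lebesgue has_integral_Beta_real assms)
  also have "ennreal d * \<dots> = ennreal (rl_kernel (p + q) (t - b))"
    using K d nz assms
    by (simp add: ennreal_mult'[symmetric] rl_kernel_def d_def[symmetric] K_def Beta_def powr_diff powr_numeral
        field_simps power2_eq_square)
  finally show ?thesis .
qed

lemma nn_integral_rl_measure:
  assumes "h \<in> borel_measurable borel"
  shows "(\<integral>\<^sup>+ r. h r \<partial>rl_measure a t) = (\<integral>\<^sup>+ r. ennreal (rl_kernel a (t - r)) * indicator {0<..} r * h r \<partial>lborel)"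
  unfolding rl_measure_def using assms by (subst nn_integral_density) auto

lemma nn_integral_laplace_measure:
  assumes "h \<in> borel_measurable borel"
  shows "(\<integral>\<^sup>+ r. h r \<partial>laplace_measure s) = (\<integral>\<^sup>+ r. ennreal (exp (- s * r)) * indicator {0<..} r * h r \<partial>lborel)"
  unfolding laplace_measure_def using assms by (subst nn_integral_density) auto

lemma nn_integral_rl_measure_parametric [measurable]:
  assumes [measurable]: "case_prod h \<in> borel_measurable (N \<Otimes>\<^sub>M borel)" "f \<in> borel_measurable N"
  shows "(\<lambda>x. \<integral>\<^sup>+ r. h x r \<partial>rl_measure a (f x)) \<in> borel_measurable N"
proof -
  have [measurable]: "h x \<in> borel_measurable borel" if "x \<in> space N" for x
    using that by measurable
  have "(\<lambda>x. \<integral>\<^sup>+ r. ennreal (rl_kernel a (f x - r)) * indicator {0<..} r * h x r \<partial>lborel) \<in> borel_measurable N"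
    by measurable
  then show ?thesis
    by (subst measurable_cong[OF nn_integral_rl_measure]) auto
qed

text \<open>Tonelli reduces the composition of two fractional integrals to the convolution of their
  kernels.\<close>

lemma nn_integral_rl_semigroup:
  assumes "p > 0" "q > 0" and [measurable]: "h \<in> borel_measurable borel"
  shows "(\<integral>\<^sup>+ r. (\<integral>\<^sup>+ v. h v \<partial>rl_measure q r) \<partial>rl_measure p t) = (\<integral>\<^sup>+ v. h v \<partial>rl_measure (p + q) t)"
proof -
  have "(\<integral>\<^sup>+ r. (\<integral>\<^sup>+ v. h v \<partial>rl_measure q r) \<partial>rl_measure p t)
     = (\<integral>\<^sup>+ r. ennreal (rl_kernel p (t - r)) * indicator {0<..} r *
         (\<integral>\<^sup>+ v. ennreal (rl_kernel q (r - v)) * indicator {0<..} v * h v \<partial>lborel) \<partial>lborel)"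
    by (subst nn_integral_rl_measure) (auto intro!: nn_integral_cong simp: nn_integral_rl_measure)
  also have "\<dots> = (\<integral>\<^sup>+ r. (\<integral>\<^sup>+ v. ennreal (rl_kernel p (t - r)) * indicator {0<..} r *
          (ennreal (rl_kernel q (r - v)) * indicator {0<..} v * h v) \<partial>lborel) \<partial>lborel)"
    by (subst nn_integral_cmult) auto
  also have "\<dots> = (\<integral>\<^sup>+ v. (\<integral>\<^sup>+ r. ennreal (rl_kernel p (t - r)) * indicator {0<..} r *
          (ennreal (rl_kernel q (r - v)) * indicator {0<..} v * h v) \<partial>lborel) \<partial>lborel)"
    by (rule lborel_pair.Fubini') measurable
  \<comment> \<open>For \<open>v > 0\<close> the kernel \<open>rl_kernel q (r - v)\<close> is
    nonzero only when \<open>r > v\<close>, so the indicator of \<open>r > 0\<close> is implied and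
    disappears.\<close>
  also have "\<dots> = (\<integral>\<^sup>+ v. (\<integral>\<^sup>+ r. indicator {0<..} v * h v *
       (ennreal (rl_kernel p (t - r)) * ennreal (rl_kernel q (r - v))) \<partial>lborel) \<partial>lborel)"
    by (intro nn_integral_cong) (auto simp: indicator_def rl_kernel_def mult_ac)
  also have "\<dots> = (\<integral>\<^sup>+ v. indicator {0<..} v * h v * ennreal (rl_kernel (p + q) (t - v)) \<partial>lborel)"
    by (intro nn_integral_cong) (simp add: nn_integral_cmult rl_kernel_convolution assms)
  also have "\<dots> = (\<integral>\<^sup>+ v. h v \<partial>rl_measure (p + q) t)"
    by (subst nn_integral_rl_measure) (auto simp: mult_ac)
  finally show ?thesis .
qed

lemma emeasure_rl_measure:
  assumes "a > 0"
  shows "emeasure (rl_measure a t) UNIV = ennreal (rl_kernel (a + 1) t)"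
proof -
  have "emeasure (rl_measure a t) UNIV = (\<integral>\<^sup>+ r. 1 \<partial>rl_measure a t)"
    by simp
  \<comment> \<open>The indicator of the positive half line is the kernel of order 1, so the mass is
    again a convolution of kernels.\<close>
  also have "\<dots> = (\<integral>\<^sup>+ r. ennreal (rl_kernel a (t - r)) * ennreal (rl_kernel 1 (r - 0)) \<partial>lborel)"
    by (subst nn_integral_rl_measure) (auto intro!: nn_integral_cong simp: rl_kernel_def indicator_def)
  also have "\<dots> = ennreal (rl_kernel (a + 1) t)"
    by (subst rl_kernel_convolution) (auto simp: assms)
  finally show ?thesis .
qed

lemma finite_measure_rl_measure: "a > 0 \<Longrightarrow> finite_measure (rl_measure a t)"
  by (rule finite_measureI) (simp add: emeasure_rl_measure)

lemma AE_rl_measure: "AE r in rl_measure a t. 0 < r \<and> r < t"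
  unfolding rl_measure_def
  by (subst AE_density) (auto simp: indicator_def rl_kernel_def intro!: AE_I2)

lemma AE_laplace_measure: "AE r in laplace_measure a. 0 < r"
  unfolding laplace_measure_def
  by (subst AE_density) (auto simp: indicator_def intro!: AE_I2)

lemma integrable_rl_measure_iff:
  fixes h :: "real \<Rightarrow> real"
  assumes "a > 0"
  shows "integrable (rl_measure a t) h \<longleftrightarrow>
    (h \<in> borel_measurable borel \<and> integrable lborel (\<lambda>r. rl_kernel a (t - r) * indicator {0<..} r * h r))"
proof -
  have eq: "rl_measure a t = density lborel (\<lambda>r. ennreal (rl_kernel a (t - r) * indicator {0<..} r))"
    unfolding rl_measure_def using assms
    by (intro arg_cong[where f = "density lborel"] ext) (auto simp: indicator_def)
  show ?thesis
  proof (cases "h \<in> borel_measurable borel")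
    case True
    then show ?thesis unfolding eq using assms
      by (subst integrable_density) (auto simp: rl_kernel_nonneg)
  next
    case False
    then show ?thesis using measurable_cong_sets[OF sets_rl_measure[of a t] refl, of borel] 
      by (auto dest!: borel_measurable_integrable)
  qed
qed

lemma integral_rl_measure:
  fixes h :: "real \<Rightarrow> real"
  assumes "a > 0" "h \<in> borel_measurable borel"
  shows "(\<integral> r. h r \<partial>rl_measure a t) = (\<integral> r. rl_kernel a (t - r) * indicator {0<..} r * h r \<partial>lborel)"
proof -
  have eq: "rl_measure a t = density lborel (\<lambda>r. ennreal (rl_kernel a (t - r) * indicator {0<..} r))"
    unfolding rl_measure_def using assms
    by (intro arg_cong[where f = "density lborel"] ext) (auto simp: indicator_def)
  show ?thesis unfolding eq using assms by (subst integral_density) (auto simp: rl_kernel_nonneg)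
qed

text \<open>The substitution \<open>t = b + x / s\<close> turns this into the Gamma integral. The
  case \<open>a = 1\<close>, \<open>b = 0\<close> yields the mass of
  \<open>laplace_measure\<close>.\<close>

lemma nn_integral_rl_kernel_laplace:
  assumes "a > 0" "s > 0"
  shows "(\<integral>\<^sup>+ t. ennreal (exp (- s * t)) * ennreal (rl_kernel a (t - b)) \<partial>lborel) = ennreal (s powr (- a) * exp (- s * b))"
proof -
  have G: "Gamma a > 0" using assms by (simp add: Gamma_real_pos)
  then have "Gamma a \<noteq> 0" by linarith
  note G = G this
  have "(\<integral>\<^sup>+ t. ennreal (exp (- s * t)) * ennreal (rl_kernel a (t - b)) \<partial>lborel)
     = ennreal (1 / s) * (\<integral>\<^sup>+ x. ennreal (exp (- s * (b + x / s))) * ennreal (rl_kernel a (x / s)) \<partial>lborel)"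
    using assms by (subst nn_integral_real_affine[where c = "1/s" and t = b]) (auto simp: mult_ac)
  also have "(\<integral>\<^sup>+ x. ennreal (exp (- s * (b + x / s))) * ennreal (rl_kernel a (x / s)) \<partial>lborel)
     = (\<integral>\<^sup>+ x. ennreal (exp (- s * b) * s powr (1 - a) / Gamma a) * ennreal (indicator {0..} x * x powr (a - 1) / exp x) \<partial>lborel)"
  proof (rule nn_integral_cong_AE)
    have "AE x in lborel. x \<noteq> (0::real)" by (auto intro: AE_lborel_singleton)
    then show "AE x in lborel. ennreal (exp (- s * (b + x / s))) * ennreal (rl_kernel a (x / s))
       = ennreal (exp (- s * b) * s powr (1 - a) / Gamma a) * ennreal (indicator {0..} x * x powr (a - 1) / exp x)"
    proof eventually_elim
      case (elim x)
      show ?case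
      proof (cases "x > 0")
        case True
        have "exp (- s * (b + x / s)) * rl_kernel a (x / s) = (exp (- s * b) * s powr (1 - a) / Gamma a) * (x powr (a - 1) / exp x)"
        proof -
          have "- s * (b + x / s) = - s * b - x" using assms by (simp add: field_simps)
          then have "exp (- s * (b + x / s)) = exp (- s * b) / exp x" by (simp only: exp_diff)
          moreover have "rl_kernel a (x / s) = s powr (1 - a) / Gamma a * x powr (a - 1)"
            using True assms by (simp add: rl_kernel_def powr_divide powr_diff mult_ac)
          ultimately show ?thesis by (simp add: mult_ac)
        qed
        then show ?thesis using True assms G by (simp add: ennreal_mult'[symmetric] rl_kernel_nonneg)
      next
        case False
        then show ?thesis using elim assms by (simp add: rl_kernel_def indicator_def zero_less_divide_iff)
      qed
    qed
  qed
  also have "\<dots> = ennreal (exp (- s * b) * s powr (1 - a) / Gamma a) * ennreal (Gamma a)"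
    by (subst nn_integral_cmult) (use assms in \<open>auto simp: Gamma_conv_nn_integral_real\<close>)
  also have "ennreal (1 / s) * \<dots> = ennreal (s powr (- a) * exp (- s * b))"
    using assms G by (simp add: ennreal_mult'[symmetric] powr_diff powr_minus field_simps)
  finally show ?thesis .
qed

text \<open>After Tonelli the inner integral is the transform of a shifted kernel, so a fractional
  integral of order \<open>a\<close> becomes multiplication by \<open>s powr (- a)\<close>. This is
  how the Caputo derivatives turn into algebra.\<close>

lemma nn_integral_laplace_rl:
  assumes "a > 0" "s > 0" and [measurable]: "h \<in> borel_measurable borel"
  shows "(\<integral>\<^sup>+ t. (\<integral>\<^sup>+ r. h r \<partial>rl_measure a t) \<partial>laplace_measure s) = ennreal (s powr (- a)) * (\<integral>\<^sup>+ r. h r \<partial>laplace_measure s)"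
proof -
  have "(\<integral>\<^sup>+ t. (\<integral>\<^sup>+ r. h r \<partial>rl_measure a t) \<partial>laplace_measure s)
     = (\<integral>\<^sup>+ t. ennreal (exp (- s * t)) * indicator {0<..} t *
         (\<integral>\<^sup>+ r. ennreal (rl_kernel a (t - r)) * indicator {0<..} r * h r \<partial>lborel) \<partial>lborel)"
    by (subst nn_integral_laplace_measure) (auto intro!: nn_integral_cong simp: nn_integral_rl_measure)
  also have "\<dots> = (\<integral>\<^sup>+ t. (\<integral>\<^sup>+ r. ennreal (exp (- s * t)) * indicator {0<..} t *
         (ennreal (rl_kernel a (t - r)) * indicator {0<..} r * h r) \<partial>lborel) \<partial>lborel)"
    by (subst nn_integral_cmult) auto
  also have "\<dots> = (\<integral>\<^sup>+ r. (\<integral>\<^sup>+ t. ennreal (exp (- s * t)) * indicator {0<..} t *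
         (ennreal (rl_kernel a (t - r)) * indicator {0<..} r * h r) \<partial>lborel) \<partial>lborel)"
    by (rule lborel_pair.Fubini') measurable
  also have "\<dots> = (\<integral>\<^sup>+ r. (\<integral>\<^sup>+ t. indicator {0<..} r * h r *
       (ennreal (exp (- s * t)) * ennreal (rl_kernel a (t - r))) \<partial>lborel) \<partial>lborel)"
    by (intro nn_integral_cong) (auto simp: indicator_def rl_kernel_def mult_ac)
  also have "\<dots> = (\<integral>\<^sup>+ r. indicator {0<..} r * h r * ennreal (s powr (- a) * exp (- s * r)) \<partial>lborel)"
    by (intro nn_integral_cong) (simp add: nn_integral_cmult nn_integral_rl_kernel_laplace[simplified] assms)
  also have "\<dots> = (\<integral>\<^sup>+ r. ennreal (s powr (- a)) * (ennreal (exp (- s * r)) * indicator {0<..} r * h r) \<partial>lborel)"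
    by (simp add: ennreal_mult' mult_ac)
  also have "\<dots> = ennreal (s powr (- a)) * (\<integral>\<^sup>+ r. h r \<partial>laplace_measure s)"
    by (subst nn_integral_laplace_measure) (auto simp: nn_integral_cmult)
  finally show ?thesis .
qed

lemma emeasure_laplace_measure:
  assumes "s > 0"
  shows "emeasure (laplace_measure s) UNIV = ennreal (1 / s)"
proof -
  have "emeasure (laplace_measure s) UNIV = (\<integral>\<^sup>+ r. 1 \<partial>laplace_measure s)" by simp
  also have "\<dots> = (\<integral>\<^sup>+ t. ennreal (exp (- s * t)) * ennreal (rl_kernel 1 (t - 0)) \<partial>lborel)"
    by (subst nn_integral_laplace_measure) (auto intro!: nn_integral_cong simp: rl_kernel_def indicator_def)
  also have "\<dots> = ennreal (1 / s)"
    using assms by (subst nn_integral_rl_kernel_laplace) (auto simp: powr_minus field_simps)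
  finally show ?thesis .
qed

lemma finite_measure_laplace_measure: "s > 0 \<Longrightarrow> finite_measure (laplace_measure s)"
  by (rule finite_measureI) (simp add: emeasure_laplace_measure)

lemma rl_measure_integral_parametric [measurable]:
  fixes h :: "'b \<Rightarrow> real \<Rightarrow> real"
  assumes a: "a > 0" and [measurable]: "case_prod h \<in> borel_measurable (N \<Otimes>\<^sub>M borel)" "f \<in> borel_measurable N"
  shows "(\<lambda>x. \<integral> r. h x r \<partial>rl_measure a (f x)) \<in> borel_measurable N"
proof -
  have [measurable]: "h x \<in> borel_measurable borel" if "x \<in> space N" for x
    using that by measurable
  have "(\<lambda>x. \<integral> r. rl_kernel a (f x - r) * indicator {0<..} r * h x r \<partial>lborel) \<in> borel_measurable N"
    by measurable
  then show ?thesis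
    by (subst measurable_cong[OF integral_rl_measure[OF a]]) auto
qed

text \<open>Integrability at order \<open>p + q\<close> suffices for Fubini: the nonnegative version
  applied to the absolute value of \<open>h\<close> shows the double integral to be finite.\<close>

lemma integral_rl_semigroup:
  fixes h :: "real \<Rightarrow> real"
  assumes p: "p > 0" and q: "q > 0" and int: "integrable (rl_measure (p + q) t) h"
  shows "(\<integral> r. (\<integral> v. h v \<partial>rl_measure q r) \<partial>rl_measure p t) = (\<integral> v. h v \<partial>rl_measure (p + q) t)"
proof -
  have pq: "p + q > 0" using p q by simp
  have [measurable]: "h \<in> borel_measurable borel"
    using int integrable_rl_measure_iff[OF pq] by blast
  define f where "f r v = rl_kernel p (t - r) * indicator {0<..} r * (rl_kernel q (r - v) * indicator {0<..} v * h v)" for r v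
  have [measurable]: "case_prod f \<in> borel_measurable (lborel \<Otimes>\<^sub>M lborel)"
    unfolding f_def by measurable
  have "integrable (lborel \<Otimes>\<^sub>M lborel) (case_prod f)"
  proof (rule integrableI_bounded)
    have "(\<integral>\<^sup>+ x. ennreal (norm (case_prod f x)) \<partial>(lborel \<Otimes>\<^sub>M lborel)) = (\<integral>\<^sup>+ r. (\<integral>\<^sup>+ v. ennreal (norm (f r v)) \<partial>lborel) \<partial>lborel)"
      by (subst lborel.nn_integral_fst[symmetric]) auto
    also have "\<dots> = (\<integral>\<^sup>+ r. ennreal (rl_kernel p (t - r)) * indicator {0<..} r *
         (\<integral>\<^sup>+ v. ennreal (rl_kernel q (r - v)) * indicator {0<..} v * ennreal \<bar>h v\<bar> \<partial>lborel) \<partial>lborel)"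
      by (intro nn_integral_cong, subst nn_integral_cmult[symmetric])
         (auto intro!: nn_integral_cong simp: f_def abs_mult rl_kernel_nonneg p q ennreal_mult' indicator_def)
    also have "\<dots> = (\<integral>\<^sup>+ r. (\<integral>\<^sup>+ v. ennreal \<bar>h v\<bar> \<partial>rl_measure q r) \<partial>rl_measure p t)"
      by (subst nn_integral_rl_measure) (auto intro!: nn_integral_cong simp: nn_integral_rl_measure)
    also have "\<dots> = (\<integral>\<^sup>+ v. ennreal (norm (h v)) \<partial>rl_measure (p + q) t)"
      by (subst nn_integral_rl_semigroup) (auto simp: p q)
    also have "\<dots> < \<infinity>" using int by (simp add: integrable_iff_bounded)
    finally show "(\<integral>\<^sup>+ x. ennreal (norm (case_prod f x)) \<partial>(lborel \<Otimes>\<^sub>M lborel)) < \<infinity>" .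
  qed auto
  from lborel_pair.Fubini_integral[OF this]
  have Fub: "(\<integral> v. (\<integral> r. f r v \<partial>lborel) \<partial>lborel) = (\<integral> r. (\<integral> v. f r v \<partial>lborel) \<partial>lborel)" .
  have conv: "(\<integral> r. rl_kernel p (t - r) * rl_kernel q (r - v) \<partial>lborel) = rl_kernel (p + q) (t - v)" for v
    using rl_kernel_convolution[OF p q, of t v]
    by (subst integral_eq_nn_integral) (auto simp: rl_kernel_nonneg p q pq ennreal_mult')
  have "(\<integral> r. f r v \<partial>lborel) = rl_kernel (p + q) (t - v) * indicator {0<..} v * h v" for v
  proof -
    have "(\<integral> r. f r v \<partial>lborel) = (\<integral> r. (indicator {0<..} v * h v) * (rl_kernel p (t - r) * rl_kernel q (r - v)) \<partial>lborel)"
      by (intro Bochner_Integration.integral_cong) (auto simp: f_def indicator_def rl_kernel_def)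
    then show ?thesis by (simp add: conv mult_ac)
  qed
  moreover have "(\<integral> v. f r v \<partial>lborel) = rl_kernel p (t - r) * indicator {0<..} r * (\<integral> v. h v \<partial>rl_measure q r)" for r
    by (simp add: f_def integral_rl_measure q)
  ultimately show ?thesis
    using Fub by (simp add: integral_rl_measure p q pq)
qed

section \<open>Inversion of Caputo derivatives\<close>

lemma LINT_deriv_eq_diff:
  fixes g :: "real \<Rightarrow> real"
  assumes cont: "continuous_on {0..} g" and diff: "\<And>s. s > 0 \<Longrightarrow> g differentiable at s"
    and int: "set_integrable lborel {0<..<t} (deriv g)" and t: "t > 0"
  shows "(LINT s:{0<..<t}|lborel. deriv g s) = g t - g 0"
proof -
  \<comment> \<open>The gauge integral is used because its fundamental theorem asks for
    differentiability only inside the interval and for no regularity of \<open>deriv g\<close>; the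
    assumed Lebesgue integrability then identifies the two integrals.\<close>
  have "(deriv g has_integral (g t - g 0)) {0..t}"
    using t by (intro fundamental_theorem_of_calculus_interior continuous_on_subset[OF cont])
       (auto intro!: diff simp: has_real_derivative_iff_has_vector_derivative[symmetric] DERIV_deriv_iff_real_differentiable)
  then have "(deriv g has_integral (g t - g 0)) {0<..<t}"
    using has_integral_Icc_iff_Ioo by blast
  moreover have "(deriv g has_integral (LINT s:{0<..<t}|lborel. deriv g s)) {0<..<t}"
    using has_integral_set_lebesgue set_borel_integral_eq_integral[OF int] by (metis integrable_integral)
  ultimately show ?thesis using has_integral_unique by blast
qed

text \<open>Measurability of the highest derivative is only implicit in its integrability over
  bounded intervals, so it is recovered from a pointwise limit of the restrictions to
  \<open>{0<..<real n}\<close>.\<close>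

lemma caputo_differentiable_measurable_deriv:
  assumes "caputo_differentiable \<nu> g"
  shows "(\<lambda>s. indicator {0<..} s * (deriv ^^ nat \<lceil>\<nu>\<rceil>) g s) \<in> borel_measurable borel"
proof (rule borel_measurable_LIMSEQ_real)
  fix s :: real
  have "eventually (\<lambda>n. (indicator {0<..<real n} s :: real) = indicator {0<..} s) sequentially"
    using eventually_gt_at_top[of "nat \<lceil>\<bar>s\<bar>\<rceil>"] by eventually_elim (auto simp: indicator_def; linarith)
  then show "(\<lambda>n. indicator {0<..<real n} s * (deriv ^^ nat \<lceil>\<nu>\<rceil>) g s) \<longlonglongrightarrow> indicator {0<..} s * (deriv ^^ nat \<lceil>\<nu>\<rceil>) g s"
    by (intro tendsto_mult tendsto_const) (auto intro: tendsto_eventually)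
next
  fix n :: nat
  have "set_integrable lborel {0<..<real n} ((deriv ^^ nat \<lceil>\<nu>\<rceil>) g)"
    using assms by (cases "n = 0") (auto simp: caputo_differentiable_def Let_def set_integrable_def)
  then show "(\<lambda>s. indicator {0<..<real n} s * (deriv ^^ nat \<lceil>\<nu>\<rceil>) g s) \<in> borel_measurable borel"
    unfolding set_integrable_def by (auto dest!: borel_measurable_integrable)
qed

text \<open>In this form the inversion of a Caputo derivative is an instance of the semigroup law:
  with \<open>m = nat \<lceil>\<nu>\<rceil>\<close>, the orders \<open>\<nu>\<close> and
  \<open>m - \<nu>\<close> add up to \<open>m\<close>.\<close>

lemma caputo_deriv_eq_rl:
  assumes "caputo_differentiable \<nu> g" and "\<nu> \<noteq> real (nat \<lceil>\<nu>\<rceil>)" "\<nu> > 0"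
  shows "caputo_deriv \<nu> g t = (\<integral> s. indicator {0<..} s * (deriv ^^ nat \<lceil>\<nu>\<rceil>) g s \<partial>rl_measure (real (nat \<lceil>\<nu>\<rceil>) - \<nu>) t)"
proof -
  define m where "m = nat \<lceil>\<nu>\<rceil>"
  have pos: "real m - \<nu> > 0" using assms(2,3) unfolding m_def by linarith
  have "caputo_deriv \<nu> g t = 1 / Gamma (real m - \<nu>) *
             (LINT s:{0<..<t}|lborel. (deriv ^^ m) g s / (t - s) powr (\<nu> - real m + 1))"
    using assms(2) by (simp add: caputo_deriv_def Let_def m_def)
  also have "\<dots> = (\<integral> s. 1 / Gamma (real m - \<nu>) * (indicator {0<..<t} s * ((deriv ^^ m) g s / (t - s) powr (\<nu> - real m + 1))) \<partial>lborel)"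
    unfolding set_lebesgue_integral_def by (subst integral_mult_right_zero) simp
  also have "\<dots> = (\<integral> s. rl_kernel (real m - \<nu>) (t - s) * indicator {0<..} s * (indicator {0<..} s * (deriv ^^ m) g s) \<partial>lborel)"
  proof (intro Bochner_Integration.integral_cong refl)
    fix s
    have "(t - s) powr (real m - \<nu> - 1) = 1 / (t - s) powr (\<nu> - real m + 1)"
      by (subst powr_minus_divide[symmetric]) (simp add: algebra_simps)
    then show "1 / Gamma (real m - \<nu>) * (indicator {0<..<t} s * ((deriv ^^ m) g s / (t - s) powr (\<nu> - real m + 1)))
      = rl_kernel (real m - \<nu>) (t - s) * indicator {0<..} s * (indicator {0<..} s * (deriv ^^ m) g s)"
      by (auto simp: rl_kernel_def indicator_def)
  qed
  also have "\<dots> = (\<integral> s. indicator {0<..} s * (deriv ^^ m) g s \<partial>rl_measure (real m - \<nu>) t)"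
    using caputo_differentiable_measurable_deriv[OF assms(1)] pos
    by (subst integral_rl_measure) (auto simp: m_def)
  finally show ?thesis by (simp add: m_def)
qed

lemma caputo_deriv_measurable:
  assumes "caputo_differentiable \<nu> g" "\<nu> > 0"
  shows "(\<lambda>t. indicator {0<..} t * caputo_deriv \<nu> g t) \<in> borel_measurable borel"
proof (cases "\<nu> = real (nat \<lceil>\<nu>\<rceil>)")
  case True
  then show ?thesis using caputo_differentiable_measurable_deriv[OF assms(1)]
    by (simp add: caputo_deriv_def Let_def)
next
  case False
  have [measurable]: "(\<lambda>s. indicator {0<..} s * (deriv ^^ nat \<lceil>\<nu>\<rceil>) g s) \<in> borel_measurable borel"
    by (rule caputo_differentiable_measurable_deriv[OF assms(1)])
  have pos: "real (nat \<lceil>\<nu>\<rceil>) - \<nu> > 0" using False assms(2) by linarith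
  show ?thesis unfolding caputo_deriv_eq_rl[OF assms(1) False assms(2)]
    using pos by (intro borel_measurable_times rl_measure_integral_parametric) auto
qed

text \<open>The fractional integral of order \<open>\<alpha>\<close> of the derivative of order
  \<open>\<alpha>\<close> is, since \<open>\<alpha> + (1 - \<alpha>) = 1\<close>, the ordinary
  integral of \<open>deriv g\<close>, hence \<open>g t - g 0\<close>. The function \<open>h\<close>
  has to agree with the Caputo derivative only strictly between 0 and \<open>t\<close>, which lets
  callers supply a representative that is measurable on the whole line.\<close>

lemma integral_rl_caputo_deriv:
  assumes cd: "caputo_differentiable \<alpha> g" and \<alpha>: "0 < \<alpha>" "\<alpha> \<le> 1" and t: "t > 0"
    and [measurable]: "h \<in> borel_measurable borel" and h: "\<And>r. 0 < r \<Longrightarrow> r < t \<Longrightarrow> h r = caputo_deriv \<alpha> g r"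
  shows "(\<integral> r. h r \<partial>rl_measure \<alpha> t) = g t - g 0"
proof -
  have m: "nat \<lceil>\<alpha>\<rceil> = 1" using \<alpha> by linarith
  define g' where "g' s = indicator {0<..} s * deriv g s" for s
  have [measurable]: "g' \<in> borel_measurable borel"
    using caputo_differentiable_measurable_deriv[OF cd] by (simp add: m g'_def[abs_def])
  have int: "set_integrable lborel {0<..<t} (deriv g)"
    using cd t by (auto simp: caputo_differentiable_def Let_def m)
  have rl1: "rl_kernel 1 (t - r) * indicator {0<..} r * g' r = indicator {0<..<t} r *\<^sub>R deriv g r" for r
    by (auto simp: rl_kernel_def indicator_def g'_def)
  have int1: "integrable (rl_measure 1 t) g'"
    using int by (simp add: integrable_rl_measure_iff rl1[abs_def] set_integrable_def)
  have ftc: "(\<integral> r. g' r \<partial>rl_measure 1 t) = g t - g 0"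
  proof -
    have "(\<integral> r. g' r \<partial>rl_measure 1 t) = (LINT s:{0<..<t}|lborel. deriv g s)"
      by (simp add: integral_rl_measure rl1[abs_def] set_lebesgue_integral_def)
    also have "\<dots> = g t - g 0"
      using cd t int by (intro LINT_deriv_eq_diff) (auto simp: caputo_differentiable_def Let_def m)
    finally show ?thesis .
  qed
  show ?thesis
  proof (cases "\<alpha> = 1")
    case True
    have "(\<integral> r. h r \<partial>rl_measure 1 t) = (\<integral> r. g' r \<partial>rl_measure 1 t)"
    proof (intro integral_cong_AE)
      show "AE r in rl_measure 1 t. h r = g' r"
        using AE_rl_measure[of t 1]
      proof eventually_elim
        case (elim r)
        show ?case using h[of r] elim True by (simp add: caputo_deriv_def Let_def g'_def)
      qed
    qed auto
    then show ?thesis using ftc True by simp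
  next
    case False
    have "(\<integral> r. h r \<partial>rl_measure \<alpha> t) = (\<integral> r. (\<integral> s. g' s \<partial>rl_measure (1 - \<alpha>) r) \<partial>rl_measure \<alpha> t)"
    proof (intro integral_cong_AE)
      show "(\<lambda>r. \<integral> s. g' s \<partial>rl_measure (1 - \<alpha>) r) \<in> borel_measurable (rl_measure \<alpha> t)"
        using False \<alpha> by (intro rl_measure_integral_parametric) auto
      show "AE x in rl_measure \<alpha> t. h x = integral\<^sup>L (rl_measure (1 - \<alpha>) x) g'"
        using AE_rl_measure[of t \<alpha>]
      proof eventually_elim
        case (elim r)
        show ?case using h[of r] elim caputo_deriv_eq_rl[OF cd, of r] False \<alpha> m by (simp add: g'_def[abs_def])
      qed
    qed auto
    also have "\<dots> = (\<integral> r. g' r \<partial>rl_measure 1 t)"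
      using integral_rl_semigroup[of \<alpha> "1 - \<alpha>" t g'] int1 False \<alpha> by simp
    finally show ?thesis using ftc by simp
  qed
qed

section \<open>Laplace transforms of bounded functions\<close>

lemma integral_laplace_measure:
  fixes h :: "real \<Rightarrow> real"
  assumes "h \<in> borel_measurable borel"
  shows "(\<integral> r. h r \<partial>laplace_measure s) = (\<integral> r. exp (- s * r) * indicator {0<..} r * h r \<partial>lborel)"
proof -
  have eq: "laplace_measure s = density lborel (\<lambda>r. ennreal (exp (- s * r) * indicator {0<..} r))"
    unfolding laplace_measure_def
    by (intro arg_cong[where f = "density lborel"] ext) (auto simp: indicator_def)
  show ?thesis unfolding eq using assms by (subst integral_density) auto
qed

lemma integrable_laplace_measure_bounded:
  fixes h :: "real \<Rightarrow> real"
  assumes "s > 0" "h \<in> borel_measurable borel" "\<And>r. r > 0 \<Longrightarrow> \<bar>h r\<bar> \<le> K"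
  shows "integrable (laplace_measure s) h"
proof -
  interpret finite_measure "laplace_measure s" using assms(1) by (rule finite_measure_laplace_measure)
  have "AE r in laplace_measure s. norm (h r) \<le> K"
    using AE_laplace_measure[of s] by eventually_elim (use assms(3) in auto)
  then show ?thesis using assms(2) by (intro integrable_const_bound[where B = K]) auto
qed

text \<open>
  Weierstrass approximation in the variable \<open>v = exp (- t)\<close>; the factor \<open>v * (1 - v)\<close> makes \<open>f (- ln v)\<close>
  continuous at both end points.
\<close>
lemma laplace_injective:
  fixes f :: "real \<Rightarrow> real"
  assumes [measurable]: "f \<in> borel_measurable borel"
    and cont: "continuous_on {0<..} f" and bd: "\<And>r. r > 0 \<Longrightarrow> \<bar>f r\<bar> \<le> K"
    and zero: "\<And>s. s > 0 \<Longrightarrow> (\<integral> r. f r \<partial>laplace_measure s) = 0"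
    and t: "t > 0"
  shows "f t = 0"
proof -
  let ?L = "laplace_measure 1"
  have K: "K \<ge> 0" using bd[OF t] by linarith
  interpret finite_measure ?L by (rule finite_measure_laplace_measure) simp
  have intf: "integrable ?L f" using bd by (intro integrable_laplace_measure_bounded[where K = K]) auto
  define g where "g v = (if 0 < v \<and> v < 1 then v * (1 - v) * f (- ln v) else 0)" for v :: real
  have g_bd: "\<bar>g v\<bar> \<le> \<bar>v * (1 - v)\<bar> * K" for v
    using bd[of "- ln v"] K by (auto simp: g_def abs_mult intro!: mult_left_mono)
  have contg: "continuous_on {0..1} g"
  proof -
    have "isCont g v" if "v \<in> {0..1}" for v
    proof (cases "0 < v \<and> v < 1")
      case True
      have "isCont f (- ln v)" using cont True by (subst (asm) continuous_on_eq_continuous_at) auto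
      then have "isCont (\<lambda>v. v * (1 - v) * f (- ln v)) v"
        using True by (intro continuous_mult[where f = "\<lambda>v. v * (1 - v)"] isCont_o2[where g = f and f = "\<lambda>v. - ln v"]) (auto intro!: continuous_intros)
      moreover have "eventually (\<lambda>x. g x = x * (1 - x) * f (- ln x)) (nhds v)"
        using eventually_nhds_in_open[of "{0<..<1}" v] True by (auto simp: g_def elim!: eventually_mono)
      ultimately show ?thesis by (simp add: isCont_cong)
    next
      case False
      then have v: "v = 0 \<or> v = 1" using that by auto
      have "((\<lambda>x. \<bar>x * (1 - x)\<bar> * K) \<longlongrightarrow> \<bar>v * (1 - v)\<bar> * K) (at v)" by (intro tendsto_intros)
      then have "((\<lambda>x. \<bar>x * (1 - x)\<bar> * K) \<longlongrightarrow> 0) (at v)" using v by auto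
      then have "(g \<longlongrightarrow> 0) (at v)"
        by (rule Lim_null_comparison[rotated]) (use g_bd in auto)
      then show ?thesis using v by (auto simp: isCont_def g_def)
    qed
    then show ?thesis by (simp add: continuous_at_imp_continuous_on)
  qed
  \<comment> \<open>The factor \<open>exp (- (real k * r))\<close> merely shifts the transform
    parameter from 1 to \<open>1 + k\<close>, where the transform vanishes by assumption.\<close>
  have poly: "(\<integral> r. exp (- (real k * r)) * f r \<partial>?L) = 0" for k
  proof -
    have "(\<integral> r. exp (- (real k * r)) * f r \<partial>?L) = (\<integral> r. f r \<partial>laplace_measure (1 + real k))"
    proof -
      have "exp (- 1 * r) * indicator {0<..} r * (exp (- (real k * r)) * f r) = exp (- (1 + real k) * r) * indicator {0<..} r * f r" for r
      proof -
        have "exp (- (1 + real k) * r) = exp (- 1 * r) * exp (- (real k * r))"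
          by (subst exp_add[symmetric]) (simp add: algebra_simps)
        then show ?thesis by simp
      qed
      then show ?thesis
        by (subst integral_laplace_measure, measurable, subst integral_laplace_measure, measurable) (simp only:)
    qed
    also have "\<dots> = 0" by (rule zero) simp
    finally show ?thesis .
  qed
  \<comment> \<open>For \<open>r > 0\<close> this is \<open>g\<close> at \<open>exp (- r)\<close>,
    hence a uniform limit of polynomials in \<open>exp (- r)\<close>. At the same time
    \<open>\<gamma> r * f r\<close> is nonnegative there, so a vanishing integral forces
    \<open>f = 0\<close> almost everywhere.\<close>
  define \<gamma> where "\<gamma> r = exp (- r) * (1 - exp (- r)) * f r" for r
  have \<gamma>g: "\<gamma> r = g (exp (- r))" if "r > 0" for r using that by (simp add: \<gamma>_def g_def)
  have \<gamma>_bd: "\<bar>\<gamma> r\<bar> \<le> K" if "r > 0" for r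
  proof -
    have "\<bar>\<gamma> r\<bar> = exp (- r) * (1 - exp (- r)) * \<bar>f r\<bar>" using that by (simp add: \<gamma>_def abs_mult)
    also have "\<dots> \<le> 1 * 1 * K" using that bd[OF that] by (intro mult_mono) auto
    finally show ?thesis by simp
  qed
  have [measurable]: "\<gamma> \<in> borel_measurable borel" unfolding \<gamma>_def by measurable
  have int\<gamma>f: "integrable ?L (\<lambda>r. \<gamma> r * f r)"
    using bd \<gamma>_bd K by (intro integrable_laplace_measure_bounded[where K = "K * K"]) (auto simp: abs_mult intro!: mult_mono)
  have "\<bar>\<integral> r. \<gamma> r * f r \<partial>?L\<bar> \<le> e * K" if e: "e > 0" for e
  proof -
    obtain P where P: "real_polynomial_function P" "\<And>x. x \<in> {0..1} \<Longrightarrow> \<bar>g x - P x\<bar> < e"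
      using Stone_Weierstrass_real_polynomial_function[of "{0..1}" g e] contg e by auto
    then obtain a n where Pa: "P = (\<lambda>x. \<Sum>i\<le>n. a i * x ^ i)"
      using real_polynomial_function_iff_sum by blast
    have Pz: "(\<integral> r. P (exp (- r)) * f r \<partial>?L) = 0" and intP: "integrable ?L (\<lambda>r. P (exp (- r)) * f r)"
    proof -
      have eq: "P (exp (- r)) * f r = (\<Sum>i\<le>n. a i * (exp (- (real i * r)) * f r))" for r
      proof -
        have "exp (- (real i * r)) = exp (- r) ^ i" for i
          by (subst exp_of_nat_mult[symmetric]) simp
        then show ?thesis by (simp add: Pa sum_distrib_right mult.assoc)
      qed
      have i: "integrable ?L (\<lambda>r. exp (- (real i * r)) * f r)" for i
      proof (intro integrable_laplace_measure_bounded[where K = K])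
        show "\<bar>exp (- (real i * r)) * f r\<bar> \<le> K" if "r > 0" for r
        proof -
          have "\<bar>exp (- (real i * r)) * f r\<bar> = exp (- (real i * r)) * \<bar>f r\<bar>" by (simp add: abs_mult)
          also have "\<dots> \<le> 1 * K" using that bd[OF that] by (intro mult_mono) auto
          finally show ?thesis by simp
        qed
      qed auto
      show "integrable ?L (\<lambda>r. P (exp (- r)) * f r)" unfolding eq by (intro Bochner_Integration.integrable_sum integrable_mult_right i)
      show "(\<integral> r. P (exp (- r)) * f r \<partial>?L) = 0" unfolding eq
        by (subst Bochner_Integration.integral_sum) (auto intro!: integrable_mult_right i simp: poly)
    qed
    have "(\<integral> r. \<gamma> r * f r \<partial>?L) = (\<integral> r. (\<gamma> r - P (exp (- r))) * f r \<partial>?L)"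
      using Pz intP int\<gamma>f by (simp add: left_diff_distrib)
    also have "\<bar>\<dots>\<bar> \<le> (\<integral> r. \<bar>(\<gamma> r - P (exp (- r))) * f r\<bar> \<partial>?L)"
      using integral_norm_bound[of ?L "\<lambda>r. (\<gamma> r - P (exp (- r))) * f r"] by simp
    also have "\<dots> \<le> (\<integral> r. e * K \<partial>?L)"
    proof (rule integral_mono_AE)
      show "integrable ?L (\<lambda>r. \<bar>(\<gamma> r - P (exp (- r))) * f r\<bar>)"
        using intP int\<gamma>f by (simp add: left_diff_distrib)
      show "AE r in ?L. \<bar>(\<gamma> r - P (exp (- r))) * f r\<bar> \<le> e * K"
        using AE_laplace_measure[of 1]
      proof eventually_elim
        case (elim r)
        then show ?case using P(2)[of "exp (- r)"] bd[of r] e unfolding abs_mult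
          by (intro mult_mono) (auto simp: \<gamma>g)
      qed
    qed auto
    also have "\<dots> = e * K" using emeasure_laplace_measure[of 1] by (simp add: measure_def)
    finally show ?thesis .
  qed
  note small = this
  have "(\<integral> r. \<gamma> r * f r \<partial>?L) = 0"
  proof (rule ccontr)
    define I where "I = \<bar>\<integral> r. \<gamma> r * f r \<partial>?L\<bar>"
    assume "(\<integral> r. \<gamma> r * f r \<partial>?L) \<noteq> 0"
    then have I: "I > 0" by (simp add: I_def)
    \<comment> \<open>The choice \<open>e = I / (2 * (K + 1))\<close> makes \<open>e * K < I\<close>
      even when \<open>K = 0\<close>.\<close>
    have "I \<le> I / (2 * (K + 1)) * K" using small[of "I / (2 * (K + 1))"] I K by (simp add: I_def)
    also have "\<dots> = I * (K / (2 * (K + 1)))" using K by simp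
    also have "\<dots> < I * 1" using I K by (intro mult_strict_left_mono) (auto simp: divide_simps)
    finally show False by simp
  qed
  moreover have nonneg: "AE r in ?L. 0 \<le> \<gamma> r * f r"
    using AE_laplace_measure[of 1] by eventually_elim (auto simp: \<gamma>_def mult.assoc)
  ultimately have "AE r in ?L. \<gamma> r * f r = 0"
    using integral_nonneg_eq_0_iff_AE[OF int\<gamma>f nonneg] by simp
  then have "AE r in ?L. f r = 0"
    using AE_laplace_measure[of 1] by eventually_elim (auto simp: \<gamma>_def)
  then have ae: "AE r in lborel. 0 < r \<longrightarrow> f r = 0"
    unfolding laplace_measure_def by (subst (asm) AE_density) (auto simp: indicator_def)
  \<comment> \<open>Continuity upgrades almost everywhere to everywhere: the exceptional set is open
    and null, hence empty.\<close>
  define U where "U = {r \<in> {0<..}. f r \<noteq> 0}"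
  have "open U" unfolding U_def using continuous_open_preimage[OF cont, of "- {0}"]
    by (auto simp: vimage_def Int_def)
  moreover have "U \<in> null_sets lborel"
    using ae by (subst AE_iff_null_sets) (auto simp: U_def)
  then have "negligible U" by (simp add: negligible_iff_null_sets null_sets_completionI)
  ultimately have "U = {}" using open_not_negligible by blast
  then show ?thesis using t by (auto simp: U_def)
qed

section \<open>Caputo derivatives of order between one and two\<close>

text \<open>The derivative of order \<open>\<nu>\<close> of \<open>g\<close> is that of order
  \<open>\<nu> - 1\<close> of \<open>deriv g\<close>, and \<open>deriv g\<close> starts from 0 by
  \<open>lim\<close>. So the case of order below 1 recovers \<open>deriv g\<close>, one more
  integration recovers \<open>g\<close>, and the orders add up to \<open>\<nu>\<close>. The bound on
  \<open>h\<close> provides the integrability for the semigroup law.\<close>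

lemma integral_rl_caputo_deriv_2:
  assumes cd: "caputo_differentiable \<nu> g" and \<nu>: "1 < \<nu>" "\<nu> < 2" and t: "t > 0"
    and lim: "(deriv g \<longlongrightarrow> 0) (at_right 0)"
    and [measurable]: "h \<in> borel_measurable borel" and h: "\<And>r. 0 < r \<Longrightarrow> h r = caputo_deriv \<nu> g r"
    and bd: "\<And>r. 0 < r \<Longrightarrow> \<bar>h r\<bar> \<le> K"
  shows "(\<integral> r. h r \<partial>rl_measure \<nu> t) = g t - g 0"
proof -
  have m: "nat \<lceil>\<nu>\<rceil> = 2" "nat \<lceil>\<nu> - 1\<rceil> = 1" using \<nu> by linarith+
  \<comment> \<open>\<open>deriv g 0\<close> is an arbitrary value; putting 0 there makes the
    derivative continuous on \<open>{0..}\<close>, as \<open>caputo_differentiable\<close>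
    demands.\<close>
  define g1 where "g1 s = (if s \<le> 0 then 0 else deriv g s)" for s
  have d1: "g differentiable at s" "deriv g differentiable at s" if "s > 0" for s
  proof -
    have "\<forall>i<2. \<forall>t>0. (deriv ^^ i) g differentiable at t"
      using cd by (simp add: caputo_differentiable_def Let_def m)
    then have "(deriv ^^ 0) g differentiable at s" "(deriv ^^ 1) g differentiable at s"
      using that by (metis zero_less_numeral) (metis that one_less_numeral_iff semiring_norm(76) \<open>\<forall>i<2. \<forall>t>0. (deriv ^^ i) g differentiable at t\<close>)
    then show "g differentiable at s" "deriv g differentiable at s" by simp_all
  qed
  have ev: "eventually (\<lambda>x. g1 x = deriv g x) (nhds s)" if "s > 0" for s
    using eventually_nhds_in_open[of "{0<..}" s] that by (auto simp: g1_def elim!: eventually_mono)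
  have dg1: "g1 differentiable at s" "deriv g1 s = deriv (deriv g) s" if "s > 0" for s
  proof -
    have D: "(deriv g has_real_derivative deriv (deriv g) s) (at s)"
      using d1(2)[OF that] by (simp add: DERIV_deriv_iff_real_differentiable)
    have "(g1 has_real_derivative deriv (deriv g) s) (at s)"
      using D DERIV_cong_ev[OF refl ev[OF that] refl] by simp
    then show "g1 differentiable at s" "deriv g1 s = deriv (deriv g) s"
      by (auto simp: DERIV_imp_deriv real_differentiable_def)
  qed
  have cont1: "continuous_on {0..} g1"
    unfolding continuous_on_eq_continuous_within
  proof
    fix x :: real assume "x \<in> {0..}"
    then consider "x > 0" | "x = 0" by force
    then show "continuous (at x within {0..}) g1"
    proof cases
      case 1
      then show ?thesis using dg1(1) by (simp add: differentiable_imp_continuous_within continuous_at_imp_continuous_at_within)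
    next
      case 2
      have "(g1 \<longlongrightarrow> 0) (at_right 0)"
        using lim by (rule Lim_transform_eventually) (auto simp: g1_def intro: eventually_mono[OF eventually_at_right_less])
      then have "(g1 \<longlongrightarrow> 0) (at 0 within {0..})"
        by (simp add: at_within_Ici_at_right)
      then show ?thesis using 2 by (simp add: continuous_within g1_def)
    qed
  qed
  have eq2: "(deriv ^^ 2) g = deriv (deriv g)" by (simp add: numeral_2_eq_2)
  have si: "set_integrable lborel {0<..<t} f \<longleftrightarrow> set_integrable lborel {0<..<t} f'" if "\<And>s. 0 < s \<Longrightarrow> f s = f' s"
    for f f' :: "real \<Rightarrow> real" and t
    using that by (intro set_integrable_cong) auto
  have cd1: "caputo_differentiable (\<nu> - 1) g1"
    unfolding caputo_differentiable_def Let_def m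
  proof (intro conjI allI impI)
    fix t :: real assume t: "t > 0"
    have A: "set_integrable lborel {0<..<t} ((deriv ^^ 2) g)"
      "set_integrable lborel {0<..<t} (\<lambda>s. (deriv ^^ 2) g s / (t - s) powr (\<nu> - 2 + 1))"
      using cd t \<nu> by (auto simp: caputo_differentiable_def Let_def m)
    show "set_integrable lborel {0<..<t} ((deriv ^^ 1) g1)"
      using A(1) by (subst si[where f' = "(deriv ^^ 2) g"]) (auto simp: dg1 eq2)
    show "set_integrable lborel {0<..<t} (\<lambda>s. (deriv ^^ 1) g1 s / (t - s) powr (\<nu> - 1 - real 1 + 1))"
      using A(2) by (subst si[where f' = "\<lambda>s. (deriv ^^ 2) g s / (t - s) powr (\<nu> - 2 + 1)"]) (auto simp: dg1 eq2)
  qed (use cont1 dg1 in auto)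
  have cap: "caputo_deriv (\<nu> - 1) g1 r = caputo_deriv \<nu> g r" for r
  proof -
    have "(LINT s:{0<..<r}|lborel. deriv g1 s / (r - s) powr (\<nu> - 1)) = (LINT s:{0<..<r}|lborel. deriv (deriv g) s / (r - s) powr (\<nu> - 1))"
      by (intro set_lebesgue_integral_cong) (auto simp: dg1)
    moreover have "\<lceil>\<nu>\<rceil> = 2" using \<nu> by linarith
    ultimately show ?thesis using \<nu> by (simp add: caputo_deriv_def Let_def eq2)
  qed
  have g1: "g1 r = (\<integral> r. h r \<partial>rl_measure (\<nu> - 1) r)" if "r > 0" for r
    using integral_rl_caputo_deriv[OF cd1, of r h] \<nu> that h cap by (simp add: g1_def)
  have [measurable]: "g1 \<in> borel_measurable borel"
  proof -
    have "(\<lambda>x. indicator {0..} x *\<^sub>R g1 x) \<in> borel_measurable borel"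
      by (rule borel_measurable_continuous_on_indicator) (use cont1 in auto)
    also have "(\<lambda>x. indicator {0..} x *\<^sub>R g1 x) = g1" by (auto simp: g1_def indicator_def)
    finally show ?thesis .
  qed
  have cd0: "caputo_differentiable 1 g"
    unfolding caputo_differentiable_def Let_def
  proof (intro conjI allI impI)
    show "continuous_on {0..} g" using cd by (auto simp: caputo_differentiable_def Let_def)
    show "(deriv ^^ i) g differentiable at t" if "i < nat \<lceil>1::real\<rceil>" "0 < t" for i t
      using that d1 by auto
    fix t :: real assume "t > 0"
    have "set_integrable lborel {0..t} g1"
      by (rule borel_integrable_compact[of "{0..t}" g1, folded set_integrable_def]) (auto intro: continuous_on_subset[OF cont1])
    then have "set_integrable lborel {0<..<t} g1"
      by (rule set_integrable_subset) auto
    then show "set_integrable lborel {0<..<t} ((deriv ^^ nat \<lceil>1::real\<rceil>) g)"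
      by (subst (asm) si[where f' = "deriv g"]) (auto simp: g1_def)
  qed auto
  have "g t - g 0 = (\<integral> r. g1 r \<partial>rl_measure 1 t)"
    using integral_rl_caputo_deriv[OF cd0, of t g1] t by (simp add: caputo_deriv_def Let_def g1_def)
  also have "\<dots> = (\<integral> r. (\<integral> r. h r \<partial>rl_measure (\<nu> - 1) r) \<partial>rl_measure 1 t)"
  proof (intro integral_cong_AE)
    show "(\<lambda>r. \<integral> r. h r \<partial>rl_measure (\<nu> - 1) r) \<in> borel_measurable (rl_measure 1 t)"
      using \<nu> by (intro rl_measure_integral_parametric) auto
    show "AE x in rl_measure 1 t. g1 x = integral\<^sup>L (rl_measure (\<nu> - 1) x) h"
      using AE_rl_measure[of t 1] by eventually_elim (simp add: g1)
  qed auto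
  also have "\<dots> = (\<integral> r. h r \<partial>rl_measure (1 + (\<nu> - 1)) t)"
  proof (rule integral_rl_semigroup)
    interpret finite_measure "rl_measure (1 + (\<nu> - 1)) t" using \<nu> by (intro finite_measure_rl_measure) auto
    show "integrable (rl_measure (1 + (\<nu> - 1)) t) h"
    proof (rule integrable_const_bound[where B = K])
      show "AE x in rl_measure (1 + (\<nu> - 1)) t. norm (h x) \<le> K"
        using AE_rl_measure[of t "1 + (\<nu> - 1)"] by eventually_elim (simp add: bd)
    qed auto
  qed (use \<nu> in auto)
  finally show ?thesis by simp
qed

section \<open>Fractional integrals of bounded functions\<close>

lemma integrable_rl_measure_bounded:
  fixes h :: "real \<Rightarrow> real"
  assumes "a > 0" "h \<in> borel_measurable borel" "\<And>r. r > 0 \<Longrightarrow> \<bar>h r\<bar> \<le> K"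
  shows "integrable (rl_measure a t) h"
proof -
  interpret finite_measure "rl_measure a t" using assms(1) by (rule finite_measure_rl_measure)
  have "AE r in rl_measure a t. norm (h r) \<le> K"
    using AE_rl_measure[of t a] by eventually_elim (use assms(3) in auto)
  then show ?thesis using assms(2) by (intro integrable_const_bound[where B = K]) auto
qed

text \<open>The nonnegative version is applied to the positive and the negative part; boundedness
  keeps both transforms finite.\<close>

lemma integral_laplace_rl:
  fixes h :: "real \<Rightarrow> real"
  assumes a: "a > 0" and s: "s > 0" and m[measurable]: "h \<in> borel_measurable borel" and bd: "\<And>r. r > 0 \<Longrightarrow> \<bar>h r\<bar> \<le> K"
  shows "(\<integral> t. (\<integral> r. h r \<partial>rl_measure a t) \<partial>laplace_measure s) = s powr (- a) * (\<integral> r. h r \<partial>laplace_measure s)" (is ?A)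
    and "integrable (laplace_measure s) (\<lambda>t. \<integral> r. h r \<partial>rl_measure a t)" (is ?B)
proof -
  have pos: "(\<integral> t. (\<integral> r. h r \<partial>rl_measure a t) \<partial>laplace_measure s) = s powr (- a) * (\<integral> r. h r \<partial>laplace_measure s) \<and>
      integrable (laplace_measure s) (\<lambda>t. \<integral> r. h r \<partial>rl_measure a t)"
    if [measurable]: "h \<in> borel_measurable borel" and bd: "\<And>r. r > 0 \<Longrightarrow> \<bar>h r\<bar> \<le> K" and nn: "\<And>r. h r \<ge> 0" for h :: "real \<Rightarrow> real"
  proof -
    have [measurable]: "(\<lambda>t. \<integral> r. h r \<partial>rl_measure a t) \<in> borel_measurable borel"
      using a by (intro rl_measure_integral_parametric) auto
    have intl: "integrable (laplace_measure s) h" using s bd by (intro integrable_laplace_measure_bounded[where K = K]) auto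
    have "(\<integral>\<^sup>+ t. ennreal (\<integral> r. h r \<partial>rl_measure a t) \<partial>laplace_measure s)
       = (\<integral>\<^sup>+ t. (\<integral>\<^sup>+ r. ennreal (h r) \<partial>rl_measure a t) \<partial>laplace_measure s)"
      using a bd nn by (intro nn_integral_cong nn_integral_eq_integral[symmetric] integrable_rl_measure_bounded[where K = K]) auto
    also have "\<dots> = ennreal (s powr (- a)) * (\<integral>\<^sup>+ r. ennreal (h r) \<partial>laplace_measure s)"
      using a s by (intro nn_integral_laplace_rl) auto
    also have "(\<integral>\<^sup>+ r. ennreal (h r) \<partial>laplace_measure s) = ennreal (\<integral> r. h r \<partial>laplace_measure s)"
      using nn intl by (intro nn_integral_eq_integral) auto
    finally have eq: "(\<integral>\<^sup>+ t. ennreal (\<integral> r. h r \<partial>rl_measure a t) \<partial>laplace_measure s)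
       = ennreal (s powr (- a) * (\<integral> r. h r \<partial>laplace_measure s))"
      by (simp add: ennreal_mult' nn)
    have nn': "(\<integral> r. h r \<partial>rl_measure a t) \<ge> 0" for t using nn by simp
    have "integrable (laplace_measure s) (\<lambda>t. \<integral> r. h r \<partial>rl_measure a t)"
      using eq nn' by (intro integrableI_nonneg) auto
    moreover have "(\<integral> t. (\<integral> r. h r \<partial>rl_measure a t) \<partial>laplace_measure s) = s powr (- a) * (\<integral> r. h r \<partial>laplace_measure s)"
      using eq nn' nn by (subst integral_eq_nn_integral) auto
    ultimately show ?thesis by simp
  qed
  define hp hm where "hp r = max 0 (h r)" and "hm r = max 0 (- h r)" for r
  have [measurable]: "hp \<in> borel_measurable borel" "hm \<in> borel_measurable borel"
    unfolding hp_def hm_def by measurable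
  have b: "\<bar>hp r\<bar> \<le> K" "\<bar>hm r\<bar> \<le> K" if "r > 0" for r using bd[OF that] by (auto simp: hp_def hm_def)
  have P: "hp r \<ge> 0" "hm r \<ge> 0" for r by (auto simp: hp_def hm_def)
  have h: "h = (\<lambda>r. hp r - hm r)" by (auto simp: hp_def hm_def)
  have d: "(\<integral> r. h r \<partial>rl_measure a t) = (\<integral> r. hp r \<partial>rl_measure a t) - (\<integral> r. hm r \<partial>rl_measure a t)" for t
    unfolding h using a b by (intro Bochner_Integration.integral_diff integrable_rl_measure_bounded[where K = K]) auto
  note pp = pos[of hp] and pm = pos[of hm]
  show ?B unfolding d using pp pm b P by (intro Bochner_Integration.integrable_diff) auto
  have "(\<integral> r. h r \<partial>laplace_measure s) = (\<integral> r. hp r \<partial>laplace_measure s) - (\<integral> r. hm r \<partial>laplace_measure s)"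
    unfolding h using s b by (intro Bochner_Integration.integral_diff integrable_laplace_measure_bounded[where K = K]) auto
  then show ?A unfolding d using pp pm b P by (subst Bochner_Integration.integral_diff) (auto simp: right_diff_distrib)
qed

text \<open>For \<open>a < 1\<close> the kernel is singular at \<open>r = t\<close>, and the
  singularity moves with \<open>t\<close>, which obstructs a direct use of dominated convergence.
  Scheffe's lemma replaces it: the kernels converge pointwise almost everywhere and so do their
  masses \<open>rl_kernel (a + 1)\<close>, hence they converge in mean, which is enough against a
  bounded \<open>h\<close>.\<close>

lemma continuous_on_integral_rl_measure:
  fixes h :: "real \<Rightarrow> real"
  assumes a: "a > 0" and m[measurable]: "h \<in> borel_measurable borel" and bd: "\<And>r. r > 0 \<Longrightarrow> \<bar>h r\<bar> \<le> K"
  shows "continuous_on {0<..} (\<lambda>t. \<integral> r. h r \<partial>rl_measure a t)"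
  unfolding continuous_on_sequentially
proof (intro allI ballI impI, elim conjE)
  fix x :: "nat \<Rightarrow> real" and t :: real
  assume t: "t \<in> {0<..}" and x: "\<forall>n. x n \<in> {0<..}" and lim: "x \<longlonglongrightarrow> t"
  define F where "F t r = rl_kernel a (t - r) * indicator {0<..} r" for t r :: real
  have [measurable]: "F t \<in> borel_measurable borel" for t unfolding F_def by measurable
  have Fnn: "F t r \<ge> 0" for t r using a by (simp add: F_def rl_kernel_nonneg)
  have nnF: "(\<integral>\<^sup>+ r. ennreal (norm (F t r)) \<partial>lborel) = ennreal (rl_kernel (a + 1) t)" for t
  proof -
    have "(\<integral>\<^sup>+ r. ennreal (norm (F t r)) \<partial>lborel) = (\<integral>\<^sup>+ r. 1 \<partial>rl_measure a t)"
      using Fnn by (subst nn_integral_rl_measure) (auto intro!: nn_integral_cong simp: F_def indicator_def rl_kernel_nonneg a)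
    then show ?thesis using emeasure_rl_measure[OF a] by simp
  qed
  have intF: "integrable lborel (F t)" for t
    using nnF[of t] by (intro integrableI_bounded) auto
  have sch: "(\<lambda>n. \<integral>\<^sup>+ r. norm (F (x n) r - F t r) \<partial>lborel) \<longlonglongrightarrow> 0"
  proof (rule Scheffe_lemma1[OF intF intF])
    have "AE r in lborel. r \<noteq> t" by (rule AE_lborel_singleton)
    then show "AE r in lborel. (\<lambda>n. F (x n) r) \<longlonglongrightarrow> F t r"
    proof eventually_elim
      case (elim r)
      have "(\<lambda>n. rl_kernel a (x n - r)) \<longlonglongrightarrow> rl_kernel a (t - r)"
      proof (cases "t > r")
        case True
        have l: "(\<lambda>n. (x n - r) powr (a - 1) / Gamma a) \<longlonglongrightarrow> (t - r) powr (a - 1) / Gamma a"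
          using True Gamma_real_pos[OF a] by (intro tendsto_divide tendsto_powr tendsto_diff tendsto_const lim) linarith+
        have "eventually (\<lambda>n. x n > r) sequentially" using order_tendstoD(1)[OF lim True] .
        then have "eventually (\<lambda>n. (x n - r) powr (a - 1) / Gamma a = rl_kernel a (x n - r)) sequentially"
          by eventually_elim (simp add: rl_kernel_def)
        from Lim_transform_eventually[OF l this] show ?thesis using True by (simp add: rl_kernel_def)
      next
        case False
        then have "t < r" using elim by simp
        then have "eventually (\<lambda>n. x n < r) sequentially" using order_tendstoD(2)[OF lim] by blast
        then have "eventually (\<lambda>n. rl_kernel a (x n - r) = rl_kernel a (t - r)) sequentially"
          by eventually_elim (use False in \<open>simp add: rl_kernel_def\<close>)
        then show ?thesis by (rule tendsto_eventually)
      qed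
      then show ?case unfolding F_def by (intro tendsto_intros)
    qed
    have "(\<lambda>n. (x n) powr (a + 1 - 1) / Gamma (a + 1)) \<longlonglongrightarrow> t powr (a + 1 - 1) / Gamma (a + 1)"
    proof (intro tendsto_divide tendsto_powr tendsto_const lim)
      show "Gamma (a + 1) \<noteq> 0" using Gamma_real_pos[of "a + 1"] a by linarith
    qed (use t in auto)
    then have "(\<lambda>n. rl_kernel (a + 1) (x n)) \<longlonglongrightarrow> rl_kernel (a + 1) t"
      using x t by (simp add: rl_kernel_def)
    then have "(\<lambda>n. ennreal (rl_kernel (a + 1) (x n))) \<longlonglongrightarrow> ennreal (rl_kernel (a + 1) t)"
      by (rule tendsto_ennrealI)
    then show "limsup (\<lambda>n. \<integral>\<^sup>+ r. norm (F (x n) r) \<partial>lborel) \<le> (\<integral>\<^sup>+ r. norm (F t r) \<partial>lborel)"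
      unfolding nnF by (simp add: lim_imp_Limsup)
  qed
  have K: "K \<ge> 0" using bd[of 1] by linarith
  have hF: "(\<integral> r. h r \<partial>rl_measure a t) = (\<integral> r. F t r * h r \<partial>lborel)" for t
    using a by (simp add: integral_rl_measure F_def)
  have bF: "norm (F t r * h r) \<le> K * norm (F t r)" for t r
  proof (cases "r > 0")
    case True
    show ?thesis unfolding norm_mult mult.commute[of K] using bd[OF True] by (intro mult_left_mono) auto
  next
    case False
    then show ?thesis by (simp add: F_def)
  qed
  have intFh: "integrable lborel (\<lambda>r. F t r * h r)" for t
    by (rule Bochner_Integration.integrable_bound[of _ "\<lambda>r. K * norm (F t r)"])
       (use intF[of t] bF K in \<open>auto simp: abs_mult\<close>)
  have sch': "(\<lambda>n. \<integral> r. norm (F (x n) r - F t r) \<partial>lborel) \<longlonglongrightarrow> 0"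
  proof -
    have "(\<integral>\<^sup>+ r. norm (F (x n) r - F t r) \<partial>lborel) = ennreal (\<integral> r. norm (F (x n) r - F t r) \<partial>lborel)" for n
      by (intro nn_integral_eq_integral) (auto intro!: Bochner_Integration.integrable_norm Bochner_Integration.integrable_diff intF)
    then show ?thesis using sch by (simp add: ennreal_0[symmetric] del: ennreal_0)
  qed
  have "norm ((\<integral> r. h r \<partial>rl_measure a (x n)) - (\<integral> r. h r \<partial>rl_measure a t)) \<le> K * (\<integral> r. norm (F (x n) r - F t r) \<partial>lborel)" for n
  proof -
    have "(\<integral> r. h r \<partial>rl_measure a (x n)) - (\<integral> r. h r \<partial>rl_measure a t) = (\<integral> r. (F (x n) r - F t r) * h r \<partial>lborel)"
      unfolding hF using intFh by (simp add: left_diff_distrib)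
    also have "norm \<dots> \<le> (\<integral> r. norm ((F (x n) r - F t r) * h r) \<partial>lborel)" by (rule integral_norm_bound)
    also have "\<dots> \<le> (\<integral> r. K * norm (F (x n) r - F t r) \<partial>lborel)"
    proof (rule Bochner_Integration.integral_mono)
      show "integrable lborel (\<lambda>r. norm ((F (x n) r - F t r) * h r))" using intFh by (simp add: left_diff_distrib)
      show "integrable lborel (\<lambda>r. K * norm (F (x n) r - F t r))" using intF by simp
      show "norm ((F (x n) r - F t r) * h r) \<le> K * norm (F (x n) r - F t r)" for r
      proof (cases "r > 0")
        case True
        show ?thesis unfolding norm_mult mult.commute[of K] using bd[OF True] by (intro mult_left_mono) auto
      next
        case False
        then show ?thesis by (simp add: F_def)
      qed
    qed
    finally show ?thesis by simp
  qed
  then have "eventually (\<lambda>n. norm ((\<integral> r. h r \<partial>rl_measure a (x n)) - (\<integral> r. h r \<partial>rl_measure a t))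
      \<le> K * (\<integral> r. norm (F (x n) r - F t r) \<partial>lborel)) sequentially"
    by (rule always_eventually[OF allI])
  from Lim_null_comparison[OF this tendsto_mult_right_zero[OF sch']]
  have "(\<lambda>n. (\<integral> r. h r \<partial>rl_measure a (x n)) - (\<integral> r. h r \<partial>rl_measure a t)) \<longlonglongrightarrow> 0" .
  then show "((\<lambda>t. \<integral> r. h r \<partial>rl_measure a t) \<circ> x) \<longlonglongrightarrow> (\<integral> r. h r \<partial>rl_measure a t)"
    by (simp add: LIM_zero_iff o_def)
qed

section \<open>The time-fractional diffusion equation\<close>

text \<open>The enlarged class of test functions: boundedness replaces compact support. The
  derivatives are arguments, so that explicit formulas can stand in place of
  \<open>deriv\<close>.\<close>

definition C2_bounded :: "(real \<Rightarrow> real) \<Rightarrow> (real \<Rightarrow> real) \<Rightarrow> (real \<Rightarrow> real) \<Rightarrow> bool" where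
  "C2_bounded \<phi> \<phi>1 \<phi>2 \<longleftrightarrow>
     (\<forall>x. (\<phi> has_real_derivative \<phi>1 x) (at x)) \<and> (\<forall>x. (\<phi>1 has_real_derivative \<phi>2 x) (at x)) \<and>
     continuous_on UNIV \<phi>2 \<and> (\<exists>K. \<forall>x. \<bar>\<phi> x\<bar> \<le> K \<and> \<bar>\<phi>1 x\<bar> \<le> K \<and> \<bar>\<phi>2 x\<bar> \<le> K)"

text \<open>Applied to the square and the cube of a positive part: the cube is twice continuously
  differentiable, so a cutoff built from it keeps products within
  \<open>test_function\<close>.\<close>

lemma max_0_power_deriv:
  fixes x :: real
  assumes "n \<ge> 1"
  shows "((\<lambda>y. max 0 y ^ Suc n) has_real_derivative real (Suc n) * max 0 x ^ n) (at x)"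
proof -
  consider "x > 0" | "x < 0" | "x = 0" by linarith
  then show ?thesis
  proof cases
    case 1
    then have "eventually (\<lambda>y. max 0 y ^ Suc n = y ^ Suc n) (nhds x)"
      using eventually_nhds_in_open[of "{0<..}" x] by (auto elim!: eventually_mono)
    moreover have "((\<lambda>y. y ^ Suc n) has_real_derivative real (Suc n) * max 0 x ^ n) (at x)"
      using DERIV_pow[of "Suc n" x] 1 by simp
    ultimately show ?thesis using DERIV_cong_ev[OF refl _ refl] by fast
  next
    case 2
    then have "eventually (\<lambda>y. max 0 y ^ Suc n = 0) (nhds x)"
      using eventually_nhds_in_open[of "{..<0}" x] by (auto elim!: eventually_mono)
    moreover have "((\<lambda>y. 0) has_real_derivative real (Suc n) * max 0 x ^ n) (at x)"
      using 2 assms by (simp add: max_def power_0_left)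
    ultimately show ?thesis using DERIV_cong_ev[OF refl _ refl] by fast
  next
    case 3
    \<comment> \<open>At 0 the difference quotient is dominated by \<open>\<bar>h\<bar> ^ n\<close>,
      which tends to 0 because \<open>n \<ge> 1\<close>.\<close>
    have "((\<lambda>h. \<bar>h\<bar> ^ n) \<longlongrightarrow> \<bar>0::real\<bar> ^ n) (at 0)" by (intro tendsto_intros)
    then have z: "((\<lambda>h. \<bar>h\<bar> ^ n) \<longlongrightarrow> (0::real)) (at 0)" using assms by (simp add: power_0_left)
    have "((\<lambda>h. max 0 h ^ Suc n / h) \<longlongrightarrow> (0::real)) (at 0)"
      by (rule Lim_null_comparison[OF _ z]) (auto simp: max_def abs_mult power_abs intro!: always_eventually)
    then show ?thesis using 3 assms by (simp add: DERIV_def power_0_left)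
  qed
qed

text \<open>Inverting the Caputo derivative turns the weak equation into a Volterra equation in
  time. It contains no time derivative and is therefore stable under limits in
  \<open>\<phi>\<close>, on which the passage to larger test functions relies.\<close>

lemma diffusion_test_function_eq:
  assumes \<nu>: "0 < \<nu>" "\<nu> < 2" and u: "diffusion_solution \<nu> u" and \<phi>: "test_function \<phi>"
    and t: "t > 0" and K: "\<And>r. r > 0 \<Longrightarrow> \<bar>LINT x|lborel. deriv (deriv \<phi>) x * u x r\<bar> \<le> K"
  shows "(\<lambda>r. indicator {0<..} r * (LINT x|lborel. deriv (deriv \<phi>) x * u x r)) \<in> borel_measurable borel"
    and "(LINT x|lborel. \<phi> x * u x t) = \<phi> 0 +
       (\<integral> r. indicator {0<..} r * (LINT x|lborel. deriv (deriv \<phi>) x * u x r) \<partial>rl_measure \<nu> t)"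
proof -
  let ?h = "\<lambda>r. indicator {0<..} r * (LINT x|lborel. deriv (deriv \<phi>) x * u x r)"
  have cd: "caputo_differentiable \<nu> (pairing u \<phi>)"
    and ce: "\<And>t. t > 0 \<Longrightarrow> caputo_deriv \<nu> (pairing u \<phi>) t = pairing u (deriv (deriv \<phi>)) t"
    and lim: "\<nu> > 1 \<Longrightarrow> (deriv (pairing u \<phi>) \<longlongrightarrow> 0) (at_right 0)"
    using u \<phi> by (auto simp: diffusion_solution_def)
  have h: "?h r = caputo_deriv \<nu> (pairing u \<phi>) r" if "r > 0" for r
    using ce[OF that] that by (simp add: pairing_def)
  have "(\<lambda>t. indicator {0<..} t * caputo_deriv \<nu> (pairing u \<phi>) t) \<in> borel_measurable borel"
    by (rule caputo_deriv_measurable[OF cd \<nu>(1)])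
  also have "(\<lambda>t. indicator {0<..} t * caputo_deriv \<nu> (pairing u \<phi>) t) = ?h"
    using h by (auto simp: indicator_def fun_eq_iff)
  finally show m: "?h \<in> borel_measurable borel" .
  have "(\<integral> r. ?h r \<partial>rl_measure \<nu> t) = pairing u \<phi> t - pairing u \<phi> 0"
  proof (cases "\<nu> \<le> 1")
    case True
    show ?thesis by (rule integral_rl_caputo_deriv[OF cd \<nu>(1) True t m]) (use h in auto)
  next
    case False
    show ?thesis
      by (rule integral_rl_caputo_deriv_2[OF cd _ \<nu>(2) t lim m h, where K = K]) (use False K in auto)
  qed
  then show "(LINT x|lborel. \<phi> x * u x t) = \<phi> 0 + (\<integral> r. ?h r \<partial>rl_measure \<nu> t)"
    using t by (simp add: pairing_def)
qed

context
  fixes \<nu> C :: real and u :: "real \<Rightarrow> real \<Rightarrow> real"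
  assumes \<nu>: "0 < \<nu>" "\<nu> < 2" and u: "diffusion_solution \<nu> u"
    and C: "\<And>t. t > 0 \<Longrightarrow> (LINT x|lborel. \<bar>u x t\<bar>) \<le> C"
begin

lemma diffusion_integrable: "t > 0 \<Longrightarrow> integrable lborel (\<lambda>x. u x t)"
  using u by (simp add: diffusion_solution_def)

lemma diffusion_pairing_integrable:
  assumes "t > 0" and [measurable]: "f \<in> borel_measurable borel" and "\<And>x. \<bar>f x\<bar> \<le> K"
  shows "integrable lborel (\<lambda>x. f x * u x t)"
proof (rule Bochner_Integration.integrable_bound[of _ "\<lambda>x. K * \<bar>u x t\<bar>"])
  show "integrable lborel (\<lambda>x. K * \<bar>u x t\<bar>)" using diffusion_integrable[OF assms(1)] by simp
  have "(\<lambda>x. u x t) \<in> borel_measurable lborel" using diffusion_integrable[OF assms(1)] by simp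
  then show "(\<lambda>x. f x * u x t) \<in> borel_measurable lborel" by measurable
  have K: "K \<ge> 0" using assms(3)[of 0] by linarith
  show "AE x in lborel. norm (f x * u x t) \<le> norm (K * \<bar>u x t\<bar>)"
    using assms(3) K by (auto simp: abs_mult intro!: mult_right_mono)
qed

lemma diffusion_pairing_bound:
  assumes "t > 0" and [measurable]: "f \<in> borel_measurable borel" and K: "\<And>x. \<bar>f x\<bar> \<le> K"
  shows "\<bar>LINT x|lborel. f x * u x t\<bar> \<le> K * C"
proof -
  have K0: "K \<ge> 0" using K[of 0] by linarith
  have "\<bar>LINT x|lborel. f x * u x t\<bar> \<le> (LINT x|lborel. \<bar>f x * u x t\<bar>)"
    using integral_norm_bound[of lborel "\<lambda>x. f x * u x t"] by simp
  also have "\<dots> \<le> (LINT x|lborel. K * \<bar>u x t\<bar>)"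
  proof (rule Bochner_Integration.integral_mono)
    show "integrable lborel (\<lambda>x. \<bar>f x * u x t\<bar>)"
      using diffusion_pairing_integrable[OF assms(1,2) K] by (rule Bochner_Integration.integrable_abs)
    show "integrable lborel (\<lambda>x. K * \<bar>u x t\<bar>)" using diffusion_integrable[OF assms(1)] by simp
    show "\<bar>f x * u x t\<bar> \<le> K * \<bar>u x t\<bar>" for x unfolding abs_mult using K by (intro mult_right_mono) auto
  qed
  also have "\<dots> \<le> K * C" using C[OF assms(1)] K0 by (simp add: mult_left_mono)
  finally show ?thesis .
qed

lemma diffusion_bound_nonneg: "C \<ge> 0"
proof -
  have "0 \<le> (LINT x|lborel. \<bar>u x 1\<bar>)" by simp
  then show ?thesis using C[of 1] by linarith
qed

text \<open>The cutoffs are \<open>(1 - x\<^sup>2 / R\<^sup>2)\<^sup>3\<close>, extended by zero.\<close>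
lemma diffusion_C2_eq:
  assumes \<phi>: "C2_bounded \<phi> \<phi>1 \<phi>2"
  shows "(\<lambda>r. indicator {0<..} r * (LINT x|lborel. \<phi>2 x * u x r)) \<in> borel_measurable borel"
    and "t > 0 \<Longrightarrow> (LINT x|lborel. \<phi> x * u x t) = \<phi> 0 +
       (\<integral> r. indicator {0<..} r * (LINT x|lborel. \<phi>2 x * u x r) \<partial>rl_measure \<nu> t)"
proof -
  obtain K where K: "\<bar>\<phi> x\<bar> \<le> K" "\<bar>\<phi>1 x\<bar> \<le> K" "\<bar>\<phi>2 x\<bar> \<le> K" for x using \<phi> unfolding C2_bounded_def by blast
  have K0: "K \<ge> 0" using K(1)[of 0] by linarith
  have D: "(\<phi> has_real_derivative \<phi>1 x) (at x)" "(\<phi>1 has_real_derivative \<phi>2 x) (at x)" for x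
    using \<phi> by (auto simp: C2_bounded_def)
  have cont2: "continuous_on UNIV \<phi>2" using \<phi> by (auto simp: C2_bounded_def)
  have cont: "continuous_on UNIV \<phi>" "continuous_on UNIV \<phi>1"
    using D by (auto intro!: DERIV_continuous_on)
  note [measurable] = cont[THEN borel_measurable_continuous_onI] cont2[THEN borel_measurable_continuous_onI]
  \<comment> \<open>\<open>R n \<ge> 1\<close> allows terms quadratic in \<open>1 / R n\<close> to
    be bounded by linear ones.\<close>
  define R where "R n = real n + 1" for n :: nat
  have R: "R n \<ge> 1" for n by (simp add: R_def)
  define m where "m n x = max 0 (1 - x\<^sup>2 / (R n)\<^sup>2)" for n x
  have m: "0 \<le> m n x" "m n x \<le> 1" for n x by (auto simp: m_def)
  have m0: "m n x = 0" if "\<bar>x\<bar> \<ge> R n" for n x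
  proof -
    have "(R n)\<^sup>2 \<le> x\<^sup>2" using that R[of n] by (subst power2_abs[of x, symmetric], intro power_mono) auto
    then show ?thesis using R[of n] by (simp add: m_def divide_simps)
  qed
  define \<chi>1 where "\<chi>1 n x = 3 * m n x ^ 2 * (- 2 * x / (R n)\<^sup>2)" for n x
  define \<chi>2 where "\<chi>2 n x = 6 * m n x * (- 2 * x / (R n)\<^sup>2)\<^sup>2 + 3 * m n x ^ 2 * (- 2 / (R n)\<^sup>2)" for n x
  have dq: "((\<lambda>x. 1 - x\<^sup>2 / (R n)\<^sup>2) has_real_derivative (- 2 * x / (R n)\<^sup>2)) (at x)" for n x
    using R[of n] by (auto intro!: derivative_eq_intros simp: field_simps)
  have dm3: "((\<lambda>x. m n x ^ 3) has_real_derivative \<chi>1 n x) (at x)" for n x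
    unfolding m_def \<chi>1_def
    using DERIV_chain2[OF max_0_power_deriv[of 2] dq[of n x]] by (simp add: numeral_3_eq_3 numeral_2_eq_2)
  have dm2: "((\<lambda>x. m n x ^ 2) has_real_derivative 2 * m n x * (- 2 * x / (R n)\<^sup>2)) (at x)" for n x
    unfolding m_def
    using DERIV_chain2[OF max_0_power_deriv[of 1] dq[of n x]] by (simp add: numeral_2_eq_2)
  have d\<chi>1: "(\<chi>1 n has_real_derivative \<chi>2 n x) (at x)" for n x
  proof -
    have "((\<lambda>x. 3 * (m n x ^ 2) * (- 2 * x / (R n)\<^sup>2)) has_real_derivative \<chi>2 n x) (at x)"
    proof -
      have "((\<lambda>x. - 2 * x / (R n)\<^sup>2) has_real_derivative - 2 / (R n)\<^sup>2) (at x)"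
        by (rule DERIV_cdivide[OF DERIV_cmult_Id])
      from DERIV_mult[OF DERIV_cmult[OF dm2, of 3] this] show ?thesis
        unfolding \<chi>2_def by (rule DERIV_cong) (simp add: power2_eq_square algebra_simps)
    qed
    then show ?thesis by (simp add: \<chi>1_def[abs_def])
  qed
  \<comment> \<open>Inside the support the slope of \<open>1 - x\<^sup>2 / (R n)\<^sup>2\<close> is
    at most \<open>2 / R n\<close> in modulus. This gives \<open>3 * 2 = 6\<close> and, with
    \<open>1 / (R n)\<^sup>2 \<le> 1 / R n\<close>, \<open>6 * 4 + 3 * 2 = 30\<close>.\<close>
  have bnd: "\<bar>\<chi>1 n x\<bar> \<le> 6 / R n" "\<bar>\<chi>2 n x\<bar> \<le> 30 / R n" for n x
  proof -
    have "\<bar>\<chi>1 n x\<bar> \<le> 6 / R n \<and> \<bar>\<chi>2 n x\<bar> \<le> 30 / R n"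
    proof (cases "\<bar>x\<bar> \<ge> R n")
      case True
      then show ?thesis using m0[OF True] R[of n] by (simp add: \<chi>1_def \<chi>2_def)
    next
      case False
      define y where "y = - 2 * x / (R n)\<^sup>2"
      have "\<bar>y\<bar> = 2 * \<bar>x\<bar> / (R n)\<^sup>2" by (simp add: y_def abs_mult)
      also have "\<dots> \<le> 2 * R n / (R n)\<^sup>2" using False R[of n] by (intro divide_right_mono) auto
      finally have y: "\<bar>y\<bar> \<le> 2 / R n" using R[of n] by (simp add: power2_eq_square)
      have m2: "m n x ^ 2 \<le> 1" using m[of n x] by (simp add: power_le_one)
      have "\<bar>\<chi>1 n x\<bar> = 3 * m n x ^ 2 * \<bar>y\<bar>" by (simp add: \<chi>1_def y_def abs_mult)
      also have "\<dots> \<le> 3 * 1 * (2 / R n)" using y m2 R[of n] by (intro mult_mono) auto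
      finally have 1: "\<bar>\<chi>1 n x\<bar> \<le> 6 / R n" by simp
      have y2: "y\<^sup>2 \<le> 4 / R n"
      proof -
        have "y\<^sup>2 = \<bar>y\<bar> * \<bar>y\<bar>" by (simp add: power2_eq_square)
        also have "\<dots> \<le> (2 / R n) * (2 / R n)" using y R[of n] by (intro mult_mono) auto
        also have "\<dots> \<le> 4 / R n" using R[of n] by (simp add: field_simps)
        finally show ?thesis .
      qed
      have R2: "2 / (R n)\<^sup>2 \<le> 2 / R n"
        using R[of n] by (intro divide_left_mono) (auto simp: power2_eq_square)
      have "\<bar>\<chi>2 n x\<bar> \<le> \<bar>6 * m n x * y\<^sup>2\<bar> + \<bar>3 * m n x ^ 2 * (- 2 / (R n)\<^sup>2)\<bar>"
        unfolding \<chi>2_def y_def by (rule abs_triangle_ineq)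
      also have "\<dots> = 6 * m n x * y\<^sup>2 + 3 * m n x ^ 2 * (2 / (R n)\<^sup>2)" using m[of n x] by (simp add: abs_mult)
      also have "\<dots> \<le> 6 * 1 * (4 / R n) + 3 * 1 * (2 / R n)"
        using m[of n x] m2 y2 R2 R[of n] by (intro add_mono mult_mono) auto
      finally have 2: "\<bar>\<chi>2 n x\<bar> \<le> 30 / R n" using R[of n] by (simp add: field_simps)
      show ?thesis using 1 2 by simp
    qed
    then show "\<bar>\<chi>1 n x\<bar> \<le> 6 / R n" "\<bar>\<chi>2 n x\<bar> \<le> 30 / R n" by auto
  qed
  have contm: "continuous_on UNIV (m n)" for n unfolding m_def[abs_def] using R[of n] by (intro continuous_intros) auto
  have cont\<chi>: "continuous_on UNIV (\<chi>2 n)" for n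
    unfolding \<chi>2_def[abs_def] using R[of n] by (intro continuous_intros contm) auto
  define f where "f n x = \<phi> x * m n x ^ 3" for n x
  define f1 where "f1 n x = \<phi>1 x * m n x ^ 3 + \<chi>1 n x * \<phi> x" for n x
  define f2 where "f2 n x = (\<phi>2 x * m n x ^ 3 + \<chi>1 n x * \<phi>1 x) + (\<chi>2 n x * \<phi> x + \<phi>1 x * \<chi>1 n x)" for n x
  have df: "(f n has_real_derivative f1 n x) (at x)" for n x
    unfolding f_def[abs_def] f1_def using DERIV_mult[OF D(1)[of x] dm3[of n x]] by (simp add: mult_ac)
  have df1: "(f1 n has_real_derivative f2 n x) (at x)" for n x
    unfolding f1_def[abs_def] f2_def
    by (intro DERIV_add DERIV_mult D dm3 d\<chi>1)
  have deq: "deriv (f n) = f1 n" "deriv (f1 n) = f2 n" for n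
  proof -
    show "deriv (f n) = f1 n" using df by (auto intro!: DERIV_imp_deriv)
    show "deriv (f1 n) = f2 n" using df1 by (auto intro!: DERIV_imp_deriv)
  qed
  have tf: "test_function (f n)" for n
    unfolding test_function_def deq
  proof (intro conjI allI)
    show "f n differentiable at x" for x using df real_differentiable_def by blast
    show "f1 n differentiable at x" for x using df1 real_differentiable_def by blast
    have "continuous_on UNIV (\<chi>1 n)" using d\<chi>1 by (auto intro!: DERIV_continuous_on)
    then show "continuous_on UNIV (f2 n)"
      unfolding f2_def[abs_def] by (intro continuous_intros cont cont2 contm cont\<chi>)
    have "{x. f n x \<noteq> 0} \<subseteq> {- R n .. R n}"
      using m0[of n] by (auto simp: f_def) (metis abs_ge_minus_self abs_le_iff linorder_le_cases m0 minus_le_iff power_eq_0_iff mult_zero_right zero_less_numeral)+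
    then show "bounded {x. f n x \<noteq> 0}" using bounded_subset bounded_closed_interval by blast
  qed
  have m3: "m n x ^ 3 \<le> 1" "0 \<le> m n x ^ 3" for n x using m[of n x] by (auto simp: power_le_one)
  have Rle: "a / R n \<le> a" if "a \<ge> 0" for a n using that R[of n] by (simp add: divide_le_eq mult_left_mono mult_le_cancel_left1)
  have fb: "\<bar>f n x\<bar> \<le> K" for n x
  proof -
    have "\<bar>f n x\<bar> = \<bar>\<phi> x\<bar> * m n x ^ 3" using m3[of n x] by (simp add: f_def abs_mult)
    also have "\<dots> \<le> K * 1" using K(1)[of x] m3[of n x] K0 by (intro mult_mono) auto
    finally show ?thesis by simp
  qed
  \<comment> \<open>The difference collects the terms in which a derivative falls on the cutoff:
    \<open>6 + 30 + 6 = 42\<close>. The bound \<open>43 * K\<close> below adds the term with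
    \<open>\<phi>2\<close>.\<close>
  have err: "\<bar>f2 n x - \<phi>2 x * m n x ^ 3\<bar> \<le> 42 * K / R n" for n x
  proof -
    have "\<bar>f2 n x - \<phi>2 x * m n x ^ 3\<bar> = \<bar>\<chi>1 n x * \<phi>1 x + \<chi>2 n x * \<phi> x + \<phi>1 x * \<chi>1 n x\<bar>"
      by (simp add: f2_def)
    also have "\<dots> \<le> \<bar>\<chi>1 n x\<bar> * \<bar>\<phi>1 x\<bar> + \<bar>\<chi>2 n x\<bar> * \<bar>\<phi> x\<bar> + \<bar>\<chi>1 n x\<bar> * \<bar>\<phi>1 x\<bar>"
      by (simp add: abs_mult[symmetric] mult.commute[of "\<phi>1 x"])
    also have "\<dots> \<le> 6 / R n * K + 30 / R n * K + 6 / R n * K"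
      using bnd[of n x] K[of x] R[of n] by (intro add_mono mult_mono) auto
    finally show ?thesis by (simp add: field_simps)
  qed
  have f2b: "\<bar>f2 n x\<bar> \<le> 43 * K" for n x
  proof -
    have "\<bar>\<phi>2 x * m n x ^ 3\<bar> \<le> K * 1"
      unfolding abs_mult using K(3)[of x] m3[of n x] K0 by (intro mult_mono) auto
    then show ?thesis using err[of n x] Rle[of "42 * K" n] K0 by linarith
  qed
  have mlim: "(\<lambda>n. m n x) \<longlonglongrightarrow> 1" for x
  proof -
    have "(\<lambda>n. x\<^sup>2 * inverse (real (Suc n)) * inverse (real (Suc n))) \<longlonglongrightarrow> x\<^sup>2 * 0 * 0"
      by (intro tendsto_intros LIMSEQ_inverse_real_of_nat)
    then have "(\<lambda>n. x\<^sup>2 / (R n)\<^sup>2) \<longlonglongrightarrow> 0"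
      by (simp add: R_def power2_eq_square divide_inverse mult_ac add_ac)
    then have "(\<lambda>n. max 0 (1 - x\<^sup>2 / (R n)\<^sup>2)) \<longlonglongrightarrow> max 0 (1 - 0)" by (intro tendsto_intros)
    then show ?thesis by (simp add: m_def)
  qed
  have flim: "(\<lambda>n. f n x) \<longlonglongrightarrow> \<phi> x" for x
    using tendsto_mult[OF tendsto_const[of "\<phi> x"] tendsto_power[OF mlim[of x], of 3]] by (simp add: f_def)
  have f2lim: "(\<lambda>n. f2 n x) \<longlonglongrightarrow> \<phi>2 x" for x
  proof -
    have "(\<lambda>n. 42 * K * inverse (real (Suc n))) \<longlonglongrightarrow> 42 * K * 0"
      by (intro tendsto_intros LIMSEQ_inverse_real_of_nat)
    then have z: "(\<lambda>n. 42 * K / R n) \<longlonglongrightarrow> 0" by (simp add: R_def divide_inverse add_ac)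
    have "(\<lambda>n. f2 n x - \<phi>2 x * m n x ^ 3) \<longlonglongrightarrow> 0"
      by (rule Lim_null_comparison[OF _ z]) (use err in auto)
    moreover have "(\<lambda>n. \<phi>2 x * m n x ^ 3) \<longlonglongrightarrow> \<phi>2 x * 1 ^ 3" by (intro tendsto_intros mlim)
    ultimately have "(\<lambda>n. (f2 n x - \<phi>2 x * m n x ^ 3) + \<phi>2 x * m n x ^ 3) \<longlonglongrightarrow> 0 + \<phi>2 x * 1 ^ 3" by (rule tendsto_add)
    then show ?thesis by simp
  qed
  have mf[measurable]: "f n \<in> borel_measurable borel" "f2 n \<in> borel_measurable borel" for n
  proof -
    have "continuous_on UNIV (f n)" using df by (auto intro!: DERIV_continuous_on)
    then show "f n \<in> borel_measurable borel" by (rule borel_measurable_continuous_onI)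
    have "continuous_on UNIV (f2 n)" using tf[of n] by (simp add: test_function_def deq)
    then show "f2 n \<in> borel_measurable borel" by (rule borel_measurable_continuous_onI)
  qed
  have lim: "(\<lambda>n. LINT x|lborel. F n x * u x t) \<longlonglongrightarrow> (LINT x|lborel. G x * u x t)"
    if "t > 0" and [measurable]: "\<And>n. F n \<in> borel_measurable borel" "G \<in> borel_measurable borel"
      and "\<And>n x. \<bar>F n x\<bar> \<le> L" "\<And>x. (\<lambda>n. F n x) \<longlonglongrightarrow> G x" for F G L t
  proof (rule integral_dominated_convergence[where w = "\<lambda>x. L * \<bar>u x t\<bar>"])
    have [measurable]: "(\<lambda>x. u x t) \<in> borel_measurable lborel" using diffusion_integrable[OF that(1)] by simp
    show "(\<lambda>x. G x * u x t) \<in> borel_measurable lborel" "\<And>n. (\<lambda>x. F n x * u x t) \<in> borel_measurable lborel" by measurable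
    show "integrable lborel (\<lambda>x. L * \<bar>u x t\<bar>)" using diffusion_integrable[OF that(1)] by simp
    show "AE x in lborel. (\<lambda>n. F n x * u x t) \<longlonglongrightarrow> G x * u x t" using that(5) by (auto intro!: tendsto_mult)
    show "AE x in lborel. norm (F n x * u x t) \<le> L * \<bar>u x t\<bar>" for n
      using that(4) by (auto simp: abs_mult intro!: mult_right_mono)
  qed
  let ?h = "\<lambda>n r. indicator {0<..} r * (LINT x|lborel. f2 n x * u x r) :: real"
  let ?h2 = "\<lambda>r. indicator {0<..} r * (LINT x|lborel. \<phi>2 x * u x r) :: real"
  have hb: "\<bar>LINT x|lborel. f2 n x * u x r\<bar> \<le> 43 * K * C" if "r > 0" for n r
    using diffusion_pairing_bound[OF that mf(2) f2b] .
  have mh[measurable]: "?h n \<in> borel_measurable borel" for n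
    using diffusion_test_function_eq(1)[OF \<nu> u tf zero_less_one, where K = "43 * K * C"] hb by (simp add: deq)
  have hlim: "(\<lambda>n. ?h n r) \<longlonglongrightarrow> ?h2 r" for r
    using lim[of r f2 \<phi>2, OF _ _ _ f2b f2lim] by (cases "r > 0") auto
  show mh2[measurable]: "?h2 \<in> borel_measurable borel"
    by (rule borel_measurable_LIMSEQ_real[OF hlim mh])
  assume t: "t > 0"
  \<comment> \<open>The cutoff is 1 at the origin, so the initial value remains
    \<open>\<phi> 0\<close>.\<close>
  have e: "(LINT x|lborel. f n x * u x t) = \<phi> 0 + (\<integral> r. ?h n r \<partial>rl_measure \<nu> t)" for n
    using diffusion_test_function_eq(2)[OF \<nu> u tf t, where K = "43 * K * C"] hb R[of n] by (simp add: deq) (simp add: f_def m_def)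
  have "(\<lambda>n. LINT x|lborel. f n x * u x t) \<longlonglongrightarrow> (LINT x|lborel. \<phi> x * u x t)"
    by (rule lim[OF t _ _ fb flim]) auto
  moreover have "(\<lambda>n. \<phi> 0 + (\<integral> r. ?h n r \<partial>rl_measure \<nu> t)) \<longlonglongrightarrow> \<phi> 0 + (\<integral> r. ?h2 r \<partial>rl_measure \<nu> t)"
  proof (intro tendsto_add tendsto_const integral_dominated_convergence[where w = "\<lambda>_. 43 * K * C"])
    interpret finite_measure "rl_measure \<nu> t" using \<nu>(1) by (rule finite_measure_rl_measure)
    show "integrable (rl_measure \<nu> t) (\<lambda>_. 43 * K * C)" by simp
    show "AE r in rl_measure \<nu> t. norm (?h n r) \<le> 43 * K * C" for n
      using K0 diffusion_bound_nonneg hb by (intro AE_I2) (auto simp: indicator_def)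
    show "AE r in rl_measure \<nu> t. (\<lambda>n. ?h n r) \<longlonglongrightarrow> ?h2 r" using hlim by (intro AE_I2)
  qed auto
  ultimately show "(LINT x|lborel. \<phi> x * u x t) = \<phi> 0 + (\<integral> r. ?h2 r \<partial>rl_measure \<nu> t)"
    unfolding e by (rule LIMSEQ_unique)
qed

text \<open>Continuity in time is part of the definition only for compactly supported test
  functions; for the larger class it is read off the right-hand side of the Volterra
  equation.\<close>

lemma diffusion_C2_continuous:
  assumes "C2_bounded \<phi> \<phi>1 \<phi>2"
  shows "continuous_on {0<..} (\<lambda>t. LINT x|lborel. \<phi> x * u x t)"
proof -
  obtain K where K: "\<bar>\<phi>2 x\<bar> \<le> K" for x using assms unfolding C2_bounded_def by blast
  have [measurable]: "\<phi>2 \<in> borel_measurable borel"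
    using assms by (auto simp: C2_bounded_def intro: borel_measurable_continuous_onI)
  have "continuous_on {0<..} (\<lambda>t. \<phi> 0 + (\<integral> r. indicator {0<..} r * (LINT x|lborel. \<phi>2 x * u x r) \<partial>rl_measure \<nu> t))"
    by (intro continuous_intros continuous_on_integral_rl_measure[where K = "K * C"] diffusion_C2_eq(1)[OF assms] \<nu>)
       (use diffusion_pairing_bound[OF _ _ K] in auto)
  then show ?thesis by (rule continuous_on_eq) (simp add: diffusion_C2_eq(2)[OF assms])
qed

text \<open>An algebraic relation between the transforms of two pairings. It determines a transform
  whenever \<open>\<phi>2\<close> is built from the same functions as \<open>\<phi>\<close>, as for
  sines and for combinations of two exponentials.\<close>

lemma diffusion_C2_laplace:
  assumes \<phi>: "C2_bounded \<phi> \<phi>1 \<phi>2" and s: "s > 0"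
  shows "(\<integral> t. indicator {0<..} t * (LINT x|lborel. \<phi> x * u x t) \<partial>laplace_measure s) =
    \<phi> 0 / s + s powr (- \<nu>) * (\<integral> t. indicator {0<..} t * (LINT x|lborel. \<phi>2 x * u x t) \<partial>laplace_measure s)"
proof -
  let ?h = "\<lambda>r. indicator {0<..} r * (LINT x|lborel. \<phi>2 x * u x r) :: real"
  let ?J = "\<lambda>t. \<integral> r. ?h r \<partial>rl_measure \<nu> t"
  obtain K where K: "\<bar>\<phi>2 x\<bar> \<le> K" for x using \<phi> unfolding C2_bounded_def by blast
  have [measurable]: "\<phi>2 \<in> borel_measurable borel"
    using \<phi> by (auto simp: C2_bounded_def intro: borel_measurable_continuous_onI)
  have hb: "\<bar>?h r\<bar> \<le> K * C" if "r > 0" for r using that diffusion_pairing_bound[OF that _ K] by auto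
  note J = integral_laplace_rl[OF \<nu>(1) s diffusion_C2_eq(1)[OF \<phi>] hb]
  interpret finite_measure "laplace_measure s" using s by (rule finite_measure_laplace_measure)
  have [measurable]: "?J \<in> borel_measurable borel"
    by (rule rl_measure_integral_parametric) (use \<nu> diffusion_C2_eq(1)[OF \<phi>] in measurable)
  have [measurable]: "(\<lambda>t. indicator {0<..} t * (LINT x|lborel. \<phi> x * u x t)) \<in> borel_measurable borel"
  proof -
    have "(\<lambda>t. indicator {0<..} t * (\<phi> 0 + ?J t)) \<in> borel_measurable borel" by measurable
    also have "(\<lambda>t. indicator {0<..} t * (\<phi> 0 + ?J t)) = (\<lambda>t. indicator {0<..} t * (LINT x|lborel. \<phi> x * u x t))"
      by (intro ext) (simp add: diffusion_C2_eq(2)[OF \<phi>] indicator_def)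
    finally show ?thesis .
  qed
  have "(\<integral> t. indicator {0<..} t * (LINT x|lborel. \<phi> x * u x t) \<partial>laplace_measure s) = (\<integral> t. \<phi> 0 + ?J t \<partial>laplace_measure s)"
  proof (intro integral_cong_AE)
    show "AE t in laplace_measure s. indicator {0<..} t * (LINT x|lborel. \<phi> x * u x t) = \<phi> 0 + ?J t"
      using AE_laplace_measure[of s] by eventually_elim (simp add: diffusion_C2_eq(2)[OF \<phi>])
  qed auto
  also have "\<dots> = \<phi> 0 / s + s powr (- \<nu>) * (\<integral> t. ?h t \<partial>laplace_measure s)"
    using J emeasure_laplace_measure[OF s] s by (simp add: measure_def)
  finally show ?thesis .
qed

end

section \<open>Explicit test functions\<close>

lemma C2_bounded_sin: "C2_bounded (\<lambda>x. sin (k * x)) (\<lambda>x. k * cos (k * x)) (\<lambda>x. - k\<^sup>2 * sin (k * x))"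
  unfolding C2_bounded_def
proof (intro conjI allI exI[of _ "1 + \<bar>k\<bar> + k\<^sup>2"])
  fix x
  have s: "\<bar>sin (k * x)\<bar> \<le> 1" and c: "\<bar>cos (k * x)\<bar> \<le> 1" by simp_all
  show "\<bar>sin (k * x)\<bar> \<le> 1 + \<bar>k\<bar> + k\<^sup>2" using s by (smt (verit) zero_le_power2)
  have "\<bar>k * cos (k * x)\<bar> \<le> \<bar>k\<bar> * 1" unfolding abs_mult using c by (intro mult_left_mono) auto
  then show "\<bar>k * cos (k * x)\<bar> \<le> 1 + \<bar>k\<bar> + k\<^sup>2" by (smt (verit) zero_le_power2)
  have "\<bar>- k\<^sup>2 * sin (k * x)\<bar> \<le> k\<^sup>2 * 1" unfolding abs_mult using s by (intro mult_mono) auto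
  then show "\<bar>- k\<^sup>2 * sin (k * x)\<bar> \<le> 1 + \<bar>k\<bar> + k\<^sup>2" by linarith
  show "((\<lambda>x. sin (k * x)) has_real_derivative k * cos (k * x)) (at x)"
    by (auto intro!: derivative_eq_intros)
  show "((\<lambda>x. k * cos (k * x)) has_real_derivative - k\<^sup>2 * sin (k * x)) (at x)"
    by (auto intro!: derivative_eq_intros simp: power2_eq_square)
qed (intro continuous_intros)

lemma DERIV_glue:
  fixes f g h :: "real \<Rightarrow> real"
  assumes "(f has_real_derivative D) (at a)" "(g has_real_derivative D) (at a)"
    and "\<And>x. x \<le> a \<Longrightarrow> h x = f x" "\<And>x. x \<ge> a \<Longrightarrow> h x = g x"
  shows "(h has_real_derivative D) (at a)"
proof -
  have f: "((\<lambda>y. (f y - f a) / (y - a)) \<longlongrightarrow> D) (at_left a)" and g: "((\<lambda>y. (g y - g a) / (y - a)) \<longlongrightarrow> D) (at_right a)"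
    using assms(1,2) by (auto simp: has_field_derivative_iff filterlim_at_split)
  have "((\<lambda>y. (h y - h a) / (y - a)) \<longlongrightarrow> D) (at_left a)"
    by (rule Lim_transform_eventually[OF f]) (auto simp: eventually_at_filter assms(3) intro!: always_eventually)
  moreover have "((\<lambda>y. (h y - h a) / (y - a)) \<longlongrightarrow> D) (at_right a)"
    by (rule Lim_transform_eventually[OF g]) (auto simp: eventually_at_filter assms(4) intro!: always_eventually)
  ultimately show ?thesis by (auto simp: has_field_derivative_iff filterlim_at_split)
qed

text \<open>The first derivative jumps by \<open>- 2 * (a * \<mu> + b * m)\<close> at the origin, so
  \<open>z\<close> says that the two kinks cancel. At 0 the derivative vanishes, and so does
  \<open>sgn\<close>.\<close>

lemma C2_bounded_exp_abs:
  assumes nn: "\<mu> \<ge> 0" "m \<ge> 0" and z: "a * \<mu> + b * m = 0"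
  shows "C2_bounded (\<lambda>x. a * exp (- \<mu> * \<bar>x\<bar>) + b * exp (- m * \<bar>x\<bar>))
     (\<lambda>x. - sgn x * (a * \<mu> * exp (- \<mu> * \<bar>x\<bar>) + b * m * exp (- m * \<bar>x\<bar>)))
     (\<lambda>x. a * \<mu>\<^sup>2 * exp (- \<mu> * \<bar>x\<bar>) + b * m\<^sup>2 * exp (- m * \<bar>x\<bar>))"
    (is "C2_bounded ?f ?f1 ?f2")
proof -
  have ab: "b * m = - (a * \<mu>)" using z by simp
  have d: "((\<lambda>x. A * exp (c * x) + B * exp (e * x)) has_real_derivative A * c * exp (c * x) + B * e * exp (e * x)) (at x)"
    for A B c e x :: real by (auto intro!: derivative_eq_intros)
  have d0: "(?f has_real_derivative ?f1 x) (at x)" for x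
  proof -
    let ?l = "\<lambda>x. a * exp (\<mu> * x) + b * exp (m * x)" and ?r = "\<lambda>x. a * exp ((- \<mu>) * x) + b * exp ((- m) * x)"
    consider "x < 0" | "x > 0" | "x = 0" by linarith
    then show ?thesis
    proof cases
      case 1
      have "eventually (\<lambda>y. ?f y = ?l y) (nhds x)"
        using eventually_nhds_in_open[of "{..<0}" x] 1 by (auto elim!: eventually_mono)
      moreover have "(?l has_real_derivative ?f1 x) (at x)"
        using d[of a \<mu> b m x] 1 by simp
      ultimately show ?thesis using DERIV_cong_ev[OF refl _ refl] by fast
    next
      case 2
      have "eventually (\<lambda>y. ?f y = ?r y) (nhds x)"
        using eventually_nhds_in_open[of "{0<..}" x] 2 by (auto elim!: eventually_mono)
      moreover have "(?r has_real_derivative ?f1 x) (at x)"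
        using d[of a "- \<mu>" b "- m" x] 2 by simp
      ultimately show ?thesis using DERIV_cong_ev[OF refl _ refl] by fast
    next
      case 3
      show ?thesis unfolding 3
        by (rule DERIV_glue[where f = ?l and g = ?r])
           (use d[of a \<mu> b m 0] d[of a "- \<mu>" b "- m" 0] ab in auto)
    qed
  qed
  have d1: "(?f1 has_real_derivative ?f2 x) (at x)" for x
  proof -
    let ?l = "\<lambda>x. a * \<mu> * exp (\<mu> * x) + b * m * exp (m * x)" and ?r = "\<lambda>x. - (a * \<mu>) * exp ((- \<mu>) * x) + - (b * m) * exp ((- m) * x)"
    consider "x < 0" | "x > 0" | "x = 0" by linarith
    then show ?thesis
    proof cases
      case 1
      have "eventually (\<lambda>y. ?f1 y = ?l y) (nhds x)"
        using eventually_nhds_in_open[of "{..<0}" x] 1 by (auto elim!: eventually_mono)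
      moreover have "(?l has_real_derivative ?f2 x) (at x)"
        using d[of "a * \<mu>" \<mu> "b * m" m x] 1 by (simp add: power2_eq_square mult_ac)
      ultimately show ?thesis using DERIV_cong_ev[OF refl _ refl] by fast
    next
      case 2
      have "eventually (\<lambda>y. ?f1 y = ?r y) (nhds x)"
        using eventually_nhds_in_open[of "{0<..}" x] 2 by (auto elim!: eventually_mono)
      moreover have "(?r has_real_derivative ?f2 x) (at x)"
        using d[of "- (a * \<mu>)" "- \<mu>" "- (b * m)" "- m" x] 2 by (simp add: power2_eq_square mult_ac)
      ultimately show ?thesis using DERIV_cong_ev[OF refl _ refl] by fast
    next
      case 3
      show ?thesis unfolding 3
      proof (rule DERIV_glue[where f = ?l and g = ?r])
        show "(?l has_real_derivative ?f2 0) (at 0)"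
          using d[of "a * \<mu>" \<mu> "b * m" m 0] by (simp add: power2_eq_square mult_ac)
        show "(?r has_real_derivative ?f2 0) (at 0)"
          using d[of "- (a * \<mu>)" "- \<mu>" "- (b * m)" "- m" 0] by (simp add: power2_eq_square mult_ac)
      qed (auto simp: ab sgn_real_def)
    qed
  qed
  have e: "\<bar>exp (- \<mu> * \<bar>x\<bar>)\<bar> \<le> 1" "\<bar>exp (- m * \<bar>x\<bar>)\<bar> \<le> 1" for x using nn by (auto simp: mult_nonneg_nonneg)
  have tri: "\<bar>A * exp (- \<mu> * \<bar>x\<bar>) + B * exp (- m * \<bar>x\<bar>)\<bar> \<le> \<bar>A\<bar> + \<bar>B\<bar>" for A B x
  proof -
    have "\<bar>A * exp (- \<mu> * \<bar>x\<bar>) + B * exp (- m * \<bar>x\<bar>)\<bar> \<le> \<bar>A\<bar> * \<bar>exp (- \<mu> * \<bar>x\<bar>)\<bar> + \<bar>B\<bar> * \<bar>exp (- m * \<bar>x\<bar>)\<bar>"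
      by (rule order_trans[OF abs_triangle_ineq]) (simp only: abs_mult order_refl)
    also have "\<dots> \<le> \<bar>A\<bar> * 1 + \<bar>B\<bar> * 1" using e by (intro add_mono mult_left_mono) auto
    finally show ?thesis by simp
  qed
  define K1 K2 K3 where "K1 = \<bar>a\<bar> + \<bar>b\<bar>" and "K2 = \<bar>a * \<mu>\<bar> + \<bar>b * m\<bar>" and "K3 = \<bar>a * \<mu>\<^sup>2\<bar> + \<bar>b * m\<^sup>2\<bar>"
  define K where "K = K1 + K2 + K3"
  have Knn: "K1 \<ge> 0" "K2 \<ge> 0" "K3 \<ge> 0" by (auto simp: K1_def K2_def K3_def)
  have "\<bar>?f x\<bar> \<le> K \<and> \<bar>?f1 x\<bar> \<le> K \<and> \<bar>?f2 x\<bar> \<le> K" for x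
  proof -
    have "\<bar>?f1 x\<bar> \<le> 1 * \<bar>a * \<mu> * exp (- \<mu> * \<bar>x\<bar>) + b * m * exp (- m * \<bar>x\<bar>)\<bar>"
      unfolding abs_mult by (intro mult_right_mono) (auto simp: abs_sgn_eq)
    also have "\<dots> \<le> K2" using tri[of "a * \<mu>" x "b * m"] by (simp add: K2_def)
    also have "K2 \<le> K" using Knn by (simp add: K_def)
    finally have 2: "\<bar>?f1 x\<bar> \<le> K" .
    have 1: "\<bar>?f x\<bar> \<le> K" using tri[of a x b] unfolding K1_def[symmetric] K_def by (rule order_trans) (use Knn in simp)
    have "\<bar>?f2 x\<bar> \<le> K" using tri[of "a * \<mu>\<^sup>2" x "b * m\<^sup>2"] unfolding K3_def[symmetric] K_def
      by (rule order_trans) (use Knn in simp)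
    with 1 2 show ?thesis by blast
  qed
  moreover have "continuous_on UNIV ?f2" by (intro continuous_intros)
  ultimately show ?thesis unfolding C2_bounded_def using d0 d1 by blast
qed

lemma C2_bounded_one: "C2_bounded (\<lambda>_. 1) (\<lambda>_. 0) (\<lambda>_. 0)"
  by (auto simp: C2_bounded_def)

text \<open>Twice the odd part of \<open>w\<close> integrates to 0 against sines by assumption and
  against cosines by symmetry, so its Fourier transform vanishes. To apply Levy's uniqueness
  theorem, its positive and negative parts, which have equal mass, are normalised to probability
  densities with the same characteristic function.\<close>

lemma AE_even_of_sine_integrals_zero:
  fixes w :: "real \<Rightarrow> real"
  assumes int: "integrable lborel w" and z: "\<And>k. (LINT x|lborel. sin (k * x) * w x) = 0"
  shows "AE x in lborel. w (- x) = w x"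
proof -
  define h where "h x = w x - w (- x)" for x
  have intm: "integrable lborel (\<lambda>x. w (- x))"
    using lborel_integrable_real_affine[OF int, of "-1" 0] by simp
  have inth: "integrable lborel h" unfolding h_def using int intm by simp
  have [measurable]: "w \<in> borel_measurable borel" "h \<in> borel_measurable borel"
    using int inth by auto
  have odd: "h (- x) = - h x" for x by (simp add: h_def)
  \<comment> \<open>\<open>v 1\<close> and \<open>v (-1)\<close> are the positive and the negative
    part of \<open>h\<close>.\<close>
  define v where "v s x = max 0 (s * h x)" for s x :: real
  have [measurable]: "v s \<in> borel_measurable borel" for s unfolding v_def by measurable
  have intv: "integrable lborel (v s)" for s unfolding v_def using inth by simp
  have bdd: "integrable lborel (\<lambda>x. f x * g x)" if "integrable lborel g" "f \<in> borel_measurable borel" "\<And>x. \<bar>f x\<bar> \<le> 1" for f g :: "real \<Rightarrow> real"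
    by (rule Bochner_Integration.integrable_bound[OF that(1)]) 
       (use that in \<open>auto simp: abs_mult intro!: AE_I2 mult_left_le_one_le borel_measurable_times borel_measurable_integrable\<close>)
  have cosz: "(LINT x|lborel. cos (k * x) * h x) = 0" for k
  proof -
    have "(LINT x|lborel. cos (k * x) * h x) = (LINT x|lborel. cos (k * - x) * h (- x))"
      using lborel_integral_real_affine[of "-1" "\<lambda>x. cos (k * x) * h x" 0] by simp
    then show ?thesis by (simp add: odd)
  qed
  have sinz: "(LINT x|lborel. sin (k * x) * h x) = 0" for k
  proof -
    have "(LINT x|lborel. sin (k * x) * w (- x)) = (LINT x|lborel. sin (k * - x) * w x)"
      using lborel_integral_real_affine[of "-1" "\<lambda>x. sin (k * x) * w (- x)" 0] by simp
    then have "(LINT x|lborel. sin (k * x) * w (- x)) = 0" using z[of k] by simp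
    then show ?thesis using z[of k] bdd[OF int, of "\<lambda>x. sin (k * x)"] bdd[OF intm, of "\<lambda>x. sin (k * x)"]
      by (simp add: h_def right_diff_distrib)
  qed
  define A where "A = (LINT x|lborel. v 1 x)"
  have hv: "h x = v 1 x - v (-1) x" for x by (auto simp: v_def)
  have A': "(LINT x|lborel. v (-1) x) = A"
  proof -
    have "(LINT x|lborel. h x) = 0" using cosz[of 0] by simp
    then show ?thesis unfolding hv A_def using intv by simp
  qed
  have vnn: "v s x \<ge> 0" for s x by (simp add: v_def)
  have A0: "A \<ge> 0" unfolding A_def using vnn by simp
  have "AE x in lborel. v 1 x = v (-1) x"
  proof (cases "A = 0")
    case True
    have "AE x in lborel. v 1 x = 0" "AE x in lborel. v (-1) x = 0"
      using integral_nonneg_eq_0_iff_AE[OF intv[of 1]] integral_nonneg_eq_0_iff_AE[OF intv[of "-1"]] vnn A' True A_def by auto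
    then show ?thesis by eventually_elim simp
  next
    case False
    then have A: "A > 0" using A0 by simp
    define P where "P s = density lborel (\<lambda>x. ennreal (v s x / A))" for s
    have rd: "real_distribution (P s)" if "s = 1 \<or> s = -1" for s
    proof -
      have "(\<integral>\<^sup>+ x. ennreal (v s x / A) \<partial>lborel) = ennreal (LINT x|lborel. v s x / A)"
        using intv[of s] vnn A by (intro nn_integral_eq_integral) auto
      also have "(LINT x|lborel. v s x / A) = 1" using A' A that by (auto simp: A_def)
      finally have "emeasure (P s) (space (P s)) = 1" unfolding P_def by (subst emeasure_density) auto
      then have "prob_space (P s)" by (rule prob_spaceI)
      then show ?thesis by (simp add: real_distribution_def real_distribution_axioms_def P_def)
    qed
    have ch: "char (P s) t = complex_of_real (LINT x|lborel. cos (t * x) * (v s x / A)) + \<i> * complex_of_real (LINT x|lborel. sin (t * x) * (v s x / A))" for s t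
    proof -
      have ic: "integrable lborel (\<lambda>x. cos (t * x) * (v s x / A))" "integrable lborel (\<lambda>x. sin (t * x) * (v s x / A))"
        using intv[of s] by (auto intro!: bdd)
      have "char (P s) t = (LINT x|lborel. (v s x / A) *\<^sub>R iexp (t * x))"
        unfolding char_def P_def using vnn A by (subst integral_density) auto
      also have "\<dots> = (LINT x|lborel. complex_of_real (cos (t * x) * (v s x / A)) + \<i> * complex_of_real (sin (t * x) * (v s x / A)))"
      proof (intro Bochner_Integration.integral_cong refl)
        fix x
        have "iexp (t * x) = complex_of_real (cos (t * x)) + \<i> * complex_of_real (sin (t * x))"
          by (simp only: cis_conv_exp[symmetric]) (simp add: complex_eq_iff)
        then show "(v s x / A) *\<^sub>R iexp (t * x) = complex_of_real (cos (t * x) * (v s x / A)) + \<i> * complex_of_real (sin (t * x) * (v s x / A))"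
          by (simp only: scaleR_conv_of_real of_real_mult distrib_left mult_ac)
      qed
      also have "\<dots> = complex_of_real (LINT x|lborel. cos (t * x) * (v s x / A)) + \<i> * complex_of_real (LINT x|lborel. sin (t * x) * (v s x / A))"
      proof (subst Bochner_Integration.integral_add)
        show "complex_integrable lborel (\<lambda>x. complex_of_real (cos (t * x) * (v s x / A)))"
          using ic(1) by (rule integrable_of_real)
        show "complex_integrable lborel (\<lambda>x. \<i> * complex_of_real (sin (t * x) * (v s x / A)))"
          using ic(2) by (intro integrable_mult_right integrable_of_real)
      qed (simp only: integral_complex_of_real integral_mult_right_zero)
      finally show ?thesis .
    qed
    have "char (P 1) = char (P (-1))"
    proof
      fix t
      have eq: "(LINT x|lborel. f x * (v 1 x / A)) = (LINT x|lborel. f x * (v (-1) x / A))"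
        if "(LINT x|lborel. f x * h x) = 0" "f \<in> borel_measurable borel" "\<And>x. \<bar>f x\<bar> \<le> 1" for f
      proof -
        have i: "integrable lborel (\<lambda>x. f x * v s x)" for s using bdd[OF intv that(2,3)] .
        have "(LINT x|lborel. f x * v 1 x) - (LINT x|lborel. f x * v (-1) x) = (LINT x|lborel. f x * h x)"
          unfolding hv using i by (simp add: right_diff_distrib)
        then show ?thesis using that(1) by simp
      qed
      have "(LINT x|lborel. cos (t * x) * (v 1 x / A)) = (LINT x|lborel. cos (t * x) * (v (-1) x / A))"
        by (rule eq[OF cosz]) auto
      moreover have "(LINT x|lborel. sin (t * x) * (v 1 x / A)) = (LINT x|lborel. sin (t * x) * (v (-1) x / A))"
        by (rule eq[OF sinz]) auto
      ultimately show "char (P 1) t = char (P (-1)) t" unfolding ch by (simp only:)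
    qed
    then have "P 1 = P (-1)" using rd by (intro Levy_uniqueness) auto
    then have "AE x in lborel. ennreal (v 1 x / A) = ennreal (v (-1) x / A)"
      unfolding P_def by (subst (asm) sigma_finite_measure.density_unique_iff[OF sigma_finite_lborel]) auto
    then show ?thesis by eventually_elim (use A vnn in \<open>simp add: ennreal_inj\<close>)
  qed
  then show ?thesis
  proof eventually_elim
    case (elim x)
    then have "h x = 0" using hv[of x] by simp
    then show ?case by (simp add: h_def)
  qed
qed

section \<open>Symmetry and mass of solutions, pairing with exponentials\<close>

context
  fixes \<nu> C :: real and u :: "real \<Rightarrow> real \<Rightarrow> real"
  assumes \<nu>: "0 < \<nu>" "\<nu> < 2" and u: "diffusion_solution \<nu> u"
    and C: "\<And>t. t > 0 \<Longrightarrow> (LINT x|lborel. \<bar>u x t\<bar>) \<le> C"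
begin

text \<open>The sine is an eigenfunction of the second derivative and vanishes at 0, so the
  transform \<open>G\<close> of the pairing satisfies
  \<open>(1 + s powr (- \<nu>) * k\<^sup>2) * G = 0\<close>, where the first factor is
  positive.\<close>

lemma diffusion_sin:
  assumes "t > 0"
  shows "(LINT x|lborel. sin (k * x) * u x t) = 0"
proof -
  let ?g = "\<lambda>t. indicator {0<..} t * (LINT x|lborel. sin (k * x) * u x t) :: real"
  note c2 = C2_bounded_sin[of k]
  have cont: "continuous_on {0<..} (\<lambda>t. LINT x|lborel. sin (k * x) * u x t)"
    using diffusion_C2_continuous[OF \<nu> u C c2] .
  have cont': "continuous_on {0<..} ?g" using cont by (rule continuous_on_eq) auto
  have m: "?g \<in> borel_measurable borel"
    using borel_measurable_continuous_on_indicator[OF _ cont] by simp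
  have L: "(\<integral> t. ?g t \<partial>laplace_measure s) = 0" if s: "s > 0" for s
  proof -
    have "(\<integral> t. ?g t \<partial>laplace_measure s) = s powr (- \<nu>) * (\<integral> t. indicator {0<..} t * (LINT x|lborel. - k\<^sup>2 * sin (k * x) * u x t) \<partial>laplace_measure s)"
      using diffusion_C2_laplace[OF \<nu> u C c2 s] by simp
    also have "(\<lambda>t. indicator {0<..} t * (LINT x|lborel. - k\<^sup>2 * sin (k * x) * u x t)) = (\<lambda>t. - k\<^sup>2 * ?g t)"
      by (simp only: mult.assoc integral_mult_right_zero) (simp only: mult.left_commute)
    also have "(\<integral> t. - k\<^sup>2 * ?g t \<partial>laplace_measure s) = - k\<^sup>2 * (\<integral> t. ?g t \<partial>laplace_measure s)"
      by (rule integral_mult_right_zero)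
    finally have "(1 + s powr (- \<nu>) * k\<^sup>2) * (\<integral> t. ?g t \<partial>laplace_measure s) = 0" by (simp add: algebra_simps)
    moreover have "1 + s powr (- \<nu>) * k\<^sup>2 > 0" by (intro add_pos_nonneg) auto
    ultimately show ?thesis by simp
  qed
  have "?g t = 0"
  proof (rule laplace_injective[OF m cont' _ L assms])
    show "\<bar>?g r\<bar> \<le> 1 * C" if "r > 0" for r
      using diffusion_pairing_bound[OF \<nu> u C that, of "\<lambda>x. sin (k * x)" 1] that by simp
  qed
  then show ?thesis using assms by simp
qed

lemma diffusion_even: "t > 0 \<Longrightarrow> AE x in lborel. u (- x) t = u x t"
  by (rule AE_even_of_sine_integrals_zero) (auto simp: diffusion_sin diffusion_integrable[OF \<nu> u C])

lemma diffusion_mass: "t > 0 \<Longrightarrow> (LINT x|lborel. u x t) = 1"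
  using diffusion_C2_eq(2)[OF \<nu> u C C2_bounded_one] by simp

text \<open>The effect of folding: by evenness, \<open>u\<close> acts on functions of
  \<open>\<bar>x\<bar>\<close> like \<open>2 * u\<close> on the positive half line.\<close>

lemma diffusion_integral_abs:
  assumes t: "t > 0" and [measurable]: "f \<in> borel_measurable borel" and K: "\<And>x. \<bar>f x\<bar> \<le> K"
  shows "(LINT x|lborel. f \<bar>x\<bar> * u x t) = (LINT x|lborel. f x * (indicator {0<..} x * (2 * u x t)))"
proof -
  have [measurable]: "(\<lambda>x. u x t) \<in> borel_measurable borel" using diffusion_integrable[OF \<nu> u C t] by simp
  have "(LINT x|lborel. indicator {..<0} x * f (- x) * u x t) = (LINT x|lborel. indicator {0<..} x * f x * u (- x) t)"
    using lborel_integral_real_affine[of "-1" "\<lambda>x. indicator {..<0} x * f (- x) * u x t" 0]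
    by (simp add: indicator_def cong: if_cong)
  also have "\<dots> = (LINT x|lborel. indicator {0<..} x * f x * u x t)"
    by (intro integral_cong_AE) (use diffusion_even[OF t] in \<open>auto elim!: eventually_mono\<close>)
  finally have 1: "(LINT x|lborel. indicator {..<0} x * f (- x) * u x t) = (LINT x|lborel. indicator {0<..} x * f x * u x t)" .
  have i: "integrable lborel (\<lambda>x. indicator {..<0} x * f (- x) * u x t)" "integrable lborel (\<lambda>x. indicator {0<..} x * f x * u x t)"
  proof -
    have "\<bar>indicator {..<0} x * f (- x)\<bar> \<le> K" "\<bar>indicator {0<..} x * f x\<bar> \<le> K" for x
      using K[of x] K[of "- x"] by (auto simp: indicator_def)
    then show "integrable lborel (\<lambda>x. indicator {..<0} x * f (- x) * u x t)" "integrable lborel (\<lambda>x. indicator {0<..} x * f x * u x t)"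
      by (auto intro!: diffusion_pairing_integrable[OF \<nu> u C t])
  qed
  have "(LINT x|lborel. f \<bar>x\<bar> * u x t) = (LINT x|lborel. indicator {..<0} x * f (- x) * u x t + indicator {0<..} x * f x * u x t)"
  proof (intro integral_cong_AE)
    have "AE x in lborel. x \<noteq> (0::real)" by (rule AE_lborel_singleton)
    then show "AE x in lborel. f \<bar>x\<bar> * u x t = indicator {..<0} x * f (- x) * u x t + indicator {0<..} x * f x * u x t"
      by eventually_elim (auto simp: indicator_def)
  qed auto
  also have "\<dots> = (LINT x|lborel. indicator {0<..} x * f x * u x t) + (LINT x|lborel. indicator {0<..} x * f x * u x t)"
    using i 1 by simp
  also have "\<dots> = (LINT x|lborel. 2 * (indicator {0<..} x * f x * u x t))" by simp
  finally show ?thesis by (simp add: mult_ac)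
qed

text \<open>The kink of \<open>exp (- \<mu> * \<bar>x\<bar>)\<close> is cancelled by a steep
  exponential of rate \<open>Suc n\<close> with coefficient \<open>- \<mu> / Suc n\<close>, so the
  correction is uniformly small. The pairings are thus uniform limits of continuous ones.\<close>

lemma diffusion_exp_continuous:
  assumes \<mu>: "\<mu> \<ge> 0"
  shows "continuous_on {0<..} (\<lambda>t. LINT x|lborel. exp (- \<mu> * \<bar>x\<bar>) * u x t)"
proof (rule uniform_limit_theorem[OF _ _ trivial_limit_sequentially])
  let ?f = "\<lambda>n x. 1 * exp (- \<mu> * \<bar>x\<bar>) + (- \<mu> / real (Suc n)) * exp (- real (Suc n) * \<bar>x\<bar>)"
  show "eventually (\<lambda>n. continuous_on {0<..} (\<lambda>t. LINT x|lborel. ?f n x * u x t)) sequentially"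
    by (intro always_eventually allI diffusion_C2_continuous[OF \<nu> u C C2_bounded_exp_abs]) (use \<mu> in auto)
  have C0: "C \<ge> 0" using diffusion_bound_nonneg[OF \<nu> u C] .
  have bound: "\<bar>(LINT x|lborel. ?f n x * u x t) - (LINT x|lborel. exp (- \<mu> * \<bar>x\<bar>) * u x t)\<bar> \<le> \<mu> / real (Suc n) * C"
    if t: "t > 0" for n t
  proof -
    have e: "\<bar>exp (- c * \<bar>x\<bar>)\<bar> \<le> 1" if "c \<ge> 0" for c x :: real using that by (auto simp: mult_nonneg_nonneg)
    have i: "integrable lborel (\<lambda>x. exp (- c * \<bar>x\<bar>) * u x t)" if "c \<ge> 0" for c
      by (rule diffusion_pairing_integrable[OF \<nu> u C t _ e[OF that]]) measurable
    have "(LINT x|lborel. ?f n x * u x t) = (LINT x|lborel. exp (- \<mu> * \<bar>x\<bar>) * u x t + (- \<mu> / real (Suc n)) * (exp (- real (Suc n) * \<bar>x\<bar>) * u x t))"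
      by (intro Bochner_Integration.integral_cong) (auto simp: algebra_simps)
    also have "\<dots> = (LINT x|lborel. exp (- \<mu> * \<bar>x\<bar>) * u x t) + (- \<mu> / real (Suc n)) * (LINT x|lborel. exp (- real (Suc n) * \<bar>x\<bar>) * u x t)"
      using i[OF \<mu>] i[of "real (Suc n)"] by (subst Bochner_Integration.integral_add) auto
    finally have "\<bar>(LINT x|lborel. ?f n x * u x t) - (LINT x|lborel. exp (- \<mu> * \<bar>x\<bar>) * u x t)\<bar>
      = \<mu> / real (Suc n) * \<bar>LINT x|lborel. exp (- real (Suc n) * \<bar>x\<bar>) * u x t\<bar>" using \<mu> by (simp add: abs_mult)
    also have "\<bar>LINT x|lborel. exp (- real (Suc n) * \<bar>x\<bar>) * u x t\<bar> \<le> 1 * C"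
      by (rule diffusion_pairing_bound[OF \<nu> u C t]) (use e[of "real (Suc n)"] in auto)
    finally show ?thesis using \<mu> by (simp add: mult_left_mono divide_right_mono)
  qed
  have lim: "(\<lambda>n. \<mu> * inverse (real (Suc n)) * C) \<longlonglongrightarrow> \<mu> * 0 * C"
    by (intro tendsto_intros LIMSEQ_inverse_real_of_nat)
  show "uniform_limit {0<..} (\<lambda>n t. LINT x|lborel. ?f n x * u x t) (\<lambda>t. LINT x|lborel. exp (- \<mu> * \<bar>x\<bar>) * u x t) sequentially"
  proof (rule uniform_limitI)
    fix e :: real assume "e > 0"
    then have "eventually (\<lambda>n. \<mu> / real (Suc n) * C < e) sequentially"
      using order_tendstoD(2)[OF lim, of e] by (simp add: divide_inverse)
    then show "eventually (\<lambda>n. \<forall>t\<in>{0<..}. dist (LINT x|lborel. ?f n x * u x t) (LINT x|lborel. exp (- \<mu> * \<bar>x\<bar>) * u x t) < e) sequentially"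
    proof eventually_elim
      case (elim n)
      show ?case
      proof
        fix t :: real assume "t \<in> {0<..}"
        then have "t > 0" by simp
        from order.strict_trans1[OF bound[OF this, of n] elim]
        show "dist (LINT x|lborel. ?f n x * u x t) (LINT x|lborel. exp (- \<mu> * \<bar>x\<bar>) * u x t) < e"
          unfolding dist_real_def .
      qed
    qed
  qed
qed

end

section \<open>The folded solution processes\<close>

text \<open>
  The kinks of \<open>exp (- \<mu> * \<bar>x\<bar>) / \<mu>\<close> and \<open>exp (- \<kappa> * \<bar>x\<bar>) / \<kappa>\<close> at the origin cancel, so their difference is
  an admissible test function; for \<open>\<kappa>\<^sup>2 = s powr \<nu>\<close> the equation determines the \<open>\<mu>\<close>-term.
\<close>
lemma diffusion_exp_laplace:
  fixes \<nu> C :: real and u :: "real \<Rightarrow> real \<Rightarrow> real"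
  assumes \<nu>: "0 < \<nu>" "\<nu> < 2" and u: "diffusion_solution \<nu> u"
    and C: "\<And>t. t > 0 \<Longrightarrow> (LINT x|lborel. \<bar>u x t\<bar>) \<le> C"
    and \<mu>: "\<mu> \<ge> 0" and s: "s > 0"
  shows "(\<integral> t. indicator {0<..} t * (LINT x|lborel. exp (- \<mu> * \<bar>x\<bar>) * u x t) \<partial>laplace_measure s)
      = s powr (\<nu> / 2 - 1) / (s powr (\<nu> / 2) + \<mu>)"
proof -
  define \<kappa> where "\<kappa> = s powr (\<nu> / 2)"
  have \<kappa>: "\<kappa> > 0" using s by (simp add: \<kappa>_def)
  have "s powr \<nu> = s powr (\<nu> / 2) * s powr (\<nu> / 2)" by (subst powr_add[symmetric]) simp
  then have \<kappa>2: "s powr (- \<nu>) = 1 / \<kappa>\<^sup>2" unfolding \<kappa>_def powr_minus_divide power2_eq_square by (simp only:)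
  have \<kappa>s: "s powr (\<nu> / 2 - 1) = \<kappa> / s" using s by (simp add: \<kappa>_def powr_diff)
  define V where "V \<mu> t = indicator {0<..} t * (LINT x|lborel. exp (- \<mu> * \<bar>x\<bar>) * u x t)" for \<mu> t :: real
  define L where "L \<mu> = (\<integral> t. V \<mu> t \<partial>laplace_measure s)" for \<mu>
  have e: "\<bar>exp (- c * \<bar>x\<bar>)\<bar> \<le> 1" if "c \<ge> 0" for c x :: real using that by (auto simp: mult_nonneg_nonneg)
  have V_bd: "\<bar>V \<mu> t\<bar> \<le> C" if "\<mu> \<ge> 0" for \<mu> t
    using diffusion_pairing_bound[OF \<nu> u C, of t "\<lambda>x. exp (- \<mu> * \<bar>x\<bar>)" 1] e[OF that] diffusion_bound_nonneg[OF \<nu> u C]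
    by (auto simp: V_def indicator_def)
  have V_meas: "V \<mu> \<in> borel_measurable borel" if "\<mu> \<ge> 0" for \<mu>
    using borel_measurable_continuous_on_indicator[OF _ diffusion_exp_continuous[OF \<nu> u C that]]
    unfolding V_def[abs_def] by simp
  have V_int: "integrable (laplace_measure s) (V \<mu>)" if "\<mu> \<ge> 0" for \<mu>
    using s V_meas[OF that] V_bd[OF that] by (intro integrable_laplace_measure_bounded[where K = C]) auto
  have V_lin: "indicator {0<..} t * (LINT x|lborel. (a * exp (- \<mu> * \<bar>x\<bar>) + b * exp (- m * \<bar>x\<bar>)) * u x t) = a * V \<mu> t + b * V m t"
    if "\<mu> \<ge> 0" "m \<ge> 0" for a b \<mu> m t
  proof (cases "t > 0")
    case True
    have i: "integrable lborel (\<lambda>x. exp (- c * \<bar>x\<bar>) * u x t)" if "c \<ge> 0" for c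
      by (rule diffusion_pairing_integrable[OF \<nu> u C True _ e[OF that]]) measurable
    have "(LINT x|lborel. (a * exp (- \<mu> * \<bar>x\<bar>) + b * exp (- m * \<bar>x\<bar>)) * u x t)
       = (LINT x|lborel. a * (exp (- \<mu> * \<bar>x\<bar>) * u x t) + b * (exp (- m * \<bar>x\<bar>) * u x t))"
      by (intro Bochner_Integration.integral_cong refl) (simp add: algebra_simps)
    also have "\<dots> = a * (LINT x|lborel. exp (- \<mu> * \<bar>x\<bar>) * u x t) + b * (LINT x|lborel. exp (- m * \<bar>x\<bar>) * u x t)"
      using i[OF that(1)] i[OF that(2)] by (subst Bochner_Integration.integral_add) auto
    finally show ?thesis using True by (simp add: V_def)
  qed (simp add: V_def)
  have main: "L \<mu> = \<kappa> / s / (\<kappa> + \<mu>)" if \<mu>: "\<mu> > 0" "\<mu> \<noteq> \<kappa>" for \<mu>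
  proof -
    have c2: "C2_bounded (\<lambda>x. (1 / \<mu>) * exp (- \<mu> * \<bar>x\<bar>) + (- 1 / \<kappa>) * exp (- \<kappa> * \<bar>x\<bar>))
     (\<lambda>x. - sgn x * ((1 / \<mu>) * \<mu> * exp (- \<mu> * \<bar>x\<bar>) + (- 1 / \<kappa>) * \<kappa> * exp (- \<kappa> * \<bar>x\<bar>)))
     (\<lambda>x. (1 / \<mu>) * \<mu>\<^sup>2 * exp (- \<mu> * \<bar>x\<bar>) + (- 1 / \<kappa>) * \<kappa>\<^sup>2 * exp (- \<kappa> * \<bar>x\<bar>))"
      by (rule C2_bounded_exp_abs) (use \<mu> \<kappa> in auto)
    have lin: "(\<integral> t. a * V \<mu> t + b * V \<kappa> t \<partial>laplace_measure s) = a * L \<mu> + b * L \<kappa>" for a b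
      using V_int[of \<mu>] V_int[of \<kappa>] \<mu> \<kappa> by (simp add: L_def)
    have "(1 / \<mu>) * L \<mu> + (- 1 / \<kappa>) * L \<kappa> = ((1 / \<mu>) * exp (- \<mu> * \<bar>0\<bar>) + (- 1 / \<kappa>) * exp (- \<kappa> * \<bar>0\<bar>)) / s
      + 1 / \<kappa>\<^sup>2 * (((1 / \<mu>) * \<mu>\<^sup>2) * L \<mu> + ((- 1 / \<kappa>) * \<kappa>\<^sup>2) * L \<kappa>)"
      using diffusion_C2_laplace[OF \<nu> u C c2 s] V_lin[of \<mu> \<kappa>] \<mu> \<kappa> by (simp only: lin \<kappa>2 less_imp_le)
    then have "L \<mu> / \<mu> - L \<kappa> / \<kappa> = (1 / \<mu> - 1 / \<kappa>) / s + (\<mu> * L \<mu> - \<kappa> * L \<kappa>) / \<kappa>\<^sup>2"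
      using \<mu> \<kappa> by (simp add: power2_eq_square)
    \<comment> \<open>Because of \<open>\<kappa>\<^sup>2 = s powr \<nu>\<close> the term
      \<open>L \<kappa> / \<kappa>\<close> occurs on both sides and cancels.\<close>
    then have "L \<mu> / \<mu> = (1 / \<mu> - 1 / \<kappa>) / s + \<mu> * L \<mu> / \<kappa>\<^sup>2"
      using \<kappa> by (simp add: diff_divide_distrib power2_eq_square)
    then have "L \<mu> * (s * (\<kappa> + \<mu>)) * (\<kappa> - \<mu>) = \<kappa> * (\<kappa> - \<mu>)"
      using \<mu> \<kappa> s by (simp add: field_simps power2_eq_square) 
    then have "L \<mu> * (s * (\<kappa> + \<mu>)) = \<kappa>" using \<mu> by simp
    then have "L \<mu> = \<kappa> / (s * (\<kappa> + \<mu>))" using \<mu> \<kappa> s by (subst nonzero_eq_divide_eq) auto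
    then show ?thesis by simp
  qed
  consider "\<mu> > 0" "\<mu> \<noteq> \<kappa>" | "\<mu> = 0 \<or> \<mu> = \<kappa>" using \<mu> by linarith
  then have "L \<mu> = \<kappa> / s / (\<kappa> + \<mu>)"
  proof cases
    case 1
    then show ?thesis by (rule main)
  next
    case 2
    \<comment> \<open>The exceptional values 0 and \<open>\<kappa>\<close> are reached by
      continuity. With \<open>Suc (Suc n)\<close> the approximants stay below
      \<open>\<kappa>\<close> when \<open>\<mu> = 0\<close>; with \<open>Suc n\<close> the first one
      would equal \<open>\<kappa>\<close>.\<close>
    define \<mu>' where "\<mu>' n = \<mu> + \<kappa> * inverse (real (Suc (Suc n)))" for n
    have \<mu>': "\<mu>' n > 0" "\<mu>' n \<noteq> \<kappa>" for n
    proof -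
      have "\<kappa> + \<kappa> * real n > 0" using \<kappa> by (intro add_pos_nonneg) auto
      then show "\<mu>' n > 0" "\<mu>' n \<noteq> \<kappa>" using 2 \<kappa> \<mu> by (auto simp: \<mu>'_def add_nonneg_pos field_simps)
    qed
    have lim: "\<mu>' \<longlonglongrightarrow> \<mu>"
    proof -
      have "(\<lambda>n. \<mu> + \<kappa> * inverse (real (Suc (Suc n)))) \<longlonglongrightarrow> \<mu> + \<kappa> * 0"
        by (intro tendsto_intros LIMSEQ_Suc[OF LIMSEQ_inverse_real_of_nat])
      then show ?thesis by (simp add: \<mu>'_def[abs_def])
    qed
    have "(\<lambda>n. L (\<mu>' n)) \<longlonglongrightarrow> L \<mu>"
      unfolding L_def
    proof (rule integral_dominated_convergence[where w = "\<lambda>_. C"])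
      interpret finite_measure "laplace_measure s" using s by (rule finite_measure_laplace_measure)
      show "V \<mu> \<in> borel_measurable (laplace_measure s)" using V_meas[OF \<mu>] by simp
      show "V (\<mu>' n) \<in> borel_measurable (laplace_measure s)" for n using V_meas[of "\<mu>' n"] \<mu>'(1)[of n] by simp
      show "integrable (laplace_measure s) (\<lambda>_. C)" by simp
      show "AE t in laplace_measure s. norm (V (\<mu>' n) t) \<le> C" for n
        using V_bd[of "\<mu>' n"] \<mu>'(1)[of n] by (intro AE_I2) simp
      show "AE t in laplace_measure s. (\<lambda>n. V (\<mu>' n) t) \<longlonglongrightarrow> V \<mu> t"
        using AE_laplace_measure[of s]
      proof eventually_elim
        case (elim t)
        have [measurable]: "(\<lambda>x. u x t) \<in> borel_measurable lborel" using diffusion_integrable[OF \<nu> u C elim] by simp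
        have "(\<lambda>n. LINT x|lborel. exp (- \<mu>' n * \<bar>x\<bar>) * u x t) \<longlonglongrightarrow> (LINT x|lborel. exp (- \<mu> * \<bar>x\<bar>) * u x t)"
        proof (rule integral_dominated_convergence[where w = "\<lambda>x. \<bar>u x t\<bar>"])
          show "integrable lborel (\<lambda>x. \<bar>u x t\<bar>)" using diffusion_integrable[OF \<nu> u C elim] by simp
          show "AE x in lborel. (\<lambda>n. exp (- \<mu>' n * \<bar>x\<bar>) * u x t) \<longlonglongrightarrow> exp (- \<mu> * \<bar>x\<bar>) * u x t"
            by (intro AE_I2 tendsto_intros lim)
          show "AE x in lborel. norm (exp (- \<mu>' n * \<bar>x\<bar>) * u x t) \<le> \<bar>u x t\<bar>" for n
            using e[of "\<mu>' n"] \<mu>'(1)[of n] by (intro AE_I2) (simp add: abs_mult mult_left_le_one_le)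
        qed auto
        then show ?case using elim by (simp add: V_def)
      qed
    qed
    moreover have "(\<lambda>n. L (\<mu>' n)) \<longlonglongrightarrow> \<kappa> / s / (\<kappa> + \<mu>)"
      unfolding main[OF \<mu>'] using \<kappa> \<mu> s by (intro tendsto_intros lim) auto
    ultimately show ?thesis by (rule LIMSEQ_unique)
  qed
  then show ?thesis unfolding \<kappa>s by (simp add: L_def V_def \<kappa>_def)
qed

text \<open>
  Nonnegativity of \<open>u\<close> is not assumed: the positive part of \<open>2 * u x t\<close> on the half line has integral 1
  as a density, and by evenness \<open>2 * u x t\<close> itself has the same integral there.
\<close>
lemma folded_solution_expectation:
  assumes M: "prob_space M" and T: "folded_solution_process M \<alpha> T" and \<alpha>: "0 < \<alpha>" "\<alpha> < 1"
  obtains u C where "diffusion_solution (2 * \<alpha>) u" "\<And>t. t > 0 \<Longrightarrow> (LINT x|lborel. \<bar>u x t\<bar>) \<le> C"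
    "\<And>t f K. t > 0 \<Longrightarrow> f \<in> borel_measurable borel \<Longrightarrow> (\<And>x. \<bar>f x\<bar> \<le> K) \<Longrightarrow>
       (\<integral> \<omega>. f (T t \<omega>) \<partial>M) = (LINT x|lborel. f \<bar>x\<bar> * u x t)"
proof -
  interpret prob_space M by fact
  obtain u where u: "diffusion_solution (2 * \<alpha>) u"
    and d: "\<And>t. t > 0 \<Longrightarrow> distributed M lborel (T t) (\<lambda>x. ennreal (if x \<ge> 0 then 2 * u x t else 0))"
    using T \<alpha> by (auto simp: folded_solution_process_def)
  obtain C where C: "\<And>t. t > 0 \<Longrightarrow> (LINT x|lborel. \<bar>u x t\<bar>) \<le> C"
    using u unfolding diffusion_solution_def by blast
  have \<nu>: "0 < 2 * \<alpha>" "2 * \<alpha> < 2" using \<alpha> by auto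
  show ?thesis
  proof (rule that[OF u C])
    fix t K :: real and f :: "real \<Rightarrow> real"
    assume t: "t > 0" and f[measurable]: "f \<in> borel_measurable borel" and K: "\<And>x. \<bar>f x\<bar> \<le> K"
    have [measurable]: "(\<lambda>x. u x t) \<in> borel_measurable borel" and iu: "integrable lborel (\<lambda>x. u x t)"
      using diffusion_integrable[OF \<nu> u C t] by auto
    define g where "g x = indicator {0<..} x * (2 * u x t)" for x
    \<comment> \<open>\<open>ennreal\<close> truncates negative values at 0, so this positive part
      is the density of \<open>T t\<close>.\<close>
    define g' where "g' x = max 0 (if x \<ge> 0 then 2 * u x t else 0)" for x
    have [measurable]: "g \<in> borel_measurable borel" "g' \<in> borel_measurable borel"
      unfolding g_def g'_def by measurable
    have d': "distributed M lborel (T t) (\<lambda>x. ennreal (g' x))"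
    proof -
      have "(\<lambda>x. ennreal (if x \<ge> 0 then 2 * u x t else 0)) = (\<lambda>x. ennreal (g' x))"
        by (intro ext) (auto simp: g'_def max_def ennreal_neg)
      then show ?thesis using d[OF t] by simp
    qed
    have ig: "integrable lborel g"
      using diffusion_pairing_integrable[OF \<nu> u C t, of "\<lambda>x. 2 * indicator {0<..} x" 2]
      by (simp add: g_def[abs_def] indicator_def mult_ac cong: if_cong)
    have ig': "integrable lborel g'"
    proof (rule Bochner_Integration.integrable_bound[of _ "\<lambda>x. 2 * u x t"])
      show "AE x in lborel. norm (g' x) \<le> norm (2 * u x t)" by (auto simp: g'_def)
    qed (use iu in auto)
    have Ef: "(\<integral> \<omega>. f (T t \<omega>) \<partial>M) = (LINT x|lborel. g' x * f x)" if "f \<in> borel_measurable borel" for f :: "real \<Rightarrow> real"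
      by (rule distributed_integral[OF d', symmetric]) (use that in \<open>auto simp: g'_def\<close>)
    have "(LINT x|lborel. g' x) = 1" using Ef[of "\<lambda>_. 1"] by (simp add: prob_space)
    moreover have "(LINT x|lborel. g x) = 1"
      using diffusion_integral_abs[OF \<nu> u C t, of "\<lambda>_. 1" 1] diffusion_mass[OF \<nu> u C t] by (simp add: g_def)
    ultimately have "(LINT x|lborel. g' x - g x) = 0" using ig ig' by simp
    moreover have ge: "AE x in lborel. 0 \<le> g' x - g x" by (auto simp: g_def g'_def indicator_def)
    ultimately have "AE x in lborel. g' x - g x = 0"
      using integral_nonneg_eq_0_iff_AE[of lborel "\<lambda>x. g' x - g x"] ig ig' by auto
    then have "(LINT x|lborel. g' x * f x) = (LINT x|lborel. f x * g x)"
      by (intro integral_cong_AE) (auto elim!: eventually_mono)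
    then show "(\<integral> \<omega>. f (T t \<omega>) \<partial>M) = (LINT x|lborel. f \<bar>x\<bar> * u x t)"
      using Ef[OF f] diffusion_integral_abs[OF \<nu> u C t f K] by (simp add: g_def)
  qed auto
qed

section \<open>Laplace transforms of the folded processes\<close>

context
  fixes M :: "'a measure" and \<alpha> :: real and T :: "real \<Rightarrow> 'a \<Rightarrow> real"
  assumes M: "prob_space M" and T: "folded_solution_process M \<alpha> T" and \<alpha>: "0 < \<alpha>" "\<alpha> \<le> 1"
begin

lemma folded_measurable: "t \<ge> 0 \<Longrightarrow> T t \<in> borel_measurable M"
  using T by (simp add: folded_solution_process_def)

lemma folded_nonneg: "t \<ge> 0 \<Longrightarrow> \<omega> \<in> space M \<Longrightarrow> T t \<omega> \<ge> 0"
  using T by (simp add: folded_solution_process_def)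

lemma folded_exp_bound:
  assumes "\<mu> \<ge> 0" "t \<ge> 0"
  shows "0 \<le> (\<integral> \<omega>. exp (- \<mu> * T t \<omega>) \<partial>M)" "(\<integral> \<omega>. exp (- \<mu> * T t \<omega>) \<partial>M) \<le> 1"
proof -
  interpret prob_space M by (rule M)
  show "0 \<le> (\<integral> \<omega>. exp (- \<mu> * T t \<omega>) \<partial>M)" by simp
  have [measurable]: "T t \<in> borel_measurable M" using folded_measurable assms by simp
  have "exp (- \<mu> * T t \<omega>) \<le> 1" if "\<omega> \<in> space M" for \<omega>
    using folded_nonneg[OF assms(2) that] assms by simp
  then show "(\<integral> \<omega>. exp (- \<mu> * T t \<omega>) \<partial>M) \<le> 1"
    by (intro integral_le_const integrable_const_bound[where B = 1] AE_I2) auto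
qed

text \<open>The transform is that of the Mittag-Leffler function of order \<open>\<alpha>\<close> at
  \<open>- \<mu> * t powr \<alpha>\<close>. For \<open>\<alpha> < 1\<close> it comes from the
  diffusion equation of order \<open>2 * \<alpha>\<close>; for \<open>\<alpha> = 1\<close> the
  process is the point mass at \<open>t\<close> and the integral is elementary.\<close>

lemma folded_laplace_props:
  assumes \<mu>: "\<mu> \<ge> 0"
  shows "continuous_on {0<..} (\<lambda>t. \<integral> \<omega>. exp (- \<mu> * T t \<omega>) \<partial>M)" (is ?C)
    and "s > 0 \<Longrightarrow> (\<integral> t. indicator {0<..} t * (\<integral> \<omega>. exp (- \<mu> * T t \<omega>) \<partial>M) \<partial>laplace_measure s) = s powr (\<alpha> - 1) / (s powr \<alpha> + \<mu>)"
proof -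
  interpret prob_space M by (rule M)
  have "?C \<and> (\<forall>s>0. (\<integral> t. indicator {0<..} t * (\<integral> \<omega>. exp (- \<mu> * T t \<omega>) \<partial>M) \<partial>laplace_measure s) = s powr (\<alpha> - 1) / (s powr \<alpha> + \<mu>))"
  proof (cases "\<alpha> = 1")
    case True
    have eq: "(\<integral> \<omega>. exp (- \<mu> * T t \<omega>) \<partial>M) = exp (- \<mu> * t)" if "t > 0" for t
    proof -
      have [measurable]: "T t \<in> borel_measurable M" using folded_measurable that by simp
      have "AE \<omega> in M. T t \<omega> = t" using T True that by (simp add: folded_solution_process_def)
      then have "(\<integral> \<omega>. exp (- \<mu> * T t \<omega>) \<partial>M) = (\<integral> \<omega>. exp (- \<mu> * t) \<partial>M)"
        by (intro integral_cong_AE) (auto elim!: eventually_mono)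
      then show ?thesis by (simp add: prob_space)
    qed
    have "continuous_on {0<..} (\<lambda>t. exp (- \<mu> * t))" by (intro continuous_intros)
    then have c: ?C by (rule continuous_on_eq) (subst eq, simp, rule refl)
    have "(\<integral> t. indicator {0<..} t * (\<integral> \<omega>. exp (- \<mu> * T t \<omega>) \<partial>M) \<partial>laplace_measure s) = s powr (1 - 1) / (s powr 1 + \<mu>)" if s: "s > 0" for s
    proof -
      have "(\<lambda>t. indicator {0<..} t * (\<integral> \<omega>. exp (- \<mu> * T t \<omega>) \<partial>M)) = (\<lambda>t. indicator {0<..} t * exp (- \<mu> * t))"
      proof
        fix t show "indicator {0<..} t * (\<integral> \<omega>. exp (- \<mu> * T t \<omega>) \<partial>M) = indicator {0<..} t * exp (- \<mu> * t)"
          by (cases "t > 0") (simp_all only: eq, simp)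
      qed
      then have "(\<integral> t. indicator {0<..} t * (\<integral> \<omega>. exp (- \<mu> * T t \<omega>) \<partial>M) \<partial>laplace_measure s)
         = (\<integral> t. exp (- s * t) * indicator {0<..} t * (indicator {0<..} t * exp (- \<mu> * t)) \<partial>lborel)"
        by (simp only:) (subst integral_laplace_measure, auto)
      also have "\<dots> = (\<integral> t. exp (- (s + \<mu>) * t) * indicator {0<..} t * 1 \<partial>lborel)"
        by (intro Bochner_Integration.integral_cong refl) (auto simp: indicator_def exp_add[symmetric] algebra_simps)
      also have "\<dots> = (\<integral> t. 1 \<partial>laplace_measure (s + \<mu>))" by (subst integral_laplace_measure) auto
      also have "\<dots> = 1 / (s + \<mu>)" using emeasure_laplace_measure[of "s + \<mu>"] s \<mu> by (simp add: measure_def)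
      finally show ?thesis using s by simp
    qed
    then show ?thesis using c True by simp
  next
    case False
    then have \<alpha>1: "\<alpha> < 1" using \<alpha> by simp
    obtain u C where u: "diffusion_solution (2 * \<alpha>) u" and C: "\<And>t. t > 0 \<Longrightarrow> (LINT x|lborel. \<bar>u x t\<bar>) \<le> C"
      and E: "\<And>t f K. t > 0 \<Longrightarrow> f \<in> borel_measurable borel \<Longrightarrow> (\<And>x. \<bar>f x\<bar> \<le> K) \<Longrightarrow>
         (\<integral> \<omega>. f (T t \<omega>) \<partial>M) = (LINT x|lborel. f \<bar>x\<bar> * u x t)"
    proof (rule folded_solution_expectation[OF M T \<alpha>(1) \<alpha>1], goal_cases)
      case prems: (1 u C)
      show ?case by (rule prems(1)[OF prems(2-3)]) (assumption | rule prems(4))+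
    qed
    have \<nu>: "0 < 2 * \<alpha>" "2 * \<alpha> < 2" using \<alpha> \<alpha>1 by auto
    have eq: "(\<integral> \<omega>. exp (- \<mu> * T t \<omega>) \<partial>M) = (LINT x|lborel. exp (- \<mu> * \<bar>x\<bar>) * u x t)" if t: "t > 0" for t
    proof -
      have [measurable]: "T t \<in> borel_measurable M" using folded_measurable that by simp
      have "(\<integral> \<omega>. exp (- \<mu> * T t \<omega>) \<partial>M) = (\<integral> \<omega>. exp (- \<mu> * \<bar>T t \<omega>\<bar>) \<partial>M)"
        using folded_nonneg[of t] t by (intro Bochner_Integration.integral_cong refl) auto
      also have "\<dots> = (LINT x|lborel. exp (- \<mu> * \<bar>\<bar>x\<bar>\<bar>) * u x t)"
      proof (rule E[OF t])
        show "\<bar>exp (- \<mu> * \<bar>x\<bar>)\<bar> \<le> 1" for x using \<mu> by (simp add: mult_nonneg_nonneg)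
      qed auto
      finally show ?thesis by simp
    qed
    have "continuous_on {0<..} (\<lambda>t. LINT x|lborel. exp (- \<mu> * \<bar>x\<bar>) * u x t)"
      by (rule diffusion_exp_continuous[OF \<nu> u C \<mu>])
    then have "?C" by (rule continuous_on_eq) (subst eq, simp, rule refl)
    moreover have "(\<lambda>t. indicator {0<..} t * (\<integral> \<omega>. exp (- \<mu> * T t \<omega>) \<partial>M)) = (\<lambda>t. indicator {0<..} t * (LINT x|lborel. exp (- \<mu> * \<bar>x\<bar>) * u x t))"
    proof
      fix t show "indicator {0<..} t * (\<integral> \<omega>. exp (- \<mu> * T t \<omega>) \<partial>M) = indicator {0<..} t * (LINT x|lborel. exp (- \<mu> * \<bar>x\<bar>) * u x t)"
        by (cases "t > 0") (simp_all only: eq, simp)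
    qed
    ultimately show ?thesis using diffusion_exp_laplace[OF \<nu> u C \<mu>] by simp
  qed
  then show ?C and "s > 0 \<Longrightarrow> (\<integral> t. indicator {0<..} t * (\<integral> \<omega>. exp (- \<mu> * T t \<omega>) \<partial>M) \<partial>laplace_measure s) = s powr (\<alpha> - 1) / (s powr \<alpha> + \<mu>)"
    by blast+
qed

lemma folded_exp_measurable:
  assumes \<mu>: "\<mu> \<ge> 0"
  shows "(\<lambda>t. indicator {0<..} t * (\<integral> \<omega>. exp (- \<mu> * T t \<omega>) \<partial>M)) \<in> borel_measurable borel"
  using borel_measurable_continuous_on_indicator[OF _ folded_laplace_props(1)[OF \<mu>]] by simp

text \<open>Self-similarity of \<open>T\<close> at the level of Laplace transforms: with
  \<open>c powr \<alpha> = \<mu>\<close> both sides have the same transform in \<open>t\<close>, and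
  both are bounded and continuous.\<close>

lemma folded_exp_scaling:
  assumes \<mu>: "\<mu> > 0" and t: "t > 0"
  shows "(\<integral> \<omega>. exp (- \<mu> * T t \<omega>) \<partial>M) = (\<integral> \<omega>. exp (- T (\<mu> powr (1 / \<alpha>) * t) \<omega>) \<partial>M)"
proof -
  define c where "c = \<mu> powr (1 / \<alpha>)"
  have c: "c > 0" using \<mu> by (simp add: c_def)
  have c\<alpha>: "c powr \<alpha> = \<mu>" using \<mu> \<alpha> by (simp add: c_def powr_powr)
  define V where "V \<mu> t = indicator {0<..} t * (\<integral> \<omega>. exp (- \<mu> * T t \<omega>) \<partial>M)" for \<mu> t
  have Vm[measurable]: "V 1 \<in> borel_measurable borel" "V \<mu> \<in> borel_measurable borel"
    unfolding V_def[abs_def] using folded_exp_measurable[of 1] folded_exp_measurable[of \<mu>] \<mu> by auto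
  have Vb: "0 \<le> V \<mu> t \<and> V \<mu> t \<le> 1" if "\<mu> \<ge> 0" for \<mu> t
    using folded_exp_bound[OF that, of t] by (auto simp: V_def indicator_def)
  define f where "f t = V \<mu> t - V 1 (c * t)" for t
  have [measurable]: "f \<in> borel_measurable borel" unfolding f_def[abs_def] by measurable
  have fb: "\<bar>f r\<bar> \<le> 1" for r using Vb[of \<mu> r] Vb[of 1 "c * r"] \<mu> by (auto simp: f_def)
  have "f t = 0"
  proof (rule laplace_injective[where K = 1 and f = f])
    have V: "continuous_on {0<..} (V \<mu>)" if "\<mu> \<ge> 0" for \<mu>
      using folded_laplace_props(1)[OF that] by (rule continuous_on_eq) (simp add: V_def)
    show "continuous_on {0<..} f"
      unfolding f_def[abs_def] using \<mu> c
      by (intro continuous_intros V continuous_on_compose2[OF V[of 1]]) auto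
    fix s :: real assume s: "s > 0"
    have "(\<integral> t. V 1 (c * t) \<partial>laplace_measure s) = (\<integral> t. exp (- s * t) * indicator {0<..} t * V 1 (c * t) \<partial>lborel)"
      by (rule integral_laplace_measure) measurable
    also have "\<dots> = (1 / c) * (\<integral> t. exp (- (s / c) * t) * indicator {0<..} t * V 1 t \<partial>lborel)"
      using c by (subst lborel_integral_real_affine[where c = "1 / c" and t = 0]) (auto simp: indicator_def zero_less_divide_iff)
    also have "(\<integral> t. exp (- (s / c) * t) * indicator {0<..} t * V 1 t \<partial>lborel) = (\<integral> t. V 1 t \<partial>laplace_measure (s / c))"
      by (rule integral_laplace_measure[symmetric]) measurable
    also have "\<dots> = (s / c) powr (\<alpha> - 1) / ((s / c) powr \<alpha> + 1)"
      using folded_laplace_props(2)[of 1 "s / c"] s c by (simp add: V_def[abs_def])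
    also have "(1 / c) * \<dots> = s powr (\<alpha> - 1) / (s powr \<alpha> + \<mu>)"
      using s c \<mu> by (simp add: powr_divide powr_diff c\<alpha> divide_simps)
    also have "\<dots> = (\<integral> t. V \<mu> t \<partial>laplace_measure s)"
      using folded_laplace_props(2)[of \<mu> s] s \<mu> by (simp add: V_def[abs_def])
    finally have eq: "(\<integral> t. V 1 (c * t) \<partial>laplace_measure s) = (\<integral> t. V \<mu> t \<partial>laplace_measure s)" .
    have "integrable (laplace_measure s) (V \<mu>)" "integrable (laplace_measure s) (\<lambda>t. V 1 (c * t))"
      using Vb \<mu> by (auto intro!: integrable_laplace_measure_bounded[OF s, where K = 1])
    then show "(\<integral> r. f r \<partial>laplace_measure s) = 0" using eq by (simp add: f_def)
  qed (use fb t in auto)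
  then show ?thesis using c t by (simp add: f_def V_def c_def)
qed

end

text \<open>Both orders of integration are provided, because continuity in either time is obtained
  by conditioning on the process that carries the other.\<close>

lemma (in prob_space) indep_var_integral_iterated:
  fixes X Y :: "'a \<Rightarrow> real" and f :: "real \<Rightarrow> real \<Rightarrow> real"
  assumes ind: "indep_var borel X borel Y"
    and [measurable]: "case_prod f \<in> borel_measurable (borel \<Otimes>\<^sub>M borel)"
    and bd: "\<And>x y. \<bar>f x y\<bar> \<le> K"
  shows "(\<integral> \<omega>. f (X \<omega>) (Y \<omega>) \<partial>M) = (\<integral> \<omega>. (\<integral> \<omega>'. f (X \<omega>) (Y \<omega>') \<partial>M) \<partial>M)"
    and "(\<integral> \<omega>. f (X \<omega>) (Y \<omega>) \<partial>M) = (\<integral> \<omega>'. (\<integral> \<omega>. f (X \<omega>) (Y \<omega>') \<partial>M) \<partial>M)"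
proof -
  have rv[measurable]: "random_variable borel X" "random_variable borel Y"
    and D: "distr M borel X \<Otimes>\<^sub>M distr M borel Y = distr M (borel \<Otimes>\<^sub>M borel) (\<lambda>x. (X x, Y x))"
    using ind unfolding indep_var_distribution_eq by auto
  interpret X: prob_space "distr M borel X" by (rule prob_space_distr) measurable
  interpret Y: prob_space "distr M borel Y" by (rule prob_space_distr) measurable
  interpret XY: pair_prob_space "distr M borel X" "distr M borel Y" ..
  have m[measurable]: "case_prod f \<in> borel_measurable (distr M borel X \<Otimes>\<^sub>M distr M borel Y)"
    using assms(2) by measurable
  have int: "integrable (distr M borel X \<Otimes>\<^sub>M distr M borel Y) (case_prod f)"
    by (rule XY.P.integrable_const_bound[where B = K]) (use bd in auto)
  have E: "(\<integral> \<omega>. f (X \<omega>) (Y \<omega>) \<partial>M) = integral\<^sup>L (distr M borel X \<Otimes>\<^sub>M distr M borel Y) (case_prod f)"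
    unfolding D by (subst integral_distr) auto
  have in1: "(\<integral> y. f x y \<partial>distr M borel Y) = (\<integral> \<omega>'. f x (Y \<omega>') \<partial>M)" for x
    by (subst integral_distr) auto
  have in2: "(\<integral> x. f x y \<partial>distr M borel X) = (\<integral> \<omega>. f (X \<omega>) y \<partial>M)" for y
    by (subst integral_distr) auto
  have "integral\<^sup>L (distr M borel X \<Otimes>\<^sub>M distr M borel Y) (case_prod f) = (\<integral> x. (\<integral> y. f x y \<partial>distr M borel Y) \<partial>distr M borel X)"
    by (rule XY.integral_fst[OF int, symmetric])
  also have "\<dots> = (\<integral> \<omega>. (\<integral> \<omega>'. f (X \<omega>) (Y \<omega>') \<partial>M) \<partial>M)"
    unfolding in1 by (subst integral_distr) auto
  finally show "(\<integral> \<omega>. f (X \<omega>) (Y \<omega>) \<partial>M) = (\<integral> \<omega>. (\<integral> \<omega>'. f (X \<omega>) (Y \<omega>') \<partial>M) \<partial>M)" unfolding E .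
  have "integral\<^sup>L (distr M borel X \<Otimes>\<^sub>M distr M borel Y) (case_prod f) = (\<integral> y. (\<integral> x. f x y \<partial>distr M borel X) \<partial>distr M borel Y)"
    by (rule XY.integral_snd[OF int, symmetric])
  also have "\<dots> = (\<integral> \<omega>'. (\<integral> \<omega>. f (X \<omega>) (Y \<omega>') \<partial>M) \<partial>M)"
    unfolding in2 by (subst integral_distr) auto
  finally show "(\<integral> \<omega>. f (X \<omega>) (Y \<omega>) \<partial>M) = (\<integral> \<omega>'. (\<integral> \<omega>. f (X \<omega>) (Y \<omega>') \<partial>M) \<partial>M)" unfolding E .
qed

text \<open>
  The transform \<open>E exp (- \<mu> T(t))\<close> is only separately measurable by construction; by the scaling
  relation it is a function of \<open>\<mu> powr (1 / \<alpha>) * t\<close> alone, which makes it jointly measurable.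
\<close>
definition folded_transform :: "'a measure \<Rightarrow> (real \<Rightarrow> 'a \<Rightarrow> real) \<Rightarrow> real \<Rightarrow> real" where
  "folded_transform M T r = (if r > 0 then \<integral> \<omega>. exp (- T r \<omega>) \<partial>M else 1)"

context
  fixes M :: "'a measure" and \<alpha> :: real and T :: "real \<Rightarrow> 'a \<Rightarrow> real"
  assumes M: "prob_space M" and T: "folded_solution_process M \<alpha> T" and \<alpha>: "0 < \<alpha>" "\<alpha> \<le> 1"
begin

lemma folded_transform_measurable: "folded_transform M T \<in> borel_measurable borel"
proof -
  have [measurable]: "(\<lambda>t. indicator {0<..} t * (\<integral> \<omega>. exp (- 1 * T t \<omega>) \<partial>M)) \<in> borel_measurable borel"
    by (rule folded_exp_measurable[OF M T \<alpha>]) simp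
  have "(\<lambda>t. indicator {0<..} t * (\<integral> \<omega>. exp (- 1 * T t \<omega>) \<partial>M) + indicator {..0} t) \<in> borel_measurable borel"
    by measurable
  also have "(\<lambda>t. indicator {0<..} t * (\<integral> \<omega>. exp (- 1 * T t \<omega>) \<partial>M) + indicator {..0} t) = folded_transform M T"
    by (auto simp: folded_transform_def fun_eq_iff)
  finally show ?thesis .
qed

lemma folded_transform:
  assumes "\<mu> \<ge> 0" "t > 0"
  shows "(\<integral> \<omega>. exp (- \<mu> * T t \<omega>) \<partial>M) = folded_transform M T (\<mu> powr (1 / \<alpha>) * t)"
proof (cases "\<mu> = 0")
  case True
  interpret prob_space M by (rule M)
  show ?thesis using True by (simp add: folded_transform_def prob_space)
next
  case False
  then show ?thesis using folded_exp_scaling[OF M T \<alpha>, of \<mu> t] assms by (simp add: folded_transform_def)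
qed

lemma nn_integral_laplace_folded:
  assumes \<mu>: "\<mu> \<ge> 0" and s: "s > 0"
  shows "(\<integral>\<^sup>+ t. ennreal (folded_transform M T (\<mu> powr (1 / \<alpha>) * t)) \<partial>laplace_measure s)
     = ennreal (s powr (\<alpha> - 1) / (s powr \<alpha> + \<mu>))"
proof -
  let ?V = "\<lambda>t. indicator {0<..} t * (\<integral> \<omega>. exp (- \<mu> * T t \<omega>) \<partial>M) :: real"
  have b: "0 \<le> ?V t" "?V t \<le> 1" for t
    using folded_exp_bound[OF M T \<alpha> \<mu>, of t] by (auto simp: indicator_def)
  have int: "integrable (laplace_measure s) ?V"
    by (rule integrable_laplace_measure_bounded[OF s folded_exp_measurable[OF M T \<alpha> \<mu>], where K = 1])
       (use b in \<open>simp only: abs_of_nonneg\<close>)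
  have "(\<integral>\<^sup>+ t. ennreal (folded_transform M T (\<mu> powr (1 / \<alpha>) * t)) \<partial>laplace_measure s)
     = (\<integral>\<^sup>+ t. ennreal (?V t) \<partial>laplace_measure s)"
  proof (rule nn_integral_cong_AE)
    show "AE t in laplace_measure s. ennreal (folded_transform M T (\<mu> powr (1 / \<alpha>) * t)) = ennreal (?V t)"
      using AE_laplace_measure[of s]
    proof eventually_elim
      case (elim t)
      then show ?case using folded_transform[OF \<mu> elim] by simp
    qed
  qed
  also have "\<dots> = ennreal (\<integral> t. ?V t \<partial>laplace_measure s)"
    using b by (intro nn_integral_eq_integral int) auto
  finally show ?thesis using folded_laplace_props(2)[OF M T \<alpha> \<mu> s] by simp
qed

end

text \<open>Read from right to left: \<open>1 / (c + b)\<close> is a mixture of exponentials in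
  \<open>b\<close>. For random \<open>b\<close> this expresses the expectation of the quotient
  through the Laplace transform of \<open>b\<close>.\<close>

lemma nn_integral_laplace_exp:
  assumes "c > 0" "b \<ge> 0"
  shows "(\<integral>\<^sup>+ r. ennreal (exp (- b * r)) \<partial>laplace_measure c) = ennreal (1 / (c + b))"
proof -
  have "(\<integral>\<^sup>+ r. ennreal (exp (- b * r)) \<partial>laplace_measure c)
      = (\<integral>\<^sup>+ r. ennreal (exp (- (c + b) * r)) * indicator {0<..} r * 1 \<partial>lborel)"
  proof (subst nn_integral_laplace_measure, measurable, intro nn_integral_cong)
    fix r
    have "exp (- (c + b) * r) = exp (- c * r) * exp (- b * r)" by (simp add: exp_add[symmetric] algebra_simps)
    then show "ennreal (exp (- c * r)) * indicator {0<..} r * ennreal (exp (- b * r)) = ennreal (exp (- (c + b) * r)) * indicator {0<..} r * 1"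
      by (simp add: ennreal_mult' mult_ac)
  qed
  also have "\<dots> = emeasure (laplace_measure (c + b)) UNIV"
    by (subst nn_integral_laplace_measure[symmetric]) auto
  finally show ?thesis using assms by (simp add: emeasure_laplace_measure)
qed

lemma sigma_finite_laplace_measure: "s > 0 \<Longrightarrow> sigma_finite_measure (laplace_measure s)"
  using finite_measure_laplace_measure by (simp add: finite_measure_def)

section \<open>The joint transform of the two random times\<close>

context
  fixes M :: "'a measure" and \<alpha>1 \<alpha>2 w :: real and T1 T2 :: "real \<Rightarrow> 'a \<Rightarrow> real"
  assumes M: "prob_space M" and T1: "folded_solution_process M \<alpha>1 T1" and T2: "folded_solution_process M \<alpha>2 T2"
    and \<alpha>1: "0 < \<alpha>1" "\<alpha>1 \<le> 1" and \<alpha>2: "0 < \<alpha>2" "\<alpha>2 \<le> 1"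
    and ind: "\<And>t1 t2. t1 \<ge> 0 \<Longrightarrow> t2 \<ge> 0 \<Longrightarrow> prob_space.indep_var M borel (T1 t1) borel (T2 t2)"
    and w: "w \<ge> 0"
begin

interpretation prob_space M by (rule M)

definition "product_transform t1 t2 = (\<integral> \<omega>. exp (- w * T1 t1 \<omega> * T2 t2 \<omega>) \<partial>M)"

lemma product_transform_iterated:
  assumes "t1 \<ge> 0" "t2 \<ge> 0"
  shows "product_transform t1 t2 = (\<integral> \<omega>. (\<integral> \<omega>'. exp (- (w * T1 t1 \<omega>) * T2 t2 \<omega>') \<partial>M) \<partial>M)"
    and "product_transform t1 t2 = (\<integral> \<omega>'. (\<integral> \<omega>. exp (- (w * T2 t2 \<omega>') * T1 t1 \<omega>) \<partial>M) \<partial>M)"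
proof -
  \<comment> \<open>\<open>max 0\<close> makes the integrand bounded on the whole plane; at the
    values taken by \<open>T1\<close> and \<open>T2\<close> it changes nothing.\<close>
  let ?f = "\<lambda>x y. exp (- w * max 0 x * max 0 y)"
  have m: "case_prod ?f \<in> borel_measurable (borel \<Otimes>\<^sub>M borel)" by measurable
  have b: "\<bar>?f x y\<bar> \<le> 1" for x y using w by (simp add: mult_nonneg_nonneg mult.assoc)
  note nn = folded_nonneg[OF M T1 \<alpha>1 assms(1)] folded_nonneg[OF M T2 \<alpha>2 assms(2)]
  note I = indep_var_integral_iterated[OF ind[OF assms] m b]
  have 0: "product_transform t1 t2 = (\<integral> \<omega>. ?f (T1 t1 \<omega>) (T2 t2 \<omega>) \<partial>M)"
    unfolding product_transform_def using nn by (intro Bochner_Integration.integral_cong) auto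
  show "product_transform t1 t2 = (\<integral> \<omega>. (\<integral> \<omega>'. exp (- (w * T1 t1 \<omega>) * T2 t2 \<omega>') \<partial>M) \<partial>M)"
    unfolding 0 I(1) using nn by (intro Bochner_Integration.integral_cong) auto
  show "product_transform t1 t2 = (\<integral> \<omega>'. (\<integral> \<omega>. exp (- (w * T2 t2 \<omega>') * T1 t1 \<omega>) \<partial>M) \<partial>M)"
    unfolding 0 I(2) using nn by (intro Bochner_Integration.integral_cong refl) (auto simp: mult_ac)
qed

lemma product_transform_bounds:
  assumes "t1 \<ge> 0" "t2 \<ge> 0"
  shows "0 \<le> product_transform t1 t2" "product_transform t1 t2 \<le> 1"
proof -
  show "0 \<le> product_transform t1 t2" by (simp add: product_transform_def)
  note [measurable] = folded_measurable[OF M T1 \<alpha>1 assms(1)] folded_measurable[OF M T2 \<alpha>2 assms(2)]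
  note nn = folded_nonneg[OF M T1 \<alpha>1 assms(1)] folded_nonneg[OF M T2 \<alpha>2 assms(2)]
  have "exp (- w * T1 t1 \<omega> * T2 t2 \<omega>) \<le> 1" if "\<omega> \<in> space M" for \<omega> using w nn[OF that] by (simp add: mult_nonneg_nonneg)
  then show "product_transform t1 t2 \<le> 1" unfolding product_transform_def
    by (intro integral_le_const integrable_const_bound[where B = 1] AE_I2) auto
qed

text \<open>Conditionally on one random time, the other enters through a transform already known to
  be continuous. Nothing is assumed about the paths in time, so continuity is obtained in each time
  separately; the injectivity of the double transform asks for no more.\<close>

lemma product_transform_continuous:
  shows "t2 \<ge> 0 \<Longrightarrow> continuous_on {0<..} (\<lambda>t1. product_transform t1 t2)"
    and "t1 \<ge> 0 \<Longrightarrow> continuous_on {0<..} (\<lambda>t2. product_transform t1 t2)"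
proof -
  have gen: "continuous_on {0<..} (\<lambda>t. \<integral> \<omega>'. (\<integral> \<omega>. exp (- (w * Y \<omega>') * T t \<omega>) \<partial>M) \<partial>M)"
    if T: "folded_solution_process M \<alpha> T" and \<alpha>: "0 < \<alpha>" "\<alpha> \<le> 1" and [measurable]: "Y \<in> borel_measurable M"
      and Y: "\<And>\<omega>. \<omega> \<in> space M \<Longrightarrow> Y \<omega> \<ge> 0" for T :: "real \<Rightarrow> 'a \<Rightarrow> real" and \<alpha> Y
    unfolding continuous_on_sequentially
  proof (intro allI ballI impI, elim conjE)
    fix x :: "nat \<Rightarrow> real" and t :: real
    assume t: "t \<in> {0<..}" and x: "\<forall>n. x n \<in> {0<..}" and lim: "x \<longlonglongrightarrow> t"
    have tm: "T t \<in> borel_measurable M" if "t > 0" for t using folded_measurable[OF M T \<alpha>] that by simp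
    have xp: "x n > 0" for n using x by simp
    have [measurable]: "T t \<in> borel_measurable M" using tm t by simp
    note [measurable] = tm[OF xp]
    have "(\<lambda>n. \<integral> \<omega>'. (\<integral> \<omega>. exp (- (w * Y \<omega>') * T (x n) \<omega>) \<partial>M) \<partial>M) \<longlonglongrightarrow> (\<integral> \<omega>'. (\<integral> \<omega>. exp (- (w * Y \<omega>') * T t \<omega>) \<partial>M) \<partial>M)"
    proof (rule integral_dominated_convergence[where w = "\<lambda>_. 1"])
      show "(\<lambda>\<omega>'. \<integral> \<omega>. exp (- (w * Y \<omega>') * T t \<omega>) \<partial>M) \<in> borel_measurable M"
        by measurable
      show "(\<lambda>\<omega>'. \<integral> \<omega>. exp (- (w * Y \<omega>') * T (x n) \<omega>) \<partial>M) \<in> borel_measurable M" for n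
        by measurable
      show "AE \<omega>' in M. (\<lambda>n. \<integral> \<omega>. exp (- (w * Y \<omega>') * T (x n) \<omega>) \<partial>M) \<longlonglongrightarrow> (\<integral> \<omega>. exp (- (w * Y \<omega>') * T t \<omega>) \<partial>M)"
      proof (rule AE_I2)
        fix \<omega>' assume "\<omega>' \<in> space M"
        then have "w * Y \<omega>' \<ge> 0" using w Y by simp
        from folded_laplace_props(1)[OF M T \<alpha> this] t x lim
        show "(\<lambda>n. \<integral> \<omega>. exp (- (w * Y \<omega>') * T (x n) \<omega>) \<partial>M) \<longlonglongrightarrow> (\<integral> \<omega>. exp (- (w * Y \<omega>') * T t \<omega>) \<partial>M)"
          unfolding continuous_on_sequentially o_def by blast
      qed
      show "AE \<omega>' in M. norm (\<integral> \<omega>. exp (- (w * Y \<omega>') * T (x n) \<omega>) \<partial>M) \<le> 1" for n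
      proof (rule AE_I2)
        fix \<omega>' assume "\<omega>' \<in> space M"
        then have "w * Y \<omega>' \<ge> 0" using w Y by simp
        from folded_exp_bound[OF M T \<alpha> this less_imp_le[OF xp]]
        show "norm (\<integral> \<omega>. exp (- (w * Y \<omega>') * T (x n) \<omega>) \<partial>M) \<le> 1" by simp
      qed
    qed simp
    then show "((\<lambda>t. \<integral> \<omega>'. (\<integral> \<omega>. exp (- (w * Y \<omega>') * T t \<omega>) \<partial>M) \<partial>M) \<circ> x) \<longlonglongrightarrow> (\<integral> \<omega>'. (\<integral> \<omega>. exp (- (w * Y \<omega>') * T t \<omega>) \<partial>M) \<partial>M)"
      by (simp add: o_def)
  qed
  show "continuous_on {0<..} (\<lambda>t1. product_transform t1 t2)" if "t2 \<ge> 0"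
  proof (rule continuous_on_eq)
    show "continuous_on {0<..} (\<lambda>t. \<integral> \<omega>'. (\<integral> \<omega>. exp (- (w * T2 t2 \<omega>') * T1 t \<omega>) \<partial>M) \<partial>M)"
      by (rule gen[OF T1 \<alpha>1 folded_measurable[OF M T2 \<alpha>2 that] folded_nonneg[OF M T2 \<alpha>2 that]])
  qed (rule product_transform_iterated(2)[symmetric]; use that in simp)
  show "continuous_on {0<..} (\<lambda>t2. product_transform t1 t2)" if "t1 \<ge> 0"
  proof (rule continuous_on_eq)
    show "continuous_on {0<..} (\<lambda>t. \<integral> \<omega>'. (\<integral> \<omega>. exp (- (w * T1 t1 \<omega>') * T2 t \<omega>) \<partial>M) \<partial>M)"
      by (rule gen[OF T2 \<alpha>2 folded_measurable[OF M T1 \<alpha>1 that] folded_nonneg[OF M T1 \<alpha>1 that]])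
  qed (rule product_transform_iterated(1)[symmetric]; use that in simp)
qed

text \<open>Given \<open>T1 t1\<close>, the transform in \<open>t2\<close> is
  \<open>s2 powr (\<alpha>2 - 1) / (\<kappa>2 + w * T1 t1)\<close>. The quotient is resolved into
  exponentials in \<open>T1 t1\<close>, to which the transform in \<open>t1\<close> applies and
  yields \<open>s1 powr (\<alpha>1 - 1) / (\<kappa>1 + w * r)\<close>. The integral in
  \<open>r\<close> is left as it is; the generating function will produce the same one.\<close>

lemma product_transform_laplace:
  assumes s: "s1 > 0" "s2 > 0"
  shows "(\<integral>\<^sup>+ t1. (\<integral>\<^sup>+ t2. ennreal (product_transform t1 t2) \<partial>laplace_measure s2) \<partial>laplace_measure s1)
    = ennreal (s1 powr (\<alpha>1 - 1) * s2 powr (\<alpha>2 - 1)) *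
      (\<integral>\<^sup>+ r. ennreal (1 / (s1 powr \<alpha>1 + w * r)) \<partial>laplace_measure (s2 powr \<alpha>2))"
proof -
  define \<kappa>1 \<kappa>2 where "\<kappa>1 = s1 powr \<alpha>1" and "\<kappa>2 = s2 powr \<alpha>2"
  have \<kappa>: "\<kappa>1 > 0" "\<kappa>2 > 0" using s by (auto simp: \<kappa>1_def \<kappa>2_def)
  interpret L1: sigma_finite_measure "laplace_measure s1" using s(1) by (rule sigma_finite_laplace_measure)
  interpret L2: sigma_finite_measure "laplace_measure s2" using s(2) by (rule sigma_finite_laplace_measure)
  interpret K2: sigma_finite_measure "laplace_measure \<kappa>2" using \<kappa>(2) by (rule sigma_finite_laplace_measure)
  interpret P2: pair_sigma_finite "laplace_measure s2" M ..
  interpret Q2: pair_sigma_finite "laplace_measure \<kappa>2" M ..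
  interpret R: pair_sigma_finite "laplace_measure s1" "laplace_measure \<kappa>2" ..
  note [measurable] = folded_transform_measurable[OF M T1 \<alpha>1] folded_transform_measurable[OF M T2 \<alpha>2]
  \<comment> \<open>Through \<open>folded_transform\<close> the transforms are jointly measurable in
    \<open>\<mu>\<close> and \<open>t\<close>, as Tonelli requires.\<close>
  let ?e1 = "\<lambda>\<mu> t. folded_transform M T1 (\<mu> powr (1 / \<alpha>1) * t)"
  let ?e2 = "\<lambda>\<mu> t. folded_transform M T2 (\<mu> powr (1 / \<alpha>2) * t)"
  have inner: "(\<integral>\<^sup>+ t2. ennreal (product_transform t1 t2) \<partial>laplace_measure s2)
      = ennreal (s2 powr (\<alpha>2 - 1)) * (\<integral>\<^sup>+ r. ennreal (?e1 (w * r) t1) \<partial>laplace_measure \<kappa>2)" if t1: "t1 > 0" for t1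
  proof -
    have m1[measurable]: "T1 t1 \<in> borel_measurable M" using folded_measurable[OF M T1 \<alpha>1] t1 by simp
    have nn1: "\<omega> \<in> space M \<Longrightarrow> T1 t1 \<omega> \<ge> 0" for \<omega> using folded_nonneg[OF M T1 \<alpha>1] t1 by simp
    have "(\<integral>\<^sup>+ t2. ennreal (product_transform t1 t2) \<partial>laplace_measure s2)
       = (\<integral>\<^sup>+ t2. (\<integral>\<^sup>+ \<omega>. ennreal (?e2 (w * T1 t1 \<omega>) t2) \<partial>M) \<partial>laplace_measure s2)"
    proof (rule nn_integral_cong_AE)
      show "AE t2 in laplace_measure s2. ennreal (product_transform t1 t2) = (\<integral>\<^sup>+ \<omega>. ennreal (?e2 (w * T1 t1 \<omega>) t2) \<partial>M)"
        using AE_laplace_measure[of s2]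
      proof eventually_elim
        case (elim t2)
        have e2: "?e2 (w * T1 t1 \<omega>) t2 = (\<integral> \<omega>'. exp (- (w * T1 t1 \<omega>) * T2 t2 \<omega>') \<partial>M)" if "\<omega> \<in> space M" for \<omega>
          using folded_transform[OF M T2 \<alpha>2, of "w * T1 t1 \<omega>" t2] w nn1[OF that] elim by simp
        have b: "0 \<le> ?e2 (w * T1 t1 \<omega>) t2 \<and> ?e2 (w * T1 t1 \<omega>) t2 \<le> 1" if "\<omega> \<in> space M" for \<omega>
          unfolding e2[OF that] using folded_exp_bound[OF M T2 \<alpha>2, of "w * T1 t1 \<omega>" t2] w nn1[OF that] elim by simp
        have "product_transform t1 t2 = (\<integral> \<omega>. ?e2 (w * T1 t1 \<omega>) t2 \<partial>M)"
          using t1 elim by (simp add: product_transform_iterated(1) e2 cong: Bochner_Integration.integral_cong)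
        moreover have "(\<integral>\<^sup>+ \<omega>. ennreal (?e2 (w * T1 t1 \<omega>) t2) \<partial>M) = ennreal (\<integral> \<omega>. ?e2 (w * T1 t1 \<omega>) t2 \<partial>M)"
          using b by (intro nn_integral_eq_integral integrable_const_bound[where B = 1] AE_I2) auto
        ultimately show ?case by simp
      qed
    qed
    also have "\<dots> = (\<integral>\<^sup>+ \<omega>. (\<integral>\<^sup>+ t2. ennreal (?e2 (w * T1 t1 \<omega>) t2) \<partial>laplace_measure s2) \<partial>M)"
      by (rule P2.Fubini'[symmetric]) measurable
    also have "\<dots> = (\<integral>\<^sup>+ \<omega>. ennreal (s2 powr (\<alpha>2 - 1)) * (\<integral>\<^sup>+ r. ennreal (exp (- (w * T1 t1 \<omega>) * r)) \<partial>laplace_measure \<kappa>2) \<partial>M)"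
    proof (intro nn_integral_cong)
      fix \<omega> assume "\<omega> \<in> space M"
      then have nn: "w * T1 t1 \<omega> \<ge> 0" using nn1 w by simp
      have "ennreal (s2 powr (\<alpha>2 - 1) / (\<kappa>2 + w * T1 t1 \<omega>)) = ennreal (s2 powr (\<alpha>2 - 1)) * ennreal (1 / (\<kappa>2 + w * T1 t1 \<omega>))"
        by (simp add: ennreal_mult'[symmetric])
      then show "(\<integral>\<^sup>+ t2. ennreal (?e2 (w * T1 t1 \<omega>) t2) \<partial>laplace_measure s2)
         = ennreal (s2 powr (\<alpha>2 - 1)) * (\<integral>\<^sup>+ r. ennreal (exp (- (w * T1 t1 \<omega>) * r)) \<partial>laplace_measure \<kappa>2)"
        by (simp only: nn_integral_laplace_folded[OF M T2 \<alpha>2 nn s(2), folded \<kappa>2_def] nn_integral_laplace_exp[OF \<kappa>(2) nn])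
    qed
    also have "\<dots> = ennreal (s2 powr (\<alpha>2 - 1)) * (\<integral>\<^sup>+ \<omega>. (\<integral>\<^sup>+ r. ennreal (exp (- (w * T1 t1 \<omega>) * r)) \<partial>laplace_measure \<kappa>2) \<partial>M)"
      by (rule nn_integral_cmult) measurable
    also have "(\<integral>\<^sup>+ \<omega>. (\<integral>\<^sup>+ r. ennreal (exp (- (w * T1 t1 \<omega>) * r)) \<partial>laplace_measure \<kappa>2) \<partial>M)
        = (\<integral>\<^sup>+ r. (\<integral>\<^sup>+ \<omega>. ennreal (exp (- (w * T1 t1 \<omega>) * r)) \<partial>M) \<partial>laplace_measure \<kappa>2)"
      by (rule Q2.Fubini') measurable
    also have "\<dots> = (\<integral>\<^sup>+ r. ennreal (?e1 (w * r) t1) \<partial>laplace_measure \<kappa>2)"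
    proof (rule nn_integral_cong_AE)
      show "AE r in laplace_measure \<kappa>2. (\<integral>\<^sup>+ \<omega>. ennreal (exp (- (w * T1 t1 \<omega>) * r)) \<partial>M) = ennreal (?e1 (w * r) t1)"
        using AE_laplace_measure[of \<kappa>2]
      proof eventually_elim
        case (elim r)
        have "exp (- (w * T1 t1 \<omega>) * r) \<le> 1" if "\<omega> \<in> space M" for \<omega>
          using w nn1[OF that] elim by (simp add: mult_nonneg_nonneg)
        then have "(\<integral>\<^sup>+ \<omega>. ennreal (exp (- (w * T1 t1 \<omega>) * r)) \<partial>M) = ennreal (\<integral> \<omega>. exp (- (w * T1 t1 \<omega>) * r) \<partial>M)"
          by (intro nn_integral_eq_integral integrable_const_bound[where B = 1] AE_I2) auto
        also have "(\<integral> \<omega>. exp (- (w * T1 t1 \<omega>) * r) \<partial>M) = (\<integral> \<omega>. exp (- (w * r) * T1 t1 \<omega>) \<partial>M)"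
          by (intro Bochner_Integration.integral_cong) (auto simp: mult_ac)
        also have "\<dots> = ?e1 (w * r) t1" using w elim t1 by (intro folded_transform[OF M T1 \<alpha>1]) auto
        finally show ?case .
      qed
    qed
    finally show ?thesis .
  qed
  have "(\<integral>\<^sup>+ t1. (\<integral>\<^sup>+ t2. ennreal (product_transform t1 t2) \<partial>laplace_measure s2) \<partial>laplace_measure s1)
     = (\<integral>\<^sup>+ t1. ennreal (s2 powr (\<alpha>2 - 1)) * (\<integral>\<^sup>+ r. ennreal (?e1 (w * r) t1) \<partial>laplace_measure \<kappa>2) \<partial>laplace_measure s1)"
  proof (rule nn_integral_cong_AE)
    show "AE t1 in laplace_measure s1. (\<integral>\<^sup>+ t2. ennreal (product_transform t1 t2) \<partial>laplace_measure s2)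
       = ennreal (s2 powr (\<alpha>2 - 1)) * (\<integral>\<^sup>+ r. ennreal (?e1 (w * r) t1) \<partial>laplace_measure \<kappa>2)"
      using AE_laplace_measure[of s1] by eventually_elim (rule inner)
  qed
  also have "\<dots> = ennreal (s2 powr (\<alpha>2 - 1)) * (\<integral>\<^sup>+ t1. (\<integral>\<^sup>+ r. ennreal (?e1 (w * r) t1) \<partial>laplace_measure \<kappa>2) \<partial>laplace_measure s1)"
    by (rule nn_integral_cmult) measurable
  also have "(\<integral>\<^sup>+ t1. (\<integral>\<^sup>+ r. ennreal (?e1 (w * r) t1) \<partial>laplace_measure \<kappa>2) \<partial>laplace_measure s1)
     = (\<integral>\<^sup>+ r. (\<integral>\<^sup>+ t1. ennreal (?e1 (w * r) t1) \<partial>laplace_measure s1) \<partial>laplace_measure \<kappa>2)"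
    by (rule R.Fubini'[symmetric]) measurable
  also have "\<dots> = (\<integral>\<^sup>+ r. ennreal (s1 powr (\<alpha>1 - 1)) * ennreal (1 / (\<kappa>1 + w * r)) \<partial>laplace_measure \<kappa>2)"
  proof (rule nn_integral_cong_AE)
    show "AE r in laplace_measure \<kappa>2. (\<integral>\<^sup>+ t1. ennreal (?e1 (w * r) t1) \<partial>laplace_measure s1) = ennreal (s1 powr (\<alpha>1 - 1)) * ennreal (1 / (\<kappa>1 + w * r))"
      using AE_laplace_measure[of \<kappa>2]
    proof eventually_elim
      case (elim r)
      then have "w * r \<ge> 0" using w by simp
      from nn_integral_laplace_folded[OF M T1 \<alpha>1 this s(1)] show ?case
        by (simp add: \<kappa>1_def ennreal_mult'[symmetric])
    qed
  qed
  also have "\<dots> = ennreal (s1 powr (\<alpha>1 - 1)) * (\<integral>\<^sup>+ r. ennreal (1 / (\<kappa>1 + w * r)) \<partial>laplace_measure \<kappa>2)"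
    by (rule nn_integral_cmult) measurable
  finally show ?thesis by (simp add: \<kappa>1_def \<kappa>2_def ennreal_mult' mult_ac)
qed

end

section \<open>The governing system of the Poisson random field\<close>

lemma backward_shift_funpow: "(backward_shift ^^ k) f n = f (n - int k)"
  by (induction k arbitrary: n) (auto simp: backward_shift_def algebra_simps)

lemma frac_difference_finite:
  assumes "\<And>m. m < 0 \<Longrightarrow> f m = 0"
  shows "frac_difference \<beta> f (int n) = (\<Sum>k\<le>n. (\<beta> gchoose k) * (-1) ^ k * f (int (n - k)))"
proof -
  have "frac_difference \<beta> f (int n) = (\<Sum>k\<le>n. (\<beta> gchoose k) * (-1) ^ k * f (int n - int k))"
    unfolding frac_difference_def backward_shift_funpow
    by (rule suminf_finite) (auto intro!: assms)
  also have "\<dots> = (\<Sum>k\<le>n. (\<beta> gchoose k) * (-1) ^ k * f (int (n - k)))"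
    by (intro sum.cong) (auto simp: of_nat_diff)
  finally show ?thesis .
qed

text \<open>Continuity is given only for positive \<open>l\<close> and nonnegative times.
  Composition with \<open>clamp_real\<close> yields functions on the whole space that are
  continuous, hence Borel, and bounded, without altering them where the measures live.\<close>

definition clamp_real :: "real \<Rightarrow> real \<Rightarrow> real \<Rightarrow> real" where
  "clamp_real a b x = max a (min b x)"

lemma clamp_real_in: "a \<le> b \<Longrightarrow> clamp_real a b x \<in> {a..b}"
  by (auto simp: clamp_real_def)

lemma clamp_real_id: "a \<le> x \<Longrightarrow> x \<le> b \<Longrightarrow> clamp_real a b x = x"
  by (auto simp: clamp_real_def)

lemma continuous_clamp_real [continuous_intros]:
  "continuous_on S f \<Longrightarrow> continuous_on S (\<lambda>x. clamp_real a b (f x))"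
  unfolding clamp_real_def by (intro continuous_intros)

definition rl_rectangle :: "real \<Rightarrow> real \<Rightarrow> real \<Rightarrow> real \<Rightarrow> (real \<times> real) measure" where
  "rl_rectangle \<alpha>1 \<alpha>2 t1 t2 = rl_measure \<alpha>1 t1 \<Otimes>\<^sub>M rl_measure \<alpha>2 t2"

lemma sets_rl_rectangle [simp, measurable_cong]: "sets (rl_rectangle \<alpha>1 \<alpha>2 t1 t2) = sets (borel \<Otimes>\<^sub>M borel)"
  unfolding rl_rectangle_def by (intro sets_pair_measure_cong) auto

lemma finite_measure_rl_rectangle:
  assumes "\<alpha>1 > 0" "\<alpha>2 > 0"
  shows "finite_measure (rl_rectangle \<alpha>1 \<alpha>2 t1 t2)"
proof -
  interpret m1: finite_measure "rl_measure \<alpha>1 t1" using assms(1) by (rule finite_measure_rl_measure)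
  interpret m2: finite_measure "rl_measure \<alpha>2 t2" using assms(2) by (rule finite_measure_rl_measure)
  show ?thesis unfolding rl_rectangle_def by (rule finite_measure_pair_measure) unfold_locales
qed

lemma AE_rl_rectangle:
  assumes "\<alpha>1 > 0" "\<alpha>2 > 0"
  shows "AE x in rl_rectangle \<alpha>1 \<alpha>2 t1 t2. 0 < fst x \<and> fst x < t1 \<and> 0 < snd x \<and> snd x < t2"
proof -
  interpret m1: finite_measure "rl_measure \<alpha>1 t1" using assms(1) by (rule finite_measure_rl_measure)
  interpret m2: finite_measure "rl_measure \<alpha>2 t2" using assms(2) by (rule finite_measure_rl_measure)
  interpret pair_sigma_finite "rl_measure \<alpha>1 t1" "rl_measure \<alpha>2 t2" ..
  show ?thesis unfolding rl_rectangle_def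
  proof (rule AE_pair_measure)
    show "{x \<in> space (rl_measure \<alpha>1 t1 \<Otimes>\<^sub>M rl_measure \<alpha>2 t2). 0 < fst x \<and> fst x < t1 \<and> 0 < snd x \<and> snd x < t2}
      \<in> sets (rl_measure \<alpha>1 t1 \<Otimes>\<^sub>M rl_measure \<alpha>2 t2)" by measurable
    show "AE x in rl_measure \<alpha>1 t1. AE y in rl_measure \<alpha>2 t2.
      0 < fst (x, y) \<and> fst (x, y) < t1 \<and> 0 < snd (x, y) \<and> snd (x, y) < t2"
      using AE_rl_measure[of t1 \<alpha>1]
    proof eventually_elim
      case (elim x)
      show ?case using AE_rl_measure[of t2 \<alpha>2] by eventually_elim (use elim in auto)
    qed
  qed
qed

definition Icc_measure :: "real \<Rightarrow> real \<Rightarrow> real measure" where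
  "Icc_measure l0 l1 = density lborel (\<lambda>l::real. ennreal (indicator {l0..l1} l))"

lemma sets_Icc_measure [simp, measurable_cong]: "sets (Icc_measure l0 l1) = sets borel"
  by (simp add: Icc_measure_def)

lemma finite_measure_Icc_measure: "finite_measure (Icc_measure l0 l1)"
proof (rule finite_measureI)
  have "emeasure (Icc_measure l0 l1) (space (Icc_measure l0 l1)) = emeasure lborel {l0..l1}"
    unfolding Icc_measure_def by (subst emeasure_density) (auto simp: ennreal_indicator)
  then show "emeasure (Icc_measure l0 l1) (space (Icc_measure l0 l1)) \<noteq> \<infinity>"
    using emeasure_lborel_cbox_finite[of l0 l1] by auto
qed

lemma integral_Icc_measure:
  fixes f :: "real \<Rightarrow> real"
  assumes "f \<in> borel_measurable borel"
  shows "(\<integral> l. f l \<partial>Icc_measure l0 l1) = (\<integral> l. indicator {l0..l1} l * f l \<partial>lborel)"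
  unfolding Icc_measure_def using assms by (subst integral_density) auto

lemma compact_bounded_3:
  fixes f :: "real \<Rightarrow> real \<Rightarrow> real \<Rightarrow> real"
  assumes "continuous_on ({0<..} \<times> {0..} \<times> {0..}) (\<lambda>(l, a, b). f l a b)" and "0 < l0"
  obtains K where "\<And>l a b. l0 \<le> l \<Longrightarrow> l \<le> l1 \<Longrightarrow> 0 \<le> a \<Longrightarrow> a \<le> t1 \<Longrightarrow> 0 \<le> b \<Longrightarrow> b \<le> t2 \<Longrightarrow> \<bar>f l a b\<bar> \<le> K"
proof -
  have "compact ((\<lambda>(l, a, b). f l a b) ` ({l0..l1} \<times> {0..t1} \<times> {0..t2}))"
    by (intro compact_continuous_image compact_Times continuous_on_subset[OF assms(1)]) (use assms(2) in auto)
  then have "bounded ((\<lambda>(l, a, b). f l a b) ` ({l0..l1} \<times> {0..t1} \<times> {0..t2}))" by (rule compact_imp_bounded)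
  then obtain K where "\<forall>x\<in>(\<lambda>(l, a, b). f l a b) ` ({l0..l1} \<times> {0..t1} \<times> {0..t2}). norm x \<le> K"
    unfolding bounded_iff by blast
  then have "\<bar>f l a b\<bar> \<le> K" if "l0 \<le> l" "l \<le> l1" "0 \<le> a" "a \<le> t1" "0 \<le> b" "b \<le> t2" for l a b
    using that by force
  then show ?thesis using that by blast
qed

lemma clamped_measurable:
  fixes f :: "real \<Rightarrow> real \<Rightarrow> real \<Rightarrow> real"
  assumes "continuous_on ({0<..} \<times> {0..} \<times> {0..}) (\<lambda>(l, a, b). f l a b)" and "0 < l0" "l0 \<le> l1" "0 \<le> t1" "0 \<le> t2"
  shows "(\<lambda>(l, a, b). f (clamp_real l0 l1 l) (clamp_real 0 t1 a) (clamp_real 0 t2 b)) \<in> borel_measurable (borel \<Otimes>\<^sub>M (borel \<Otimes>\<^sub>M borel))"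
proof -
  have "continuous_on UNIV (\<lambda>x. (\<lambda>(l, a, b). f l a b) (clamp_real l0 l1 (fst x), clamp_real 0 t1 (fst (snd x)), clamp_real 0 t2 (snd (snd x))))"
    by (intro continuous_on_compose2[OF assms(1)] continuous_intros) (use assms in \<open>auto simp: clamp_real_def\<close>)
  then have "(\<lambda>x. (\<lambda>(l, a, b). f l a b) (clamp_real l0 l1 (fst x), clamp_real 0 t1 (fst (snd x)), clamp_real 0 t2 (snd (snd x)))) \<in> borel_measurable borel"
    by (rule borel_measurable_continuous_onI)
  then show ?thesis by (simp add: borel_prod case_prod_beta)
qed

section \<open>The system as an integral equation in the times and in the parameter\<close>

context
  fixes \<alpha>1 \<alpha>2 \<beta> :: real and p :: "real \<Rightarrow> int \<Rightarrow> real \<Rightarrow> real \<Rightarrow> real"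
  assumes \<alpha>1: "0 < \<alpha>1" "\<alpha>1 \<le> 1" and \<alpha>2: "0 < \<alpha>2" "\<alpha>2 \<le> 1" and \<beta>: "0 < \<beta>"
    and sys: "stfprf_system \<alpha>1 \<alpha>2 \<beta> p"
begin

lemma system_nonneg: "l > 0 \<Longrightarrow> t1 \<ge> 0 \<Longrightarrow> t2 \<ge> 0 \<Longrightarrow> p l (int n) t1 t2 \<ge> 0"
  using sys by (simp add: stfprf_system_def)

lemma system_neg: "l > 0 \<Longrightarrow> t1 \<ge> 0 \<Longrightarrow> t2 \<ge> 0 \<Longrightarrow> n < 0 \<Longrightarrow> p l n t1 t2 = 0"
  using sys by (simp add: stfprf_system_def)

lemma system_sums: "l > 0 \<Longrightarrow> t1 \<ge> 0 \<Longrightarrow> t2 \<ge> 0 \<Longrightarrow> (\<lambda>n. p l (int n) t1 t2) sums 1"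
  using sys by (simp add: stfprf_system_def)

lemma system_le_1:
  assumes "l > 0" "t1 \<ge> 0" "t2 \<ge> 0"
  shows "p l (int n) t1 t2 \<le> 1"
proof -
  have "sum (\<lambda>n. p l (int n) t1 t2) {n} \<le> (\<Sum>n. p l (int n) t1 t2)"
    using system_sums[OF assms] system_nonneg[OF assms] by (intro sum_le_suminf) (auto simp: sums_iff)
  then show ?thesis using system_sums[OF assms] by (simp add: sums_iff)
qed

text \<open>The initial conditions fix only the probability of 0. Being 1, it exhausts the total
  mass, so all other probabilities vanish on the axes.\<close>

lemma system_axes:
  assumes "l > 0" "t1 \<ge> 0" "t2 \<ge> 0" "t1 = 0 \<or> t2 = 0"
  shows "p l (int n) t1 t2 = (if n = 0 then 1 else 0)"
proof -
  have 0: "p l 0 t1 t2 = 1" using sys assms by (auto simp: stfprf_system_def)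
  show ?thesis
  proof (cases "n = 0")
    case False
    have "sum (\<lambda>n. p l (int n) t1 t2) {0, n} \<le> (\<Sum>n. p l (int n) t1 t2)"
      using system_sums[OF assms(1-3)] system_nonneg[OF assms(1-3)] by (intro sum_le_suminf) (auto simp: sums_iff)
    then have "p l (int n) t1 t2 \<le> 0" using system_sums[OF assms(1-3)] 0 False by (simp add: sums_iff)
    then show ?thesis using system_nonneg[OF assms(1-3), of n] False by simp
  qed (use 0 in simp)
qed

lemma system_continuous: "continuous_on ({0<..} \<times> {0..} \<times> {0..}) (\<lambda>(l, t1, t2). p l (int n) t1 t2)"
  using sys by (simp add: stfprf_system_def)

lemma system_deriv_continuous:
  "continuous_on ({0<..} \<times> {0..} \<times> {0..}) (\<lambda>(l, t1, t2). deriv (\<lambda>r. p r (int n) t1 t2) l)"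
  using sys by (simp add: stfprf_system_def)

lemma system_DERIV:
  assumes "l > 0" "t1 \<ge> 0" "t2 \<ge> 0"
  shows "((\<lambda>r. p r (int n) t1 t2) has_real_derivative deriv (\<lambda>r. p r (int n) t1 t2) l) (at l)"
  using sys assms by (simp add: stfprf_system_def DERIV_deriv_iff_real_differentiable)

definition "binomial_coeff k = (\<beta> gchoose k) * (-1) ^ k"

definition "system_rhs n l t1 t2 =
  - (l powr (\<beta> + 1) / \<beta> * (\<Sum>k\<le>n. binomial_coeff k * deriv (\<lambda>r. p r (int (n - k)) t1 t2) l)
     + l powr \<beta> * (\<Sum>k\<le>n. binomial_coeff k * p l (int (n - k)) t1 t2))"

lemma system_rhs_continuous: "continuous_on ({0<..} \<times> {0..} \<times> {0..}) (\<lambda>(l, t1, t2). system_rhs n l t1 t2)"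
proof -
  have "continuous_on ({0<..} \<times> {0..} \<times> {0..}) (\<lambda>x. - (fst x powr (\<beta> + 1) / \<beta> * (\<Sum>k\<le>n. binomial_coeff k * (\<lambda>(l, t1, t2). deriv (\<lambda>r. p r (int (n - k)) t1 t2) l) x)
     + fst x powr \<beta> * (\<Sum>k\<le>n. binomial_coeff k * (\<lambda>(l, t1, t2). p l (int (n - k)) t1 t2) x)))"
    by (intro continuous_intros system_continuous system_deriv_continuous) (use \<beta> in auto)
  then show ?thesis by (rule continuous_on_eq) (auto simp: system_rhs_def)
qed

text \<open>Since \<open>p\<close> vanishes at negative states, the fractional difference is a
  finite sum near every \<open>l > 0\<close>, and its derivative in \<open>l\<close> may be taken
  term by term.\<close>

lemma system_equation:
  assumes "l > 0" "t1 > 0" "t2 > 0"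
  shows "caputo_deriv \<alpha>2 (\<lambda>s2. caputo_deriv \<alpha>1 (\<lambda>s1. p l (int n) s1 s2) t1) t2 = system_rhs n l t1 t2"
proof -
  have fd: "frac_difference \<beta> (\<lambda>m. p r m t1 t2) (int n) = (\<Sum>k\<le>n. binomial_coeff k * p r (int (n - k)) t1 t2)" if "r > 0" for r
    unfolding binomial_coeff_def using that assms by (intro frac_difference_finite system_neg) auto
  have D: "((\<lambda>r. \<Sum>k\<le>n. binomial_coeff k * p r (int (n - k)) t1 t2) has_real_derivative
      (\<Sum>k\<le>n. binomial_coeff k * deriv (\<lambda>r. p r (int (n - k)) t1 t2) l)) (at l)"
    using assms by (intro DERIV_sum DERIV_cmult system_DERIV) auto
  have ev: "eventually (\<lambda>r. frac_difference \<beta> (\<lambda>m. p r m t1 t2) (int n) = (\<Sum>k\<le>n. binomial_coeff k * p r (int (n - k)) t1 t2)) (nhds l)"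
  proof -
    have "eventually (\<lambda>r. r > 0) (nhds l)" using eventually_nhds_in_open[of "{0<..}" l] assms by simp
    then show ?thesis by eventually_elim (rule fd)
  qed
  have "((\<lambda>r. frac_difference \<beta> (\<lambda>m. p r m t1 t2) (int n)) has_real_derivative
      (\<Sum>k\<le>n. binomial_coeff k * deriv (\<lambda>r. p r (int (n - k)) t1 t2) l)) (at l)"
    by (rule DERIV_cong_ev[OF refl ev refl, THEN iffD2, OF D])
  then have "deriv (\<lambda>r. frac_difference \<beta> (\<lambda>m. p r m t1 t2) (int n)) l = (\<Sum>k\<le>n. binomial_coeff k * deriv (\<lambda>r. p r (int (n - k)) t1 t2) l)"
    by (rule DERIV_imp_deriv)
  moreover have "caputo_deriv \<alpha>2 (\<lambda>s2. caputo_deriv \<alpha>1 (\<lambda>s1. p l (int n) s1 s2) t1) t2 =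
        - (l powr (\<beta> + 1) / \<beta> * deriv (\<lambda>r. frac_difference \<beta> (\<lambda>m. p r m t1 t2) (int n)) l
           + l powr \<beta> * frac_difference \<beta> (\<lambda>m. p l m t1 t2) (int n))"
    using sys assms unfolding stfprf_system_def by (meson of_nat_0_le_iff)
  ultimately show ?thesis by (simp add: system_rhs_def fd assms)
qed

text \<open>Integration of order \<open>\<alpha>2\<close> in the second time is followed by order
  \<open>\<alpha>1\<close> in the first. The boundary terms are explicit: along
  \<open>t2 = 0\<close> the function \<open>p\<close> is constant, so its derivative in the first
  time is 0, and at \<open>t1 = 0\<close> it is 1 or 0 according to whether
  \<open>n = 0\<close>.\<close>

lemma system_integrated:
  assumes l: "l > 0" and t: "t1 > 0" "t2 > 0"
  shows "p l (int n) t1 t2 - (if n = 0 then 1 else 0)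
    = (\<integral> (a, b). system_rhs n l (clamp_real 0 t1 a) (clamp_real 0 t2 b) \<partial>rl_rectangle \<alpha>1 \<alpha>2 t1 t2)"
proof -
  let ?R = "\<lambda>a b. system_rhs n l (clamp_real 0 t1 a) (clamp_real 0 t2 b)"
  \<comment> \<open>The general measurability statement is used on the degenerate interval from
    \<open>l\<close> to \<open>l\<close>, on which the clamped parameter is constant.\<close>
  have Rm: "(\<lambda>(a, b). ?R a b) \<in> borel_measurable (borel \<Otimes>\<^sub>M borel)"
    using measurable_Pair2[OF clamped_measurable[OF system_rhs_continuous l order_refl less_imp_le[OF t(1)] less_imp_le[OF t(2)]], of l n]
    by (simp add: clamp_real_id)
  note [measurable] = Rm
  obtain K where "\<And>l' a b. l \<le> l' \<Longrightarrow> l' \<le> l \<Longrightarrow> 0 \<le> a \<Longrightarrow> a \<le> t1 \<Longrightarrow> 0 \<le> b \<Longrightarrow> b \<le> t2 \<Longrightarrow> \<bar>system_rhs n l' a b\<bar> \<le> K"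
    using compact_bounded_3[OF system_rhs_continuous l, of l t1 t2 n] by blast
  then have K: "\<bar>system_rhs n l a b\<bar> \<le> K" if "0 \<le> a" "a \<le> t1" "0 \<le> b" "b \<le> t2" for a b
    using that by blast
  have Kc: "\<bar>?R a b\<bar> \<le> K" for a b using t by (intro K) (auto simp: clamp_real_def)
  interpret m1: finite_measure "rl_measure \<alpha>1 t1" using \<alpha>1(1) by (rule finite_measure_rl_measure)
  interpret m2: finite_measure "rl_measure \<alpha>2 t2" using \<alpha>2(1) by (rule finite_measure_rl_measure)
  interpret pair_sigma_finite "rl_measure \<alpha>1 t1" "rl_measure \<alpha>2 t2" ..
  have reg1: "caputo_differentiable \<alpha>1 (\<lambda>s1. p l (int n) s1 s2)" if "s2 \<ge> 0" for s2
    using sys l that by (simp add: stfprf_system_def)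
  have reg2: "caputo_differentiable \<alpha>2 (\<lambda>s2. caputo_deriv \<alpha>1 (\<lambda>s1. p l (int n) s1 s2) s1)" if "s1 > 0" for s1
    using sys l that by (simp add: stfprf_system_def)
  have D0: "caputo_deriv \<alpha>1 (\<lambda>s1. p l (int n) s1 0) a = 0" if a: "a > 0" for a
  proof -
    have "deriv (\<lambda>s1. p l (int n) s1 0) s = 0" if "s > 0" for s
    proof -
      have "eventually (\<lambda>s1. p l (int n) s1 0 = (if n = 0 then 1 else 0)) (nhds s)"
        using eventually_nhds_in_open[of "{0<..}" s] that system_axes[OF l, of _ 0 n] by (auto elim!: eventually_mono)
      then have "((\<lambda>s1. p l (int n) s1 0) has_real_derivative 0) (at s)"
        using DERIV_cong_ev[OF refl _ refl, of "\<lambda>s1. p l (int n) s1 0" "\<lambda>_. if n = 0 then 1 else 0" s 0] by simp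
      then show ?thesis by (rule DERIV_imp_deriv)
    qed
    note d0 = this
    have m: "nat \<lceil>\<alpha>1\<rceil> = 1" using \<alpha>1 by linarith
    have "(LINT s:{0<..<a}|lborel. deriv (\<lambda>s1. p l (int n) s1 0) s / (a - s) powr \<alpha>1) = (LINT s:{0<..<a}|lborel. 0)"
      by (intro set_lebesgue_integral_cong) (auto simp: d0)
    then show ?thesis using a by (simp add: caputo_deriv_def Let_def m d0)
  qed
  have inner: "(\<integral> b. ?R a b \<partial>rl_measure \<alpha>2 t2) = caputo_deriv \<alpha>1 (\<lambda>s1. p l (int n) s1 t2) a" if "0 < a" "a < t1" for a
  proof -
    have "(\<integral> b. ?R a b \<partial>rl_measure \<alpha>2 t2) = caputo_deriv \<alpha>1 (\<lambda>s1. p l (int n) s1 t2) a - caputo_deriv \<alpha>1 (\<lambda>s1. p l (int n) s1 0) a"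
    proof (rule integral_rl_caputo_deriv[OF reg2 \<alpha>2 t(2)])
      show "?R a \<in> borel_measurable borel" by measurable
      show "?R a r = caputo_deriv \<alpha>2 (\<lambda>s2. caputo_deriv \<alpha>1 (\<lambda>s1. p l (int n) s1 s2) a) r" if "0 < r" "r < t2" for r
        using that \<open>0 < a\<close> \<open>a < t1\<close> l by (simp add: system_equation clamp_real_id)
    qed (use that in auto)
    then show ?thesis using D0 that by simp
  qed
  have "(\<integral> a. (\<integral> b. ?R a b \<partial>rl_measure \<alpha>2 t2) \<partial>rl_measure \<alpha>1 t1) = p l (int n) t1 t2 - p l (int n) 0 t2"
  proof (rule integral_rl_caputo_deriv[OF reg1 \<alpha>1 t(1)])
    show "(\<lambda>a. \<integral> b. ?R a b \<partial>rl_measure \<alpha>2 t2) \<in> borel_measurable borel"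
      by (rule rl_measure_integral_parametric[OF \<alpha>2(1)]) measurable
  qed (use t inner in auto)
  moreover have "(\<integral> a. (\<integral> b. ?R a b \<partial>rl_measure \<alpha>2 t2) \<partial>rl_measure \<alpha>1 t1) = (\<integral> (a, b). ?R a b \<partial>rl_rectangle \<alpha>1 \<alpha>2 t1 t2)"
    unfolding rl_rectangle_def
  proof (rule integral_fst)
    interpret finite_measure "rl_rectangle \<alpha>1 \<alpha>2 t1 t2" using \<alpha>1 \<alpha>2 by (intro finite_measure_rl_rectangle) auto
    have "integrable (rl_rectangle \<alpha>1 \<alpha>2 t1 t2) (\<lambda>(a, b). ?R a b)"
      by (rule integrable_const_bound[where B = K]) (use Kc in auto)
    then show "integrable (rl_measure \<alpha>1 t1 \<Otimes>\<^sub>M rl_measure \<alpha>2 t2) (\<lambda>(a, b). ?R a b)" by (simp add: rl_rectangle_def)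
  qed
  ultimately show ?thesis using system_axes[OF l, of 0 t2 n] t by simp
qed

text \<open>The factor \<open>\<beta> / l\<close> makes the operator exact: \<open>\<beta> / l * (l
  powr (\<beta> + 1) / \<beta> * q' + l powr \<beta> * q)\<close> is the derivative of
  \<open>l powr \<beta> * q\<close>. Integration over \<open>{l0..l1}\<close> thus removes the
  derivative in \<open>l\<close>, and only values of \<open>p\<close> remain.\<close>

lemma system_lambda_integrated:
  fixes n :: nat
  assumes l: "0 < l0" "l0 \<le> l1" and t: "t1 > 0" "t2 > 0"
  defines "W \<equiv> \<lambda>l a b. \<Sum>k\<le>n. binomial_coeff k * (l powr \<beta> * p l (int (n - k)) (clamp_real 0 t1 a) (clamp_real 0 t2 b))"
  shows "(\<integral> l. \<beta> / clamp_real l0 l1 l * ((if n = 0 then 1 else 0) - p (clamp_real l0 l1 l) (int n) t1 t2) \<partial>Icc_measure l0 l1)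
    = (\<integral> (a, b). W l1 a b - W l0 a b \<partial>rl_rectangle \<alpha>1 \<alpha>2 t1 t2)"
proof -
  let ?N = "Icc_measure l0 l1" and ?Q = "rl_rectangle \<alpha>1 \<alpha>2 t1 t2"
  let ?c = "clamp_real l0 l1" and ?c1 = "clamp_real 0 t1" and ?c2 = "clamp_real 0 t2"
  interpret N: finite_measure ?N by (rule finite_measure_Icc_measure)
  interpret Q: finite_measure ?Q using \<alpha>1 \<alpha>2 by (intro finite_measure_rl_rectangle) auto
  interpret NQ: pair_sigma_finite ?N ?Q ..
  interpret NQf: finite_measure "?N \<Otimes>\<^sub>M ?Q" by (rule finite_measure_pair_measure) unfold_locales
  have cpos: "?c l > 0" for l using clamp_real_in[OF l(2), of l] l by auto
  define \<Phi> where "\<Phi> l x = \<beta> / ?c l * system_rhs n (?c l) (?c1 (fst x)) (?c2 (snd x))" for l x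
  have \<Phi>m[measurable]: "case_prod \<Phi> \<in> borel_measurable (borel \<Otimes>\<^sub>M (borel \<Otimes>\<^sub>M borel))"
  proof -
    have [measurable]: "?c \<in> borel_measurable borel" unfolding clamp_real_def by measurable
    note [measurable] = clamped_measurable[OF system_rhs_continuous l less_imp_le[OF t(1)] less_imp_le[OF t(2)], of n]
    have "(\<lambda>x. \<beta> / ?c (fst x) * (\<lambda>(l, a, b). system_rhs n (?c l) (?c1 a) (?c2 b)) x) \<in> borel_measurable (borel \<Otimes>\<^sub>M (borel \<Otimes>\<^sub>M borel))"
      by measurable
    also have "(\<lambda>x. \<beta> / ?c (fst x) * (\<lambda>(l, a, b). system_rhs n (?c l) (?c1 a) (?c2 b)) x) = case_prod \<Phi>"
      by (auto simp: \<Phi>_def fun_eq_iff)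
    finally show ?thesis .
  qed
  obtain K where K: "\<bar>system_rhs n l a b\<bar> \<le> K" if "l0 \<le> l" "l \<le> l1" "0 \<le> a" "a \<le> t1" "0 \<le> b" "b \<le> t2" for l a b
    using compact_bounded_3[OF system_rhs_continuous l(1), of l1 t1 t2 n] by auto
  have \<Phi>b: "\<bar>\<Phi> l x\<bar> \<le> \<beta> / l0 * K" for l x
  proof -
    have "\<bar>\<Phi> l x\<bar> = \<beta> / ?c l * \<bar>system_rhs n (?c l) (?c1 (fst x)) (?c2 (snd x))\<bar>"
      using \<beta> cpos[of l] by (simp add: \<Phi>_def abs_mult)
    also have "\<dots> \<le> \<beta> / l0 * K"
      using \<beta> l t cpos[of l] clamp_real_in[OF l(2), of l] clamp_real_in[of 0 t1 "fst x"] clamp_real_in[of 0 t2 "snd x"]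
      by (intro mult_mono K divide_left_mono) auto
    finally show ?thesis .
  qed
  have int: "integrable (?N \<Otimes>\<^sub>M ?Q) (case_prod \<Phi>)"
    by (rule NQf.integrable_const_bound[where B = "\<beta> / l0 * K"]) (use \<Phi>b in auto)
  have "(\<integral> l. \<beta> / ?c l * ((if n = 0 then 1 else 0) - p (?c l) (int n) t1 t2) \<partial>?N) = (\<integral> l. - (\<integral> x. \<Phi> l x \<partial>?Q) \<partial>?N)"
  proof (intro Bochner_Integration.integral_cong refl)
    fix l
    have "(\<integral> x. \<Phi> l x \<partial>?Q) = \<beta> / ?c l * (\<integral> (a, b). system_rhs n (?c l) (?c1 a) (?c2 b) \<partial>?Q)"
      by (simp only: \<Phi>_def case_prod_unfold integral_mult_right_zero)
    also have "\<dots> = \<beta> / ?c l * (p (?c l) (int n) t1 t2 - (if n = 0 then 1 else 0))"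
      using system_integrated[OF cpos[of l] t, of n] by (simp only:)
    finally show "\<beta> / ?c l * ((if n = 0 then 1 else 0) - p (?c l) (int n) t1 t2) = - (\<integral> x. \<Phi> l x \<partial>?Q)"
      by (simp only: right_diff_distrib)
  qed
  also have "\<dots> = - (\<integral> x. (\<integral> l. \<Phi> l x \<partial>?N) \<partial>?Q)"
    using NQ.Fubini_integral[OF int] by simp
  also have "\<dots> = (\<integral> x. - (\<integral> l. \<Phi> l x \<partial>?N) \<partial>?Q)" by simp
  also have "\<dots> = (\<integral> (a, b). W l1 a b - W l0 a b \<partial>?Q)"
  proof (intro Bochner_Integration.integral_cong refl, clarify)
    fix a b :: real
    let ?a = "?c1 a" and ?b = "?c2 b"
    have ab: "?a \<ge> 0" "?b \<ge> 0" using t by (auto simp: clamp_real_def)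
    \<comment> \<open>Minus the derivative of \<open>W\<close> in \<open>l\<close>;
      \<open>w\<Phi>\<close> below identifies it with the right-hand side of the system times
      \<open>\<beta> / l\<close>.\<close>
    define w where "w l = - (\<Sum>k\<le>n. binomial_coeff k * (\<beta> * l powr (\<beta> - 1) * p l (int (n - k)) ?a ?b + deriv (\<lambda>r. p r (int (n - k)) ?a ?b) l * l powr \<beta>))" for l
    have dW: "((\<lambda>l. W l a b) has_real_derivative - w l) (at l)" if "l > 0" for l
      unfolding W_def w_def minus_minus
      using that ab by (intro DERIV_sum DERIV_cmult DERIV_mult has_real_derivative_powr system_DERIV) auto
    have w\<Phi>: "\<Phi> l (a, b) = w l" if "l0 \<le> l" "l \<le> l1" for l
    proof -
      have lp: "l > 0" using that l by simp
      have e: "\<beta> / l * (l powr (\<beta> + 1) / \<beta>) = l powr \<beta>" "\<beta> / l * l powr \<beta> = \<beta> * l powr (\<beta> - 1)"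
        using lp \<beta> by (auto simp: powr_add powr_diff)
      have "\<Phi> l (a, b) = - ((\<beta> / l * (l powr (\<beta> + 1) / \<beta>)) * (\<Sum>k\<le>n. binomial_coeff k * deriv (\<lambda>r. p r (int (n - k)) ?a ?b) l)
         + (\<beta> / l * l powr \<beta>) * (\<Sum>k\<le>n. binomial_coeff k * p l (int (n - k)) ?a ?b))"
        using that by (simp add: \<Phi>_def clamp_real_id system_rhs_def algebra_simps)
      also have "\<dots> = w l" unfolding e w_def
        by (simp add: sum_distrib_left distrib_left sum.distrib mult_ac)
      finally show ?thesis .
    qed
    have wc: "continuous_on {l0..l1} w"
    proof -
      have "continuous_on {l0..l1} (\<lambda>l. \<beta> / l * (\<lambda>(l, t1, t2). system_rhs n l t1 t2) (l, ?a, ?b))"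
        by (intro continuous_intros continuous_on_compose2[OF system_rhs_continuous]) (use l ab in auto)
      then show ?thesis by (rule continuous_on_eq) (use w\<Phi> in \<open>auto simp: \<Phi>_def clamp_real_id\<close>)
    qed
    have "(\<integral> l. \<Phi> l (a, b) \<partial>?N) = (\<integral> l. indicator {l0..l1} l * \<Phi> l (a, b) \<partial>lborel)"
      by (rule integral_Icc_measure) measurable
    also have "\<dots> = (\<integral> l. indicator {l0..l1} l *\<^sub>R w l \<partial>lborel)"
      by (intro Bochner_Integration.integral_cong) (auto simp: w\<Phi> indicator_def)
    also have "\<dots> = - W l1 a b - (- W l0 a b)"
    proof (rule integral_FTC_atLeastAtMost[OF l(2) _ wc])
      show "((\<lambda>l. - W l a b) has_vector_derivative w x) (at x within {l0..l1})" if "l0 \<le> x" "x \<le> l1" for x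
        using DERIV_minus[OF dW[of x]] that l
        by (auto simp: has_real_derivative_iff_has_vector_derivative[symmetric] intro: DERIV_subset)
    qed
    finally show "- (\<integral> l. \<Phi> l (a, b) \<partial>?N) = W l1 a b - W l0 a b" by simp
  qed
  finally show ?thesis .
qed

end

lemma (in finite_measure) sums_integral_bounded:
  fixes f :: "nat \<Rightarrow> 'a \<Rightarrow> real"
  assumes [measurable]: "\<And>n. f n \<in> borel_measurable M" and bd: "\<And>n x. x \<in> space M \<Longrightarrow> \<bar>f n x\<bar> \<le> B n" and B: "summable B"
  shows "(\<lambda>n. \<integral> x. f n x \<partial>M) sums (\<integral> x. (\<Sum>n. f n x) \<partial>M)"
proof (rule sums_integral)
  show int: "integrable M (f n)" for n
    by (rule integrable_const_bound[where B = "B n"]) (use bd in auto)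
  show "AE x in M. summable (\<lambda>n. norm (f n x))"
    by (intro AE_I2 summable_comparison_test'[OF B]) (use bd in auto)
  show "summable (\<lambda>n. \<integral> x. norm (f n x) \<partial>M)"
  proof (rule summable_comparison_test'[OF summable_mult2[OF B, of "measure M (space M)"]])
    fix n :: nat
    have "(\<integral> x. norm (f n x) \<partial>M) \<le> (\<integral> x. B n \<partial>M)"
      using bd int by (intro integral_mono_AE AE_I2) auto
    then show "norm (\<integral> x. norm (f n x) \<partial>M) \<le> B n * measure M (space M)" by (simp add: mult.commute)
  qed
qed

section \<open>The generating function\<close>

context
  fixes \<alpha>1 \<alpha>2 \<beta> z :: real and p :: "real \<Rightarrow> int \<Rightarrow> real \<Rightarrow> real \<Rightarrow> real"
  assumes \<alpha>1: "0 < \<alpha>1" "\<alpha>1 \<le> 1" and \<alpha>2: "0 < \<alpha>2" "\<alpha>2 \<le> 1" and \<beta>: "0 < \<beta>"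
    and sys: "stfprf_system \<alpha>1 \<alpha>2 \<beta> p" and z: "0 \<le> z" "z < 1"
begin

definition "system_pgf l t1 t2 = (\<Sum>n. p l (int n) t1 t2 * z ^ n)"

lemma system_pgf_bound:
  assumes "l > 0" "t1 \<ge> 0" "t2 \<ge> 0"
  shows "\<bar>p l (int n) t1 t2 * z ^ n\<bar> \<le> z ^ n"
proof -
  have "0 \<le> p l (int n) t1 t2" "p l (int n) t1 t2 \<le> 1"
    using system_nonneg[OF \<alpha>1 \<alpha>2 \<beta> sys assms] system_le_1[OF \<alpha>1 \<alpha>2 \<beta> sys assms] by auto
  then show ?thesis using z by (simp add: abs_mult mult_left_le_one_le)
qed

lemma geometric_summable: "summable (\<lambda>n. z ^ n)"
  using z by (intro summable_geometric) auto

lemma system_pgf_summable: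
  assumes "l > 0" "t1 \<ge> 0" "t2 \<ge> 0"
  shows "summable (\<lambda>n. \<bar>p l (int n) t1 t2 * z ^ n\<bar>)"
  by (rule summable_comparison_test'[OF geometric_summable]) (use system_pgf_bound[OF assms] in auto)

lemma system_pgf_01:
  assumes "l > 0" "t1 \<ge> 0" "t2 \<ge> 0"
  shows "0 \<le> system_pgf l t1 t2" "system_pgf l t1 t2 \<le> 1"
proof -
  note nn = system_nonneg[OF \<alpha>1 \<alpha>2 \<beta> sys assms]
  note s = system_sums[OF \<alpha>1 \<alpha>2 \<beta> sys assms]
  show "0 \<le> system_pgf l t1 t2" unfolding system_pgf_def
    using nn z by (intro suminf_nonneg summable_rabs_cancel[OF system_pgf_summable[OF assms]]) auto
  have "system_pgf l t1 t2 \<le> (\<Sum>n. p l (int n) t1 t2)" unfolding system_pgf_def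
    using nn z s by (intro suminf_le summable_rabs_cancel[OF system_pgf_summable[OF assms]])
      (auto simp: sums_iff intro!: mult_right_le_one_le power_le_one)
  then show "system_pgf l t1 t2 \<le> 1" using s by (simp add: sums_iff)
qed

lemma system_pgf_axes:
  assumes "l > 0" "t1 \<ge> 0" "t2 \<ge> 0" "t1 = 0 \<or> t2 = 0"
  shows "system_pgf l t1 t2 = 1"
proof -
  have "system_pgf l t1 t2 = (\<Sum>n. if n = 0 then 1 else 0)" unfolding system_pgf_def
    by (intro suminf_cong) (simp add: system_axes[OF \<alpha>1 \<alpha>2 \<beta> sys assms])
  then show ?thesis using suminf_finite[of "{0::nat}" "\<lambda>n. if n = 0 then 1 else 0 :: real"] by simp
qed

text \<open>For \<open>z < 1\<close> the series has the majorant \<open>z ^ n\<close>, uniformly in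
  the parameter and the times, so joint continuity passes from the coefficients to the sum.\<close>

lemma system_pgf_continuous: "continuous_on ({0<..} \<times> {0..} \<times> {0..}) (\<lambda>(l, t1, t2). system_pgf l t1 t2)"
proof -
  let ?S = "{0<..} \<times> {0..} \<times> {0..} :: (real \<times> real \<times> real) set"
  let ?f = "\<lambda>n (l, t1, t2). p l (int n) t1 t2 * z ^ n"
  have "uniform_limit ?S (\<lambda>n x. \<Sum>i<n. ?f i x) (\<lambda>x. \<Sum>i. ?f i x) sequentially"
    by (rule Weierstrass_m_test[OF _ geometric_summable]) (auto intro: system_pgf_bound[simplified])
  moreover have "continuous_on ?S (\<lambda>x. \<Sum>i<n. ?f i x)" for n
  proof -
    have "continuous_on ?S (\<lambda>x. \<Sum>i<n. (\<lambda>(l, t1, t2). p l (int i) t1 t2) x * z ^ i)"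
      by (intro continuous_intros system_continuous[OF \<alpha>1 \<alpha>2 \<beta> sys])
    then show ?thesis by (rule continuous_on_eq) auto
  qed
  ultimately have "continuous_on ?S (\<lambda>x. \<Sum>i. ?f i x)"
    by (intro uniform_limit_theorem[OF always_eventually]) auto
  then show ?thesis by (rule continuous_on_eq) (auto simp: system_pgf_def)
qed

lemma binomial_coeff_sums: "(\<lambda>k. binomial_coeff \<beta> k * z ^ k) sums (1 - z) powr \<beta>"
proof -
  have "(\<lambda>k. (\<beta> gchoose k) * (- z) ^ k) sums (1 + - z) powr \<beta>"
    by (rule gen_binomial_real) (use z in auto)
  then show ?thesis by (simp add: binomial_coeff_def[OF \<alpha>1 \<alpha>2 \<beta> sys] power_minus[of z] mult_ac)
qed

lemma binomial_coeff_abs_summable: "summable (\<lambda>k. \<bar>binomial_coeff \<beta> k * z ^ k\<bar>)"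
proof -
  \<comment> \<open>Any point strictly between \<open>z\<close> and 1 serves: convergence there
    gives absolute convergence at \<open>z\<close>.\<close>
  define y where "y = (1 + z) / 2"
  have y: "\<bar>- y\<bar> < 1" "\<bar>- z\<bar> < \<bar>- y\<bar>" using z by (auto simp: y_def)
  have "summable (\<lambda>k. (\<beta> gchoose k) * (- y) ^ k)" using gen_binomial_real[OF y(1), of \<beta>] by (rule sums_summable)
  then have "summable (\<lambda>k. norm ((\<beta> gchoose k) * (- z) ^ k))" by (rule powser_insidea) (use y in auto)
  then show ?thesis
    by (simp add: binomial_coeff_def[OF \<alpha>1 \<alpha>2 \<beta> sys] abs_mult power_abs)
qed

text \<open>The fractional difference is a discrete convolution with the coefficients of
  \<open>(1 - z) powr \<beta>\<close>, so by the Cauchy product it acts on the generating function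
  as multiplication by this number. Sum and integrals are interchanged in the integrated equation,
  where all terms have summable bounds.\<close>

lemma system_pgf_integrated:
  assumes l: "0 < l0" "l0 \<le> l1" and t: "t1 > 0" "t2 > 0"
  shows "(\<integral> l. \<beta> / clamp_real l0 l1 l * (1 - system_pgf (clamp_real l0 l1 l) t1 t2) \<partial>Icc_measure l0 l1)
    = (1 - z) powr \<beta> * (\<integral> (a, b). l1 powr \<beta> * system_pgf l1 (clamp_real 0 t1 a) (clamp_real 0 t2 b)
         - l0 powr \<beta> * system_pgf l0 (clamp_real 0 t1 a) (clamp_real 0 t2 b) \<partial>rl_rectangle \<alpha>1 \<alpha>2 t1 t2)"
proof -
  let ?N = "Icc_measure l0 l1" and ?Q = "rl_rectangle \<alpha>1 \<alpha>2 t1 t2"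
  let ?c = "clamp_real l0 l1" and ?c1 = "clamp_real 0 t1" and ?c2 = "clamp_real 0 t2"
  let ?b = "binomial_coeff \<beta>"
  interpret N: finite_measure ?N by (rule finite_measure_Icc_measure)
  interpret Q: finite_measure ?Q using \<alpha>1 \<alpha>2 by (intro finite_measure_rl_rectangle) auto
  have cpos: "?c l > 0" "?c l \<ge> l0" for l using clamp_real_in[OF l(2), of l] l by auto
  have cnn: "?c1 a \<ge> 0" "?c2 a \<ge> 0" for a using t by (auto simp: clamp_real_def)
  note t' = less_imp_le[OF t(1)] less_imp_le[OF t(2)]
  note pm = clamped_measurable[OF system_continuous[OF \<alpha>1 \<alpha>2 \<beta> sys]]
  have pm1[measurable]: "(\<lambda>l. p (?c l) (int n) t1 t2) \<in> borel_measurable borel" for n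
  proof -
    have "(\<lambda>l. (\<lambda>(l, a, b). p (?c l) (int n) (?c1 a) (?c2 b)) (l, t1, t2)) \<in> borel_measurable borel"
      by (rule measurable_compose[OF _ pm[OF l t', of n]]) measurable
    then show ?thesis using t by (simp add: clamp_real_id)
  qed
  have pm2[measurable]: "(\<lambda>x. p l (int n) (?c1 (fst x)) (?c2 (snd x))) \<in> borel_measurable (borel \<Otimes>\<^sub>M borel)" if "l > 0" for l n
  proof -
    have "(\<lambda>x. (\<lambda>(l', a, b). p (clamp_real l l l') (int n) (?c1 a) (?c2 b)) (l, fst x, snd x)) \<in> borel_measurable (borel \<Otimes>\<^sub>M borel)"
      by (rule measurable_compose[OF _ pm[OF that order_refl t', of n]]) measurable
    then show ?thesis by (simp add: clamp_real_id)
  qed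
  define L where "L n = (\<integral> l. \<beta> / ?c l * ((if n = 0 then 1 else 0) - p (?c l) (int n) t1 t2) * z ^ n \<partial>?N)" for n
  \<comment> \<open>The Cauchy product of two absolutely convergent series; up to the factor
    \<open>l powr \<beta>\<close> it bounds the terms \<open>W n l x * z ^ n\<close>.\<close>
  define B where "B n = (\<Sum>k\<le>n. \<bar>?b k * z ^ k\<bar> * z ^ (n - k))" for n
  have B: "summable B"
    unfolding B_def using binomial_coeff_abs_summable geometric_summable z
    by (intro summable_Cauchy_product) (auto simp: power_abs)
  define W where "W n l x = (\<Sum>k\<le>n. ?b k * (l powr \<beta> * p l (int (n - k)) (?c1 (fst x)) (?c2 (snd x))))" for n l x
  have Wm[measurable]: "W n l \<in> borel_measurable (borel \<Otimes>\<^sub>M borel)" if "l > 0" for n l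
    unfolding W_def[abs_def] using that by measurable
  have Wz: "W n l x * z ^ n = l powr \<beta> * (\<Sum>k\<le>n. (?b k * z ^ k) * (p l (int (n - k)) (?c1 (fst x)) (?c2 (snd x)) * z ^ (n - k)))" for n l x
  proof -
    have "?b k * (l powr \<beta> * P) * z ^ n = l powr \<beta> * ((?b k * z ^ k) * (P * z ^ (n - k)))" if "k \<le> n" for k P
    proof -
      have "z ^ n = z ^ k * z ^ (n - k)" using that by (simp add: power_add[symmetric])
      then show ?thesis by simp
    qed
    then show ?thesis unfolding W_def sum_distrib_right sum_distrib_left by (intro sum.cong) auto
  qed
  have Wb: "\<bar>W n l x * z ^ n\<bar> \<le> l powr \<beta> * B n" if "l > 0" for n l x
  proof -
    have "\<bar>\<Sum>k\<le>n. (?b k * z ^ k) * (p l (int (n - k)) (?c1 (fst x)) (?c2 (snd x)) * z ^ (n - k))\<bar> \<le> B n"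
      unfolding B_def
    proof (rule order_trans[OF sum_abs], rule sum_mono)
      fix k
      show "\<bar>?b k * z ^ k * (p l (int (n - k)) (?c1 (fst x)) (?c2 (snd x)) * z ^ (n - k))\<bar> \<le> \<bar>?b k * z ^ k\<bar> * z ^ (n - k)"
        unfolding abs_mult[of "?b k * z ^ k"] using system_pgf_bound[OF that cnn] by (intro mult_left_mono) auto
    qed
    then show ?thesis unfolding Wz abs_mult by (intro mult_mono) auto
  qed
  have Wsums: "(\<lambda>n. W n l x * z ^ n) sums (l powr \<beta> * ((1 - z) powr \<beta> * system_pgf l (?c1 (fst x)) (?c2 (snd x))))" if "l > 0" for l x
    unfolding Wz
  proof (rule sums_mult)
    have "(\<lambda>n. \<Sum>k\<le>n. (?b k * z ^ k) * (p l (int (n - k)) (?c1 (fst x)) (?c2 (snd x)) * z ^ (n - k)))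
       sums ((\<Sum>k. ?b k * z ^ k) * (\<Sum>n. p l (int n) (?c1 (fst x)) (?c2 (snd x)) * z ^ n))"
      using binomial_coeff_abs_summable system_pgf_summable[OF that cnn] by (intro Cauchy_product_sums) auto
    then show "(\<lambda>n. \<Sum>k\<le>n. (?b k * z ^ k) * (p l (int (n - k)) (?c1 (fst x)) (?c2 (snd x)) * z ^ (n - k)))
       sums ((1 - z) powr \<beta> * system_pgf l (?c1 (fst x)) (?c2 (snd x)))"
      using binomial_coeff_sums by (simp add: sums_iff system_pgf_def)
  qed
  have "L sums (\<integral> l. (\<Sum>n. \<beta> / ?c l * ((if n = 0 then 1 else 0) - p (?c l) (int n) t1 t2) * z ^ n) \<partial>?N)"
    unfolding L_def
  proof (rule N.sums_integral_bounded)
    have [measurable]: "?c \<in> borel_measurable borel" unfolding clamp_real_def by measurable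
    show "(\<lambda>l. \<beta> / ?c l * ((if n = 0 then 1 else 0) - p (?c l) (int n) t1 t2) * z ^ n) \<in> borel_measurable ?N" for n
      by measurable
    show "summable (\<lambda>n. \<beta> / l0 * z ^ n)" using geometric_summable by (rule summable_mult)
    show "\<bar>\<beta> / ?c l * ((if n = 0 then 1 else 0) - p (?c l) (int n) t1 t2) * z ^ n\<bar> \<le> \<beta> / l0 * z ^ n" for n l
    proof -
      have "0 \<le> p (?c l) (int n) t1 t2" "p (?c l) (int n) t1 t2 \<le> 1"
        using system_nonneg[OF \<alpha>1 \<alpha>2 \<beta> sys cpos(1) t'] system_le_1[OF \<alpha>1 \<alpha>2 \<beta> sys cpos(1) t'] by auto
      then have 1: "\<bar>(if n = 0 then 1 else 0) - p (?c l) (int n) t1 t2\<bar> \<le> 1" by auto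
      have "\<bar>\<beta> / ?c l\<bar> \<le> \<beta> / l0" using \<beta> l cpos[of l] by (auto intro!: divide_left_mono)
      then have "\<bar>\<beta> / ?c l\<bar> * \<bar>(if n = 0 then 1 else 0) - p (?c l) (int n) t1 t2\<bar> \<le> \<beta> / l0 * 1"
        using 1 \<beta> l by (intro mult_mono) auto
      from mult_right_mono[OF this, of "z ^ n"] z show ?thesis
        unfolding abs_mult[of _ "z ^ n"] abs_mult[of "\<beta> / ?c l"] by (simp only: mult_1_right abs_of_nonneg zero_le_power)
    qed
  qed
  moreover have "(\<Sum>n. \<beta> / ?c l * ((if n = 0 then 1 else 0) - p (?c l) (int n) t1 t2) * z ^ n) = \<beta> / ?c l * (1 - system_pgf (?c l) t1 t2)" for l
  proof (rule sums_unique[symmetric])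
    have "(\<lambda>n. if n = 0 then 1 else 0 :: real) sums 1" using sums_single[of 0 "\<lambda>_. 1 :: real"] by simp
    moreover have "(\<lambda>n. p (?c l) (int n) t1 t2 * z ^ n) sums system_pgf (?c l) t1 t2"
      unfolding system_pgf_def using summable_rabs_cancel[OF system_pgf_summable[OF cpos(1) t']] by (rule summable_sums)
    ultimately have "(\<lambda>n. \<beta> / ?c l * ((if n = 0 then 1 else 0) - p (?c l) (int n) t1 t2 * z ^ n)) sums (\<beta> / ?c l * (1 - system_pgf (?c l) t1 t2))"
      by (intro sums_mult sums_diff)
    also have "(\<lambda>n. \<beta> / ?c l * ((if n = 0 then 1 else 0) - p (?c l) (int n) t1 t2 * z ^ n))
        = (\<lambda>n. \<beta> / ?c l * ((if n = 0 then 1 else 0) - p (?c l) (int n) t1 t2) * z ^ n)"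
      by (intro ext) (simp add: left_diff_distrib)
    finally show "(\<lambda>n. \<beta> / ?c l * ((if n = 0 then 1 else 0) - p (?c l) (int n) t1 t2) * z ^ n) sums (\<beta> / ?c l * (1 - system_pgf (?c l) t1 t2))" .
  qed
  ultimately have S1: "L sums (\<integral> l. \<beta> / ?c l * (1 - system_pgf (?c l) t1 t2) \<partial>?N)" by simp
  have l1: "l1 > 0" using l by simp
  have "(\<lambda>n. \<integral> x. W n l1 x * z ^ n - W n l0 x * z ^ n \<partial>?Q) sums (\<integral> x. (\<Sum>n. W n l1 x * z ^ n - W n l0 x * z ^ n) \<partial>?Q)"
  proof (rule Q.sums_integral_bounded)
    note [measurable] = Wm[OF l1] Wm[OF l(1)]
    show "(\<lambda>x. W n l1 x * z ^ n - W n l0 x * z ^ n) \<in> borel_measurable ?Q" for n by measurable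
    show "summable (\<lambda>n. l1 powr \<beta> * B n + l0 powr \<beta> * B n)" using B by (intro summable_add summable_mult)
    show "\<bar>W n l1 x * z ^ n - W n l0 x * z ^ n\<bar> \<le> l1 powr \<beta> * B n + l0 powr \<beta> * B n" for n x
      using Wb[OF l1, of n x] Wb[OF l(1), of n x] by linarith
  qed
  moreover have "(\<integral> x. W n l1 x * z ^ n - W n l0 x * z ^ n \<partial>?Q) = L n" for n
  proof -
    have "L n = (\<integral> l. \<beta> / ?c l * ((if n = 0 then 1 else 0) - p (?c l) (int n) t1 t2) \<partial>?N) * z ^ n"
      unfolding L_def by (rule integral_mult_left_zero)
    also have "\<dots> = (\<integral> x. W n l1 x - W n l0 x \<partial>?Q) * z ^ n"
      unfolding W_def by (subst system_lambda_integrated[OF \<alpha>1 \<alpha>2 \<beta> sys l t]) (simp only: case_prod_unfold)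
    also have "\<dots> = (\<integral> x. (W n l1 x - W n l0 x) * z ^ n \<partial>?Q)" by (rule integral_mult_left_zero[symmetric])
    finally show ?thesis by (simp only: left_diff_distrib)
  qed
  moreover have "(\<Sum>n. W n l1 x * z ^ n - W n l0 x * z ^ n) = (1 - z) powr \<beta> * (l1 powr \<beta> * system_pgf l1 (?c1 (fst x)) (?c2 (snd x))
         - l0 powr \<beta> * system_pgf l0 (?c1 (fst x)) (?c2 (snd x)))" for x
    using sums_diff[OF Wsums[OF l1, of x] Wsums[OF l(1), of x]] by (simp add: sums_iff algebra_simps)
  ultimately have "L sums (\<integral> x. (1 - z) powr \<beta> * (l1 powr \<beta> * system_pgf l1 (?c1 (fst x)) (?c2 (snd x))
         - l0 powr \<beta> * system_pgf l0 (?c1 (fst x)) (?c2 (snd x))) \<partial>?Q)" by (simp only:)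
  from sums_unique2[OF S1 this] show ?thesis
    by (simp only: integral_mult_right_zero case_prod_unfold)
qed

end

section \<open>Laplace transforms in both times\<close>

definition laplace_plane :: "real \<Rightarrow> real \<Rightarrow> (real \<times> real) measure" where
  "laplace_plane s1 s2 = laplace_measure s1 \<Otimes>\<^sub>M laplace_measure s2"

lemma sets_laplace_plane [simp, measurable_cong]: "sets (laplace_plane s1 s2) = sets (borel \<Otimes>\<^sub>M borel)"
  unfolding laplace_plane_def by (intro sets_pair_measure_cong) auto

lemma nn_integral_laplace_plane:
  assumes "s1 > 0" "s2 > 0" and [measurable]: "h \<in> borel_measurable (borel \<Otimes>\<^sub>M borel)"
  shows "(\<integral>\<^sup>+ x. h x \<partial>laplace_plane s1 s2) = (\<integral>\<^sup>+ t1. (\<integral>\<^sup>+ t2. h (t1, t2) \<partial>laplace_measure s2) \<partial>laplace_measure s1)"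
proof -
  interpret sigma_finite_measure "laplace_measure s2" using assms(2) by (rule sigma_finite_laplace_measure)
  show ?thesis unfolding laplace_plane_def by (rule nn_integral_fst[symmetric]) measurable
qed

lemma laplace_plane_mass:
  assumes "s1 > 0" "s2 > 0"
  shows "emeasure (laplace_plane s1 s2) (space (laplace_plane s1 s2)) = ennreal (1 / (s1 * s2))"
proof -
  have "emeasure (laplace_plane s1 s2) (space (laplace_plane s1 s2)) = (\<integral>\<^sup>+ x. 1 \<partial>laplace_plane s1 s2)" by simp
  also have "\<dots> = ennreal (1 / s1) * ennreal (1 / s2)"
    using assms by (subst nn_integral_laplace_plane) (auto simp: emeasure_laplace_measure mult.commute)
  finally show ?thesis using assms by (simp add: ennreal_mult'[symmetric])
qed

lemma finite_measure_laplace_plane: "s1 > 0 \<Longrightarrow> s2 > 0 \<Longrightarrow> finite_measure (laplace_plane s1 s2)"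
  by (rule finite_measureI) (simp add: laplace_plane_mass)

lemma AE_laplace_plane:
  assumes "s1 > 0" "s2 > 0"
  shows "AE x in laplace_plane s1 s2. 0 < fst x \<and> 0 < snd x"
proof -
  interpret m1: sigma_finite_measure "laplace_measure s1" using assms(1) by (rule sigma_finite_laplace_measure)
  interpret m2: sigma_finite_measure "laplace_measure s2" using assms(2) by (rule sigma_finite_laplace_measure)
  interpret pair_sigma_finite "laplace_measure s1" "laplace_measure s2" ..
  show ?thesis unfolding laplace_plane_def
  proof (rule AE_pair_measure)
    show "{x \<in> space (laplace_measure s1 \<Otimes>\<^sub>M laplace_measure s2). 0 < fst x \<and> 0 < snd x}
      \<in> sets (laplace_measure s1 \<Otimes>\<^sub>M laplace_measure s2)" by measurable
    show "AE x in laplace_measure s1. AE y in laplace_measure s2. 0 < fst (x, y) \<and> 0 < snd (x, y)"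
      using AE_laplace_measure[of s1]
    proof eventually_elim
      case (elim x)
      show ?case using AE_laplace_measure[of s2] by eventually_elim (use elim in auto)
    qed
  qed
qed

lemma nn_integral_rl_rectangle:
  assumes "\<alpha>1 > 0" "\<alpha>2 > 0" and [measurable]: "h \<in> borel_measurable (borel \<Otimes>\<^sub>M borel)"
  shows "(\<integral>\<^sup>+ x. h x \<partial>rl_rectangle \<alpha>1 \<alpha>2 t1 t2) = (\<integral>\<^sup>+ a. (\<integral>\<^sup>+ b. h (a, b) \<partial>rl_measure \<alpha>2 t2) \<partial>rl_measure \<alpha>1 t1)"
proof -
  interpret finite_measure "rl_measure \<alpha>2 t2" using assms(2) by (rule finite_measure_rl_measure)
  show ?thesis unfolding rl_rectangle_def by (rule nn_integral_fst[symmetric]) measurable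
qed

lemma nn_integral_laplace_rl_rectangle:
  assumes \<alpha>: "\<alpha>1 > 0" "\<alpha>2 > 0" and s: "s1 > 0" "s2 > 0" and [measurable]: "h \<in> borel_measurable (borel \<Otimes>\<^sub>M borel)"
  shows "(\<integral>\<^sup>+ t. (\<integral>\<^sup>+ x. h x \<partial>rl_rectangle \<alpha>1 \<alpha>2 (fst t) (snd t)) \<partial>laplace_plane s1 s2)
    = ennreal (s1 powr (- \<alpha>1) * s2 powr (- \<alpha>2)) * (\<integral>\<^sup>+ x. h x \<partial>laplace_plane s1 s2)"
proof -
  interpret L2: sigma_finite_measure "laplace_measure s2" using s(2) by (rule sigma_finite_laplace_measure)
  have [measurable]: "(\<lambda>t. \<integral>\<^sup>+ x. h x \<partial>rl_rectangle \<alpha>1 \<alpha>2 (fst t) (snd t)) \<in> borel_measurable (borel \<Otimes>\<^sub>M borel)"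
    using \<alpha> by (simp add: nn_integral_rl_rectangle)
  have "(\<integral>\<^sup>+ t. (\<integral>\<^sup>+ x. h x \<partial>rl_rectangle \<alpha>1 \<alpha>2 (fst t) (snd t)) \<partial>laplace_plane s1 s2)
    = (\<integral>\<^sup>+ t1. (\<integral>\<^sup>+ t2. (\<integral>\<^sup>+ a. (\<integral>\<^sup>+ b. h (a, b) \<partial>rl_measure \<alpha>2 t2) \<partial>rl_measure \<alpha>1 t1) \<partial>laplace_measure s2) \<partial>laplace_measure s1)"
    using \<alpha> s by (subst nn_integral_laplace_plane) (auto simp: nn_integral_rl_rectangle)
  also have "\<dots> = (\<integral>\<^sup>+ t1. (\<integral>\<^sup>+ a. (\<integral>\<^sup>+ t2. (\<integral>\<^sup>+ b. h (a, b) \<partial>rl_measure \<alpha>2 t2) \<partial>laplace_measure s2) \<partial>rl_measure \<alpha>1 t1) \<partial>laplace_measure s1)"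
  proof (intro nn_integral_cong)
    fix t1
    interpret m1: finite_measure "rl_measure \<alpha>1 t1" using \<alpha>(1) by (rule finite_measure_rl_measure)
    interpret pair_sigma_finite "rl_measure \<alpha>1 t1" "laplace_measure s2" ..
    show "(\<integral>\<^sup>+ t2. (\<integral>\<^sup>+ a. (\<integral>\<^sup>+ b. h (a, b) \<partial>rl_measure \<alpha>2 t2) \<partial>rl_measure \<alpha>1 t1) \<partial>laplace_measure s2)
      = (\<integral>\<^sup>+ a. (\<integral>\<^sup>+ t2. (\<integral>\<^sup>+ b. h (a, b) \<partial>rl_measure \<alpha>2 t2) \<partial>laplace_measure s2) \<partial>rl_measure \<alpha>1 t1)"
      by (rule Fubini') measurable
  qed
  also have "\<dots> = (\<integral>\<^sup>+ t1. (\<integral>\<^sup>+ a. ennreal (s2 powr (- \<alpha>2)) * (\<integral>\<^sup>+ b. h (a, b) \<partial>laplace_measure s2) \<partial>rl_measure \<alpha>1 t1) \<partial>laplace_measure s1)"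
    using \<alpha> s by (intro nn_integral_cong nn_integral_laplace_rl) auto
  also have "\<dots> = ennreal (s1 powr (- \<alpha>1)) * (\<integral>\<^sup>+ a. ennreal (s2 powr (- \<alpha>2)) * (\<integral>\<^sup>+ b. h (a, b) \<partial>laplace_measure s2) \<partial>laplace_measure s1)"
    using \<alpha> s by (intro nn_integral_laplace_rl) auto
  also have "\<dots> = ennreal (s1 powr (- \<alpha>1)) * (ennreal (s2 powr (- \<alpha>2)) * (\<integral>\<^sup>+ x. h x \<partial>laplace_plane s1 s2))"
    using s by (subst nn_integral_cmult) (auto simp: nn_integral_laplace_plane)
  finally show ?thesis by (simp add: ennreal_mult' mult.assoc)
qed

context
  fixes \<alpha>1 \<alpha>2 \<beta> z :: real and p :: "real \<Rightarrow> int \<Rightarrow> real \<Rightarrow> real \<Rightarrow> real"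
  assumes \<alpha>1: "0 < \<alpha>1" "\<alpha>1 \<le> 1" and \<alpha>2: "0 < \<alpha>2" "\<alpha>2 \<le> 1" and \<beta>: "0 < \<beta>"
    and sys: "stfprf_system \<alpha>1 \<alpha>2 \<beta> p" and z: "0 \<le> z" "z < 1"
begin

abbreviation (input) "pgf \<equiv> system_pgf z p"
lemmas pgf_01 = system_pgf_01[OF \<alpha>1 \<alpha>2 \<beta> sys z]
lemmas pgf_continuous = system_pgf_continuous[OF \<alpha>1 \<alpha>2 \<beta> sys z]

text \<open>\<open>max 0\<close> only extends the generating function to the whole plane; negative
  times carry no mass of \<open>laplace_plane\<close>.\<close>

definition "pgf_laplace s1 s2 l = (\<integral> x. pgf l (max 0 (fst x)) (max 0 (snd x)) \<partial>laplace_plane s1 s2)"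

lemma pgf_measurable:
  assumes "0 < l0" "l0 \<le> l1"
  shows "(\<lambda>(l, x). pgf (clamp_real l0 l1 l) (max 0 (fst x)) (max 0 (snd x))) \<in> borel_measurable (borel \<Otimes>\<^sub>M (borel \<Otimes>\<^sub>M borel))"
proof -
  have "continuous_on UNIV (\<lambda>x. (\<lambda>(l, a, b). pgf l a b) (clamp_real l0 l1 (fst x), max 0 (fst (snd x)), max 0 (snd (snd x))))"
    by (intro continuous_on_compose2[OF pgf_continuous] continuous_intros) (use assms in \<open>auto simp: clamp_real_def\<close>)
  then have "(\<lambda>x. (\<lambda>(l, a, b). pgf l a b) (clamp_real l0 l1 (fst x), max 0 (fst (snd x)), max 0 (snd (snd x)))) \<in> borel_measurable borel"
    by (rule borel_measurable_continuous_onI)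
  then show ?thesis by (simp add: borel_prod case_prod_beta)
qed

lemma pgf_measurable2:
  assumes "l > 0"
  shows "(\<lambda>x. pgf l (max 0 (fst x)) (max 0 (snd x))) \<in> borel_measurable (borel \<Otimes>\<^sub>M borel)"
proof -
  have "(\<lambda>x. (\<lambda>(l', x). pgf (clamp_real l l l') (max 0 (fst x)) (max 0 (snd x))) (l, x)) \<in> borel_measurable (borel \<Otimes>\<^sub>M borel)"
    by (rule measurable_compose[OF _ pgf_measurable[OF assms order_refl]]) measurable
  then show ?thesis by (simp add: clamp_real_id)
qed

lemma pgf_integrable:
  assumes "s1 > 0" "s2 > 0" "l > 0"
  shows "integrable (laplace_plane s1 s2) (\<lambda>x. pgf l (max 0 (fst x)) (max 0 (snd x)))"
proof -
  interpret finite_measure "laplace_plane s1 s2" using assms by (intro finite_measure_laplace_plane)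
  show ?thesis using pgf_measurable2[OF assms(3)] pgf_01[OF assms(3)]
    by (intro integrable_const_bound[where B = 1] AE_I2) auto
qed

lemma pgf_laplace_bounds:
  assumes "s1 > 0" "s2 > 0" "l > 0"
  shows "0 \<le> pgf_laplace s1 s2 l" "pgf_laplace s1 s2 l \<le> 1 / (s1 * s2)"
proof -
  interpret finite_measure "laplace_plane s1 s2" using assms by (intro finite_measure_laplace_plane)
  show "0 \<le> pgf_laplace s1 s2 l" unfolding pgf_laplace_def using pgf_01[OF assms(3)] by (intro integral_nonneg_AE AE_I2) auto
  have "pgf_laplace s1 s2 l \<le> (\<integral> x. 1 \<partial>laplace_plane s1 s2)" unfolding pgf_laplace_def
    using pgf_01[OF assms(3)] pgf_integrable[OF assms] by (intro integral_mono) auto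
  also have "\<dots> = 1 / (s1 * s2)" using laplace_plane_mass[OF assms(1,2)] assms by (simp add: measure_def)
  finally show "pgf_laplace s1 s2 l \<le> 1 / (s1 * s2)" .
qed

lemma pgf_laplace_continuous:
  assumes s: "s1 > 0" "s2 > 0"
  shows "continuous_on {0<..} (pgf_laplace s1 s2)"
  unfolding continuous_on_sequentially
proof (intro allI ballI impI, elim conjE)
  fix x :: "nat \<Rightarrow> real" and l assume l: "l \<in> {0<..}" and x: "\<forall>n. x n \<in> {0<..}" and lim: "x \<longlonglongrightarrow> l"
  interpret finite_measure "laplace_plane s1 s2" using s by (intro finite_measure_laplace_plane)
  have xp: "x n > 0" for n using x by simp
  have "(\<lambda>n. pgf_laplace s1 s2 (x n)) \<longlonglongrightarrow> pgf_laplace s1 s2 l"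
    unfolding pgf_laplace_def
  proof (rule integral_dominated_convergence[where w = "\<lambda>_. 1"])
    show "(\<lambda>y. pgf l (max 0 (fst y)) (max 0 (snd y))) \<in> borel_measurable (laplace_plane s1 s2)"
      "\<And>n. (\<lambda>y. pgf (x n) (max 0 (fst y)) (max 0 (snd y))) \<in> borel_measurable (laplace_plane s1 s2)"
      using pgf_measurable2[of l] pgf_measurable2[OF xp] l by auto
    show "AE y in laplace_plane s1 s2. (\<lambda>n. pgf (x n) (max 0 (fst y)) (max 0 (snd y))) \<longlonglongrightarrow> pgf l (max 0 (fst y)) (max 0 (snd y))"
    proof (rule AE_I2)
      fix y :: "real \<times> real"
      have "continuous_on {0<..} (\<lambda>l. (\<lambda>(l, a, b). pgf l a b) (l, max 0 (fst y), max 0 (snd y)))"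
        by (intro continuous_on_compose2[OF pgf_continuous] continuous_intros) auto
      then show "(\<lambda>n. pgf (x n) (max 0 (fst y)) (max 0 (snd y))) \<longlonglongrightarrow> pgf l (max 0 (fst y)) (max 0 (snd y))"
        using l x lim unfolding continuous_on_sequentially o_def by auto
    qed
    show "AE y in laplace_plane s1 s2. norm (pgf (x n) (max 0 (fst y)) (max 0 (snd y))) \<le> 1" for n
      using pgf_01[OF xp] by (intro AE_I2) auto
  qed simp
  then show "(pgf_laplace s1 s2 \<circ> x) \<longlonglongrightarrow> pgf_laplace s1 s2 l" by (simp add: o_def)
qed

text \<open>The transform in both times replaces the fractional integrals by the factor
  \<open>s1 powr (- \<alpha>1) * s2 powr (- \<alpha>2)\<close> and the constant 1 by
  \<open>1 / (s1 * s2)\<close>. What is left is an integral equation in \<open>l\<close>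
  alone.\<close>

lemma pgf_laplace_equation:
  assumes s: "s1 > 0" "s2 > 0" and l: "0 < l0" "l0 \<le> l1"
  defines "w \<equiv> (1 - z) powr \<beta> * (s1 powr (- \<alpha>1) * s2 powr (- \<alpha>2))"
  shows "(\<integral> l. \<beta> / clamp_real l0 l1 l * (1 / (s1 * s2) - pgf_laplace s1 s2 (clamp_real l0 l1 l)) \<partial>Icc_measure l0 l1)
    = w * (l1 powr \<beta> * pgf_laplace s1 s2 l1 - l0 powr \<beta> * pgf_laplace s1 s2 l0)"
proof -
  let ?N = "Icc_measure l0 l1" and ?\<Lambda> = "laplace_plane s1 s2" and ?c = "clamp_real l0 l1"
  let ?g = "\<lambda>l x. pgf l (max 0 (fst x)) (max 0 (snd x))"
  let ?\<Gamma> = "pgf_laplace s1 s2"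
  interpret N: finite_measure ?N by (rule finite_measure_Icc_measure)
  interpret \<Lambda>: finite_measure ?\<Lambda> using s by (intro finite_measure_laplace_plane)
  interpret N\<Lambda>: pair_sigma_finite ?N ?\<Lambda> ..
  have l1: "l1 > 0" using l by simp
  have cpos: "?c l > 0" "?c l \<ge> l0" for l using clamp_real_in[OF l(2), of l] l by auto
  have \<beta>c: "0 \<le> \<beta> / ?c l" "\<beta> / ?c l \<le> \<beta> / l0" for l
    using \<beta> l cpos[of l] by (auto intro!: divide_left_mono)
  have cm[measurable]: "?c \<in> borel_measurable borel" unfolding clamp_real_def by measurable
  note gm[measurable] = pgf_measurable[OF l] pgf_measurable2[OF l(1)] pgf_measurable2[OF l1]
  have g01: "0 \<le> ?g l x" "?g l x \<le> 1" if "l > 0" for l x using pgf_01[OF that] by auto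
  have \<Gamma>m[measurable]: "(\<lambda>l. ?\<Gamma> (?c l)) \<in> borel_measurable borel"
  proof -
    have "(\<lambda>l. \<integral> x. (\<lambda>(l, x). pgf (?c l) (max 0 (fst x)) (max 0 (snd x))) (l, x) \<partial>?\<Lambda>) \<in> borel_measurable borel"
      by (rule \<Lambda>.borel_measurable_lebesgue_integral) measurable
    then show ?thesis by (simp add: pgf_laplace_def)
  qed
  have nn\<Gamma>: "(\<integral>\<^sup>+ x. ennreal (?g l x) \<partial>?\<Lambda>) = ennreal (?\<Gamma> l)" if "l > 0" for l
    unfolding pgf_laplace_def using g01[OF that] pgf_integrable[OF s that] by (intro nn_integral_eq_integral) auto
  have J: "(\<integral>\<^sup>+ t. (\<integral>\<^sup>+ x. ennreal (?g l x) \<partial>rl_rectangle \<alpha>1 \<alpha>2 (fst t) (snd t)) \<partial>?\<Lambda>)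
      = ennreal (s1 powr (- \<alpha>1) * s2 powr (- \<alpha>2) * ?\<Gamma> l)" if "l > 0" for l
    using nn_integral_laplace_rl_rectangle[OF \<alpha>1(1) \<alpha>2(1) s, of "\<lambda>x. ennreal (?g l x)"] pgf_measurable2[OF that]
      pgf_laplace_bounds[OF s that] by (simp add: nn\<Gamma>[OF that] ennreal_mult')
  define I where "I t = (\<integral>\<^sup>+ l. ennreal (\<beta> / ?c l * (1 - ?g (?c l) t)) \<partial>?N)" for t
  define Jn where "Jn l t = (\<integral>\<^sup>+ x. ennreal (?g l x) \<partial>rl_rectangle \<alpha>1 \<alpha>2 (fst t) (snd t))" for l t
  have Jm[measurable]: "Jn l \<in> borel_measurable (borel \<Otimes>\<^sub>M borel)" if "l > 0" for l
  proof -
    note [measurable] = pgf_measurable2[OF that]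
    have "(\<lambda>t. \<integral>\<^sup>+ a. (\<integral>\<^sup>+ b. ennreal (?g l (a, b)) \<partial>rl_measure \<alpha>2 (snd t)) \<partial>rl_measure \<alpha>1 (fst t)) \<in> borel_measurable (borel \<Otimes>\<^sub>M borel)"
      by measurable
    then show ?thesis unfolding Jn_def[abs_def]
      by (subst nn_integral_rl_rectangle[OF \<alpha>1(1) \<alpha>2(1)]) (auto intro: measurable_compose[OF pgf_measurable2[OF that]])
  qed
  have Im[measurable]: "I \<in> borel_measurable (borel \<Otimes>\<^sub>M borel)"
    unfolding I_def[abs_def] by measurable
  \<comment> \<open>The term at \<open>l0\<close> is moved to the left, so that all terms are
    nonnegative and Tonelli applies in \<open>ennreal\<close> without integrability conditions; the
    return to real numbers comes only at the end.\<close>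
  have eq: "I t + ennreal ((1 - z) powr \<beta> * l0 powr \<beta>) * Jn l0 t = ennreal ((1 - z) powr \<beta> * l1 powr \<beta>) * Jn l1 t"
    if t: "0 < fst t" "0 < snd t" for t
  proof -
    let ?Q = "rl_rectangle \<alpha>1 \<alpha>2 (fst t) (snd t)" and ?c1 = "clamp_real 0 (fst t)" and ?c2 = "clamp_real 0 (snd t)"
    interpret Q: finite_measure ?Q using \<alpha>1 \<alpha>2 by (intro finite_measure_rl_rectangle) auto
    have jint: "integrable ?Q (?g l)" if "l > 0" for l
      using pgf_measurable2[OF that] g01[OF that] by (intro Q.integrable_const_bound[where B = 1] AE_I2) auto
    have jn: "Jn l t = ennreal (\<integral> x. ?g l x \<partial>?Q)" "(\<integral> x. ?g l x \<partial>?Q) \<ge> 0" if "l > 0" for l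
      unfolding Jn_def using jint[OF that] g01[OF that] by (auto intro!: nn_integral_eq_integral integral_nonneg_AE)
    have ib: "0 \<le> \<beta> / ?c l * (1 - ?g (?c l) t)" "\<beta> / ?c l * (1 - ?g (?c l) t) \<le> \<beta> / l0 * 1" for l
    proof -
      have "0 \<le> 1 - ?g (?c l) t" "1 - ?g (?c l) t \<le> 1" using g01[OF cpos(1), of l t] by auto
      then show "0 \<le> \<beta> / ?c l * (1 - ?g (?c l) t)" "\<beta> / ?c l * (1 - ?g (?c l) t) \<le> \<beta> / l0 * 1"
        using \<beta>c[of l] by (auto simp only: intro!: mult_nonneg_nonneg mult_mono order_trans[OF \<beta>c(1) \<beta>c(2)])
    qed
    have iint: "integrable ?N (\<lambda>l. \<beta> / ?c l * (1 - ?g (?c l) t))"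
    proof (rule N.integrable_const_bound[where B = "\<beta> / l0"])
      have "(\<lambda>l. (\<lambda>(l, x). ?g (?c l) x) (l, t)) \<in> borel_measurable borel"
        by (rule measurable_compose[OF _ gm(1)]) (simp add: borel_prod)
      then have [measurable]: "(\<lambda>l. ?g (?c l) t) \<in> borel_measurable borel" by simp
      show "(\<lambda>l. \<beta> / ?c l * (1 - ?g (?c l) t)) \<in> borel_measurable ?N" by measurable
      show "AE l in ?N. norm (\<beta> / ?c l * (1 - ?g (?c l) t)) \<le> \<beta> / l0"
        using ib by (intro AE_I2) (simp only: real_norm_def abs_of_nonneg mult_1_right)
    qed
    have i: "I t = ennreal (\<integral> l. \<beta> / ?c l * (1 - ?g (?c l) t) \<partial>?N)" "(\<integral> l. \<beta> / ?c l * (1 - ?g (?c l) t) \<partial>?N) \<ge> 0"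
      unfolding I_def using iint ib by (auto intro!: nn_integral_eq_integral integral_nonneg_AE)
    have "(\<integral> l. \<beta> / ?c l * (1 - ?g (?c l) t) \<partial>?N) = (1 - z) powr \<beta> * (\<integral> (a, b). l1 powr \<beta> * pgf l1 (?c1 a) (?c2 b) - l0 powr \<beta> * pgf l0 (?c1 a) (?c2 b) \<partial>?Q)"
      using system_pgf_integrated[OF \<alpha>1 \<alpha>2 \<beta> sys z l t] t by simp
    also have "(\<integral> (a, b). l1 powr \<beta> * pgf l1 (?c1 a) (?c2 b) - l0 powr \<beta> * pgf l0 (?c1 a) (?c2 b) \<partial>?Q)
        = (\<integral> x. l1 powr \<beta> * ?g l1 x - l0 powr \<beta> * ?g l0 x \<partial>?Q)"
    proof (rule integral_cong_AE)
      have *: "(\<lambda>x. pgf l (?c1 (fst x)) (?c2 (snd x))) \<in> borel_measurable (borel \<Otimes>\<^sub>M borel)" if "l > 0" for l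
      proof -
        have "(\<lambda>x. (\<lambda>(l', a, b). pgf (clamp_real l l l') (?c1 a) (?c2 b)) (l, fst x, snd x)) \<in> borel_measurable (borel \<Otimes>\<^sub>M borel)"
          by (rule measurable_compose[OF _ clamped_measurable[OF pgf_continuous that order_refl]]) (use t in auto)
        then show ?thesis by (simp add: clamp_real_id)
      qed
      show "(\<lambda>(a, b). l1 powr \<beta> * pgf l1 (?c1 a) (?c2 b) - l0 powr \<beta> * pgf l0 (?c1 a) (?c2 b)) \<in> borel_measurable ?Q"
        using *[OF l1] *[OF l(1)] by (simp add: case_prod_unfold)
      show "AE x in ?Q. (case x of (a, b) \<Rightarrow> l1 powr \<beta> * pgf l1 (?c1 a) (?c2 b) - l0 powr \<beta> * pgf l0 (?c1 a) (?c2 b))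
          = l1 powr \<beta> * ?g l1 x - l0 powr \<beta> * ?g l0 x"
        using AE_rl_rectangle[OF \<alpha>1(1) \<alpha>2(1), of "fst t" "snd t"]
        by eventually_elim (auto simp: clamp_real_id)
    qed auto
    also have "\<dots> = l1 powr \<beta> * (\<integral> x. ?g l1 x \<partial>?Q) - l0 powr \<beta> * (\<integral> x. ?g l0 x \<partial>?Q)"
      using jint[OF l1] jint[OF l(1)] by simp
    finally have "(\<integral> l. \<beta> / ?c l * (1 - ?g (?c l) t) \<partial>?N) + (1 - z) powr \<beta> * l0 powr \<beta> * (\<integral> x. ?g l0 x \<partial>?Q)
        = (1 - z) powr \<beta> * l1 powr \<beta> * (\<integral> x. ?g l1 x \<partial>?Q)" by (simp add: right_diff_distrib mult.assoc)
    then show ?thesis unfolding i(1) jn(1)[OF l1] jn(1)[OF l(1)]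
      using i(2) jn(2)[OF l1] jn(2)[OF l(1)]
      by (simp only: ennreal_mult'[symmetric] ennreal_plus[symmetric] mult_nonneg_nonneg powr_ge_zero)
  qed
  have nI: "(\<integral>\<^sup>+ t. I t \<partial>?\<Lambda>) = ennreal (\<integral> l. \<beta> / ?c l * (1 / (s1 * s2) - ?\<Gamma> (?c l)) \<partial>?N)"
    and IN: "0 \<le> (\<integral> l. \<beta> / ?c l * (1 / (s1 * s2) - ?\<Gamma> (?c l)) \<partial>?N)"
  proof -
    have inn: "0 \<le> \<beta> / ?c l * (1 / (s1 * s2) - ?\<Gamma> (?c l))" for l
      using \<beta> cpos[of l] pgf_laplace_bounds[OF s cpos(1), of l] by (intro mult_nonneg_nonneg) auto
    have ib: "\<beta> / ?c l * (1 / (s1 * s2) - ?\<Gamma> (?c l)) \<le> \<beta> / l0 * (1 / (s1 * s2))" for l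
      using \<beta>c[of l] pgf_laplace_bounds[OF s cpos(1), of l] by (intro mult_mono order_trans[OF \<beta>c(1) \<beta>c(2)]) auto
    have "(\<integral>\<^sup>+ t. I t \<partial>?\<Lambda>) = (\<integral>\<^sup>+ l. (\<integral>\<^sup>+ t. ennreal (\<beta> / ?c l * (1 - ?g (?c l) t)) \<partial>?\<Lambda>) \<partial>?N)"
      unfolding I_def by (rule N\<Lambda>.Fubini') measurable
    also have "\<dots> = (\<integral>\<^sup>+ l. ennreal (\<beta> / ?c l * (1 / (s1 * s2) - ?\<Gamma> (?c l))) \<partial>?N)"
    proof (intro nn_integral_cong)
      fix l
      have "(\<integral> t. 1 \<partial>?\<Lambda>) = 1 / (s1 * s2)" using laplace_plane_mass[OF s] s by (simp add: measure_def)
      then have "(\<integral> t. \<beta> / ?c l * (1 - ?g (?c l) t) \<partial>?\<Lambda>) = \<beta> / ?c l * (1 / (s1 * s2) - ?\<Gamma> (?c l))"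
        using pgf_integrable[OF s cpos(1), of l] by (subst integral_mult_right_zero) (simp add: pgf_laplace_def)
      moreover have "(\<integral>\<^sup>+ t. ennreal (\<beta> / ?c l * (1 - ?g (?c l) t)) \<partial>?\<Lambda>) = ennreal (\<integral> t. \<beta> / ?c l * (1 - ?g (?c l) t) \<partial>?\<Lambda>)"
        using \<beta> cpos[of l] g01[OF cpos(1), of l] pgf_integrable[OF s cpos(1), of l]
        by (intro nn_integral_eq_integral integrable_mult_right Bochner_Integration.integrable_diff AE_I2 mult_nonneg_nonneg) auto
      ultimately show "(\<integral>\<^sup>+ t. ennreal (\<beta> / ?c l * (1 - ?g (?c l) t)) \<partial>?\<Lambda>) = ennreal (\<beta> / ?c l * (1 / (s1 * s2) - ?\<Gamma> (?c l)))"
        by (simp only:)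
    qed
    also have "\<dots> = ennreal (\<integral> l. \<beta> / ?c l * (1 / (s1 * s2) - ?\<Gamma> (?c l)) \<partial>?N)"
    proof (rule nn_integral_eq_integral)
      show "integrable ?N (\<lambda>l. \<beta> / ?c l * (1 / (s1 * s2) - ?\<Gamma> (?c l)))"
      proof (rule N.integrable_const_bound[where B = "\<beta> / l0 * (1 / (s1 * s2))"])
        show "AE l in ?N. norm (\<beta> / ?c l * (1 / (s1 * s2) - ?\<Gamma> (?c l))) \<le> \<beta> / l0 * (1 / (s1 * s2))"
          using inn ib by (intro AE_I2) (simp only: real_norm_def abs_of_nonneg)
      qed measurable
    qed (use inn in auto)
    finally show "(\<integral>\<^sup>+ t. I t \<partial>?\<Lambda>) = ennreal (\<integral> l. \<beta> / ?c l * (1 / (s1 * s2) - ?\<Gamma> (?c l)) \<partial>?N)" .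
    show "0 \<le> (\<integral> l. \<beta> / ?c l * (1 / (s1 * s2) - ?\<Gamma> (?c l)) \<partial>?N)" using inn by (intro integral_nonneg_AE AE_I2)
  qed
  note [measurable] = Jm[OF l1] Jm[OF l(1)]
  have "(\<integral>\<^sup>+ t. I t \<partial>?\<Lambda>) + ennreal ((1 - z) powr \<beta> * l0 powr \<beta>) * (\<integral>\<^sup>+ t. Jn l0 t \<partial>?\<Lambda>)
      = (\<integral>\<^sup>+ t. I t + ennreal ((1 - z) powr \<beta> * l0 powr \<beta>) * Jn l0 t \<partial>?\<Lambda>)"
    by (subst nn_integral_add) (auto simp: nn_integral_cmult)
  also have "\<dots> = (\<integral>\<^sup>+ t. ennreal ((1 - z) powr \<beta> * l1 powr \<beta>) * Jn l1 t \<partial>?\<Lambda>)"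
  proof (rule nn_integral_cong_AE)
    show "AE t in ?\<Lambda>. I t + ennreal ((1 - z) powr \<beta> * l0 powr \<beta>) * Jn l0 t = ennreal ((1 - z) powr \<beta> * l1 powr \<beta>) * Jn l1 t"
      using AE_laplace_plane[OF s] by eventually_elim (simp only: eq)
  qed
  also have "\<dots> = ennreal ((1 - z) powr \<beta> * l1 powr \<beta>) * (\<integral>\<^sup>+ t. Jn l1 t \<partial>?\<Lambda>)"
    by (rule nn_integral_cmult) measurable
  finally have "ennreal (\<integral> l. \<beta> / ?c l * (1 / (s1 * s2) - ?\<Gamma> (?c l)) \<partial>?N)
      + ennreal ((1 - z) powr \<beta> * l0 powr \<beta> * (s1 powr (- \<alpha>1) * s2 powr (- \<alpha>2) * ?\<Gamma> l0))
      = ennreal ((1 - z) powr \<beta> * l1 powr \<beta> * (s1 powr (- \<alpha>1) * s2 powr (- \<alpha>2) * ?\<Gamma> l1))"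
    unfolding nI Jn_def J[OF l1] J[OF l(1)] by (simp only: ennreal_mult'[symmetric] mult_nonneg_nonneg powr_ge_zero)
  moreover have "0 \<le> (1 - z) powr \<beta> * l0 powr \<beta> * (s1 powr (- \<alpha>1) * s2 powr (- \<alpha>2) * ?\<Gamma> l0)"
    "0 \<le> (1 - z) powr \<beta> * l1 powr \<beta> * (s1 powr (- \<alpha>1) * s2 powr (- \<alpha>2) * ?\<Gamma> l1)"
    using pgf_laplace_bounds[OF s l1] pgf_laplace_bounds[OF s l(1)] by auto
  ultimately have "(\<integral> l. \<beta> / ?c l * (1 / (s1 * s2) - ?\<Gamma> (?c l)) \<partial>?N)
      + (1 - z) powr \<beta> * l0 powr \<beta> * (s1 powr (- \<alpha>1) * s2 powr (- \<alpha>2) * ?\<Gamma> l0)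
      = (1 - z) powr \<beta> * l1 powr \<beta> * (s1 powr (- \<alpha>1) * s2 powr (- \<alpha>2) * ?\<Gamma> l1)"
    using IN by (simp only: ennreal_plus[symmetric] ennreal_inj add_nonneg_nonneg)
  then show ?thesis unfolding w_def by (simp add: right_diff_distrib mult_ac)
qed

end

section \<open>Uniqueness of the generating function\<close>

text \<open>
  In the variable \<open>y = l powr (- \<beta>)\<close> the integrated equation says that \<open>Y = \<Gamma> / y\<close> solves
  \<open>Y' = (Y - b / y) / w\<close>, whose homogeneous solutions \<open>exp (y / w)\<close> are unbounded.
\<close>
lemma bounded_solution_unique:
  fixes \<Gamma> :: "real \<Rightarrow> real"
  assumes w: "w > 0" and \<beta>: "\<beta> > 0" and cont: "continuous_on {0<..} \<Gamma>"
    and bd: "\<And>l. l > 0 \<Longrightarrow> 0 \<le> \<Gamma> l \<and> \<Gamma> l \<le> b"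
    and eq: "\<And>l0 l1. 0 < l0 \<Longrightarrow> l0 \<le> l1 \<Longrightarrow>
       (\<integral> l. \<beta> / clamp_real l0 l1 l * (b - \<Gamma> (clamp_real l0 l1 l)) \<partial>Icc_measure l0 l1)
         = w * (l1 powr \<beta> * \<Gamma> l1 - l0 powr \<beta> * \<Gamma> l0)"
    and l: "l > 0"
  shows "(\<integral>\<^sup>+ v. ennreal (exp (- v / w) / w * (b / v)) * indicator {l powr (- \<beta>)..} v \<partial>lborel)
     = ennreal (exp (- (l powr (- \<beta>)) / w) * (l powr \<beta> * \<Gamma> l))"
proof -
  define h where "h l = \<beta> / l * (b - \<Gamma> l)" for l
  have hc: "continuous_on {0<..} h" unfolding h_def[abs_def] by (intro continuous_intros cont) auto
  have b: "b \<ge> 0" using bd[OF l] by linarith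
  \<comment> \<open>\<open>\<Gamma>\<close> is only known to be continuous. The integral equation
    expresses \<open>l powr \<beta> * \<Gamma> l\<close> through an integral of the continuous
    \<open>h\<close>, which makes this product differentiable; \<open>{l / 2..2 * l}\<close> is
    merely a neighbourhood of \<open>l\<close>.\<close>
  have dY: "((\<lambda>l. l powr \<beta> * \<Gamma> l) has_real_derivative h l / w) (at l)" if l: "l > 0" for l
  proof -
    let ?a = "l / 2" and ?b = "2 * l"
    have hci: "continuous_on {?a..?b} h" using l by (intro continuous_on_subset[OF hc]) auto
    have int: "w * (x powr \<beta> * \<Gamma> x - ?a powr \<beta> * \<Gamma> ?a) = integral {?a..x} h" if x: "x \<in> {?a..?b}" for x
    proof -
      have cm[measurable]: "clamp_real ?a x \<in> borel_measurable borel" unfolding clamp_real_def by measurable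
      have "continuous_on UNIV (\<lambda>r. \<Gamma> (clamp_real ?a x r))"
        by (intro continuous_on_compose2[OF cont] continuous_intros) (use l x in \<open>auto simp: clamp_real_def\<close>)
      then have [measurable]: "(\<lambda>r. \<Gamma> (clamp_real ?a x r)) \<in> borel_measurable borel" by (rule borel_measurable_continuous_onI)
      have "w * (x powr \<beta> * \<Gamma> x - ?a powr \<beta> * \<Gamma> ?a)
        = (\<integral> r. \<beta> / clamp_real ?a x r * (b - \<Gamma> (clamp_real ?a x r)) \<partial>Icc_measure ?a x)"
        using l x by (intro eq[symmetric]) auto
      also have "\<dots> = (\<integral> r. indicator {?a..x} r * (\<beta> / clamp_real ?a x r * (b - \<Gamma> (clamp_real ?a x r))) \<partial>lborel)"
        by (rule integral_Icc_measure) measurable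
      also have "\<dots> = (LINT r:{?a..x}|lborel. h r)"
        unfolding set_lebesgue_integral_def by (intro Bochner_Integration.integral_cong) (auto simp: indicator_def clamp_real_id h_def)
      also have "\<dots> = integral {?a..x} h"
        by (rule set_borel_integral_eq_integral[OF borel_integrable_atLeastAtMost'])
           (use x in \<open>auto intro: continuous_on_subset[OF hci]\<close>)
      finally show ?thesis .
    qed
    have "((\<lambda>x. integral {?a..x} h) has_real_derivative h l) (at l within {?a..?b})"
      by (rule integral_has_real_derivative[OF hci]) (use l in auto)
    then have "((\<lambda>x. integral {?a..x} h) has_real_derivative h l) (at l)"
      using l by (simp add: at_within_Icc_at)
    then have "((\<lambda>x. ?a powr \<beta> * \<Gamma> ?a + integral {?a..x} h / w) has_real_derivative 0 + h l / w) (at l)"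
      by (intro DERIV_add DERIV_const DERIV_cdivide)
    moreover have "eventually (\<lambda>x. x powr \<beta> * \<Gamma> x = ?a powr \<beta> * \<Gamma> ?a + integral {?a..x} h / w) (nhds l)"
    proof -
      have "eventually (\<lambda>x. x \<in> {?a<..<?b}) (nhds l)" using l by (intro eventually_nhds_in_open) auto
      then show ?thesis
      proof eventually_elim
        case (elim x)
        then show ?case using int[of x] w by (simp add: field_simps)
      qed
    qed
    ultimately show ?thesis using DERIV_cong_ev[OF refl _ refl, of "\<lambda>x. x powr \<beta> * \<Gamma> x"] by (simp only: add_0)
  qed
  \<comment> \<open>The inverse of \<open>y = l powr (- \<beta>)\<close>.\<close>
  define L where "L v = v powr (- 1 / \<beta>)" for v
  have Lpos: "L v > 0" if "v > 0" for v using that by (simp add: L_def)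
  have Lb: "L v powr \<beta> = 1 / v" if "v > 0" for v
    unfolding L_def powr_powr using that \<beta> by (simp add: powr_minus_divide)
  have dL: "(L has_real_derivative (- 1 / \<beta>) * v powr (- 1 / \<beta> - 1)) (at v)" if "v > 0" for v
    unfolding L_def[abs_def] by (rule has_real_derivative_powr[OF that])
  \<comment> \<open>Minus the solution \<open>Y\<close> times the integrating factor
    \<open>exp (- v / w)\<close>. Its derivative no longer contains \<open>\<Gamma>\<close>, and by
    \<open>\<Gamma> \<le> b\<close> it tends to 0 at infinity, so integration from
    \<open>l powr (- \<beta>)\<close> to infinity leaves only the value at the lower end.\<close>
  define F where "F v = - (exp (- v / w) * (L v powr \<beta> * \<Gamma> (L v)))" for v
  have dF: "(F has_real_derivative exp (- v / w) / w * (b / v)) (at v)" if v: "v > 0" for v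
  proof -
    have e: "((\<lambda>v. exp (- v / w)) has_real_derivative - (exp (- v / w) / w)) (at v)"
      using w by (auto intro!: derivative_eq_intros)
    note Y = DERIV_chain2[OF dY[OF Lpos[OF v]] dL[OF v]]
    have hL: "h (L v) / w * ((- 1 / \<beta>) * v powr (- 1 / \<beta> - 1)) = - ((b - \<Gamma> (L v)) / (w * v))"
    proof -
      have pv: "v powr (- 1 / \<beta> - 1) = L v / v" using v by (simp add: L_def powr_diff)
      show ?thesis unfolding pv using Lpos[OF v] \<beta> w v by (simp add: h_def field_simps)
    qed
    have "(F has_real_derivative - (- (exp (- v / w) / w) * (L v powr \<beta> * \<Gamma> (L v)) + h (L v) / w * ((- 1 / \<beta>) * v powr (- 1 / \<beta> - 1)) * exp (- v / w))) (at v)"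
      unfolding F_def[abs_def] by (rule DERIV_minus[OF DERIV_mult[OF e Y]])
    also have "- (- (exp (- v / w) / w) * (L v powr \<beta> * \<Gamma> (L v)) + h (L v) / w * ((- 1 / \<beta>) * v powr (- 1 / \<beta> - 1)) * exp (- v / w))
       = exp (- v / w) / w * (b / v)"
      unfolding hL Lb[OF v] using v w by (simp add: field_simps)
    finally show ?thesis .
  qed
  let ?y = "l powr (- \<beta>)"
  have y: "?y > 0" using l by simp
  have lim: "(F \<longlongrightarrow> 0) at_top"
  proof (rule Lim_null_comparison)
    show "eventually (\<lambda>v. norm (F v) \<le> exp (- v / w) * b) at_top"
      using eventually_ge_at_top[of 1]
    proof eventually_elim
      case (elim v)
      then have v: "v > 0" by simp
      have "norm (F v) = exp (- v / w) * (1 / v * \<Gamma> (L v))"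
        using bd[OF Lpos[OF v]] v by (simp add: F_def Lb[OF v] abs_mult)
      also have "\<dots> \<le> exp (- v / w) * (1 * b)"
        using bd[OF Lpos[OF v]] elim by (intro mult_left_mono mult_mono) auto
      finally show ?case by simp
    qed
    have "((\<lambda>v. exp (- v / w)) \<longlongrightarrow> 0) at_top"
    proof (rule filterlim_compose[OF exp_at_bot])
      have "LIM v at_top. v * (1 / w) :> at_top"
        by (rule filterlim_at_top_mult_tendsto_pos[OF tendsto_const]) (use w in \<open>auto simp: filterlim_ident\<close>)
      then show "LIM v at_top. - v / w :> at_bot" by (simp add: filterlim_uminus_at_bot)
    qed
    then show "((\<lambda>v. exp (- v / w) * b) \<longlongrightarrow> 0) at_top" by (rule tendsto_mult_left_zero)
  qed
  have "(\<integral>\<^sup>+ v. ennreal (exp (- v / w) / w * (b / v)) * indicator {?y..} v \<partial>lborel) = ennreal (0 - F ?y)"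
  proof (rule nn_integral_FTC_atLeast[OF _ _ _ lim])
    show "(\<lambda>v. exp (- v / w) / w * (b / v)) \<in> borel_measurable borel" by measurable
    show "(F has_real_derivative exp (- x / w) / w * (b / x)) (at x)" if "?y \<le> x" for x
      using that y by (intro dF) linarith
    show "0 \<le> exp (- x / w) / w * (b / x)" if "?y \<le> x" for x
    proof -
      have "x > 0" using that y by linarith
      then show ?thesis using w b by simp
    qed
  qed
  moreover have "L ?y = l" using l \<beta> by (simp add: L_def powr_powr)
  ultimately show ?thesis by (simp add: F_def)
qed

text \<open>Separate continuity and boundedness suffice to treat an iterated transform as two
  successive one-dimensional ones: by dominated convergence the inner transform \<open>I\<close> is
  continuous in the outer variable, hence measurable.\<close>

lemma separately_continuous_iterated_laplace:
  fixes f :: "real \<Rightarrow> real \<Rightarrow> real"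
  assumes c1: "\<And>b. b > 0 \<Longrightarrow> continuous_on {0<..} (\<lambda>a. f a b)" and c2: "\<And>a. a > 0 \<Longrightarrow> continuous_on {0<..} (f a)"
    and bd: "\<And>a b. a > 0 \<Longrightarrow> b > 0 \<Longrightarrow> 0 \<le> f a b \<and> f a b \<le> 1" and s2: "s2 > 0"
  defines "I \<equiv> \<lambda>a. indicator {0<..} a * (\<integral> b. indicator {0<..} b * f a b \<partial>laplace_measure s2)"
  shows "continuous_on {0<..} I" and "I \<in> borel_measurable borel" and "\<And>a. 0 \<le> I a \<and> I a \<le> 1 / s2"
    and "\<And>s1. s1 > 0 \<Longrightarrow> (\<integral>\<^sup>+ a. (\<integral>\<^sup>+ b. ennreal (f a b) \<partial>laplace_measure s2) \<partial>laplace_measure s1) = ennreal (\<integral> a. I a \<partial>laplace_measure s1)"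
proof -
  interpret L2: finite_measure "laplace_measure s2" using s2 by (rule finite_measure_laplace_measure)
  have mb[measurable]: "(\<lambda>b. indicator {0<..} b * f a b) \<in> borel_measurable borel" if "a > 0" for a
    using borel_measurable_continuous_on_indicator[OF _ c2[OF that]] by simp
  have b01: "0 \<le> indicator {0<..} b * f a b" "indicator {0<..} b * f a b \<le> 1" if "a > 0" for a b
    using bd[OF that, of b] by (auto simp: indicator_def)
  have int: "integrable (laplace_measure s2) (\<lambda>b. indicator {0<..} b * f a b)" if "a > 0" for a
    by (rule L2.integrable_const_bound[where B = 1]) (use b01[OF that] mb[OF that] in auto)
  have mass: "(\<integral> b. 1 \<partial>laplace_measure s2) = 1 / s2" using emeasure_laplace_measure[OF s2] s2 by (simp add: measure_def)
  have Ib: "0 \<le> (\<integral> b. indicator {0<..} b * f a b \<partial>laplace_measure s2)" "(\<integral> b. indicator {0<..} b * f a b \<partial>laplace_measure s2) \<le> 1 / s2" if "a > 0" for a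
  proof -
    show "0 \<le> (\<integral> b. indicator {0<..} b * f a b \<partial>laplace_measure s2)" using b01[OF that] by (intro integral_nonneg_AE AE_I2)
    have "(\<integral> b. indicator {0<..} b * f a b \<partial>laplace_measure s2) \<le> (\<integral> b. 1 \<partial>laplace_measure s2)"
      using b01[OF that] int[OF that] by (intro integral_mono) auto
    then show "(\<integral> b. indicator {0<..} b * f a b \<partial>laplace_measure s2) \<le> 1 / s2" unfolding mass .
  qed
  show I01: "0 \<le> I a \<and> I a \<le> 1 / s2" for a using Ib[of a] s2 by (auto simp: I_def indicator_def)
  have cont: "continuous_on {0<..} (\<lambda>a. \<integral> b. indicator {0<..} b * f a b \<partial>laplace_measure s2)"
    unfolding continuous_on_sequentially
  proof (intro allI ballI impI, elim conjE)
    fix x :: "nat \<Rightarrow> real" and a :: real assume a: "a \<in> {0<..}" and x: "\<forall>n. x n \<in> {0<..}" and lim: "x \<longlonglongrightarrow> a"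
    have xp: "x n > 0" for n using x by simp
    have "(\<lambda>n. \<integral> b. indicator {0<..} b * f (x n) b \<partial>laplace_measure s2) \<longlonglongrightarrow> (\<integral> b. indicator {0<..} b * f a b \<partial>laplace_measure s2)"
    proof (rule integral_dominated_convergence[where w = "\<lambda>_. 1"])
      show "AE b in laplace_measure s2. (\<lambda>n. indicator {0<..} b * f (x n) b) \<longlonglongrightarrow> indicator {0<..} b * f a b"
        using AE_laplace_measure[of s2]
      proof eventually_elim
        case (elim b)
        have "((\<lambda>a. f a b) \<circ> x) \<longlonglongrightarrow> f a b" using c1[OF elim] a x lim unfolding continuous_on_sequentially by blast
        then show ?case using elim by (simp add: o_def)
      qed
      show "AE b in laplace_measure s2. norm (indicator {0<..} b * f (x n) b) \<le> 1" for n
        using b01[OF xp, of _ n] by (intro AE_I2) (simp only: real_norm_def abs_of_nonneg)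
    qed (use mb[OF xp] mb[of a] a in auto)
    then show "((\<lambda>a. \<integral> b. indicator {0<..} b * f a b \<partial>laplace_measure s2) \<circ> x) \<longlonglongrightarrow> (\<integral> b. indicator {0<..} b * f a b \<partial>laplace_measure s2)"
      by (simp add: o_def)
  qed
  then show "continuous_on {0<..} I" by (rule continuous_on_eq) (simp add: I_def)
  show Im: "I \<in> borel_measurable borel"
    using borel_measurable_continuous_on_indicator[OF _ cont] by (simp add: I_def)
  fix s1 :: real assume s1: "s1 > 0"
  have "(\<integral>\<^sup>+ a. (\<integral>\<^sup>+ b. ennreal (f a b) \<partial>laplace_measure s2) \<partial>laplace_measure s1) = (\<integral>\<^sup>+ a. ennreal (I a) \<partial>laplace_measure s1)"
  proof (rule nn_integral_cong_AE)
    show "AE a in laplace_measure s1. (\<integral>\<^sup>+ b. ennreal (f a b) \<partial>laplace_measure s2) = ennreal (I a)"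
      using AE_laplace_measure[of s1]
    proof eventually_elim
      case (elim a)
      have "(\<integral>\<^sup>+ b. ennreal (f a b) \<partial>laplace_measure s2) = (\<integral>\<^sup>+ b. ennreal (indicator {0<..} b * f a b) \<partial>laplace_measure s2)"
        by (rule nn_integral_cong_AE) (use AE_laplace_measure[of s2] in \<open>auto elim!: eventually_mono\<close>)
      also have "\<dots> = ennreal (\<integral> b. indicator {0<..} b * f a b \<partial>laplace_measure s2)"
        using b01[OF elim] int[OF elim] by (intro nn_integral_eq_integral AE_I2)
      finally show ?case using elim by (simp add: I_def)
    qed
  qed
  also have "\<dots> = ennreal (\<integral> a. I a \<partial>laplace_measure s1)"
    using I01 Im by (intro nn_integral_eq_integral integrable_laplace_measure_bounded[OF s1, where K = "1 / s2"]) auto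
  finally show "(\<integral>\<^sup>+ a. (\<integral>\<^sup>+ b. ennreal (f a b) \<partial>laplace_measure s2) \<partial>laplace_measure s1) = ennreal (\<integral> a. I a \<partial>laplace_measure s1)" .
qed

text \<open>Injectivity in one variable is applied twice: for fixed \<open>s2\<close> to the inner
  transforms as functions of the first variable, then at fixed \<open>t1\<close> to \<open>f\<close>
  and \<open>g\<close> as functions of the second.\<close>

lemma laplace_injective_2:
  fixes f g :: "real \<Rightarrow> real \<Rightarrow> real"
  assumes f: "\<And>b. b > 0 \<Longrightarrow> continuous_on {0<..} (\<lambda>a. f a b)" "\<And>a. a > 0 \<Longrightarrow> continuous_on {0<..} (f a)"
      "\<And>a b. a > 0 \<Longrightarrow> b > 0 \<Longrightarrow> 0 \<le> f a b \<and> f a b \<le> 1"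
    and g: "\<And>b. b > 0 \<Longrightarrow> continuous_on {0<..} (\<lambda>a. g a b)" "\<And>a. a > 0 \<Longrightarrow> continuous_on {0<..} (g a)"
      "\<And>a b. a > 0 \<Longrightarrow> b > 0 \<Longrightarrow> 0 \<le> g a b \<and> g a b \<le> 1"
    and eq: "\<And>s1 s2. s1 > 0 \<Longrightarrow> s2 > 0 \<Longrightarrow>
       (\<integral>\<^sup>+ a. (\<integral>\<^sup>+ b. ennreal (f a b) \<partial>laplace_measure s2) \<partial>laplace_measure s1) =
       (\<integral>\<^sup>+ a. (\<integral>\<^sup>+ b. ennreal (g a b) \<partial>laplace_measure s2) \<partial>laplace_measure s1)"
    and t: "t1 > 0" "t2 > 0"
  shows "f t1 t2 = g t1 t2"
proof -
  define I where "I s2 f a = indicator {0<..} a * (\<integral> b. indicator {0<..} b * f a b \<partial>laplace_measure s2)"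
    for s2 a and f :: "real \<Rightarrow> real \<Rightarrow> real"
  have If: "continuous_on {0<..} (I s2 f)" "I s2 f \<in> borel_measurable borel" "\<And>a. 0 \<le> I s2 f a \<and> I s2 f a \<le> 1 / s2"
      "\<And>s1. s1 > 0 \<Longrightarrow> (\<integral>\<^sup>+ a. (\<integral>\<^sup>+ b. ennreal (f a b) \<partial>laplace_measure s2) \<partial>laplace_measure s1) = ennreal (\<integral> a. I s2 f a \<partial>laplace_measure s1)"
    if "s2 > 0" for s2
    unfolding I_def[abs_def] by (rule separately_continuous_iterated_laplace[OF f that]; assumption)+
  have Ig: "continuous_on {0<..} (I s2 g)" "I s2 g \<in> borel_measurable borel" "\<And>a. 0 \<le> I s2 g a \<and> I s2 g a \<le> 1 / s2"
      "\<And>s1. s1 > 0 \<Longrightarrow> (\<integral>\<^sup>+ a. (\<integral>\<^sup>+ b. ennreal (g a b) \<partial>laplace_measure s2) \<partial>laplace_measure s1) = ennreal (\<integral> a. I s2 g a \<partial>laplace_measure s1)"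
    if "s2 > 0" for s2
    unfolding I_def[abs_def] by (rule separately_continuous_iterated_laplace[OF g that]; assumption)+
  have I_eq: "I s2 f t1 = I s2 g t1" if s2: "s2 > 0" for s2
  proof -
    have "I s2 f t1 - I s2 g t1 = 0"
    proof (rule laplace_injective[where f = "\<lambda>a. I s2 f a - I s2 g a" and K = "1 / s2"])
      show "(\<lambda>a. I s2 f a - I s2 g a) \<in> borel_measurable borel" using If(2)[OF s2] Ig(2)[OF s2] by (rule borel_measurable_diff)
      show "continuous_on {0<..} (\<lambda>a. I s2 f a - I s2 g a)" using If(1)[OF s2] Ig(1)[OF s2] by (intro continuous_intros)
      show "\<bar>I s2 f r - I s2 g r\<bar> \<le> 1 / s2" for r using If(3)[OF s2, of r] Ig(3)[OF s2, of r] by auto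
      fix s1 :: real assume s1: "s1 > 0"
      have i: "integrable (laplace_measure s1) (I s2 f)" "integrable (laplace_measure s1) (I s2 g)"
        using If(2,3)[OF s2] Ig(2,3)[OF s2] by (auto intro!: integrable_laplace_measure_bounded[OF s1, where K = "1 / s2"])
      have "ennreal (\<integral> a. I s2 f a \<partial>laplace_measure s1) = ennreal (\<integral> a. I s2 g a \<partial>laplace_measure s1)"
        using eq[OF s1 s2] If(4)[OF s2 s1] Ig(4)[OF s2 s1] by simp
      moreover have "0 \<le> (\<integral> a. I s2 f a \<partial>laplace_measure s1)" "0 \<le> (\<integral> a. I s2 g a \<partial>laplace_measure s1)"
        using If(3)[OF s2] Ig(3)[OF s2] by (auto intro!: integral_nonneg_AE)
      ultimately show "(\<integral> a. I s2 f a - I s2 g a \<partial>laplace_measure s1) = 0" using i by simp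
    qed (rule t)
    then show ?thesis by simp
  qed
  define D where "D b = indicator {0<..} b * (f t1 b - g t1 b)" for b
  have mf: "(\<lambda>b. indicator {0<..} b * f t1 b) \<in> borel_measurable borel" and mg: "(\<lambda>b. indicator {0<..} b * g t1 b) \<in> borel_measurable borel"
    using borel_measurable_continuous_on_indicator[OF _ f(2)[OF t(1)]] borel_measurable_continuous_on_indicator[OF _ g(2)[OF t(1)]] by simp_all
  have D: "D = (\<lambda>b. indicator {0<..} b * f t1 b - indicator {0<..} b * g t1 b)" by (auto simp: D_def right_diff_distrib)
  have "D t2 = 0"
  proof (rule laplace_injective[where f = D and K = 1])
    show "D \<in> borel_measurable borel" unfolding D using mf mg by measurable
    have "continuous_on {0<..} (\<lambda>b. f t1 b - g t1 b)" using f(2)[OF t(1)] g(2)[OF t(1)] by (intro continuous_intros)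
    then show "continuous_on {0<..} D" by (rule continuous_on_eq) (simp add: D_def)
    show "\<bar>D r\<bar> \<le> 1" if "r > 0" for r using that f(3)[OF t(1) that] g(3)[OF t(1) that] by (simp add: D_def abs_le_iff)
    fix s2 :: real assume s2: "s2 > 0"
    have "integrable (laplace_measure s2) (\<lambda>b. indicator {0<..} b * f t1 b)" "integrable (laplace_measure s2) (\<lambda>b. indicator {0<..} b * g t1 b)"
      using mf mg f(3)[OF t(1)] g(3)[OF t(1)] by (auto intro!: integrable_laplace_measure_bounded[OF s2, where K = 1])
    then show "(\<integral> b. D b \<partial>laplace_measure s2) = 0" using I_eq[OF s2] t unfolding D by (simp add: I_def)
  qed (rule t)
  then show ?thesis using t by (simp add: D_def)
qed

section \<open>Identification of the generating function\<close>

context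
  fixes \<alpha>1 \<alpha>2 \<beta> z l :: real and p :: "real \<Rightarrow> int \<Rightarrow> real \<Rightarrow> real \<Rightarrow> real"
    and M :: "'a measure" and T1 T2 :: "real \<Rightarrow> 'a \<Rightarrow> real"
  assumes \<alpha>1: "0 < \<alpha>1" "\<alpha>1 \<le> 1" and \<alpha>2: "0 < \<alpha>2" "\<alpha>2 \<le> 1" and \<beta>: "0 < \<beta>"
    and sys: "stfprf_system \<alpha>1 \<alpha>2 \<beta> p" and z: "0 \<le> z" "z < 1" and l: "l > 0"
    and M: "prob_space M" and T1: "folded_solution_process M \<alpha>1 T1" and T2: "folded_solution_process M \<alpha>2 T2"
    and ind: "\<And>t1 t2. t1 \<ge> 0 \<Longrightarrow> t2 \<ge> 0 \<Longrightarrow> prob_space.indep_var M borel (T1 t1) borel (T2 t2)"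
begin

text \<open>Uniqueness gives the transform as an integral over \<open>v \<ge> y\<close>, and
  \<open>v = y + c / \<kappa>1 * r\<close> brings it to the form found for the random times. Since
  \<open>w = c / (\<kappa>1 * \<kappa>2)\<close>, the exponent \<open>- v / w\<close> becomes
  \<open>- y / w - \<kappa>2 * r\<close>, and \<open>v\<close> itself is
  \<open>y / \<kappa>1 * (\<kappa>1 + W * r)\<close> with \<open>W = c / y\<close>.\<close>

lemma system_pgf_laplace:
  assumes s: "s1 > 0" "s2 > 0"
  shows "(\<integral>\<^sup>+ t1. (\<integral>\<^sup>+ t2. ennreal (system_pgf z p l t1 t2) \<partial>laplace_measure s2) \<partial>laplace_measure s1)
    = ennreal (s1 powr (\<alpha>1 - 1) * s2 powr (\<alpha>2 - 1)) *
      (\<integral>\<^sup>+ r. ennreal (1 / (s1 powr \<alpha>1 + (l * (1 - z)) powr \<beta> * r)) \<partial>laplace_measure (s2 powr \<alpha>2))"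
proof -
  define \<Gamma> where "\<Gamma> = pgf_laplace z p s1 s2"
  define \<kappa>1 \<kappa>2 c w b y W where "\<kappa>1 = s1 powr \<alpha>1" and "\<kappa>2 = s2 powr \<alpha>2" and "c = (1 - z) powr \<beta>"
    and "w = c * (s1 powr (- \<alpha>1) * s2 powr (- \<alpha>2))" and "b = 1 / (s1 * s2)" and "y = l powr (- \<beta>)"
    and "W = (l * (1 - z)) powr \<beta>"
  have pos: "\<kappa>1 > 0" "\<kappa>2 > 0" "c > 0" "w > 0" "b > 0" "y > 0"
    using s z l by (auto simp: \<kappa>1_def \<kappa>2_def c_def w_def b_def y_def)
  have w\<kappa>: "w = c / (\<kappa>1 * \<kappa>2)" by (simp add: w_def \<kappa>1_def \<kappa>2_def powr_minus_divide)
  have ly: "l powr \<beta> = 1 / y" using l by (simp add: y_def powr_minus_divide)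
  have Wc: "W = c / y" using l z by (simp add: W_def c_def powr_mult ly)
  have "(\<integral>\<^sup>+ v. ennreal (exp (- v / w) / w * (b / v)) * indicator {l powr (- \<beta>)..} v \<partial>lborel)
     = ennreal (exp (- (l powr (- \<beta>)) / w) * (l powr \<beta> * \<Gamma> l))"
  proof (rule bounded_solution_unique[OF pos(4) \<beta> _ _ _ l])
    show "continuous_on {0<..} \<Gamma>" unfolding \<Gamma>_def by (rule pgf_laplace_continuous[OF \<alpha>1 \<alpha>2 \<beta> sys z s])
    show "0 \<le> \<Gamma> l \<and> \<Gamma> l \<le> b" if "l > 0" for l
      using pgf_laplace_bounds[OF \<alpha>1 \<alpha>2 \<beta> sys z s that] by (simp add: \<Gamma>_def b_def)
    show "(\<integral> l. \<beta> / clamp_real l0 l1 l * (b - \<Gamma> (clamp_real l0 l1 l)) \<partial>Icc_measure l0 l1)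
         = w * (l1 powr \<beta> * \<Gamma> l1 - l0 powr \<beta> * \<Gamma> l0)" if "0 < l0" "l0 \<le> l1" for l0 l1
      unfolding \<Gamma>_def b_def w_def c_def by (rule pgf_laplace_equation[OF \<alpha>1 \<alpha>2 \<beta> sys z s that])
  qed
  then have 1: "(\<integral>\<^sup>+ v. ennreal (exp (- v / w) / w * (b / v)) * indicator {y..} v \<partial>lborel) = ennreal (exp (- y / w) / y * \<Gamma> l)"
    by (simp add: y_def[symmetric] ly)
  have c\<kappa>: "c / \<kappa>1 > 0" using pos by simp
  have "(\<integral>\<^sup>+ v. ennreal (exp (- v / w) / w * (b / v)) * indicator {y..} v \<partial>lborel)
     = ennreal (c / \<kappa>1) * (\<integral>\<^sup>+ r. ennreal (exp (- (y + c / \<kappa>1 * r) / w) / w * (b / (y + c / \<kappa>1 * r))) * indicator {y..} (y + c / \<kappa>1 * r) \<partial>lborel)"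
    by (subst nn_integral_real_affine[where c = "c / \<kappa>1" and t = y], measurable, use c\<kappa> in linarith)
       (simp only: abs_of_pos[OF c\<kappa>])
  also have "\<dots> = (\<integral>\<^sup>+ r. ennreal (c / \<kappa>1) * (ennreal (exp (- (y + c / \<kappa>1 * r) / w) / w * (b / (y + c / \<kappa>1 * r))) * indicator {y..} (y + c / \<kappa>1 * r)) \<partial>lborel)"
    by (rule nn_integral_cmult[symmetric]) measurable
  also have "\<dots> = (\<integral>\<^sup>+ r. ennreal (exp (- y / w) / y * (\<kappa>1 * \<kappa>2 * b)) * (ennreal (exp (- \<kappa>2 * r)) * indicator {0<..} r * ennreal (1 / (\<kappa>1 + W * r))) \<partial>lborel)"
  proof (rule nn_integral_cong_AE)
    have "AE r in lborel. r \<noteq> (0::real)" by (rule AE_lborel_singleton)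
    then show "AE r in lborel. ennreal (c / \<kappa>1) * (ennreal (exp (- (y + c / \<kappa>1 * r) / w) / w * (b / (y + c / \<kappa>1 * r))) * indicator {y..} (y + c / \<kappa>1 * r))
      = ennreal (exp (- y / w) / y * (\<kappa>1 * \<kappa>2 * b)) * (ennreal (exp (- \<kappa>2 * r)) * indicator {0<..} r * ennreal (1 / (\<kappa>1 + W * r)))"
    proof eventually_elim
      case (elim r)
      show ?case
      proof (cases "r > 0")
        case True
        have e: "- (y + c / \<kappa>1 * r) / w = - y / w + - \<kappa>2 * r" using pos by (simp add: w\<kappa> field_simps)
        have ee: "exp (- (y + c / \<kappa>1 * r) / w) = exp (- y / w) * exp (- \<kappa>2 * r)" unfolding e exp_add ..
        have d: "b / (y + c / \<kappa>1 * r) = \<kappa>1 * b / y * (1 / (\<kappa>1 + W * r))"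
        proof -
          have "y + c / \<kappa>1 * r = y / \<kappa>1 * (\<kappa>1 + W * r)" using pos by (simp add: Wc field_simps)
          then show ?thesis by (simp only:) simp
        qed
        have "c / \<kappa>1 * (exp (- (y + c / \<kappa>1 * r) / w) / w * (b / (y + c / \<kappa>1 * r)))
           = (exp (- y / w) / y * (\<kappa>1 * \<kappa>2 * b)) * (exp (- \<kappa>2 * r) * (1 / (\<kappa>1 + W * r)))"
          unfolding ee d using pos by (simp add: w\<kappa>)
        moreover have "y \<le> y + c / \<kappa>1 * r" using mult_pos_pos[OF c\<kappa> True] by linarith
        moreover have "W \<ge> 0" using pos by (simp add: Wc)
        ultimately show ?thesis using True pos
          by (simp only: indicator_simps atLeast_iff greaterThan_iff mult_1_right ennreal_mult'[symmetric]
              less_imp_le divide_nonneg_nonneg exp_ge_zero mult_nonneg_nonneg)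
      next
        case False
        then have "r < 0" using elim by simp
        then have "c / \<kappa>1 * r < 0" using c\<kappa> by (rule mult_pos_neg[rotated])
        then have "\<not> y \<le> y + c / \<kappa>1 * r" by simp
        then show ?thesis using False by (simp only: indicator_simps atLeast_iff greaterThan_iff mult_zero_right mult_zero_left not_False_eq_True)
      qed
    qed
  qed
  also have "\<dots> = ennreal (exp (- y / w) / y * (\<kappa>1 * \<kappa>2 * b)) * (\<integral>\<^sup>+ r. ennreal (1 / (\<kappa>1 + W * r)) \<partial>laplace_measure \<kappa>2)"
    by (subst nn_integral_cmult) (auto simp: nn_integral_laplace_measure)
  finally have f: "ennreal (exp (- y / w) / y * \<Gamma> l) = ennreal (exp (- y / w) / y * (\<kappa>1 * \<kappa>2 * b)) * (\<integral>\<^sup>+ r. ennreal (1 / (\<kappa>1 + W * r)) \<partial>laplace_measure \<kappa>2)"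
    unfolding 1 .
  have E0: "0 \<le> exp (- y / w) / y" using pos by simp
  have "ennreal (exp (- y / w) / y) * ennreal (\<Gamma> l) = ennreal (exp (- y / w) / y) * (ennreal (\<kappa>1 * \<kappa>2 * b) * (\<integral>\<^sup>+ r. ennreal (1 / (\<kappa>1 + W * r)) \<partial>laplace_measure \<kappa>2))"
    using f unfolding ennreal_mult'[OF E0] mult.assoc .
  then have 2: "ennreal (\<Gamma> l) = ennreal (\<kappa>1 * \<kappa>2 * b) * (\<integral>\<^sup>+ r. ennreal (1 / (\<kappa>1 + W * r)) \<partial>laplace_measure \<kappa>2)"
    using pos by (subst (asm) ennreal_mult_cancel_left) auto
  have k: "\<kappa>1 * \<kappa>2 * b = s1 powr (\<alpha>1 - 1) * s2 powr (\<alpha>2 - 1)" using s by (simp add: \<kappa>1_def \<kappa>2_def b_def powr_diff)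
  have "(\<integral>\<^sup>+ t1. (\<integral>\<^sup>+ t2. ennreal (system_pgf z p l t1 t2) \<partial>laplace_measure s2) \<partial>laplace_measure s1)
     = (\<integral>\<^sup>+ t1. (\<integral>\<^sup>+ t2. ennreal (system_pgf z p l (max 0 t1) (max 0 t2)) \<partial>laplace_measure s2) \<partial>laplace_measure s1)"
  proof (rule nn_integral_cong_AE)
    show "AE t1 in laplace_measure s1. (\<integral>\<^sup>+ t2. ennreal (system_pgf z p l t1 t2) \<partial>laplace_measure s2)
       = (\<integral>\<^sup>+ t2. ennreal (system_pgf z p l (max 0 t1) (max 0 t2)) \<partial>laplace_measure s2)"
      using AE_laplace_measure[of s1]
    proof eventually_elim
      case (elim t1)
      show ?case using AE_laplace_measure[of s2] elim
        by (intro nn_integral_cong_AE) (auto elim!: eventually_mono simp: max_def)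
    qed
  qed
  also have "\<dots> = (\<integral>\<^sup>+ x. ennreal (system_pgf z p l (max 0 (fst x)) (max 0 (snd x))) \<partial>laplace_plane s1 s2)"
    using pgf_measurable2[OF \<alpha>1 \<alpha>2 \<beta> sys z l] by (subst nn_integral_laplace_plane[OF s]) auto
  also have "\<dots> = ennreal (\<Gamma> l)"
    unfolding \<Gamma>_def pgf_laplace_def[OF \<alpha>1 \<alpha>2 \<beta> sys z]
    using pgf_integrable[OF \<alpha>1 \<alpha>2 \<beta> sys z s l] system_pgf_01[OF \<alpha>1 \<alpha>2 \<beta> sys z l]
    by (intro nn_integral_eq_integral) auto
  finally show ?thesis unfolding 2 k by (simp add: \<kappa>1_def \<kappa>2_def W_def)
qed

text \<open>Injectivity of the double transform covers positive times only. On the axes both sides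
  equal 1, by the initial conditions and because the random times start almost surely at 0.\<close>

lemma system_pgf_eq_product_transform:
  assumes t: "t1 \<ge> 0" "t2 \<ge> 0"
  shows "(\<Sum>n. p l (int n) t1 t2 * z ^ n) = (\<integral> \<omega>. exp (- ((l * (1 - z)) powr \<beta>) * T1 t1 \<omega> * T2 t2 \<omega>) \<partial>M)"
proof -
  let ?W = "(l * (1 - z)) powr \<beta>"
  interpret prob_space M by (rule M)
  have W: "?W \<ge> 0" by simp
  have PT: "product_transform M ?W T1 T2 t1 t2 = (\<integral> \<omega>. exp (- ?W * T1 t1 \<omega> * T2 t2 \<omega>) \<partial>M)"
    by (rule product_transform_def[OF M T1 T2 \<alpha>1 \<alpha>2 ind W])
  have pgf: "(\<Sum>n. p l (int n) t1 t2 * z ^ n) = system_pgf z p l t1 t2" for t1 t2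
    by (simp add: system_pgf_def[OF \<alpha>1 \<alpha>2 \<beta> sys z])
  show ?thesis
  proof (cases "t1 = 0 \<or> t2 = 0")
    case True
    have "AE \<omega> in M. T1 0 \<omega> = 0" "AE \<omega> in M. T2 0 \<omega> = 0"
      using T1 T2 by (auto simp: folded_solution_process_def)
    then have ae: "AE \<omega> in M. exp (- ?W * T1 t1 \<omega> * T2 t2 \<omega>) = 1"
      by eventually_elim (use True in auto)
    have [measurable]: "T1 t1 \<in> borel_measurable M" "T2 t2 \<in> borel_measurable M"
      using folded_measurable[OF M T1 \<alpha>1 t(1)] folded_measurable[OF M T2 \<alpha>2 t(2)] by auto
    have "(\<integral> \<omega>. exp (- ?W * T1 t1 \<omega> * T2 t2 \<omega>) \<partial>M) = (\<integral> \<omega>. 1 \<partial>M)"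
      by (rule integral_cong_AE) (use ae in auto)
    then show ?thesis unfolding pgf
      using system_pgf_axes[OF \<alpha>1 \<alpha>2 \<beta> sys z l t True] by (simp add: prob_space)
  next
    case False
    then have tp: "t1 > 0" "t2 > 0" using t by auto
    note PTc = product_transform_continuous[OF M T1 T2 \<alpha>1 \<alpha>2 ind W]
    note PTb = product_transform_bounds[OF M T1 T2 \<alpha>1 \<alpha>2 ind W]
    have "system_pgf z p l t1 t2 = product_transform M ?W T1 T2 t1 t2"
    proof (rule laplace_injective_2[OF _ _ _ _ _ _ _ tp])
      have gc: "continuous_on ({0..} \<times> {0..}) (\<lambda>(a, b). system_pgf z p l a b)"
      proof -
        have "continuous_on ({0..} \<times> {0..}) (\<lambda>x. (\<lambda>(l, a, b). system_pgf z p l a b) (l, fst x, snd x))"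
          by (intro continuous_on_compose2[OF system_pgf_continuous[OF \<alpha>1 \<alpha>2 \<beta> sys z]] continuous_intros) (use l in auto)
        then show ?thesis by (simp add: case_prod_unfold)
      qed
      show "continuous_on {0<..} (\<lambda>a. system_pgf z p l a b)" if "b > 0" for b
      proof -
        have "continuous_on {0<..} (\<lambda>a. (\<lambda>(a, b). system_pgf z p l a b) (a, b))"
          by (intro continuous_on_compose2[OF gc] continuous_intros) (use that in auto)
        then show ?thesis by simp
      qed
      show "continuous_on {0<..} (system_pgf z p l a)" if "a > 0" for a
      proof -
        have "continuous_on {0<..} (\<lambda>b. (\<lambda>(a, b). system_pgf z p l a b) (a, b))"
          by (intro continuous_on_compose2[OF gc] continuous_intros) (use that in auto)
        then show ?thesis by simp
      qed
      show "0 \<le> system_pgf z p l a b \<and> system_pgf z p l a b \<le> 1" if "a > 0" "b > 0" for a b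
        using system_pgf_01[OF \<alpha>1 \<alpha>2 \<beta> sys z l] that by simp
      show "continuous_on {0<..} (\<lambda>a. product_transform M ?W T1 T2 a b)" if "b > 0" for b
        using PTc(1)[of b] that by simp
      show "continuous_on {0<..} (product_transform M ?W T1 T2 a)" if "a > 0" for a
        using PTc(2)[of a] that by simp
      show "0 \<le> product_transform M ?W T1 T2 a b \<and> product_transform M ?W T1 T2 a b \<le> 1" if "a > 0" "b > 0" for a b
        using PTb[of a b] that by simp
      show "(\<integral>\<^sup>+ a. (\<integral>\<^sup>+ b. ennreal (system_pgf z p l a b) \<partial>laplace_measure s2) \<partial>laplace_measure s1) =
         (\<integral>\<^sup>+ a. (\<integral>\<^sup>+ b. ennreal (product_transform M ?W T1 T2 a b) \<partial>laplace_measure s2) \<partial>laplace_measure s1)"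
        if s: "s1 > 0" "s2 > 0" for s1 s2
        unfolding system_pgf_laplace[OF s]
        by (rule product_transform_laplace[OF M T1 T2 \<alpha>1 \<alpha>2 ind W s, symmetric])
    qed
    then show ?thesis unfolding pgf PT .
  qed
qed

end

section \<open>Random times and random indices\<close>

context prob_space
begin

lemma Int_stable_vimage_algebra: "Int_stable {f -` S \<inter> A |S. S \<in> sets N}"
proof (rule Int_stableI)
  fix a b assume "a \<in> {f -` S \<inter> A |S. S \<in> sets N}" "b \<in> {f -` S \<inter> A |S. S \<in> sets N}"
  then obtain S S' where "S \<in> sets N" "S' \<in> sets N" "a = f -` S \<inter> A" "b = f -` S' \<inter> A" by blast
  then have "a \<inter> b = f -` (S \<inter> S') \<inter> A" "S \<inter> S' \<in> sets N" by auto
  then show "a \<inter> b \<in> {f -` S \<inter> A |S. S \<in> sets N}" by blast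
qed

text \<open>Conditioning on an independent index with countably many values: on the event
  \<open>K = n\<close> the integrand is \<open>f n\<close>, independence factorises its integral,
  and the pieces are summed. It is applied to the number of summands, to discretised times of
  \<open>B\<close> and to discretised arguments of \<open>H\<close>.\<close>

lemma random_index_integral:
  fixes K :: "'a \<Rightarrow> nat" and f :: "nat \<Rightarrow> 'a \<Rightarrow> complex"
  assumes sub: "subalgebra M F" "subalgebra M G" and ind: "indep_set (sets F) (sets G)"
    and K: "K \<in> measurable F (count_space UNIV)" and f: "\<And>n. f n \<in> borel_measurable G"
    and bd: "\<And>n \<omega>. \<omega> \<in> space M \<Longrightarrow> norm (f n \<omega>) \<le> 1"
  shows "(\<lambda>\<omega>. f (K \<omega>) \<omega>) \<in> borel_measurable M"
    and "(\<integral> \<omega>. f (K \<omega>) \<omega> \<partial>M) = (\<integral> \<omega>. (\<integral> \<omega>'. f (K \<omega>) \<omega>' \<partial>M) \<partial>M)"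
proof -
  have KM[measurable]: "K \<in> measurable M (count_space UNIV)" using measurable_from_subalg[OF sub(1) K] .
  have fM[measurable]: "f n \<in> borel_measurable M" for n using measurable_from_subalg[OF sub(2) f] .
  define A where "A n = {\<omega> \<in> space M. K \<omega> = n}" for n
  have AM[measurable]: "A n \<in> events" for n unfolding A_def by measurable
  have AF: "A n \<in> sets F" for n
  proof -
    have "K -` {n} \<inter> space F \<in> sets F" by (rule measurable_sets[OF K]) auto
    then show ?thesis using sub(1) by (auto simp: A_def subalgebra_def vimage_def Int_def conj_commute)
  qed
  have ind_n: "(\<integral> \<omega>. indicator (A n) \<omega> * f n \<omega> \<partial>M) = prob (A n) * (\<integral> \<omega>. f n \<omega> \<partial>M)" for n
  proof -
    have "indep_var borel (indicator (A n) :: 'a \<Rightarrow> complex) borel (f n)"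
    proof (subst indep_var_eq, intro conjI)
      have i1: "{(indicator (A n) :: 'a \<Rightarrow> complex) -` S \<inter> space M |S. S \<in> sets borel} \<subseteq> sets F"
      proof clarify
        fix S :: "complex set" assume "S \<in> sets borel"
        moreover have "(indicator (A n) :: 'a \<Rightarrow> complex) \<in> borel_measurable F" using AF[of n] by measurable
        ultimately have "(indicator (A n) :: 'a \<Rightarrow> complex) -` S \<inter> space F \<in> sets F" by (rule measurable_sets[rotated])
        then show "(indicator (A n) :: 'a \<Rightarrow> complex) -` S \<inter> space M \<in> sets F" using sub(1) by (simp add: subalgebra_def)
      qed
      have i2: "{f n -` S \<inter> space M |S. S \<in> sets borel} \<subseteq> sets G"
      proof clarify
        fix S :: "complex set" assume "S \<in> sets borel"
        then have "f n -` S \<inter> space G \<in> sets G" by (rule measurable_sets[OF f])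
        then show "f n -` S \<inter> space M \<in> sets G" using sub(2) by (simp add: subalgebra_def)
      qed
      have "indep_set {(indicator (A n) :: 'a \<Rightarrow> complex) -` S \<inter> space M |S. S \<in> sets borel} {f n -` S \<inter> space M |S. S \<in> sets borel}"
      proof (rule indep_setI)
        show "{(indicator (A n) :: 'a \<Rightarrow> complex) -` S \<inter> space M |S. S \<in> sets borel} \<subseteq> events"
          by (rule order_trans[OF i1]) (use sub(1) in \<open>simp add: subalgebra_def\<close>)
        show "{f n -` S \<inter> space M |S. S \<in> sets borel} \<subseteq> events"
          by (rule order_trans[OF i2]) (use sub(2) in \<open>simp add: subalgebra_def\<close>)
      qed (rule indep_setD[OF ind subsetD[OF i1] subsetD[OF i2]])
      then show "indep_set (sigma_sets (space M) {(indicator (A n) :: 'a \<Rightarrow> complex) -` S \<inter> space M |S. S \<in> sets borel})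
         (sigma_sets (space M) {f n -` S \<inter> space M |S. S \<in> sets borel})"
        by (rule indep_set_sigma_sets) (rule Int_stable_vimage_algebra)+
    qed auto
    moreover have "integrable M (indicator (A n) :: 'a \<Rightarrow> complex)" by (rule integrable_const_bound[where B = 1]) (auto simp: indicator_def)
    moreover have "integrable M (f n)" by (rule integrable_const_bound[where B = 1]) (use bd in auto)
    ultimately have "(\<integral> \<omega>. indicator (A n) \<omega> * f n \<omega> \<partial>M) = (\<integral> \<omega>. indicator (A n) \<omega> \<partial>M) * (\<integral> \<omega>. f n \<omega> \<partial>M)"
      by (rule indep_var_lebesgue_integral)
    also have "(\<integral> \<omega>. indicator (A n) \<omega> \<partial>M) = complex_of_real (prob (A n))"
    proof -
      have "(\<integral> \<omega>. indicator (A n) \<omega> \<partial>M) = (\<integral> \<omega>. complex_of_real (indicator (A n) \<omega>) \<partial>M)"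
        by (intro Bochner_Integration.integral_cong) (auto simp: indicator_def)
      then show ?thesis by (simp add: sets.Int_space_eq1)
    qed
    finally show ?thesis .
  qed
  have sumA: "summable (\<lambda>n. prob (A n))"
  proof -
    have "(\<lambda>n. prob (A n)) sums prob (\<Union>n. A n)"
      by (rule finite_measure_UNION) (auto simp: disjoint_family_on_def A_def)
    then show ?thesis by (rule sums_summable)
  qed
  have S: "(\<lambda>n. \<integral> \<omega>. indicator (A n) \<omega> * g n \<omega> \<partial>M) sums (\<integral> \<omega>. g (K \<omega>) \<omega> \<partial>M)" and Sm: "(\<lambda>\<omega>. g (K \<omega>) \<omega>) \<in> borel_measurable M"
    if [measurable]: "\<And>n. g n \<in> borel_measurable M" and gb: "\<And>n \<omega>. \<omega> \<in> space M \<Longrightarrow> norm (g n \<omega>) \<le> 1" for g :: "nat \<Rightarrow> 'a \<Rightarrow> complex"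
  proof -
    have pt: "(\<lambda>n. indicator (A n) \<omega> * g n \<omega>) sums g (K \<omega>) \<omega>" if "\<omega> \<in> space M" for \<omega>
    proof -
      have "(\<lambda>n. if n = K \<omega> then g n \<omega> else 0) sums g (K \<omega>) \<omega>" by (rule sums_single)
      also have "(\<lambda>n. if n = K \<omega> then g n \<omega> else 0) = (\<lambda>n. indicator (A n) \<omega> * g n \<omega>)"
        using that by (auto simp: A_def indicator_def)
      finally show ?thesis .
    qed
    show "(\<lambda>\<omega>. g (K \<omega>) \<omega>) \<in> borel_measurable M"
      by (rule measurable_compose_countable[where f = g and g = K]) measurable
    have "(\<lambda>n. \<integral> \<omega>. indicator (A n) \<omega> * g n \<omega> \<partial>M) sums (\<integral> \<omega>. (\<Sum>n. indicator (A n) \<omega> * g n \<omega>) \<partial>M)"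
    proof (rule sums_integral)
      show int: "integrable M (\<lambda>\<omega>. indicator (A n) \<omega> * g n \<omega>)" for n
        by (rule integrable_const_bound[where B = 1]) (use gb in \<open>auto simp: indicator_def\<close>)
      show "AE \<omega> in M. summable (\<lambda>n. norm (indicator (A n) \<omega> * g n \<omega>))"
      proof (rule AE_I2)
        fix \<omega> assume "\<omega> \<in> space M"
        show "summable (\<lambda>n. norm (indicator (A n) \<omega> * g n \<omega>))"
          by (rule summable_finite[of "{K \<omega>}"]) (auto simp: A_def)
      qed
      show "summable (\<lambda>n. \<integral> \<omega>. norm (indicator (A n) \<omega> * g n \<omega>) \<partial>M)"
      proof (rule summable_comparison_test'[OF sumA])
        fix n :: nat
        have "(\<integral> \<omega>. norm (indicator (A n) \<omega> * g n \<omega>) \<partial>M) \<le> (\<integral> \<omega>. indicator (A n) \<omega> \<partial>M)"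
        proof (rule integral_mono)
          show "integrable M (indicator (A n) :: 'a \<Rightarrow> real)"
            by (rule integrable_const_bound[where B = 1]) (auto simp: indicator_def)
          show "norm (indicator (A n) \<omega> * g n \<omega>) \<le> indicator (A n) \<omega>" if "\<omega> \<in> space M" for \<omega>
            using gb[OF that] by (simp add: indicator_def)
        qed (rule integrable_norm[OF int])
        then show "norm (\<integral> \<omega>. norm (indicator (A n) \<omega> * g n \<omega>) \<partial>M) \<le> prob (A n)" by (simp add: sets.Int_space_eq1)
      qed
    qed
    also have "(\<integral> \<omega>. (\<Sum>n. indicator (A n) \<omega> * g n \<omega>) \<partial>M) = (\<integral> \<omega>. g (K \<omega>) \<omega> \<partial>M)"
      by (intro Bochner_Integration.integral_cong refl) (use pt in \<open>simp add: sums_iff\<close>)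
    finally show "(\<lambda>n. \<integral> \<omega>. indicator (A n) \<omega> * g n \<omega> \<partial>M) sums (\<integral> \<omega>. g (K \<omega>) \<omega> \<partial>M)" .
  qed
  show "(\<lambda>\<omega>. f (K \<omega>) \<omega>) \<in> borel_measurable M" using Sm[OF fM bd] .
  have nb: "norm (\<integral> \<omega>'. f n \<omega>' \<partial>M) \<le> 1" for n
  proof -
    have "norm (\<integral> \<omega>'. f n \<omega>' \<partial>M) \<le> (\<integral> \<omega>'. norm (f n \<omega>') \<partial>M)" by (rule integral_norm_bound)
    also have "\<dots> \<le> 1"
      using bd by (intro integral_le_const integrable_norm integrable_const_bound[where B = 1 and f = "f n"] AE_I2) auto
    finally show ?thesis .
  qed
  have "(\<lambda>n. \<integral> \<omega>. indicator (A n) \<omega> * (\<integral> \<omega>'. f n \<omega>' \<partial>M) \<partial>M) sums (\<integral> \<omega>. (\<integral> \<omega>'. f (K \<omega>) \<omega>' \<partial>M) \<partial>M)"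
    by (rule S[of "\<lambda>n _. \<integral> \<omega>'. f n \<omega>' \<partial>M"]) (use nb in auto)
  moreover have "(\<integral> \<omega>. indicator (A n) \<omega> * (\<integral> \<omega>'. f n \<omega>' \<partial>M) \<partial>M) = prob (A n) * (\<integral> \<omega>. f n \<omega> \<partial>M)" for n
  proof -
    have "(\<integral> \<omega>. indicator (A n) \<omega> * (\<integral> \<omega>'. f n \<omega>' \<partial>M) \<partial>M) = (\<integral> \<omega>. complex_of_real (indicator (A n) \<omega>) * (\<integral> \<omega>'. f n \<omega>' \<partial>M) \<partial>M)"
      by (intro Bochner_Integration.integral_cong) (auto simp: indicator_def)
    also have "\<dots> = (\<integral> \<omega>. complex_of_real (indicator (A n) \<omega>) \<partial>M) * (\<integral> \<omega>'. f n \<omega>' \<partial>M)"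
      by (rule integral_mult_left_zero)
    finally have "(\<integral> \<omega>. indicator (A n) \<omega> * (\<integral> \<omega>'. f n \<omega>' \<partial>M) \<partial>M) = (\<integral> \<omega>. complex_of_real (indicator (A n) \<omega>) \<partial>M) * (\<integral> \<omega>'. f n \<omega>' \<partial>M)" .
    then show ?thesis by (simp add: sets.Int_space_eq1)
  qed
  ultimately have "(\<lambda>n. \<integral> \<omega>. indicator (A n) \<omega> * f n \<omega> \<partial>M) sums (\<integral> \<omega>. (\<integral> \<omega>'. f (K \<omega>) \<omega>' \<partial>M) \<partial>M)"
    unfolding ind_n by (simp only:)
  from sums_unique2[OF S[OF fM bd] this] show "(\<integral> \<omega>. f (K \<omega>) \<omega> \<partial>M) = (\<integral> \<omega>. (\<integral> \<omega>'. f (K \<omega>) \<omega>' \<partial>M) \<partial>M)" .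
qed

lemma process_events_subalgebra:
  assumes "\<And>i. i \<in> I \<Longrightarrow> X i \<in> measurable M S"
  shows "process_events M S I X \<subseteq> events"
  unfolding process_events_def using assms by (intro sets.sigma_sets_subset) auto

lemma process_events_Int_stable: "Int_stable (process_events M S I X)"
proof -
  interpret sigma_algebra "space M" "process_events M S I X"
    unfolding process_events_def by (rule sigma_algebra_sigma_sets) auto
  show ?thesis by (rule Int_stable)
qed

lemma process_events_measurable:
  assumes "i \<in> I" "process_events M S I X \<subseteq> sets N" "space N = space M" "X i \<in> measurable M S"
  shows "X i \<in> measurable N S"
proof (rule measurableI)
  show "X i x \<in> space S" if "x \<in> space N" for x using that assms(3,4) by (auto dest: measurable_space)
  show "X i -` A \<inter> space N \<in> sets N" if "A \<in> sets S" for A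
    using assms(1,2,3) that by (auto simp: process_events_def)
qed

lemma process_events_sigma:
  assumes "process_events M S I X \<subseteq> events"
  shows "sets (sigma (space M) (process_events M S I X)) = process_events M S I X"
    and "space (sigma (space M) (process_events M S I X)) = space M"
    and "subalgebra M (sigma (space M) (process_events M S I X))"
proof -
  have P: "process_events M S I X \<subseteq> Pow (space M)" using assms sets.space_closed by blast
  interpret sigma_algebra "space M" "process_events M S I X"
    unfolding process_events_def by (rule sigma_algebra_sigma_sets) auto
  show 1: "sets (sigma (space M) (process_events M S I X)) = process_events M S I X" by (simp add: sigma_sets_eq P)
  show 2: "space (sigma (space M) (process_events M S I X)) = space M" using P by (simp add: space_measure_of_conv)
  show "subalgebra M (sigma (space M) (process_events M S I X))" unfolding subalgebra_def 1 2 using assms by simp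
qed

text \<open>The definition gives the laws of increments, so \<open>B t\<close> is replaced by
  \<open>B t - B 0\<close>. Time 0 is treated apart, since its law has no density.\<close>

lemma brownian_char:
  assumes B: "brownian_motion M B" and t: "t \<ge> 0"
  shows "(\<integral> \<omega>. iexp (u * B t \<omega>) \<partial>M) = exp (- u\<^sup>2 / 2 * t)"
proof -
  have [measurable]: "B t \<in> borel_measurable M" "B 0 \<in> borel_measurable M" using B t by (auto simp: brownian_motion_def)
  have B0: "AE \<omega> in M. B 0 \<omega> = 0" using B by (simp add: brownian_motion_def)
  show ?thesis
  proof (cases "t = 0")
    case True
    have "(\<integral> \<omega>. iexp (u * B t \<omega>) \<partial>M) = (\<integral> \<omega>. 1 \<partial>M)"
      by (rule integral_cong_AE) (use B0 True in auto)
    then show ?thesis using True by (simp add: prob_space)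
  next
    case False
    then have tp: "t > 0" using t by simp
    then have d: "distributed M lborel (\<lambda>\<omega>. B t \<omega> - B 0 \<omega>) (\<lambda>x. ennreal (normal_density 0 (sqrt t) x))"
    proof -
      have "\<forall>s t. 0 \<le> s \<and> s < t \<longrightarrow>
        distributed M lborel (\<lambda>\<omega>. B t \<omega> - B s \<omega>) (\<lambda>x. ennreal (normal_density 0 (sqrt (t - s)) x))"
        using B by (simp add: brownian_motion_def)
      from this[rule_format, of 0 t] show ?thesis using tp by simp
    qed
    define X where "X \<omega> = (B t \<omega> - B 0 \<omega>) / sqrt t" for \<omega>
    have "distributed M lborel (\<lambda>\<omega>. 0 + (1 / sqrt t) * (B t \<omega> - B 0 \<omega>)) (\<lambda>x. ennreal (normal_density (0 + (1 / sqrt t) * 0) (\<bar>1 / sqrt t\<bar> * sqrt t) x))"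
      by (rule normal_density_affine[OF d]) (use tp in auto)
    then have dX: "distributed M lborel X std_normal_density"
      using tp by (simp add: X_def[abs_def])
    have "(\<integral> \<omega>. iexp (u * B t \<omega>) \<partial>M) = (\<integral> \<omega>. iexp ((u * sqrt t) * X \<omega>) \<partial>M)"
    proof (rule integral_cong_AE)
      show "AE \<omega> in M. iexp (u * B t \<omega>) = iexp ((u * sqrt t) * X \<omega>)"
        using B0 by eventually_elim (use tp in \<open>simp add: X_def\<close>)
      have [measurable]: "X \<in> borel_measurable M" unfolding X_def[abs_def] by measurable
      show "(\<lambda>\<omega>. iexp (u * B t \<omega>)) \<in> borel_measurable M" "(\<lambda>\<omega>. iexp ((u * sqrt t) * X \<omega>)) \<in> borel_measurable M" by measurable
    qed
    also have "\<dots> = char std_normal_distribution (u * sqrt t)"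
    proof -
      have "distr M lborel X = std_normal_distribution" using distributed_distr_eq_density[OF dX] .
      moreover have Xm: "X \<in> measurable M lborel" unfolding X_def[abs_def] by measurable
      ultimately show ?thesis unfolding char_def by (subst \<open>distr M lborel X = std_normal_distribution\<close>[symmetric]) (subst integral_distr[OF Xm], auto)
    qed
    also have "\<dots> = exp (- u\<^sup>2 / 2 * t)"
    proof -
      have "- (u * sqrt t)\<^sup>2 / 2 = - u\<^sup>2 / 2 * t" using tp by (simp add: power_mult_distrib)
      then show ?thesis unfolding char_std_normal_distribution by (simp only:)
    qed
    finally show ?thesis .
  qed
qed

text \<open>
  Only almost all paths are continuous and \<open>M\<close> need not be complete, so \<open>B (\<tau> \<omega>) \<omega>\<close> itself may fail to
  be measurable.
\<close>
lemma brownian_random_time_char: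
  assumes B: "brownian_motion M B" and sub: "subalgebra M F"
    and ind: "indep_set (sets F) (process_events M borel {0..} B)"
    and \<tau>m: "\<tau> \<in> borel_measurable F" and \<tau>0: "\<And>\<omega>. \<omega> \<in> space M \<Longrightarrow> \<tau> \<omega> \<ge> 0"
  shows "\<exists>X \<in> borel_measurable M. (AE \<omega> in M. X \<omega> = B (\<tau> \<omega>) \<omega>) \<and>
    (\<forall>u. (\<integral> \<omega>. iexp (u * X \<omega>) \<partial>M) = complex_of_real (\<integral> \<omega>. exp (- u\<^sup>2 / 2 * \<tau> \<omega>) \<partial>M))"
proof -
  define G where "G = sigma (space M) (process_events M borel {0..} B)"
  have Bm: "B t \<in> borel_measurable M" if "t \<ge> 0" for t using B that by (auto simp: brownian_motion_def)
  have EB: "process_events M borel {0..} B \<subseteq> events" by (rule process_events_subalgebra) (use Bm in auto)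
  note Gs = process_events_sigma(1)[OF EB, folded G_def] and spG = process_events_sigma(2)[OF EB, folded G_def]
    and subG = process_events_sigma(3)[OF EB, folded G_def]
  have BG: "B t \<in> borel_measurable G" if "t \<ge> 0" for t
    by (rule process_events_measurable[of _ "{0..}"]) (use that Gs spG Bm in auto)
  have indG: "indep_set (sets F) (sets G)" using ind Gs by simp
  have \<tau>M[measurable]: "\<tau> \<in> borel_measurable M" using measurable_from_subalg[OF sub \<tau>m] .
  define K where "K m \<omega> = nat \<lfloor>2 ^ m * \<tau> \<omega>\<rfloor>" for m \<omega>
  \<comment> \<open>With \<open>k = nat \<lfloor>2 ^ m * \<tau> \<omega>\<rfloor>\<close> this is
    the dyadic point just above \<open>\<tau> \<omega>\<close>: it takes countably many values and
    tends to \<open>\<tau> \<omega>\<close>.\<close>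
  define c where "c m k = (real k + 1) / 2 ^ m" for m k :: nat
  have Km: "K m \<in> measurable F (count_space UNIV)" for m
    unfolding K_def[abs_def] using \<tau>m by measurable
  have cpos: "c m k \<ge> 0" for m k by (simp add: c_def)
  have eq: "(\<lambda>\<omega>. iexp (u * B (c m (K m \<omega>)) \<omega>)) \<in> borel_measurable M"
    "(\<integral> \<omega>. iexp (u * B (c m (K m \<omega>)) \<omega>) \<partial>M) = (\<integral> \<omega>. complex_of_real (exp (- u\<^sup>2 / 2 * c m (K m \<omega>))) \<partial>M)" for m u
  proof -
    have mm: "(\<lambda>\<omega>. iexp (u * B (c m k) \<omega>)) \<in> borel_measurable G" for k using BG[OF cpos[of m k]] by measurable
    note R = random_index_integral[OF sub subG indG Km[of m], of "\<lambda>k \<omega>. iexp (u * B (c m k) \<omega>)", OF mm]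
    show "(\<lambda>\<omega>. iexp (u * B (c m (K m \<omega>)) \<omega>)) \<in> borel_measurable M" by (rule R(1)) simp
    show "(\<integral> \<omega>. iexp (u * B (c m (K m \<omega>)) \<omega>) \<partial>M) = (\<integral> \<omega>. complex_of_real (exp (- u\<^sup>2 / 2 * c m (K m \<omega>))) \<partial>M)"
      by (subst R(2)) (simp_all only: brownian_char[OF B cpos], simp)
  qed
  have clim: "(\<lambda>m. c m (K m \<omega>)) \<longlonglongrightarrow> \<tau> \<omega>" if "\<omega> \<in> space M" for \<omega>
  proof -
    have b: "\<bar>c m (K m \<omega>) - \<tau> \<omega>\<bar> \<le> (1 / 2) ^ m" for m
    proof -
      have nn: "2 ^ m * \<tau> \<omega> \<ge> 0" using \<tau>0[OF that] by simp
      then have r: "real (K m \<omega>) = of_int \<lfloor>2 ^ m * \<tau> \<omega>\<rfloor>" by (simp add: K_def)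
      have "2 ^ m * \<tau> \<omega> \<le> real (K m \<omega>) + 1" "real (K m \<omega>) + 1 \<le> 2 ^ m * \<tau> \<omega> + 1" unfolding r by linarith+
      then have "\<tau> \<omega> \<le> c m (K m \<omega>)" "c m (K m \<omega>) \<le> \<tau> \<omega> + 1 / 2 ^ m" by (auto simp: c_def field_simps)
      then show ?thesis by (simp add: power_one_over)
    qed
    have "(\<lambda>m. (1 / 2 :: real) ^ m) \<longlonglongrightarrow> 0" by (intro LIMSEQ_realpow_zero) auto
    then have "(\<lambda>m. c m (K m \<omega>) - \<tau> \<omega>) \<longlonglongrightarrow> 0"
      by (rule Lim_null_comparison[rotated]) (use b in auto)
    then show ?thesis by (simp add: LIM_zero_iff)
  qed
  have cmM[measurable]: "(\<lambda>\<omega>. c m (K m \<omega>)) \<in> borel_measurable M" for m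
    using measurable_from_subalg[OF sub Km[of m]] by measurable
  have Bcm[measurable]: "(\<lambda>\<omega>. B (c m (K m \<omega>)) \<omega>) \<in> borel_measurable M" for m
    by (rule measurable_compose_countable[OF Bm[OF cpos] measurable_from_subalg[OF sub Km]])
  \<comment> \<open>The \<open>lim\<close> of a sequence of measurable functions is measurable
    everywhere, whatever its value where the sequence diverges; along continuous paths it is
    \<open>B (\<tau> \<omega>) \<omega>\<close>.\<close>
  define X where "X \<omega> = lim (\<lambda>m. B (c m (K m \<omega>)) \<omega>)" for \<omega>
  have Xm[measurable]: "X \<in> borel_measurable M" unfolding X_def[abs_def] by measurable
  have Blim: "AE \<omega> in M. (\<lambda>m. B (c m (K m \<omega>)) \<omega>) \<longlonglongrightarrow> B (\<tau> \<omega>) \<omega>"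
  proof -
    have "AE \<omega> in M. continuous_on {0..} (\<lambda>t. B t \<omega>)" using B by (simp add: brownian_motion_def)
    then show ?thesis using AE_space
    proof eventually_elim
      case (elim \<omega>)
      show ?case
        by (rule continuous_on_tendsto_compose[OF elim(1) clim[OF elim(2)]]) (use \<tau>0[OF elim(2)] cpos in auto)
    qed
  qed
  have X: "AE \<omega> in M. X \<omega> = B (\<tau> \<omega>) \<omega>" using Blim by eventually_elim (simp add: X_def limI)
  have "(\<integral> \<omega>. iexp (u * X \<omega>) \<partial>M) = complex_of_real (\<integral> \<omega>. exp (- u\<^sup>2 / 2 * \<tau> \<omega>) \<partial>M)" for u
  proof -
    have l1: "(\<lambda>m. \<integral> \<omega>. iexp (u * B (c m (K m \<omega>)) \<omega>) \<partial>M) \<longlonglongrightarrow> (\<integral> \<omega>. iexp (u * X \<omega>) \<partial>M)"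
    proof (rule integral_dominated_convergence[where w = "\<lambda>_. 1"])
      show "AE \<omega> in M. (\<lambda>m. iexp (u * B (c m (K m \<omega>)) \<omega>)) \<longlonglongrightarrow> iexp (u * X \<omega>)"
        using X Blim
      proof eventually_elim
        case (elim \<omega>)
        show ?case unfolding elim(1) by (intro tendsto_intros elim(2))
      qed
      show "(\<lambda>\<omega>. iexp (u * X \<omega>)) \<in> borel_measurable M" by measurable
    qed (use eq(1) in auto)
    have l2: "(\<lambda>m. \<integral> \<omega>. exp (- u\<^sup>2 / 2 * c m (K m \<omega>)) \<partial>M) \<longlonglongrightarrow> (\<integral> \<omega>. exp (- u\<^sup>2 / 2 * \<tau> \<omega>) \<partial>M)"
    proof (rule integral_dominated_convergence[where w = "\<lambda>_. 1"])
      show "AE \<omega> in M. (\<lambda>m. exp (- u\<^sup>2 / 2 * c m (K m \<omega>))) \<longlonglongrightarrow> exp (- u\<^sup>2 / 2 * \<tau> \<omega>)"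
        using clim by (intro AE_I2 tendsto_intros) auto
      show "AE \<omega> in M. norm (exp (- u\<^sup>2 / 2 * c m (K m \<omega>))) \<le> 1" for m
        using cpos by (intro AE_I2) simp
    qed auto
    have "(\<lambda>m. complex_of_real (\<integral> \<omega>. exp (- u\<^sup>2 / 2 * c m (K m \<omega>)) \<partial>M)) \<longlonglongrightarrow> complex_of_real (\<integral> \<omega>. exp (- u\<^sup>2 / 2 * \<tau> \<omega>) \<partial>M)"
      by (rule tendsto_of_real[OF l2])
    then have "(\<lambda>m. \<integral> \<omega>. iexp (u * B (c m (K m \<omega>)) \<omega>) \<partial>M) \<longlonglongrightarrow> complex_of_real (\<integral> \<omega>. exp (- u\<^sup>2 / 2 * \<tau> \<omega>) \<partial>M)"
      unfolding eq(2) integral_complex_of_real .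
    from LIMSEQ_unique[OF l1 this] show ?thesis .
  qed
  with X Xm show ?thesis by blast
qed

end

section \<open>The time-changed Brownian motion\<close>

text \<open>Unites the deterministic sheet \<open>t1 * t2\<close> of \<open>\<beta> = 1\<close> with
  the random case, so that later arguments need not distinguish them.\<close>

lemma stable_subordinator2_basic:
  assumes M: "prob_space M" and H: "stable_subordinator2 M \<beta> H"
  shows "\<And>t1 t2. t1 \<ge> 0 \<Longrightarrow> t2 \<ge> 0 \<Longrightarrow> H t1 t2 \<in> borel_measurable M"
    and "AE \<omega> in M. H 0 0 \<omega> = 0"
    and "AE \<omega> in M. \<forall>s1 s2 t1 t2. 0 \<le> s1 \<and> s1 \<le> t1 \<and> 0 \<le> s2 \<and> s2 \<le> t2 \<longrightarrow> H s1 s2 \<omega> \<le> H t1 t2 \<omega>"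
    and "\<And>u t1 t2. u > 0 \<Longrightarrow> t1 \<ge> 0 \<Longrightarrow> t2 \<ge> 0 \<Longrightarrow> (\<integral> \<omega>. exp (- u * H t1 t2 \<omega>) \<partial>M) = exp (- t1 * t2 * u powr \<beta>)"
proof -
  interpret prob_space M by (rule M)
  have "(\<forall>t1\<ge>0. \<forall>t2\<ge>0. H t1 t2 \<in> borel_measurable M) \<and> (AE \<omega> in M. H 0 0 \<omega> = 0) \<and>
    (AE \<omega> in M. \<forall>s1 s2 t1 t2. 0 \<le> s1 \<and> s1 \<le> t1 \<and> 0 \<le> s2 \<and> s2 \<le> t2 \<longrightarrow> H s1 s2 \<omega> \<le> H t1 t2 \<omega>) \<and>
    (\<forall>u>0. \<forall>t1\<ge>0. \<forall>t2\<ge>0. (\<integral> \<omega>. exp (- u * H t1 t2 \<omega>) \<partial>M) = exp (- t1 * t2 * u powr \<beta>))"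
  proof (cases "\<beta> = 1")
    case True
    then have e: "H t1 t2 \<omega> = t1 * t2" if "\<omega> \<in> space M" "t1 \<ge> 0" "t2 \<ge> 0" for t1 t2 \<omega>
      using H that by (simp add: stable_subordinator2_def)
    have "H t1 t2 \<in> borel_measurable M" if "t1 \<ge> 0" "t2 \<ge> 0" for t1 t2
      using that by (subst measurable_cong[where g = "\<lambda>_. t1 * t2"]) (auto simp: e)
    moreover have "AE \<omega> in M. H 0 0 \<omega> = 0" by (intro AE_I2) (simp add: e)
    moreover have "AE \<omega> in M. \<forall>s1 s2 t1 t2. 0 \<le> s1 \<and> s1 \<le> t1 \<and> 0 \<le> s2 \<and> s2 \<le> t2 \<longrightarrow> H s1 s2 \<omega> \<le> H t1 t2 \<omega>"
      by (intro AE_I2) (auto simp: e intro!: mult_mono)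
    moreover have "(\<integral> \<omega>. exp (- u * H t1 t2 \<omega>) \<partial>M) = exp (- t1 * t2 * u powr \<beta>)" if "u > 0" "t1 \<ge> 0" "t2 \<ge> 0" for u t1 t2
    proof -
      have "(\<integral> \<omega>. exp (- u * H t1 t2 \<omega>) \<partial>M) = (\<integral> \<omega>. exp (- u * (t1 * t2)) \<partial>M)"
        using that by (intro Bochner_Integration.integral_cong) (auto simp: e)
      then show ?thesis using that True by (simp add: prob_space mult_ac)
    qed
    ultimately show ?thesis by blast
  next
    case False
    then have "AE \<omega> in M. H 0 0 \<omega> = 0 \<and> H 0 0 \<omega> = 0" using H by (simp add: stable_subordinator2_def)
    then show ?thesis using H False unfolding stable_subordinator2_def by simp
  qed
  then show "\<And>t1 t2. t1 \<ge> 0 \<Longrightarrow> t2 \<ge> 0 \<Longrightarrow> H t1 t2 \<in> borel_measurable M"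
    and "AE \<omega> in M. H 0 0 \<omega> = 0"
    and "AE \<omega> in M. \<forall>s1 s2 t1 t2. 0 \<le> s1 \<and> s1 \<le> t1 \<and> 0 \<le> s2 \<and> s2 \<le> t2 \<longrightarrow> H s1 s2 \<omega> \<le> H t1 t2 \<omega>"
    and "\<And>u t1 t2. u > 0 \<Longrightarrow> t1 \<ge> 0 \<Longrightarrow> t2 \<ge> 0 \<Longrightarrow> (\<integral> \<omega>. exp (- u * H t1 t2 \<omega>) \<partial>M) = exp (- t1 * t2 * u powr \<beta>)"
    by blast+
qed

text \<open>Lower (\<open>e = 0\<close>) and upper (\<open>e = 1\<close>) dyadic approximation at level \<open>k\<close>.\<close>
definition dyadic :: "nat \<Rightarrow> nat \<Rightarrow> real \<Rightarrow> real" where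
  "dyadic e k t = (real (nat \<lfloor>2 ^ k * t\<rfloor>) + real e) / 2 ^ k"

lemma dyadic_bounds:
  assumes "t \<ge> 0"
  shows "0 \<le> dyadic e k t" "dyadic 0 k t \<le> t" "t \<le> dyadic 1 k t" "dyadic 0 k t \<le> dyadic 0 (Suc k) t"
    "dyadic 1 (Suc k) t \<le> dyadic 1 k t" "\<bar>dyadic e k t - t\<bar> \<le> (real e + 1) * (1 / 2) ^ k"
proof -
  have nn: "2 ^ j * t \<ge> 0" for j using assms by simp
  then have r: "real (nat \<lfloor>2 ^ j * t\<rfloor>) = of_int \<lfloor>2 ^ j * t\<rfloor>" for j by simp
  show "0 \<le> dyadic e k t" by (simp add: dyadic_def)
  have f: "real (nat \<lfloor>2 ^ j * t\<rfloor>) \<le> 2 ^ j * t" "2 ^ j * t < real (nat \<lfloor>2 ^ j * t\<rfloor>) + 1" for j unfolding r by linarith+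
  show "dyadic 0 k t \<le> t" using f(1)[of k] by (simp add: dyadic_def divide_le_eq mult.commute)
  show "t \<le> dyadic 1 k t" using f(2)[of k] by (simp add: dyadic_def le_divide_eq mult.commute)
  define a b where "a = \<lfloor>2 ^ k * t\<rfloor>" and "b = \<lfloor>2 ^ Suc k * t\<rfloor>"
  have "2 * of_int a \<le> 2 ^ Suc k * t" "2 ^ Suc k * t < 2 * of_int a + 2" unfolding a_def by (auto, linarith+)
  \<comment> \<open>Doubling the scale turns the floor \<open>a\<close> into \<open>2 * a\<close> or
    \<open>2 * a + 1\<close>, which is why the lower approximations increase and the upper ones
    decrease.\<close>
  then have ab: "2 * a \<le> b" "b \<le> 2 * a + 1" unfolding b_def by (auto simp: le_floor_iff, linarith)
  have r': "dyadic e k t = 2 * (of_int a + real e) / 2 ^ Suc k" "dyadic e (Suc k) t = (of_int b + real e) / 2 ^ Suc k" for e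
    unfolding dyadic_def r a_def b_def by (auto simp: field_simps)
  have ab': "2 * real_of_int a \<le> real_of_int b" "real_of_int b \<le> 2 * real_of_int a + 1" using ab by linarith+
  show "dyadic 0 k t \<le> dyadic 0 (Suc k) t" unfolding r' using ab' by (intro divide_right_mono) auto
  show "dyadic 1 (Suc k) t \<le> dyadic 1 k t" unfolding r' using ab' by (intro divide_right_mono) auto
  have "dyadic e k t - t = (real (nat \<lfloor>2 ^ k * t\<rfloor>) - 2 ^ k * t + real e) / 2 ^ k" by (simp add: dyadic_def field_simps)
  also have "\<bar>\<dots>\<bar> = \<bar>real (nat \<lfloor>2 ^ k * t\<rfloor>) - 2 ^ k * t + real e\<bar> / 2 ^ k" by (simp add: abs_divide)
  also have "\<dots> \<le> (real e + 1) / 2 ^ k"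
  proof (rule divide_right_mono)
    show "\<bar>real (nat \<lfloor>2 ^ k * t\<rfloor>) - 2 ^ k * t + real e\<bar> \<le> real e + 1" using f[of k] by linarith
  qed simp
  finally show "\<bar>dyadic e k t - t\<bar> \<le> (real e + 1) * (1 / 2) ^ k" by (simp add: power_one_over)
qed

lemma dyadic_tendsto: "t \<ge> 0 \<Longrightarrow> (\<lambda>k. dyadic e k t) \<longlonglongrightarrow> t"
proof -
  assume t: "t \<ge> 0"
  have z: "(\<lambda>m. (real e + 1) * (1 / 2 :: real) ^ m) \<longlonglongrightarrow> 0"
    by (rule tendsto_mult_right_zero[OF LIMSEQ_realpow_zero]) simp_all
  have "(\<lambda>k. dyadic e k t - t) \<longlonglongrightarrow> 0"
  proof (rule Lim_null_comparison[OF _ z])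
    show "eventually (\<lambda>k. norm (dyadic e k t - t) \<le> (real e + 1) * (1 / 2) ^ k) sequentially"
      using dyadic_bounds(6)[OF t] by (intro always_eventually allI) (simp only: real_norm_def)
  qed
  then show ?thesis by (simp add: LIM_zero_iff)
qed

text \<open>Convergence of the expectations alone would give almost sure convergence only along a
  subsequence. Monotonicity supplies a limit, and this limit is nonnegative with integral 0.\<close>

lemma (in prob_space) decseq_integral_zero:
  fixes d :: "nat \<Rightarrow> 'a \<Rightarrow> real"
  assumes [measurable]: "\<And>k. d k \<in> borel_measurable M"
    and d: "AE \<omega> in M. \<forall>k. 0 \<le> d (Suc k) \<omega> \<and> d (Suc k) \<omega> \<le> d k \<omega>" and d1: "\<And>k \<omega>. \<bar>d k \<omega>\<bar> \<le> C"
    and lim: "(\<lambda>k. \<integral> \<omega>. d k \<omega> \<partial>M) \<longlonglongrightarrow> 0"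
  shows "AE \<omega> in M. (\<lambda>k. d k \<omega>) \<longlonglongrightarrow> 0"
proof -
  define L where "L \<omega> = lim (\<lambda>k. d k \<omega>)" for \<omega>
  have conv: "AE \<omega> in M. (\<lambda>k. d k \<omega>) \<longlonglongrightarrow> L \<omega> \<and> 0 \<le> L \<omega>"
    using d
  proof eventually_elim
    case (elim \<omega>)
    have nn: "0 \<le> d (Suc k) \<omega>" for k using elim by blast
    have "decseq (\<lambda>k. d k \<omega>)" using elim by (auto intro: decseq_SucI)
    moreover have "0 \<le> d k \<omega>" for k using nn[of k] elim by (meson order_trans)
    ultimately obtain x where x: "(\<lambda>k. d k \<omega>) \<longlonglongrightarrow> x" using decseq_convergent[of "\<lambda>k. d k \<omega>" 0] by blast
    moreover have "0 \<le> x" using LIMSEQ_le_const[OF x] \<open>\<And>k. 0 \<le> d k \<omega>\<close> by blast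
    ultimately show ?case by (simp add: L_def limI)
  qed
  have Lm[measurable]: "L \<in> borel_measurable M" unfolding L_def[abs_def] by measurable
  have "(\<lambda>k. \<integral> \<omega>. d k \<omega> \<partial>M) \<longlonglongrightarrow> (\<integral> \<omega>. L \<omega> \<partial>M)"
    by (rule integral_dominated_convergence[where w = "\<lambda>_. C"]) (use conv d1 in \<open>auto elim!: eventually_mono\<close>)
  then have z: "(\<integral> \<omega>. L \<omega> \<partial>M) = 0" using lim LIMSEQ_unique by blast
  have Lb: "AE \<omega> in M. norm (L \<omega>) \<le> C"
    using conv
  proof eventually_elim
    case (elim \<omega>)
    then have "(\<lambda>k. norm (d k \<omega>)) \<longlonglongrightarrow> norm (L \<omega>)" by (intro tendsto_norm) auto
    then show ?case by (rule LIMSEQ_le_const2) (use d1 in auto)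
  qed
  have "integrable M L" using Lb by (rule integrable_const_bound) measurable
  then have "AE \<omega> in M. L \<omega> = 0"
    using z conv by (subst (asm) integral_nonneg_eq_0_iff_AE) (auto elim!: eventually_mono)
  then show ?thesis using conv by eventually_elim simp
qed

section \<open>Subordination by the two random times\<close>

context
  fixes M :: "'a measure" and \<beta> :: real and B :: "real \<Rightarrow> 'a \<Rightarrow> real" and H :: "real \<Rightarrow> real \<Rightarrow> 'a \<Rightarrow> real"
    and T1 T2 :: "real \<Rightarrow> 'a \<Rightarrow> real" and t1 t2 :: real
  assumes M: "prob_space M" and B: "brownian_motion M B" and H: "stable_subordinator2 M \<beta> H" and \<beta>: "\<beta> > 0"
    and T1m: "\<And>t. t \<ge> 0 \<Longrightarrow> T1 t \<in> borel_measurable M" and T1nn: "\<And>t \<omega>. t \<ge> 0 \<Longrightarrow> \<omega> \<in> space M \<Longrightarrow> T1 t \<omega> \<ge> 0"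
    and T2m: "\<And>t. t \<ge> 0 \<Longrightarrow> T2 t \<in> borel_measurable M" and T2nn: "\<And>t \<omega>. t \<ge> 0 \<Longrightarrow> \<omega> \<in> space M \<Longrightarrow> T2 t \<omega> \<ge> 0"
    and ind: "prob_space.indep_sets M
          (nth [process_events M borel {0..} B,
                process_events M borel ({0..} \<times> {0..}) (\<lambda>(s1, s2). H s1 s2),
                process_events M borel {0..} T1,
                process_events M borel {0..} T2]) {..<4}"
    and t: "t1 \<ge> 0" "t2 \<ge> 0"
begin

interpretation prob_space M by (rule M)

abbreviation (input) "events_B \<equiv> process_events M borel {0..} B"
abbreviation (input) "events_H \<equiv> process_events M borel ({0..} \<times> {0..}) (\<lambda>(s1, s2). H s1 s2)"
abbreviation (input) "events_T1 \<equiv> process_events M borel {0..} T1"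
abbreviation (input) "events_T2 \<equiv> process_events M borel {0..} T2"

lemma stable_subordinator2_measurable: "a \<ge> 0 \<Longrightarrow> b \<ge> 0 \<Longrightarrow> H a b \<in> borel_measurable M"
  by (rule stable_subordinator2_basic(1)[OF M H])

lemma process_events_in_events: "events_B \<subseteq> events" "events_H \<subseteq> events" "events_T1 \<subseteq> events" "events_T2 \<subseteq> events"
  using B by (auto intro!: process_events_subalgebra T1m T2m stable_subordinator2_measurable[simplified] simp: brownian_motion_def)

text \<open>The indices 0, 1, 2, 3 stand for \<open>B\<close>, \<open>H\<close>, \<open>T1\<close>,
  \<open>T2\<close>. Joint independence of the four yields independence of the sigma-algebras
  generated by disjoint groups, such as \<open>H\<close> against both random times, or
  \<open>B\<close> against the three others.\<close>

lemma indep_groups: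
  assumes "I \<inter> J = {}" "I \<union> J \<subseteq> {..<4}"
  shows "indep_set (sigma_sets (space M) (\<Union>i\<in>I. [events_B, events_H, events_T1, events_T2] ! i)) (sigma_sets (space M) (\<Union>i\<in>J. [events_B, events_H, events_T1, events_T2] ! i))"
proof -
  have st: "Int_stable ([events_B, events_H, events_T1, events_T2] ! i)" if "i < 4" for i
  proof -
    have "i = 0 \<or> i = 1 \<or> i = 2 \<or> i = 3" using that by linarith
    then show ?thesis by (auto simp: process_events_Int_stable numeral_2_eq_2 numeral_3_eq_3)
  qed
  have "indep_sets (\<lambda>j. sigma_sets (space M) (\<Union>i\<in>case_bool I J j. [events_B, events_H, events_T1, events_T2] ! i)) UNIV"
  proof (rule indep_sets_collect_sigma)
    show "indep_sets ((!) [events_B, events_H, events_T1, events_T2]) (\<Union>j\<in>UNIV. case_bool I J j)"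
      by (rule indep_sets_mono_index[OF _ ind]) (use assms(2) in \<open>auto simp: UNIV_bool\<close>)
    show "Int_stable ([events_B, events_H, events_T1, events_T2] ! i)" if "i \<in> case_bool I J j" for i j
      using that assms(2) by (intro st) (auto split: bool.splits)
    show "disjoint_family_on (case_bool I J) UNIV"
      using assms(1) by (auto simp: disjoint_family_on_def split: bool.splits)
  qed
  then show ?thesis unfolding indep_set_def
    by (rule indep_sets_mono_sets) (auto split: bool.splits)
qed

definition "sigma_T = sigma (space M) (events_T1 \<union> events_T2)"
definition "sigma_H = sigma (space M) events_H"
definition "sigma_HT = sigma (space M) (events_H \<union> events_T1 \<union> events_T2)"

lemma generated_algebras:
  "sets sigma_T = sigma_sets (space M) (events_T1 \<union> events_T2)" "sets sigma_H = sigma_sets (space M) events_H"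
  "sets sigma_HT = sigma_sets (space M) (events_H \<union> events_T1 \<union> events_T2)" "subalgebra M sigma_T" "subalgebra M sigma_H" "subalgebra M sigma_HT"
  "space sigma_T = space M" "space sigma_H = space M" "space sigma_HT = space M"
proof -
  have P: "X \<subseteq> Pow (space M)" if "X \<subseteq> events" for X using that sets.space_closed by blast
  have E: "events_T1 \<union> events_T2 \<subseteq> events" "events_H \<union> events_T1 \<union> events_T2 \<subseteq> events" using process_events_in_events by auto
  show 1: "sets sigma_T = sigma_sets (space M) (events_T1 \<union> events_T2)" unfolding sigma_T_def by (rule sets_measure_of[OF P[OF E(1)]])
  show 2: "sets sigma_H = sigma_sets (space M) events_H" unfolding sigma_H_def by (rule sets_measure_of[OF P[OF process_events_in_events(2)]])
  show 3: "sets sigma_HT = sigma_sets (space M) (events_H \<union> events_T1 \<union> events_T2)" unfolding sigma_HT_def by (rule sets_measure_of[OF P[OF E(2)]])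
  show s: "space sigma_T = space M" "space sigma_H = space M" "space sigma_HT = space M"
    unfolding sigma_T_def sigma_H_def sigma_HT_def using P[OF E(1)] P[OF E(2)] P[OF process_events_in_events(2)] by (simp_all add: space_measure_of_conv)
  show "subalgebra M sigma_T" "subalgebra M sigma_H" "subalgebra M sigma_HT"
    unfolding subalgebra_def 1 2 3 s using sets.sigma_sets_subset[OF E(1)] sets.sigma_sets_subset[OF E(2)] sets.sigma_sets_subset[OF process_events_in_events(2)] by auto
qed

lemma measurable_generated_algebras:
  "T1 t1 \<in> borel_measurable sigma_HT" "T2 t2 \<in> borel_measurable sigma_HT" "a \<ge> 0 \<Longrightarrow> b \<ge> 0 \<Longrightarrow> H a b \<in> borel_measurable sigma_HT"
  "T1 t1 \<in> borel_measurable sigma_T" "T2 t2 \<in> borel_measurable sigma_T" "a \<ge> 0 \<Longrightarrow> b \<ge> 0 \<Longrightarrow> H a b \<in> borel_measurable sigma_H"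
proof -
  have i: "events_T1 \<subseteq> sets sigma_HT" "events_T2 \<subseteq> sets sigma_HT" "events_H \<subseteq> sets sigma_HT" "events_T1 \<subseteq> sets sigma_T" "events_T2 \<subseteq> sets sigma_T" "events_H \<subseteq> sets sigma_H"
    unfolding generated_algebras by auto
  show "T1 t1 \<in> borel_measurable sigma_HT" by (rule process_events_measurable[OF _ i(1)]) (simp add: t, rule generated_algebras(9), rule T1m[OF t(1)])
  show "T2 t2 \<in> borel_measurable sigma_HT" by (rule process_events_measurable[OF _ i(2)]) (simp add: t, rule generated_algebras(9), rule T2m[OF t(2)])
  show "T1 t1 \<in> borel_measurable sigma_T" by (rule process_events_measurable[OF _ i(4)]) (simp add: t, rule generated_algebras(7), rule T1m[OF t(1)])
  show "T2 t2 \<in> borel_measurable sigma_T" by (rule process_events_measurable[OF _ i(5)]) (simp add: t, rule generated_algebras(7), rule T2m[OF t(2)])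
  assume ab: "a \<ge> 0" "b \<ge> 0"
  show "H a b \<in> borel_measurable sigma_HT"
    using process_events_measurable[OF _ i(3) generated_algebras(9), of "(a, b)"] ab stable_subordinator2_measurable[OF ab] by simp
  show "H a b \<in> borel_measurable sigma_H"
    using process_events_measurable[OF _ i(6) generated_algebras(8), of "(a, b)"] ab stable_subordinator2_measurable[OF ab] by simp
qed

definition "H_dyadic e k \<omega> = H (dyadic e k (T1 t1 \<omega>)) (dyadic e k (T2 t2 \<omega>)) \<omega>"

text \<open>The two dyadic indices are coded into one natural number, because countable composition
  and conditioning are stated for a single index.\<close>

lemma dyadic_index_measurable:
  assumes "T1 t1 \<in> borel_measurable N" "T2 t2 \<in> borel_measurable N"
  shows "(\<lambda>\<omega>. prod_encode (nat \<lfloor>2 ^ k * T1 t1 \<omega>\<rfloor>, nat \<lfloor>2 ^ k * T2 t2 \<omega>\<rfloor>)) \<in> measurable N (count_space UNIV)"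
proof -
  have [measurable]: "(\<lambda>\<omega>. nat \<lfloor>2 ^ k * T1 t1 \<omega>\<rfloor>) \<in> measurable N (count_space UNIV)" "(\<lambda>\<omega>. nat \<lfloor>2 ^ k * T2 t2 \<omega>\<rfloor>) \<in> measurable N (count_space UNIV)"
    using assms by measurable
  show ?thesis by measurable
qed

lemma H_dyadic_index:
  "H_dyadic e k \<omega> = (\<lambda>n. H ((real (fst (prod_decode n)) + real e) / 2 ^ k) ((real (snd (prod_decode n)) + real e) / 2 ^ k))
     (prod_encode (nat \<lfloor>2 ^ k * T1 t1 \<omega>\<rfloor>, nat \<lfloor>2 ^ k * T2 t2 \<omega>\<rfloor>)) \<omega>"
  by (simp add: H_dyadic_def dyadic_def)

lemma H_dyadic_measurable: "H_dyadic e k \<in> borel_measurable sigma_HT"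
  unfolding H_dyadic_index[abs_def]
  by (rule measurable_compose_countable[OF _ dyadic_index_measurable[OF measurable_generated_algebras(1,2)]])
     (intro measurable_generated_algebras(3) divide_nonneg_nonneg add_nonneg_nonneg; simp)

lemma AE_H_mono_nonneg: "AE \<omega> in M. (\<forall>s1 s2 t1 t2. 0 \<le> s1 \<and> s1 \<le> t1 \<and> 0 \<le> s2 \<and> s2 \<le> t2 \<longrightarrow> H s1 s2 \<omega> \<le> H t1 t2 \<omega>) \<and>
   (\<forall>a\<ge>0. \<forall>b\<ge>0. H a b \<omega> \<ge> 0)"
  using stable_subordinator2_basic(2,3)[OF M H]
proof eventually_elim
  case (elim \<omega>)
  then have "H a b \<omega> \<ge> H 0 0 \<omega>" if "a \<ge> 0" "b \<ge> 0" for a b using that by blast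
  with elim show ?case by auto
qed

text \<open>On the dyadic grid \<open>H\<close> is evaluated at countably many fixed points, where
  its Laplace transform is known; independence of \<open>H\<close> from both random times allows
  their values to be frozen.\<close>

lemma H_dyadic_laplace:
  assumes v: "v > 0"
  shows "(\<integral> \<omega>. exp (- v * H_dyadic e k \<omega>) \<partial>M) = (\<integral> \<omega>. exp (- (v powr \<beta>) * dyadic e k (T1 t1 \<omega>) * dyadic e k (T2 t2 \<omega>)) \<partial>M)"
proof -
  define a b where "a n = (real (fst (prod_decode n)) + real e) / 2 ^ k" and "b n = (real (snd (prod_decode n)) + real e) / 2 ^ k" for n
  have ab: "a n \<ge> 0" "b n \<ge> 0" for n by (auto simp: a_def b_def)
  define K where "K \<omega> = prod_encode (nat \<lfloor>2 ^ k * T1 t1 \<omega>\<rfloor>, nat \<lfloor>2 ^ k * T2 t2 \<omega>\<rfloor>)" for \<omega>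
  have K: "a (K \<omega>) = dyadic e k (T1 t1 \<omega>)" "b (K \<omega>) = dyadic e k (T2 t2 \<omega>)" for \<omega>
    by (auto simp: a_def b_def K_def dyadic_def)
  have Km: "K \<in> measurable sigma_T (count_space UNIV)"
    unfolding K_def[abs_def] by (rule dyadic_index_measurable[OF measurable_generated_algebras(4,5)])
  have ind': "indep_set (sets sigma_T) (sets sigma_H)"
    using indep_groups[of "{2, 3}" "{1}"] by (simp add: generated_algebras numeral_2_eq_2 numeral_3_eq_3)
  \<comment> \<open>\<open>H\<close> is nonnegative only almost surely, whereas conditioning on the
    index asks for a bound everywhere; hence \<open>max 0\<close>.\<close>
  define f where "f n \<omega> = complex_of_real (exp (- v * max 0 (H (a n) (b n) \<omega>)))" for n \<omega>
  have fm: "f n \<in> borel_measurable sigma_H" for n unfolding f_def[abs_def] using measurable_generated_algebras(6)[OF ab] by measurable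
  have fb: "norm (f n \<omega>) \<le> 1" for n \<omega> using v by (simp add: f_def)
  have f_int: "(\<integral> \<omega>. f n \<omega> \<partial>M) = complex_of_real (exp (- (v powr \<beta>) * a n * b n))" for n
  proof -
    have [measurable]: "H (a n) (b n) \<in> borel_measurable M" using stable_subordinator2_measurable[OF ab] .
    have "(\<integral> \<omega>. exp (- v * max 0 (H (a n) (b n) \<omega>)) \<partial>M) = (\<integral> \<omega>. exp (- v * H (a n) (b n) \<omega>) \<partial>M)"
    proof (rule integral_cong_AE)
      show "AE \<omega> in M. exp (- v * max 0 (H (a n) (b n) \<omega>)) = exp (- v * H (a n) (b n) \<omega>)"
        using AE_H_mono_nonneg by eventually_elim (use ab in \<open>simp add: max_def\<close>)
    qed auto
    also have "\<dots> = exp (- a n * b n * v powr \<beta>)" by (rule stable_subordinator2_basic(4)[OF M H v ab])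
    also have "- a n * b n * v powr \<beta> = - (v powr \<beta>) * a n * b n" by (simp add: mult_ac)
    finally show ?thesis unfolding f_def integral_complex_of_real by (simp only:)
  qed
  have [measurable]: "H_dyadic e k \<in> borel_measurable M" using measurable_from_subalg[OF generated_algebras(6) H_dyadic_measurable] .
  have "complex_of_real (\<integral> \<omega>. exp (- v * max 0 (H_dyadic e k \<omega>)) \<partial>M) = (\<integral> \<omega>. f (K \<omega>) \<omega> \<partial>M)"
    unfolding f_def K H_dyadic_def integral_complex_of_real ..
  also have "\<dots> = complex_of_real (\<integral> \<omega>. exp (- (v powr \<beta>) * dyadic e k (T1 t1 \<omega>) * dyadic e k (T2 t2 \<omega>)) \<partial>M)"
    unfolding random_index_integral(2)[of sigma_T sigma_H K f, OF generated_algebras(4,5) ind' Km fm fb] f_int K integral_complex_of_real ..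
  finally have "(\<integral> \<omega>. exp (- v * max 0 (H_dyadic e k \<omega>)) \<partial>M) = (\<integral> \<omega>. exp (- (v powr \<beta>) * dyadic e k (T1 t1 \<omega>) * dyadic e k (T2 t2 \<omega>)) \<partial>M)"
    by (simp only: of_real_eq_iff)
  moreover have "(\<integral> \<omega>. exp (- v * max 0 (H_dyadic e k \<omega>)) \<partial>M) = (\<integral> \<omega>. exp (- v * H_dyadic e k \<omega>) \<partial>M)"
  proof (rule integral_cong_AE)
    show "AE \<omega> in M. exp (- v * max 0 (H_dyadic e k \<omega>)) = exp (- v * H_dyadic e k \<omega>)"
      using AE_H_mono_nonneg AE_space by eventually_elim (use T1nn T2nn t in \<open>simp add: max_def H_dyadic_def dyadic_bounds(1)\<close>)
  qed auto
  ultimately show ?thesis by simp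
qed

text \<open>The limit does not depend on \<open>e\<close>: lower and upper approximations have the
  same limiting transform, which is what closes the squeeze below.\<close>

lemma H_dyadic_laplace_tendsto:
  assumes v: "v > 0"
  shows "(\<lambda>k. \<integral> \<omega>. exp (- v * H_dyadic e k \<omega>) \<partial>M) \<longlonglongrightarrow> (\<integral> \<omega>. exp (- (v powr \<beta>) * T1 t1 \<omega> * T2 t2 \<omega>) \<partial>M)"
  unfolding H_dyadic_laplace[OF v]
proof (rule integral_dominated_convergence[where w = "\<lambda>_. 1"])
  have [measurable]: "T1 t1 \<in> borel_measurable M" "T2 t2 \<in> borel_measurable M" using T1m T2m t by auto
  show "(\<lambda>\<omega>. exp (- (v powr \<beta>) * T1 t1 \<omega> * T2 t2 \<omega>)) \<in> borel_measurable M" by measurable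
  show "(\<lambda>\<omega>. exp (- (v powr \<beta>) * dyadic e k (T1 t1 \<omega>) * dyadic e k (T2 t2 \<omega>))) \<in> borel_measurable M" for k
    unfolding dyadic_def by measurable
  show "AE \<omega> in M. (\<lambda>k. exp (- (v powr \<beta>) * dyadic e k (T1 t1 \<omega>) * dyadic e k (T2 t2 \<omega>))) \<longlonglongrightarrow> exp (- (v powr \<beta>) * T1 t1 \<omega> * T2 t2 \<omega>)"
    using T1nn T2nn t by (intro AE_I2 tendsto_intros dyadic_tendsto) auto
  show "AE \<omega> in M. norm (exp (- (v powr \<beta>) * dyadic e k (T1 t1 \<omega>) * dyadic e k (T2 t2 \<omega>))) \<le> 1" for k
    using T1nn T2nn t by (intro AE_I2) (simp add: dyadic_bounds(1) mult.assoc)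
qed simp

text \<open>
  \<open>H\<close> is only monotone, so \<open>H (T1 t1 \<omega>) (T2 t2 \<omega>) \<omega>\<close> is squeezed between its values at the lower and
  upper dyadic approximations of the arguments; these are ordered and have the same limiting Laplace
  transform at \<open>1\<close>, hence the same limit.
\<close>
lemma H_dyadic_tendsto: "AE \<omega> in M. (\<lambda>k. H_dyadic 1 k \<omega>) \<longlonglongrightarrow> H (T1 t1 \<omega>) (T2 t2 \<omega>) \<omega>"
proof -
  have [measurable]: "H_dyadic e k \<in> borel_measurable M" for e k using measurable_from_subalg[OF generated_algebras(6) H_dyadic_measurable] .
  define E where "E e k \<omega> = exp (- 1 * max 0 (H_dyadic e k \<omega>))" for e k \<omega>
  have [measurable]: "E e k \<in> borel_measurable M" for e k unfolding E_def[abs_def] by measurable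
  have Eb: "0 \<le> E e k \<omega>" "E e k \<omega> \<le> 1" for e k \<omega> by (auto simp: E_def)
  have HD0: "AE \<omega> in M. \<forall>e k. H_dyadic e k \<omega> \<ge> 0"
    using AE_H_mono_nonneg AE_space by eventually_elim (use T1nn T2nn t in \<open>simp add: H_dyadic_def dyadic_bounds(1)\<close>)
  have Elim: "(\<lambda>k. \<integral> \<omega>. E e k \<omega> \<partial>M) \<longlonglongrightarrow> (\<integral> \<omega>. exp (- (1 powr \<beta>) * T1 t1 \<omega> * T2 t2 \<omega>) \<partial>M)" for e
  proof -
    have "(\<integral> \<omega>. E e k \<omega> \<partial>M) = (\<integral> \<omega>. exp (- 1 * H_dyadic e k \<omega>) \<partial>M)" for k
    proof (rule integral_cong_AE)
      show "AE \<omega> in M. E e k \<omega> = exp (- 1 * H_dyadic e k \<omega>)"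
        using HD0 by eventually_elim (simp add: E_def max_def)
    qed auto
    then show ?thesis using H_dyadic_laplace_tendsto[of 1 e] by simp
  qed
  have mono: "AE \<omega> in M. \<forall>k. H_dyadic 0 k \<omega> \<le> H_dyadic 0 (Suc k) \<omega> \<and> H_dyadic 1 (Suc k) \<omega> \<le> H_dyadic 1 k \<omega> \<and>
      H_dyadic 0 k \<omega> \<le> H (T1 t1 \<omega>) (T2 t2 \<omega>) \<omega> \<and> H (T1 t1 \<omega>) (T2 t2 \<omega>) \<omega> \<le> H_dyadic 1 k \<omega>"
    using AE_H_mono_nonneg AE_space
  proof eventually_elim
    case (elim \<omega>)
    note n = T1nn[OF t(1) elim(2)] T2nn[OF t(2) elim(2)]
    have m: "H a b \<omega> \<le> H a' b' \<omega>" if "0 \<le> a" "a \<le> a'" "0 \<le> b" "b \<le> b'" for a a' b b' using elim(1) that by blast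
    note d1 = dyadic_bounds[OF n(1)] and d2 = dyadic_bounds[OF n(2)]
    show ?case unfolding H_dyadic_def
      by (intro allI conjI m d1(1-5) d2(1-5) n)
  qed
  \<comment> \<open>Almost surely, \<open>E 0 k\<close> decreases and \<open>E 1 k\<close> increases
    with \<open>k\<close>, so \<open>d\<close> decreases; it stays nonnegative because the lower
    values of \<open>H\<close> are below the upper ones.\<close>
  define d where "d k \<omega> = E 0 k \<omega> - E 1 k \<omega>" for k \<omega>
  have "AE \<omega> in M. (\<lambda>k. d k \<omega>) \<longlonglongrightarrow> 0"
  proof (rule decseq_integral_zero[where C = 1])
    show "d k \<in> borel_measurable M" for k unfolding d_def[abs_def] by measurable
    show "AE \<omega> in M. \<forall>k. 0 \<le> d (Suc k) \<omega> \<and> d (Suc k) \<omega> \<le> d k \<omega>"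
      using mono HD0
    proof eventually_elim
      case (elim \<omega>)
      show ?case
      proof
        fix k
        have 1: "E 0 (Suc k) \<omega> \<le> E 0 k \<omega>" "E 1 k \<omega> \<le> E 1 (Suc k) \<omega>"
          using elim by (auto simp: E_def max_def)
        have "H_dyadic 0 (Suc k) \<omega> \<le> H_dyadic 1 (Suc k) \<omega>" using elim(1) by (meson order_trans)
        then have 2: "E 1 (Suc k) \<omega> \<le> E 0 (Suc k) \<omega>" using elim(2) by (auto simp: E_def max_def)
        show "0 \<le> d (Suc k) \<omega> \<and> d (Suc k) \<omega> \<le> d k \<omega>" using 1 2 by (simp add: d_def)
      qed
    qed
    show "\<bar>d k \<omega>\<bar> \<le> 1" for k \<omega> using Eb[of 0 k \<omega>] Eb[of 1 k \<omega>] by (simp add: d_def)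
    have "integrable M (E e k)" for e k by (rule integrable_const_bound[where B = 1]) (use Eb in auto)
    then show "(\<lambda>k. \<integral> \<omega>. d k \<omega> \<partial>M) \<longlonglongrightarrow> 0"
      using tendsto_diff[OF Elim[of 0] Elim[of 1]] by (simp add: d_def)
  qed
  then show ?thesis
    using mono HD0
  proof eventually_elim
    case (elim \<omega>)
    let ?h = "H (T1 t1 \<omega>) (T2 t2 \<omega>) \<omega>"
    have h: "?h \<ge> 0" using elim(2,3) by (meson order_trans)
    have "\<bar>exp (- H_dyadic 1 k \<omega>) - exp (- ?h)\<bar> \<le> d k \<omega>" for k
    proof -
      have "E e k \<omega> = exp (- H_dyadic e k \<omega>)" for e using elim(3) by (simp add: E_def max_def)
      moreover have "exp (- H_dyadic 1 k \<omega>) \<le> exp (- ?h)" "exp (- ?h) \<le> exp (- H_dyadic 0 k \<omega>)" using elim(2) by auto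
      ultimately show ?thesis by (simp add: d_def)
    qed
    then have "(\<lambda>k. exp (- H_dyadic 1 k \<omega>) - exp (- ?h)) \<longlonglongrightarrow> 0"
      by (intro Lim_null_comparison[OF _ elim(1)]) auto
    then have "(\<lambda>k. exp (- H_dyadic 1 k \<omega>)) \<longlonglongrightarrow> exp (- ?h)" by (simp add: LIM_zero_iff)
    from tendsto_minus[OF tendsto_ln[OF this]] show ?case by simp
  qed
qed

lemma T1_T2_indep_var:
  assumes "a \<ge> 0" "b \<ge> 0"
  shows "indep_var borel (T1 a) borel (T2 b)"
proof (subst indep_var_eq, intro conjI)
  have "indep_set (sigma_sets (space M) events_T1) (sigma_sets (space M) events_T2)"
    using indep_groups[of "{2}" "{3}"] by (simp add: numeral_2_eq_2 numeral_3_eq_3)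
  moreover have "sigma_sets (space M) {T1 a -` A \<inter> space M |A. A \<in> sets borel} \<subseteq> sigma_sets (space M) events_T1"
    "sigma_sets (space M) {T2 b -` A \<inter> space M |A. A \<in> sets borel} \<subseteq> sigma_sets (space M) events_T2"
    using assms unfolding process_events_def
     by - (rule sigma_sets_mono', rule subsetI, rule sigma_sets.Basic, blast)+
  ultimately show "indep_set (sigma_sets (space M) {T1 a -` A \<inter> space M |A. A \<in> sets borel})
      (sigma_sets (space M) {T2 b -` A \<inter> space M |A. A \<in> sets borel})"
    unfolding indep_sets2_eq by (meson subset_eq)
qed (use T1m T2m assms in auto)

text \<open>The random time is first replaced by its dyadic approximation, which is measurable for
  \<open>sigma_HT\<close> and so independent of \<open>B\<close>; path continuity of
  \<open>B\<close> then removes the approximation. The characteristic function of \<open>B\<close>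
  turns \<open>u\<close> into the argument \<open>u\<^sup>2 / 2\<close> of the Laplace transform of
  \<open>H\<close>, whence the power \<open>(u\<^sup>2 / 2) powr \<beta>\<close>. The case
  \<open>u = 0\<close> is separate because that transform is given for positive arguments.\<close>

lemma time_changed_brownian_char:
  assumes Xm: "(\<lambda>\<omega>. B (H (T1 t1 \<omega>) (T2 t2 \<omega>) \<omega>) \<omega>) \<in> borel_measurable M"
  shows "(\<integral> \<omega>. iexp (u * B (H (T1 t1 \<omega>) (T2 t2 \<omega>) \<omega>) \<omega>) \<partial>M)
    = (\<integral> \<omega>. exp (- ((u\<^sup>2 / 2) powr \<beta>) * T1 t1 \<omega> * T2 t2 \<omega>) \<partial>M)"
proof (cases "u = 0")
  case True
  then show ?thesis using \<beta> by (simp add: prob_space)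
next
  case False
  then have v: "u\<^sup>2 / 2 > 0" by simp
  have HDM[measurable]: "H_dyadic e k \<in> borel_measurable M" for e k using measurable_from_subalg[OF generated_algebras(6) H_dyadic_measurable] .
  have ind': "indep_set (sets sigma_HT) events_B"
  proof -
    have e: "sigma_sets (space M) (\<Union>i\<in>{1, 2, 3}. [events_B, events_H, events_T1, events_T2] ! i) = sets sigma_HT"
      by (simp add: generated_algebras numeral_2_eq_2 numeral_3_eq_3 Un_assoc)
    have "indep_set (sets sigma_HT) (sigma_sets (space M) events_B)"
      using indep_groups[of "{1, 2, 3}" "{0}"] unfolding e by simp
    then show ?thesis unfolding indep_sets2_eq by (auto intro: sigma_sets.Basic)
  qed
  \<comment> \<open>A random time has to be nonnegative everywhere, while \<open>H_dyadic\<close> is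
    so only almost surely.\<close>
  define \<tau> where "\<tau> k \<omega> = max 0 (H_dyadic 1 k \<omega>)" for k \<omega>
  have \<tau>F: "\<tau> k \<in> borel_measurable sigma_HT" for k unfolding \<tau>_def[abs_def] using H_dyadic_measurable[of 1 k] by measurable
  have HD0: "AE \<omega> in M. (\<forall>k. H_dyadic 1 k \<omega> \<ge> 0) \<and> H (T1 t1 \<omega>) (T2 t2 \<omega>) \<omega> \<ge> 0"
    using AE_H_mono_nonneg AE_space by eventually_elim (use T1nn T2nn t in \<open>simp add: H_dyadic_def dyadic_bounds(1)\<close>)
  have "\<forall>k. \<exists>X \<in> borel_measurable M. (AE \<omega> in M. X \<omega> = B (\<tau> k \<omega>) \<omega>) \<and>
    (\<forall>u. (\<integral> \<omega>. iexp (u * X \<omega>) \<partial>M) = complex_of_real (\<integral> \<omega>. exp (- u\<^sup>2 / 2 * \<tau> k \<omega>) \<partial>M))"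
    by (intro allI brownian_random_time_char[OF B generated_algebras(6) ind' \<tau>F]) (simp add: \<tau>_def)
  then obtain X where Xk: "\<And>k. X k \<in> borel_measurable M" "\<And>k. AE \<omega> in M. X k \<omega> = B (\<tau> k \<omega>) \<omega>"
    "\<And>k u. (\<integral> \<omega>. iexp (u * X k \<omega>) \<partial>M) = complex_of_real (\<integral> \<omega>. exp (- u\<^sup>2 / 2 * \<tau> k \<omega>) \<partial>M)"
    by metis
  have eq: "(\<integral> \<omega>. iexp (u * X k \<omega>) \<partial>M) = complex_of_real (\<integral> \<omega>. exp (- (u\<^sup>2 / 2) * H_dyadic 1 k \<omega>) \<partial>M)" for k
  proof -
    have "(\<integral> \<omega>. exp (- u\<^sup>2 / 2 * \<tau> k \<omega>) \<partial>M) = (\<integral> \<omega>. exp (- (u\<^sup>2 / 2) * H_dyadic 1 k \<omega>) \<partial>M)"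
    proof (rule integral_cong_AE)
      show "AE \<omega> in M. exp (- u\<^sup>2 / 2 * \<tau> k \<omega>) = exp (- (u\<^sup>2 / 2) * H_dyadic 1 k \<omega>)"
        using HD0 by eventually_elim (simp add: \<tau>_def max_def)
    qed (auto simp: \<tau>_def)
    then show ?thesis unfolding Xk(3) by (simp only:)
  qed
  have "(\<lambda>k. \<integral> \<omega>. iexp (u * X k \<omega>) \<partial>M) \<longlonglongrightarrow> (\<integral> \<omega>. iexp (u * B (H (T1 t1 \<omega>) (T2 t2 \<omega>) \<omega>) \<omega>) \<partial>M)"
  proof (rule integral_dominated_convergence[where w = "\<lambda>_. 1"])
    have "AE \<omega> in M. continuous_on {0..} (\<lambda>t. B t \<omega>)" using B by (simp add: brownian_motion_def)
    moreover have "AE \<omega> in M. \<forall>k. X k \<omega> = B (\<tau> k \<omega>) \<omega>" using Xk(2) by (simp add: AE_all_countable)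
    ultimately show "AE \<omega> in M. (\<lambda>k. iexp (u * X k \<omega>)) \<longlonglongrightarrow> iexp (u * B (H (T1 t1 \<omega>) (T2 t2 \<omega>) \<omega>) \<omega>)"
      using H_dyadic_tendsto HD0
    proof eventually_elim
      case (elim \<omega>)
      have "(\<lambda>k. \<tau> k \<omega>) \<longlonglongrightarrow> H (T1 t1 \<omega>) (T2 t2 \<omega>) \<omega>" using elim(3,4) by (simp add: \<tau>_def max_def)
      then have "(\<lambda>k. B (\<tau> k \<omega>) \<omega>) \<longlonglongrightarrow> B (H (T1 t1 \<omega>) (T2 t2 \<omega>) \<omega>) \<omega>"
        by (rule continuous_on_tendsto_compose[OF elim(1)]) (use elim(4) in \<open>auto simp: \<tau>_def\<close>)
      then show ?case using elim(2) by (intro tendsto_intros) simp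
    qed
    show "(\<lambda>\<omega>. iexp (u * B (H (T1 t1 \<omega>) (T2 t2 \<omega>) \<omega>) \<omega>)) \<in> borel_measurable M" using Xm by measurable
    show "(\<lambda>\<omega>. iexp (u * X k \<omega>)) \<in> borel_measurable M" for k using Xk(1)[of k] by measurable
  qed auto
  moreover have "(\<lambda>k. \<integral> \<omega>. iexp (u * X k \<omega>) \<partial>M) \<longlonglongrightarrow> complex_of_real (\<integral> \<omega>. exp (- ((u\<^sup>2 / 2) powr \<beta>) * T1 t1 \<omega> * T2 t2 \<omega>) \<partial>M)"
    unfolding eq by (rule tendsto_of_real[OF H_dyadic_laplace_tendsto[OF v]])
  ultimately show ?thesis using LIMSEQ_unique by blast
qed

end

section \<open>The limit theorem\<close>

lemma (in prob_space) char_iid_normal_sum: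
  assumes ind: "indep_vars (\<lambda>_. borel) Z {1..}"
    and normal: "\<And>j. j \<ge> 1 \<Longrightarrow> distributed M lborel (Z j) (\<lambda>x. ennreal (std_normal_density x))"
  shows "(\<integral> \<omega>. iexp (v * (\<Sum>j = 1..k. Z j \<omega>)) \<partial>M) = complex_of_real (exp (- v\<^sup>2 / 2) ^ k)"
proof -
  have [measurable]: "Z j \<in> borel_measurable M" if "j \<ge> 1" for j using ind that by (auto simp: indep_vars_def)
  have ind': "indep_vars (\<lambda>_. borel) Z {1..k}" by (rule indep_vars_subset[OF ind]) auto
  have c: "char (distr M borel (Z j)) v = complex_of_real (exp (- v\<^sup>2 / 2))" if "j \<ge> 1" for j
  proof -
    have "distr M borel (Z j) = distr M lborel (Z j)" by (rule distr_cong) auto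
    also have "\<dots> = std_normal_distribution" by (rule distributed_distr_eq_density[OF normal[OF that]])
    finally show ?thesis by (simp add: char_std_normal_distribution)
  qed
  have "(\<lambda>\<omega>. \<Sum>j = 1..k. Z j \<omega>) \<in> borel_measurable M" by (intro borel_measurable_sum) auto
  then have "(\<integral> \<omega>. iexp (v * (\<Sum>j = 1..k. Z j \<omega>)) \<partial>M) = char (distr M borel (\<lambda>\<omega>. \<Sum>j = 1..k. Z j \<omega>)) v"
    unfolding char_def by (subst integral_distr) auto
  also have "\<dots> = (\<Prod>j = 1..k. complex_of_real (exp (- v\<^sup>2 / 2)))"
    unfolding char_distr_sum[OF ind'] by (intro prod.cong) (auto simp: c)
  finally show ?thesis by simp
qed

lemma (in prob_space) expectation_power_nat:
  fixes K :: "'a \<Rightarrow> nat"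
  assumes [measurable]: "K \<in> measurable M (count_space UNIV)" and z: "0 \<le> z" "z < 1"
  shows "(\<integral> \<omega>. z ^ K \<omega> \<partial>M) = (\<Sum>k. measure M {\<omega> \<in> space M. K \<omega> = k} * z ^ k)"
proof -
  define f where "f k \<omega> = indicator {\<omega> \<in> space M. K \<omega> = k} \<omega> * z ^ k" for k \<omega>
  have "(\<lambda>k. \<integral> \<omega>. f k \<omega> \<partial>M) sums (\<integral> \<omega>. (\<Sum>k. f k \<omega>) \<partial>M)"
  proof (rule sums_integral_bounded)
    show "f k \<in> borel_measurable M" for k unfolding f_def[abs_def] by measurable
    show "\<bar>f k \<omega>\<bar> \<le> z ^ k" for k \<omega> using z by (auto simp: f_def indicator_def)
    show "summable (\<lambda>k. z ^ k)" using z by (intro summable_geometric) auto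
  qed
  moreover have "(\<integral> \<omega>. f k \<omega> \<partial>M) = measure M {\<omega> \<in> space M. K \<omega> = k} * z ^ k" for k
    unfolding f_def by (simp add: sets.Int_space_eq1)
  moreover have "(\<integral> \<omega>. (\<Sum>k. f k \<omega>) \<partial>M) = (\<integral> \<omega>. z ^ K \<omega> \<partial>M)"
  proof (intro Bochner_Integration.integral_cong refl)
    fix \<omega> assume "\<omega> \<in> space M"
    then have "(\<lambda>k. f k \<omega>) = (\<lambda>k. if k = K \<omega> then z ^ k else 0)" by (auto simp: f_def indicator_def)
    then show "(\<Sum>k. f k \<omega>) = z ^ K \<omega>" using sums_single[of "K \<omega>" "\<lambda>k. z ^ k"] by (simp add: sums_iff)
  qed
  ultimately show ?thesis by (simp add: sums_iff)
qed

text \<open>With \<open>c = u\<^sup>2 / 2\<close> the base of the power is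
  \<open>\<lambda> * (1 - z)\<close> for \<open>\<lambda> = n\<^sup>2\<close> and
  \<open>z = exp (- c / n\<^sup>2)\<close>. It converges to \<open>c\<close> because
  \<open>(exp h - 1) / h\<close> tends to 1 as \<open>h\<close> tends to 0.\<close>

lemma scaled_intensity_tendsto:
  fixes c \<beta> :: real
  assumes c: "c > 0"
  shows "(\<lambda>n. ((real n)\<^sup>2 * (1 - exp (- c / (real n)\<^sup>2))) powr \<beta>) \<longlonglongrightarrow> c powr \<beta>"
proof (rule tendsto_powr[OF _ tendsto_const])
  define h where "h n = - c / (real n)\<^sup>2" for n :: nat
  have "(\<lambda>n. inverse (real n) * inverse (real n)) \<longlonglongrightarrow> 0 * 0" by (intro tendsto_mult lim_inverse_n)
  then have "(\<lambda>n. - c * (inverse (real n) * inverse (real n))) \<longlonglongrightarrow> 0" by (intro tendsto_mult_right_zero) simp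
  then have h0: "h \<longlonglongrightarrow> 0" by (simp add: h_def[abs_def] divide_inverse power2_eq_square)
  have "filterlim h (at 0) sequentially"
    using h0 c eventually_gt_at_top[of "0::nat"] by (intro filterlim_atI) (auto simp: h_def elim!: eventually_mono)
  from filterlim_compose[OF lim_exp_minus_1 this]
  have "(\<lambda>n. c * ((exp (h n) - 1) / h n)) \<longlonglongrightarrow> c * 1" by (intro tendsto_intros)
  then have "(\<lambda>n. c * ((exp (h n) - 1) / h n)) \<longlonglongrightarrow> c" by simp
  moreover have "eventually (\<lambda>n. c * ((exp (h n) - 1) / h n) = (real n)\<^sup>2 * (1 - exp (- c / (real n)\<^sup>2))) sequentially"
    using eventually_gt_at_top[of "0::nat"]
  proof eventually_elim
    case (elim n)
    then show ?case using c by (simp add: h_def field_simps)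
  qed
  ultimately show "(\<lambda>n. (real n)\<^sup>2 * (1 - exp (- c / (real n)\<^sup>2))) \<longlonglongrightarrow> c" by (rule Lim_transform_eventually)
qed (use c in simp)

text \<open>Weak convergence concerns laws only, so the random field with the normal variables and
  the limit process may live on different probability spaces, \<open>M\<close> and
  \<open>M'\<close>. Characteristic functions are compared, and Levy's continuity theorem
  concludes.\<close>

theorem mainTheorem12:
  fixes M :: "'a measure" and M' :: "'b measure"
    and \<alpha>1 \<alpha>2 \<beta> t1 t2 :: real
    and N :: "nat \<Rightarrow> real \<Rightarrow> real \<Rightarrow> 'a \<Rightarrow> nat"
    and Z :: "nat \<Rightarrow> 'a \<Rightarrow> real"
    and B :: "real \<Rightarrow> 'b \<Rightarrow> real"
    and H :: "real \<Rightarrow> real \<Rightarrow> 'b \<Rightarrow> real"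
    and T1 T2 :: "real \<Rightarrow> 'b \<Rightarrow> real"
  assumes "prob_space M" and "prob_space M'"
    and "0 < \<alpha>1" "\<alpha>1 \<le> 1" "0 < \<alpha>2" "\<alpha>2 \<le> 1" "0 < \<beta>" "\<beta> \<le> 1"
    and N: "\<And>n. n \<ge> 1 \<Longrightarrow> stfprf M \<alpha>1 \<alpha>2 \<beta> ((real n)\<^sup>2) (N n)"
    and Z_indep: "prob_space.indep_vars M (\<lambda>_. borel) Z {1..}"
    and Z_normal: "\<And>j. j \<ge> 1 \<Longrightarrow> distributed M lborel (Z j) (\<lambda>x. ennreal (std_normal_density x))"
    and N_Z_indep: "\<And>n. n \<ge> 1 \<Longrightarrow>
          prob_space.indep_set M
            (process_events M (count_space UNIV) ({0..} \<times> {0..}) (\<lambda>(s1, s2). N n s1 s2))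
            (process_events M borel {1..} Z)"
    and B: "brownian_motion M' B"
    and H: "stable_subordinator2 M' \<beta> H"
    and T1: "folded_solution_process M' \<alpha>1 T1"
    and T2: "folded_solution_process M' \<alpha>2 T2"
    and BHT_indep: "prob_space.indep_sets M'
          (nth [process_events M' borel {0..} B,
                process_events M' borel ({0..} \<times> {0..}) (\<lambda>(s1, s2). H s1 s2),
                process_events M' borel {0..} T1,
                process_events M' borel {0..} T2]) {..<4}"
    and "t1 \<ge> 0" "t2 \<ge> 0"
    \<comment> \<open>the time-changed process is a random variable, so that its law is defined\<close>
    and "(\<lambda>\<omega>. B (H (T1 t1 \<omega>) (T2 t2 \<omega>) \<omega>) \<omega>) \<in> borel_measurable M'"
  shows "weak_conv_m
           (\<lambda>n. distr M borel (\<lambda>\<omega>. 1 / real n * (\<Sum>j = 1..N n t1 t2 \<omega>. Z j \<omega>)))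
           (distr M' borel (\<lambda>\<omega>. B (H (T1 t1 \<omega>) (T2 t2 \<omega>) \<omega>) \<omega>))"
proof -
  interpret M: prob_space M by fact
  interpret M': prob_space M' by fact
  note \<alpha>1 = \<open>0 < \<alpha>1\<close> \<open>\<alpha>1 \<le> 1\<close> and \<alpha>2 = \<open>0 < \<alpha>2\<close> \<open>\<alpha>2 \<le> 1\<close> and \<beta> = \<open>0 < \<beta>\<close> and t = \<open>t1 \<ge> 0\<close> \<open>t2 \<ge> 0\<close>
  note Xm = \<open>(\<lambda>\<omega>. B (H (T1 t1 \<omega>) (T2 t2 \<omega>) \<omega>) \<omega>) \<in> borel_measurable M'\<close>
  note T1m = folded_measurable[OF \<open>prob_space M'\<close> T1 \<alpha>1] and T2m = folded_measurable[OF \<open>prob_space M'\<close> T2 \<alpha>2]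
  note T1nn = folded_nonneg[OF \<open>prob_space M'\<close> T1 \<alpha>1] and T2nn = folded_nonneg[OF \<open>prob_space M'\<close> T2 \<alpha>2]
  have target: "(\<integral> \<omega>. iexp (u * B (H (T1 t1 \<omega>) (T2 t2 \<omega>) \<omega>) \<omega>) \<partial>M')
      = complex_of_real (\<integral> \<omega>. exp (- ((u\<^sup>2 / 2) powr \<beta>) * T1 t1 \<omega> * T2 t2 \<omega>) \<partial>M')" for u
    by (rule time_changed_brownian_char[OF \<open>prob_space M'\<close> B H \<beta> T1m T1nn T2m T2nn BHT_indep t Xm])
  have ind: "M'.indep_var borel (T1 a) borel (T2 b)" if "a \<ge> 0" "b \<ge> 0" for a b
    by (rule T1_T2_indep_var[OF \<open>prob_space M'\<close> B H \<beta> T1m T1nn T2m T2nn BHT_indep t that])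
  define Y where "Y n \<omega> = 1 / real n * (\<Sum>j = 1..N n t1 t2 \<omega>. Z j \<omega>)" for n \<omega>
  have Zm: "Z j \<in> borel_measurable M" if "j \<ge> 1" for j using Z_indep that by (auto simp: M.indep_vars_def)
  have Nm: "N n a b \<in> measurable M (count_space UNIV)" if "n \<ge> 1" "a \<ge> 0" "b \<ge> 0" for n a b
    using N[OF that(1)] that by (simp add: stfprf_def)
  \<comment> \<open>For \<open>n = 0\<close> nothing is known about the field, but
    \<open>1 / real 0 = 0\<close> makes \<open>Y 0\<close> constant; measurability is required for
    every \<open>n\<close>.\<close>
  have Ym: "Y n \<in> borel_measurable M" for n
  proof (cases "n \<ge> 1")
    case True
    show ?thesis unfolding Y_def[abs_def]
      by (rule measurable_compose_countable[OF _ Nm[OF True t]]) (intro borel_measurable_times borel_measurable_sum Zm; simp)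
  next
    case False
    then have "n = 0" by simp
    then show ?thesis by (simp add: Y_def[abs_def])
  qed
  have Y_char: "char (distr M borel (Y n)) u
      = complex_of_real (\<integral> \<omega>. exp (- (((real n)\<^sup>2 * (1 - exp (- (u\<^sup>2 / 2) / (real n)\<^sup>2))) powr \<beta>) * T1 t1 \<omega> * T2 t2 \<omega>) \<partial>M')"
    if n: "n \<ge> 1" and u: "u \<noteq> 0" for n u
  proof -
    let ?EN = "process_events M (count_space UNIV) ({0..} \<times> {0..}) (\<lambda>(s1, s2). N n s1 s2)"
    let ?EZ = "process_events M borel {1..} Z"
    let ?K = "N n t1 t2"
    \<comment> \<open>The characteristic function of \<open>Z j / n\<close> at \<open>u\<close>; it
      is below 1 because \<open>u \<noteq> 0\<close>, so that the generating function converges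
      geometrically.\<close>
    define z where "z = exp (- (u / real n)\<^sup>2 / 2)"
    have z: "0 \<le> z" "z < 1" and z': "z = exp (- (u\<^sup>2 / 2) / (real n)\<^sup>2)"
      using u n by (auto simp: z_def power_divide)
    have EN: "?EN \<subseteq> M.events" by (rule M.process_events_subalgebra) (use Nm[OF n] in auto)
    have EZ: "?EZ \<subseteq> M.events" by (rule M.process_events_subalgebra) (use Zm in auto)
    note sN = M.process_events_sigma[OF EN] and sZ = M.process_events_sigma[OF EZ]
    have Km: "?K \<in> measurable (sigma (space M) ?EN) (count_space UNIV)"
      using M.process_events_measurable[OF _ eq_refl[OF sN(1)[symmetric]] sN(2), of "(t1, t2)"] t Nm[OF n t] by simp
    have Zs: "Z j \<in> borel_measurable (sigma (space M) ?EZ)" if "j \<ge> 1" for j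
      by (rule M.process_events_measurable[OF _ eq_refl[OF sZ(1)[symmetric]] sZ(2)]) (use that Zm in auto)
    have ind': "M.indep_set (sets (sigma (space M) ?EN)) (sets (sigma (space M) ?EZ))"
      unfolding sN(1) sZ(1) by (rule N_Z_indep[OF n])
    define f where "f k \<omega> = iexp (u * (1 / real n * (\<Sum>j = 1..k. Z j \<omega>)))" for k :: nat and \<omega>
    have fm: "f k \<in> borel_measurable (sigma (space M) ?EZ)" for k
    proof -
      have [measurable]: "(\<lambda>\<omega>. \<Sum>j = 1..k. Z j \<omega>) \<in> borel_measurable (sigma (space M) ?EZ)"
        by (intro borel_measurable_sum Zs) simp
      show ?thesis unfolding f_def[abs_def] by measurable
    qed
    have f_int: "(\<integral> \<omega>. f k \<omega> \<partial>M) = complex_of_real (z ^ k)" for k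
    proof -
      have "f k \<omega> = iexp (u / real n * (\<Sum>j = 1..k. Z j \<omega>))" for \<omega> by (simp add: f_def)
      then show ?thesis using M.char_iid_normal_sum[OF Z_indep Z_normal, of "u / real n" k] by (simp add: z_def)
    qed
    \<comment> \<open>This \<open>p\<close> may vary with \<open>n\<close>, but each one solves the
      system for all positive values of the parameter, and that is what determines it; only
      afterwards is the parameter set to \<open>n\<^sup>2\<close>.\<close>
    obtain p where sys: "stfprf_system \<alpha>1 \<alpha>2 \<beta> p"
      and p: "measure M {\<omega> \<in> space M. int (N n t1 t2 \<omega>) = k} = p ((real n)\<^sup>2) k t1 t2" for k
      using N[OF n] t unfolding stfprf_def by blast
    have "char (distr M borel (Y n)) u = (\<integral> \<omega>. f (?K \<omega>) \<omega> \<partial>M)"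
      unfolding char_def f_def using Ym[of n] by (subst integral_distr) (auto simp: Y_def)
    also have "\<dots> = (\<integral> \<omega>. (\<integral> \<omega>'. f (?K \<omega>) \<omega>' \<partial>M) \<partial>M)"
      by (rule M.random_index_integral(2)[OF sN(3) sZ(3) ind' Km fm]) (simp add: f_def)
    also have "\<dots> = complex_of_real (\<integral> \<omega>. z ^ ?K \<omega> \<partial>M)"
      unfolding f_int integral_complex_of_real ..
    also have "(\<integral> \<omega>. z ^ ?K \<omega> \<partial>M) = (\<Sum>k. p ((real n)\<^sup>2) (int k) t1 t2 * z ^ k)"
      unfolding M.expectation_power_nat[OF Nm[OF n t] z] by (simp add: p[symmetric])
    also have "\<dots> = (\<integral> \<omega>. exp (- (((real n)\<^sup>2 * (1 - z)) powr \<beta>) * T1 t1 \<omega> * T2 t2 \<omega>) \<partial>M')"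
      by (rule system_pgf_eq_product_transform[OF \<alpha>1 \<alpha>2 \<beta> sys z _ \<open>prob_space M'\<close> T1 T2 ind t]) (use n in auto)
    finally show ?thesis unfolding z' .
  qed
  show ?thesis
    unfolding Y_def[symmetric, abs_def]
  proof (rule levy_continuity)
    show "real_distribution (distr M borel (Y n))" for n using Ym by simp
    show rd: "real_distribution (distr M' borel (\<lambda>\<omega>. B (H (T1 t1 \<omega>) (T2 t2 \<omega>) \<omega>) \<omega>))" using Xm by simp
    fix u :: real
    show "(\<lambda>n. char (distr M borel (Y n)) u) \<longlonglongrightarrow> char (distr M' borel (\<lambda>\<omega>. B (H (T1 t1 \<omega>) (T2 t2 \<omega>) \<omega>) \<omega>)) u"
    \<comment> \<open>At \<open>u = 0\<close> the argument \<open>z\<close> would be 1, outside the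
      range treated; there both characteristic functions are 1.\<close>
    proof (cases "u = 0")
      case True
      have "char (distr M borel (Y n)) 0 = 1" for n
        by (rule real_distribution.char_zero) (use Ym in simp)
      then show ?thesis using True real_distribution.char_zero[OF rd] by simp
    next
      case False
      define w where "w n = ((real n)\<^sup>2 * (1 - exp (- (u\<^sup>2 / 2) / (real n)\<^sup>2))) powr \<beta>" for n :: nat
      have w: "w \<longlonglongrightarrow> (u\<^sup>2 / 2) powr \<beta>"
        unfolding w_def[abs_def] by (rule scaled_intensity_tendsto) (use False in simp)
      have [measurable]: "T1 t1 \<in> borel_measurable M'" "T2 t2 \<in> borel_measurable M'" using T1m T2m t by auto
      have "(\<lambda>n. \<integral> \<omega>. exp (- w n * T1 t1 \<omega> * T2 t2 \<omega>) \<partial>M') \<longlonglongrightarrow> (\<integral> \<omega>. exp (- ((u\<^sup>2 / 2) powr \<beta>) * T1 t1 \<omega> * T2 t2 \<omega>) \<partial>M')"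
      proof (rule integral_dominated_convergence[where w = "\<lambda>_. 1"])
        show "AE \<omega> in M'. (\<lambda>n. exp (- w n * T1 t1 \<omega> * T2 t2 \<omega>)) \<longlonglongrightarrow> exp (- ((u\<^sup>2 / 2) powr \<beta>) * T1 t1 \<omega> * T2 t2 \<omega>)"
          by (intro AE_I2 tendsto_intros w)
        show "AE \<omega> in M'. norm (exp (- w n * T1 t1 \<omega> * T2 t2 \<omega>)) \<le> 1" for n
          using T1nn[OF t(1)] T2nn[OF t(2)] by (intro AE_I2) (simp add: w_def mult.assoc)
      qed auto
      then have "(\<lambda>n. complex_of_real (\<integral> \<omega>. exp (- w n * T1 t1 \<omega> * T2 t2 \<omega>) \<partial>M'))
          \<longlonglongrightarrow> complex_of_real (\<integral> \<omega>. exp (- ((u\<^sup>2 / 2) powr \<beta>) * T1 t1 \<omega> * T2 t2 \<omega>) \<partial>M')"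
        by (rule tendsto_of_real)
      moreover have "eventually (\<lambda>n. complex_of_real (\<integral> \<omega>. exp (- w n * T1 t1 \<omega> * T2 t2 \<omega>) \<partial>M') = char (distr M borel (Y n)) u) sequentially"
        using eventually_ge_at_top[of 1] by eventually_elim (simp only: Y_char[OF _ False] w_def)
      ultimately have "(\<lambda>n. char (distr M borel (Y n)) u)
          \<longlonglongrightarrow> complex_of_real (\<integral> \<omega>. exp (- ((u\<^sup>2 / 2) powr \<beta>) * T1 t1 \<omega> * T2 t2 \<omega>) \<partial>M')"
        by (rule Lim_transform_eventually)
      also have "complex_of_real (\<integral> \<omega>. exp (- ((u\<^sup>2 / 2) powr \<beta>) * T1 t1 \<omega> * T2 t2 \<omega>) \<partial>M')
          = char (distr M' borel (\<lambda>\<omega>. B (H (T1 t1 \<omega>) (T2 t2 \<omega>) \<omega>) \<omega>)) u"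
        unfolding target[of u, symmetric] char_def using Xm by (subst integral_distr) (simp_all only:, measurable)
      finally show ?thesis .
    qed
  qed
qed

end
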